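(* Let $R$ be a commutative Noetherian ring with identity and $\mathfrak{a}$ an ideal of $R$. Let $M,N$ be finitely generated $R$-modules such that the projective dimension $\operatorname{pd}(M)=t$ is finite and $H^{i}_{\mathfrak{a}}(N)$ is $\mathfrak{a}$-cofinite for all $i\ge 0$. Suppose also that the category of $\mathfrak{a}$-cofinite $R$-modules is Abelian. Then $H^{i}_{\mathfrak{a}}(M,N)$ is $\mathfrak{a}$-cofinite for all $i\ge 0$.
   Context: $H^{i}_{\mathfrak{a}}(N)$ is the $i$-th ordinary local cohomology module of $N$ with respect to $\mathfrak{a}$. The generalized local cohomology modules are $H^{i}_{\mathfrak{a}}(M,N)=\varinjlim_{n}\operatorname{Ext}^{i}_{R}(M/\mathfrak{a}^{n}M,N)$. An $R$-module $X$ is $\mathfrak{a}$-cofinite if $\operatorname{Supp}(X)\subseteq V(\mathfrak{a})$ and $\operatorname{Ext}^{i}_{R}(R/\mathfrak{a},X)$ is finitely generated for all $i$. That the category of $\mathfrak{a}$-cofinite $R$-modules (as a full subcategory of the category of $R$-modules) is Abelian means that for every $R$-homomorphism between $\mathfrak{a}$-cofinite modules, its kernel and cokernel (taken in the category of $R$-modules) are $\mathfrak{a}$-cofinite. *)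

theory Defs
  imports "HOL-Algebra.Module" "HOL-Algebra.Ideal_Product" "HOL-Algebra.Ring_Divisibility"
    "HOL-Library.FSet" "HOL-Library.Extended_Nat"
begin

section \<open>Modules over a commutative ring\<close>

definition regular_module :: "('a, 'r) ring_scheme \<Rightarrow> ('a, 'a) module" where
  "regular_module R =
     \<lparr>carrier = carrier R, monoid.mult = monoid.mult R, one = one R, zero = zero R, add = add R,
      smult = monoid.mult R\<rparr>"

definition module_span ::
    "('a, 'r) ring_scheme \<Rightarrow> ('a, 'm) module \<Rightarrow> 'm set \<Rightarrow> 'm set" where
  "module_span R M A = \<Inter> {H. submodule H R M \<and> A \<subseteq> H}"

definition fin_gen :: "('a, 'r) ring_scheme \<Rightarrow> ('a, 'm) module \<Rightarrow> bool" where
  "fin_gen R M \<longleftrightarrow> (\<exists>A. finite A \<and> A \<subseteq> carrier M \<and> module_span R M A = carrier M)"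

text \<open>The ring fields \<open>mult\<close> and \<open>one\<close> inherited by the module record play no role in
  the locale \<^locale>\<open>module\<close>; below they are filled arbitrarily.\<close>

definition quot_module :: "('a, 'm) module \<Rightarrow> 'm set \<Rightarrow> ('a, 'm set) module" where
  "quot_module M K =
     \<lparr>carrier = a_rcosets\<^bsub>M\<^esub> K, monoid.mult = rcoset_mult M K, one = K +>\<^bsub>M\<^esub> \<one>\<^bsub>M\<^esub>,
      zero = K, add = set_add M, smult = (\<lambda>r X. \<Union>x\<in>X. K +>\<^bsub>M\<^esub> (r \<odot>\<^bsub>M\<^esub> x))\<rparr>"

definition mod_hom ::
    "('a, 'r) ring_scheme \<Rightarrow> ('a, 'm) module \<Rightarrow> ('a, 'n) module \<Rightarrow> ('m \<Rightarrow> 'n) set" where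
  "mod_hom R M N =
     {f \<in> carrier M \<rightarrow>\<^sub>E carrier N.
        (\<forall>x\<in>carrier M. \<forall>y\<in>carrier M. f (x \<oplus>\<^bsub>M\<^esub> y) = f x \<oplus>\<^bsub>N\<^esub> f y) \<and>
        (\<forall>r\<in>carrier R. \<forall>x\<in>carrier M. f (r \<odot>\<^bsub>M\<^esub> x) = r \<odot>\<^bsub>N\<^esub> f x)}"

definition Hom_module ::
    "('a, 'r) ring_scheme \<Rightarrow> ('a, 'm) module \<Rightarrow> ('a, 'n) module \<Rightarrow> ('a, 'm \<Rightarrow> 'n) module" where
  "Hom_module R M N =
     \<lparr>carrier = mod_hom R M N, monoid.mult = undefined, one = undefined,
      zero = (\<lambda>x\<in>carrier M. \<zero>\<^bsub>N\<^esub>),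
      add = (\<lambda>f g. \<lambda>x\<in>carrier M. f x \<oplus>\<^bsub>N\<^esub> g x),
      smult = (\<lambda>r f. \<lambda>x\<in>carrier M. r \<odot>\<^bsub>N\<^esub> f x)\<rparr>"

text \<open>The free module on a set \<open>B\<close>: finitely supported functions \<open>B \<rightarrow> R\<close>, extended by zero
  to the whole type.\<close>

definition free_module :: "('a, 'r) ring_scheme \<Rightarrow> 'b set \<Rightarrow> ('a, 'b \<Rightarrow> 'a) module" where
  "free_module R B =
     \<lparr>carrier = {u. (\<forall>b. u b \<in> carrier R) \<and> finite {b. u b \<noteq> \<zero>\<^bsub>R\<^esub>} \<and> {b. u b \<noteq> \<zero>\<^bsub>R\<^esub>} \<subseteq> B},
      monoid.mult = undefined, one = undefined,
      zero = (\<lambda>_. \<zero>\<^bsub>R\<^esub>),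
      add = (\<lambda>u v b. u b \<oplus>\<^bsub>R\<^esub> v b),
      smult = (\<lambda>r u b. r \<otimes>\<^bsub>R\<^esub> u b)\<rparr>"


section \<open>The functorial free resolution\<close>

text \<open>Every module \<open>M\<close> has the free resolution \<open>\<dots> \<rightarrow> F\<^sub>1 \<rightarrow> F\<^sub>0 \<rightarrow> M\<close> in which \<open>F\<^sub>0\<close> is
  free on the underlying set of \<open>M\<close> and \<open>F\<^sub>n\<^sub>+\<^sub>1\<close> is free on the underlying set of the kernel
  of the map out of \<open>F\<^sub>n\<close>; each basis element is sent to the element it stands for.  All
  \<open>F\<^sub>n\<close> are made to live in one type by naming basis elements by finitely branching trees: a basis
  element is either an element of \<open>M\<close>, or a finitely supported function on earlier basis
  elements, stored as the finite graph of its restriction to its support.\<close>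

datatype ('a, 'm) symb = Gen (the_gen: 'm) | Comb "(('a, 'm) symb \<times> 'a) fset"

definition encode :: "('a, 'r) ring_scheme \<Rightarrow> (('a, 'm) symb \<Rightarrow> 'a) \<Rightarrow> ('a, 'm) symb" where
  "encode R u = Comb (Abs_fset {(b, u b) | b. u b \<noteq> \<zero>\<^bsub>R\<^esub>})"

definition decode :: "('a, 'r) ring_scheme \<Rightarrow> ('a, 'm) symb \<Rightarrow> ('a, 'm) symb \<Rightarrow> 'a" where
  "decode R s = (\<lambda>b. case s of
       Gen m \<Rightarrow> \<zero>\<^bsub>R\<^esub>
     | Comb G \<Rightarrow> (if \<exists>r. (b, r) |\<in>| G then THE r. (b, r) |\<in>| G else \<zero>\<^bsub>R\<^esub>))"

lemma decode_encode:
  assumes "finite {b. u b \<noteq> \<zero>\<^bsub>R\<^esub>}"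
  shows "decode R (encode R u) = u"
proof -
  have "{(b, u b) | b. u b \<noteq> \<zero>\<^bsub>R\<^esub>} = (\<lambda>b. (b, u b)) ` {b. u b \<noteq> \<zero>\<^bsub>R\<^esub>}" by auto
  with assms have "finite {(b, u b) | b. u b \<noteq> \<zero>\<^bsub>R\<^esub>}" by simp
  then show ?thesis
    by (auto simp: fun_eq_iff decode_def encode_def Abs_fset_inverse)
qed

definition augmentation ::
    "('a, 'r) ring_scheme \<Rightarrow> ('a, 'm) module \<Rightarrow> (('a, 'm) symb \<Rightarrow> 'a) \<Rightarrow> 'm" where
  "augmentation R M u = (\<Oplus>\<^bsub>M\<^esub> b \<in> {b. u b \<noteq> \<zero>\<^bsub>R\<^esub>}. u b \<odot>\<^bsub>M\<^esub> the_gen b)"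

definition boundary ::
    "('a, 'r) ring_scheme \<Rightarrow> (('a, 'm) symb \<Rightarrow> 'a) \<Rightarrow> ('a, 'm) symb \<Rightarrow> 'a" where
  "boundary R u = (\<lambda>x. \<Oplus>\<^bsub>R\<^esub> b \<in> {b. u b \<noteq> \<zero>\<^bsub>R\<^esub>}. u b \<otimes>\<^bsub>R\<^esub> decode R b x)"

fun res_basis :: "('a, 'r) ring_scheme \<Rightarrow> ('a, 'm) module \<Rightarrow> nat \<Rightarrow> ('a, 'm) symb set" where
  "res_basis R M 0 = Gen ` carrier M"
| "res_basis R M (Suc 0) =
     encode R ` {u \<in> carrier (free_module R (res_basis R M 0)). augmentation R M u = \<zero>\<^bsub>M\<^esub>}"
| "res_basis R M (Suc (Suc n)) =
     encode R ` {u \<in> carrier (free_module R (res_basis R M (Suc n))).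
                   boundary R u = (\<lambda>_. \<zero>\<^bsub>R\<^esub>)}"

definition res ::
    "('a, 'r) ring_scheme \<Rightarrow> ('a, 'm) module \<Rightarrow> nat \<Rightarrow> ('a, ('a, 'm) symb \<Rightarrow> 'a) module" where
  "res R M n = free_module R (res_basis R M n)"

text \<open>Functoriality: a homomorphism \<open>f : M \<rightarrow> M'\<close> acts on basis elements, and
  \<open>push R \<beta>\<close> is the linear extension of the map \<open>\<beta>\<close> on basis elements.\<close>

definition push :: "('a, 'r) ring_scheme \<Rightarrow> ('b \<Rightarrow> 'c) \<Rightarrow> ('b \<Rightarrow> 'a) \<Rightarrow> 'c \<Rightarrow> 'a" where
  "push R \<beta> u = (\<lambda>x. \<Oplus>\<^bsub>R\<^esub> b \<in> {b. u b \<noteq> \<zero>\<^bsub>R\<^esub> \<and> \<beta> b = x}. u b)"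

primrec res_map ::
    "('a, 'r) ring_scheme \<Rightarrow> ('m \<Rightarrow> 'k) \<Rightarrow> nat \<Rightarrow> ('a, 'm) symb \<Rightarrow> ('a, 'k) symb" where
  "res_map R f 0 b = Gen (f (the_gen b))"
| "res_map R f (Suc n) b = encode R (push R (res_map R f n) (decode R b))"


section \<open>Ext\<close>

definition cocycles ::
    "('a, 'r) ring_scheme \<Rightarrow> nat \<Rightarrow> ('a, 'm) module \<Rightarrow> ('a, 'n) module
      \<Rightarrow> ((('a, 'm) symb \<Rightarrow> 'a) \<Rightarrow> 'n) set" where
  "cocycles R n M N =
     {c \<in> mod_hom R (res R M n) N. \<forall>u\<in>carrier (res R M (Suc n)). c (boundary R u) = \<zero>\<^bsub>N\<^esub>}"

fun coboundaries ::
    "('a, 'r) ring_scheme \<Rightarrow> nat \<Rightarrow> ('a, 'm) module \<Rightarrow> ('a, 'n) module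
      \<Rightarrow> ((('a, 'm) symb \<Rightarrow> 'a) \<Rightarrow> 'n) set" where
  "coboundaries R 0 M N = {\<lambda>u\<in>carrier (res R M 0). \<zero>\<^bsub>N\<^esub>}"
| "coboundaries R (Suc n) M N =
     (\<lambda>c. \<lambda>u\<in>carrier (res R M (Suc n)). c (boundary R u)) ` mod_hom R (res R M n) N"

definition Ext ::
    "('a, 'r) ring_scheme \<Rightarrow> nat \<Rightarrow> ('a, 'm) module \<Rightarrow> ('a, 'n) module
      \<Rightarrow> ('a, ((('a, 'm) symb \<Rightarrow> 'a) \<Rightarrow> 'n) set) module" where
  "Ext R n M N =
     quot_module ((Hom_module R (res R M n) N)\<lparr>carrier := cocycles R n M N\<rparr>)
       (coboundaries R n M N)"

text \<open>\<open>Ext_map R n f M M' N\<close> is the map \<open>Ext\<^sup>n(M', N) \<rightarrow> Ext\<^sup>n(M, N)\<close> induced by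
  \<open>f : M \<rightarrow> M'\<close>.\<close>

definition Ext_map ::
    "('a, 'r) ring_scheme \<Rightarrow> nat \<Rightarrow> ('m \<Rightarrow> 'k) \<Rightarrow> ('a, 'm) module \<Rightarrow> ('a, 'k) module
      \<Rightarrow> ('a, 'n) module \<Rightarrow> ((('a, 'k) symb \<Rightarrow> 'a) \<Rightarrow> 'n) set \<Rightarrow> ((('a, 'm) symb \<Rightarrow> 'a) \<Rightarrow> 'n) set"
  where
  "Ext_map R n f M M' N X =
     (\<Union>c\<in>X. coboundaries R n M N +>\<^bsub>Hom_module R (res R M n) N\<^esub>
               (\<lambda>u\<in>carrier (res R M n). c (push R (res_map R f n) u)))"


section \<open>Direct limits of sequences of modules\<close>

text \<open>For a direct system \<open>E\<^sub>n\<close> with transition maps \<open>\<phi> n k : E\<^sub>n \<rightarrow> E\<^sub>k\<close> (\<open>n \<le> k\<close>), the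
  limit is the disjoint union of the \<open>E\<^sub>n\<close> modulo eventual equality; \<open>germ E \<phi> n x\<close> is the class
  of \<open>x \<in> E\<^sub>n\<close>.\<close>

definition germ ::
    "(nat \<Rightarrow> ('a, 'e) module) \<Rightarrow> (nat \<Rightarrow> nat \<Rightarrow> 'e \<Rightarrow> 'e) \<Rightarrow> nat \<Rightarrow> 'e \<Rightarrow> (nat \<times> 'e) set" where
  "germ E \<phi> n x = {(m, y). y \<in> carrier (E m) \<and> (\<exists>k. n \<le> k \<and> m \<le> k \<and> \<phi> n k x = \<phi> m k y)}"

definition direct_limit ::
    "(nat \<Rightarrow> ('a, 'e) module) \<Rightarrow> (nat \<Rightarrow> nat \<Rightarrow> 'e \<Rightarrow> 'e) \<Rightarrow> ('a, (nat \<times> 'e) set) module" where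
  "direct_limit E \<phi> =
     \<lparr>carrier = {germ E \<phi> n x | n x. x \<in> carrier (E n)}, monoid.mult = undefined, one = undefined,
      zero = germ E \<phi> 0 \<zero>\<^bsub>E 0\<^esub>,
      add = (\<lambda>X Y. \<Union>(n, x)\<in>X. \<Union>(m, y)\<in>Y.
               germ E \<phi> (max n m) (\<phi> n (max n m) x \<oplus>\<^bsub>E (max n m)\<^esub> \<phi> m (max n m) y)),
      smult = (\<lambda>r X. \<Union>(n, x)\<in>X. germ E \<phi> n (r \<odot>\<^bsub>E n\<^esub> x))\<rparr>"


section \<open>Local cohomology\<close>

text \<open>For a decreasing sequence \<open>S\<close> of submodules of \<open>X\<close>, the direct limit of
  \<open>Ext\<^sup>i(X/S\<^sub>n, N)\<close> along the maps induced by the projections \<open>X/S\<^sub>k \<rightarrow> X/S\<^sub>n\<close>, \<open>n \<le> k\<close>.\<close>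

definition lim_Ext ::
    "('a, 'r) ring_scheme \<Rightarrow> nat \<Rightarrow> ('a, 'm) module \<Rightarrow> (nat \<Rightarrow> 'm set) \<Rightarrow> ('a, 'n) module
      \<Rightarrow> ('a, (nat \<times> ((('a, 'm set) symb \<Rightarrow> 'a) \<Rightarrow> 'n) set) set) module" where
  "lim_Ext R i X S N =
     direct_limit (\<lambda>n. Ext R i (quot_module X (S n)) N)
       (\<lambda>n k. Ext_map R i (\<lambda>C. S n <+>\<^bsub>X\<^esub> C) (quot_module X (S k)) (quot_module X (S n)) N)"

definition ideal_power :: "('a, 'r) ring_scheme \<Rightarrow> 'a set \<Rightarrow> nat \<Rightarrow> 'a set" where
  "ideal_power R I n = I [^]\<^bsub>ideals_set R\<^esub> n"

definition ideal_smult ::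
    "('a, 'r) ring_scheme \<Rightarrow> 'a set \<Rightarrow> ('a, 'm) module \<Rightarrow> 'm set" where
  "ideal_smult R J M = module_span R M {r \<odot>\<^bsub>M\<^esub> x | r x. r \<in> J \<and> x \<in> carrier M}"

definition gen_local_cohomology ::
    "('a, 'r) ring_scheme \<Rightarrow> 'a set \<Rightarrow> nat \<Rightarrow> ('a, 'm) module \<Rightarrow> ('a, 'n) module
      \<Rightarrow> ('a, (nat \<times> ((('a, 'm set) symb \<Rightarrow> 'a) \<Rightarrow> 'n) set) set) module" where
  "gen_local_cohomology R I i M N = lim_Ext R i M (\<lambda>n. ideal_smult R (ideal_power R I n) M) N"

text \<open>Ordinary local cohomology, in Grothendieck's description as the direct limit of
  \<open>Ext\<^sup>i(R/I\<^sup>n, N)\<close>.\<close>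

definition local_cohomology ::
    "('a, 'r) ring_scheme \<Rightarrow> 'a set \<Rightarrow> nat \<Rightarrow> ('a, 'n) module
      \<Rightarrow> ('a, (nat \<times> ((('a, 'a set) symb \<Rightarrow> 'a) \<Rightarrow> 'n) set) set) module" where
  "local_cohomology R I i N = lim_Ext R i (regular_module R) (ideal_power R I) N"


section \<open>Support and cofiniteness\<close>

text \<open>The fraction \<open>x/s\<close> in the localization \<open>X\<^sub>P\<close>, as an equivalence class of pairs.\<close>

definition loc_frac ::
    "('a, 'r) ring_scheme \<Rightarrow> 'a set \<Rightarrow> ('a, 'x) module \<Rightarrow> 'x \<Rightarrow> 'a \<Rightarrow> ('x \<times> 'a) set" where
  "loc_frac R P X x s =
     {(y, t). y \<in> carrier X \<and> t \<in> carrier R - P \<and>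
        (\<exists>w\<in>carrier R - P. w \<odot>\<^bsub>X\<^esub> (t \<odot>\<^bsub>X\<^esub> x) = w \<odot>\<^bsub>X\<^esub> (s \<odot>\<^bsub>X\<^esub> y))}"

definition localization ::
    "('a, 'r) ring_scheme \<Rightarrow> 'a set \<Rightarrow> ('a, 'x) module \<Rightarrow> ('x \<times> 'a) set set" where
  "localization R P X = {loc_frac R P X x s | x s. x \<in> carrier X \<and> s \<in> carrier R - P}"

definition Supp :: "('a, 'r) ring_scheme \<Rightarrow> ('a, 'x) module \<Rightarrow> 'a set set" where
  "Supp R X = {P. primeideal P R \<and> localization R P X \<noteq> {loc_frac R P X \<zero>\<^bsub>X\<^esub> \<one>\<^bsub>R\<^esub>}}"

definition prime_variety :: "('a, 'r) ring_scheme \<Rightarrow> 'a set \<Rightarrow> 'a set set" where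
  "prime_variety R I = {P. primeideal P R \<and> I \<subseteq> P}"

definition cofinite_module ::
    "('a, 'r) ring_scheme \<Rightarrow> 'a set \<Rightarrow> ('a, 'x) module \<Rightarrow> bool" where
  "cofinite_module R I X \<longleftrightarrow>
     module R X \<and> Supp R X \<subseteq> prime_variety R I \<and>
     (\<forall>i. fin_gen R (Ext R i (quot_module (regular_module R) I) X))"

text \<open>Modules are taken with carrier in the type \<open>'a list\<close>, which loses nothing when \<open>R\<close> is
  Noetherian: an \<open>I\<close>-cofinite module \<open>X\<close> is the union of its submodules \<open>(0 :\<^sub>X I\<^sup>n)\<close>, each
  of which is finitely generated because \<open>(0 :\<^sub>X I) \<cong> Hom(R/I, X)\<close> is.  So \<open>X\<close> is countably
  generated, there is a surjection from \<open>'a list\<close> onto it, and it is isomorphic to a module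
  with carrier in \<open>'a list\<close>.\<close>

definition cofinite_category_abelian :: "('a, 'r) ring_scheme \<Rightarrow> 'a set \<Rightarrow> bool" where
  "cofinite_category_abelian R I \<longleftrightarrow>
     (\<forall>(X :: ('a, 'a list) module) (Y :: ('a, 'a list) module) f.
        cofinite_module R I X \<longrightarrow> cofinite_module R I Y \<longrightarrow> f \<in> mod_hom R X Y \<longrightarrow>
          cofinite_module R I (X\<lparr>carrier := {x \<in> carrier X. f x = \<zero>\<^bsub>Y\<^esub>}\<rparr>) \<and>
          cofinite_module R I (quot_module Y (f ` carrier X)))"


section \<open>Projective dimension\<close>

text \<open>The lifting property for modules \<open>X\<close>, \<open>Y\<close> of the two types below implies it for modules
  of all types: the canonical surjection from the free module on the set \<open>carrier P\<close> onto \<open>P\<close>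
  is among the maps \<open>g\<close>, so that \<open>P\<close> is a direct summand of a free module.\<close>

definition projective_module :: "('a, 'r) ring_scheme \<Rightarrow> ('a, 'p) module \<Rightarrow> bool" where
  "projective_module R P \<longleftrightarrow>
     module R P \<and>
     (\<forall>(X :: ('a, 'p \<Rightarrow> 'a) module) (Y :: ('a, 'p) module) g h.
        module R X \<longrightarrow> module R Y \<longrightarrow> g \<in> mod_hom R X Y \<longrightarrow> g ` carrier X = carrier Y \<longrightarrow>
        h \<in> mod_hom R P Y \<longrightarrow> (\<exists>k\<in>mod_hom R P X. \<forall>p\<in>carrier P. g (k p) = h p))"

definition projective_resolution ::
    "('a, 'r) ring_scheme \<Rightarrow> ('a, 'm) module \<Rightarrow> (nat \<Rightarrow> ('a, 'p) module) \<Rightarrow>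
      (nat \<Rightarrow> 'p \<Rightarrow> 'p) \<Rightarrow> ('p \<Rightarrow> 'm) \<Rightarrow> bool" where
  "projective_resolution R M P d \<epsilon> \<longleftrightarrow>
     (\<forall>i. projective_module R (P i)) \<and>
     \<epsilon> \<in> mod_hom R (P 0) M \<and> \<epsilon> ` carrier (P 0) = carrier M \<and>
     (\<forall>i. d i \<in> mod_hom R (P (Suc i)) (P i)) \<and>
     d 0 ` carrier (P (Suc 0)) = {x \<in> carrier (P 0). \<epsilon> x = \<zero>\<^bsub>M\<^esub>} \<and>
     (\<forall>i. d (Suc i) ` carrier (P (Suc (Suc i))) =
          {x \<in> carrier (P (Suc i)). d i x = \<zero>\<^bsub>P i\<^esub>})"

text \<open>Resolutions are taken in the type of the functorial free resolution of \<open>M\<close>.  This does not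
  change the infimum: if \<open>M\<close> has a projective resolution of length \<open>n \<ge> 1\<close> of any kind, then by
  Schanuel's lemma so is \<open>0 \<rightarrow> K \<rightarrow> F\<^sub>n\<^sub>-\<^sub>1 \<rightarrow> \<dots> \<rightarrow> F\<^sub>0 \<rightarrow> M\<close> with \<open>K\<close> the \<open>n\<close>-th syzygy; for
  \<open>n = 0\<close>, \<open>M\<close> itself is isomorphic to a module in that type.  The convention for the zero
  module is dimension 0.\<close>

definition proj_dim :: "('a, 'r) ring_scheme \<Rightarrow> ('a, 'm) module \<Rightarrow> enat" where
  "proj_dim R M =
     Inf {enat n | n. \<exists>(P :: nat \<Rightarrow> ('a, ('a, 'm) symb \<Rightarrow> 'a) module) d \<epsilon>.
            projective_resolution R M P d \<epsilon> \<and> (\<forall>i>n. carrier (P i) = {\<zero>\<^bsub>P i\<^esub>})}"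

end

theory Submission
  imports Defs "HOL-Library.Countable_Set"
begin

text \<open>Write \<open>T\<^sup>i(M)\<close> for the generalized local cohomology of \<open>M\<close> with coefficients in \<open>N\<close>.  By
  the Artin-Rees lemma a short exact sequence \<open>0 \<rightarrow> K \<rightarrow> F \<rightarrow> M \<rightarrow> 0\<close> of finitely generated modules
  stays exact modulo the powers of \<open>I\<close> up to a pro-zero kernel.  Mapping cones of the induced maps
  of functorial resolutions turn this into a long exact sequence
  \<open>\<dots> \<rightarrow> T\<^sup>i\<^sup>-\<^sup>1(K) \<rightarrow> T\<^sup>i(M) \<rightarrow> T\<^sup>i(F) \<rightarrow> T\<^sup>i(K) \<rightarrow> \<dots>\<close>.

  Take \<open>F\<close> free of finite rank, so that all \<open>T\<^sup>i(F)\<close> are cofinite, and induct on \<open>i\<close> for all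
  finitely generated modules at once.  If \<open>T\<^sup>i\<^sup>-\<^sup>1\<close> has cofinite values, the kernel of
  \<open>T\<^sup>i(M) \<rightarrow> T\<^sup>i(F)\<close> is the cokernel of a map between cofinite modules.  This applies to \<open>K\<close> as well:
  \<open>T\<^sup>i(K)\<close> maps to a cofinite module with cofinite kernel, hence the kernel of
  \<open>T\<^sup>i(F) \<rightarrow> T\<^sup>i(K)\<close> is cofinite.  So \<open>T\<^sup>i(M)\<close> is an extension of cofinite modules.\<close>

section \<open>Linear maps\<close>

text \<open>Modulo \<open>I^n\<close> a short exact sequence stays exact only on the right: the
  kernel of \<open>K/I^n K \<rightarrow> F/I^n F\<close> is \<open>(K \<inter> I^n F)/I^n K\<close>,
  and by Artin-Rees a late enough transition map kills it. Passing to the limit needs maps that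
  commute with the transition maps on the nose. So no resolutions or comparison maps are chosen:
  functorial resolutions and their cones are strict inverse systems already, and choices
  (homotopies) enter only to show that a limit vanishes, where they need not be compatible. Types
  shape the rest. An induction over modules of all types cannot be stated, so it runs over modules
  in \<open>nat \<Rightarrow> 'a\<close>, the type of the free modules \<open>R^k\<close> and hence
  of all syzygies; the type of \<open>M\<close> enters in one last step. Closure under kernels and
  cokernels is given for carriers in \<open>'a list\<close>, so cofinite modules are first copied
  there: such a module is a union of finitely generated torsion submodules, hence countably
  generated, and its elements are coded by lists of coefficients.\<close>

definition lin ::
    "('a, 'r) ring_scheme \<Rightarrow> ('a, 'm) module \<Rightarrow> ('a, 'n) module \<Rightarrow> ('m \<Rightarrow> 'n) \<Rightarrow> bool" where
  "lin R M N f \<longleftrightarrow> module R M \<and> module R N \<and> f \<in> carrier M \<rightarrow> carrier N \<and>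
     (\<forall>x\<in>carrier M. \<forall>y\<in>carrier M. f (x \<oplus>\<^bsub>M\<^esub> y) = f x \<oplus>\<^bsub>N\<^esub> f y) \<and>
     (\<forall>r\<in>carrier R. \<forall>x\<in>carrier M. f (r \<odot>\<^bsub>M\<^esub> x) = r \<odot>\<^bsub>N\<^esub> f x)"

lemma linI:
  assumes "module R M" "module R N" "\<And>x. x \<in> carrier M \<Longrightarrow> f x \<in> carrier N"
    "\<And>x y. x \<in> carrier M \<Longrightarrow> y \<in> carrier M \<Longrightarrow> f (x \<oplus>\<^bsub>M\<^esub> y) = f x \<oplus>\<^bsub>N\<^esub> f y"
    "\<And>r x. r \<in> carrier R \<Longrightarrow> x \<in> carrier M \<Longrightarrow> f (r \<odot>\<^bsub>M\<^esub> x) = r \<odot>\<^bsub>N\<^esub> f x"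
  shows "lin R M N f"
  using assms by (auto simp: lin_def)

lemma lin_module1: "lin R M N f \<Longrightarrow> module R M" and lin_module2: "lin R M N f \<Longrightarrow> module R N"
  by (auto simp: lin_def)

lemma lin_closed: "lin R M N f \<Longrightarrow> x \<in> carrier M \<Longrightarrow> f x \<in> carrier N"
  and lin_add: "lin R M N f \<Longrightarrow> x \<in> carrier M \<Longrightarrow> y \<in> carrier M \<Longrightarrow> f (x \<oplus>\<^bsub>M\<^esub> y) = f x \<oplus>\<^bsub>N\<^esub> f y"
  and lin_smult: "lin R M N f \<Longrightarrow> r \<in> carrier R \<Longrightarrow> x \<in> carrier M \<Longrightarrow> f (r \<odot>\<^bsub>M\<^esub> x) = r \<odot>\<^bsub>N\<^esub> f x"
  by (auto simp: lin_def)

lemma module_cring: "module R M \<Longrightarrow> cring R"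
  and module_abelian_group: "module R M \<Longrightarrow> abelian_group M"
  by (auto simp: module_def)

lemma module_zero_closed [simp]: "module R M \<Longrightarrow> \<zero>\<^bsub>M\<^esub> \<in> carrier M"
  by (simp add: module_def abelian_group_def abelian_monoid.zero_closed)

text \<open>Negation is a scalar, so whatever respects scalars respects negation;
  \<open>submodule_intro\<close> and \<open>lin_neg\<close> rest on this.\<close>

lemma module_neg: "module R M \<Longrightarrow> x \<in> carrier M \<Longrightarrow> (\<ominus>\<^bsub>R\<^esub> \<one>\<^bsub>R\<^esub>) \<odot>\<^bsub>M\<^esub> x = \<ominus>\<^bsub>M\<^esub> x"
proof -
  assume a: "module R M" "x \<in> carrier M"
  interpret module R M by fact
  show ?thesis using a by (simp add: smult_l_minus)
qed

lemma lin_zero: "lin R M N f \<Longrightarrow> f \<zero>\<^bsub>M\<^esub> = \<zero>\<^bsub>N\<^esub>"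
proof -
  assume a: "lin R M N f"
  interpret M: module R M using a by (simp add: lin_def)
  interpret N: module R N using a by (simp add: lin_def)
  have "f (\<zero>\<^bsub>R\<^esub> \<odot>\<^bsub>M\<^esub> \<zero>\<^bsub>M\<^esub>) = \<zero>\<^bsub>R\<^esub> \<odot>\<^bsub>N\<^esub> f \<zero>\<^bsub>M\<^esub>" by (rule lin_smult[OF a]) simp_all
  then show ?thesis using lin_closed[OF a] by simp
qed

lemma lin_neg: "lin R M N f \<Longrightarrow> x \<in> carrier M \<Longrightarrow> f (\<ominus>\<^bsub>M\<^esub> x) = \<ominus>\<^bsub>N\<^esub> f x"
proof -
  assume a: "lin R M N f" "x \<in> carrier M"
  interpret M: module R M using a by (simp add: lin_def)
  interpret N: module R N using a by (simp add: lin_def)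
  have "f ((\<ominus>\<^bsub>R\<^esub> \<one>\<^bsub>R\<^esub>) \<odot>\<^bsub>M\<^esub> x) = (\<ominus>\<^bsub>R\<^esub> \<one>\<^bsub>R\<^esub>) \<odot>\<^bsub>N\<^esub> f x" using a by (intro lin_smult) auto
  then show ?thesis
    using a lin_closed[OF a(1)] M.module_axioms N.module_axioms by (simp add: module_neg)
qed

lemma lin_diff: "lin R M N f \<Longrightarrow> x \<in> carrier M \<Longrightarrow> y \<in> carrier M \<Longrightarrow> f (x \<ominus>\<^bsub>M\<^esub> y) = f x \<ominus>\<^bsub>N\<^esub> f y"
proof -
  assume a: "lin R M N f" "x \<in> carrier M" "y \<in> carrier M"
  interpret M: module R M using a by (simp add: lin_def)
  interpret N: module R N using a by (simp add: lin_def)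
  show ?thesis using a by (simp add: M.minus_eq N.minus_eq lin_add lin_neg)
qed

lemma lin_comp: "lin R M N f \<Longrightarrow> lin R N P g \<Longrightarrow> lin R M P (\<lambda>x. g (f x))"
  by (auto simp: lin_def Pi_iff)

lemma lin_cong: "lin R M N f \<Longrightarrow> (\<And>x. x \<in> carrier M \<Longrightarrow> f x = g x) \<Longrightarrow> lin R M N g"
proof -
  assume a: "lin R M N f" "\<And>x. x \<in> carrier M \<Longrightarrow> f x = g x"
  interpret M: module R M using a by (simp add: lin_def)
  show ?thesis
    using a(1) by (intro linI) (auto simp: a(2)[symmetric] lin_def)
qed

text \<open>The maps in \<open>mod_hom\<close> are extensional, so a composite must be restricted
  before it is one again. \<open>lin\<close> ignores values outside the carrier and composes freely;
  this is the bridge between the two.\<close>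

lemma mod_hom_iff:
  "module R M \<Longrightarrow> module R N \<Longrightarrow> f \<in> mod_hom R M N \<longleftrightarrow> lin R M N f \<and> f \<in> extensional (carrier M)"
  by (auto simp: mod_hom_def lin_def PiE_def)

lemma mod_hom_lin: "module R M \<Longrightarrow> module R N \<Longrightarrow> f \<in> mod_hom R M N \<Longrightarrow> lin R M N f"
  by (simp add: mod_hom_iff)

lemma restrict_mod_hom: "lin R M N f \<Longrightarrow> restrict f (carrier M) \<in> mod_hom R M N"
proof -
  assume a: "lin R M N f"
  then have "lin R M N (restrict f (carrier M))" by (rule lin_cong) simp
  then show ?thesis using a by (simp add: mod_hom_iff lin_def)
qed

lemma lin_plus:
  assumes f: "lin R M N f" and g: "lin R M N g"
  shows "lin R M N (\<lambda>x. f x \<oplus>\<^bsub>N\<^esub> g x)"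
proof -
  interpret M: module R M using f by (simp add: lin_def)
  interpret N: module R N using f by (simp add: lin_def)
  note c = lin_closed[OF f] lin_closed[OF g]
  show ?thesis
    by (rule linI) (auto simp: c lin_add[OF f] lin_add[OF g] lin_smult[OF f] lin_smult[OF g]
        N.smult_r_distr N.add.m_ac M.module_axioms N.module_axioms)
qed

lemma lin_scale:
  assumes f: "lin R M N f" and r: "r \<in> carrier R"
  shows "lin R M N (\<lambda>x. r \<odot>\<^bsub>N\<^esub> f x)"
proof -
  interpret M: module R M using f by (simp add: lin_def)
  interpret N: module R N using f by (simp add: lin_def)
  note c = lin_closed[OF f]
  have "r \<odot>\<^bsub>N\<^esub> (s \<odot>\<^bsub>N\<^esub> y) = s \<odot>\<^bsub>N\<^esub> (r \<odot>\<^bsub>N\<^esub> y)" if "s \<in> carrier R" "y \<in> carrier N" for s y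
    using that r by (simp add: N.smult_assoc1[symmetric] M.R.m_comm)
  then show ?thesis
    by (intro linI) (auto simp: c r lin_add[OF f] lin_smult[OF f]
        N.smult_r_distr M.module_axioms N.module_axioms)
qed

lemma lin_uminus: "lin R M N f \<Longrightarrow> lin R M N (\<lambda>x. \<ominus>\<^bsub>N\<^esub> f x)"
proof -
  assume f: "lin R M N f"
  interpret N: module R N using f by (simp add: lin_def)
  show ?thesis
    by (rule lin_cong[OF lin_scale[OF f, of "\<ominus>\<^bsub>R\<^esub> \<one>\<^bsub>R\<^esub>"]])
       (auto simp: module_neg[OF N.module_axioms] lin_closed[OF f])
qed

lemma lin_minus: "lin R M N f \<Longrightarrow> lin R M N g \<Longrightarrow> lin R M N (\<lambda>x. f x \<ominus>\<^bsub>N\<^esub> g x)"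
proof -
  assume f: "lin R M N f" and g: "lin R M N g"
  interpret N: module R N using f by (simp add: lin_def)
  show ?thesis using lin_plus[OF f lin_uminus[OF g]] by (simp add: N.minus_eq)
qed

lemma lin_const_zero: "module R M \<Longrightarrow> module R N \<Longrightarrow> lin R M N (\<lambda>_. \<zero>\<^bsub>N\<^esub>)"
proof -
  assume a: "module R M" "module R N"
  interpret N: module R N by fact
  show ?thesis using a by (intro linI) auto
qed

lemma lin_ident: "module R M \<Longrightarrow> lin R M M (\<lambda>x. x)"
  by (auto simp: lin_def)


section \<open>Submodules\<close>

lemma submodule_intro:
  assumes M: "module R M" and "H \<subseteq> carrier M" "\<zero>\<^bsub>M\<^esub> \<in> H"
    "\<And>x y. x \<in> H \<Longrightarrow> y \<in> H \<Longrightarrow> x \<oplus>\<^bsub>M\<^esub> y \<in> H"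
    "\<And>r x. r \<in> carrier R \<Longrightarrow> x \<in> H \<Longrightarrow> r \<odot>\<^bsub>M\<^esub> x \<in> H"
  shows "submodule H R M"
proof -
  interpret module R M by fact
  have "\<ominus>\<^bsub>M\<^esub> x \<in> H" if "x \<in> H" for x
    using assms(5)[of "\<ominus>\<^bsub>R\<^esub> \<one>\<^bsub>R\<^esub>" x] module_neg[OF M, of x] that assms(2) by auto
  then show ?thesis using assms by (intro submoduleI) auto
qed

lemma submoduleD:
  assumes "module R M" "submodule H R M"
  shows "H \<subseteq> carrier M" "\<zero>\<^bsub>M\<^esub> \<in> H"
    "\<And>x y. x \<in> H \<Longrightarrow> y \<in> H \<Longrightarrow> x \<oplus>\<^bsub>M\<^esub> y \<in> H"
    "\<And>r x. r \<in> carrier R \<Longrightarrow> x \<in> H \<Longrightarrow> r \<odot>\<^bsub>M\<^esub> x \<in> H"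
    "\<And>x. x \<in> H \<Longrightarrow> \<ominus>\<^bsub>M\<^esub> x \<in> H"
    "\<And>x y. x \<in> H \<Longrightarrow> y \<in> H \<Longrightarrow> x \<ominus>\<^bsub>M\<^esub> y \<in> H"
proof -
  interpret module R M by fact
  note E = submoduleE[OF assms(2)]
  show "H \<subseteq> carrier M" "\<And>x. x \<in> H \<Longrightarrow> \<ominus>\<^bsub>M\<^esub> x \<in> H"
     "\<And>x y. x \<in> H \<Longrightarrow> y \<in> H \<Longrightarrow> x \<oplus>\<^bsub>M\<^esub> y \<in> H"
     "\<And>r x. r \<in> carrier R \<Longrightarrow> x \<in> H \<Longrightarrow> r \<odot>\<^bsub>M\<^esub> x \<in> H"
    using E by auto
  show "\<zero>\<^bsub>M\<^esub> \<in> H" using subgroup.one_closed[OF submodule.axioms(1)[OF assms(2)]] by simp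
  show "\<And>x y. x \<in> H \<Longrightarrow> y \<in> H \<Longrightarrow> x \<ominus>\<^bsub>M\<^esub> y \<in> H"
    using E by (simp add: minus_eq)
qed

lemma submodule_module: "module R M \<Longrightarrow> submodule H R M \<Longrightarrow> module R (M\<lparr>carrier := H\<rparr>)"
  by (rule submodule.submodule_is_module)

lemma lin_submodule:
  assumes "lin R M N f" "submodule H R M"
  shows "lin R (M\<lparr>carrier := H\<rparr>) N f"
  using submodule_module[OF lin_module1[OF assms(1)] assms(2)]
    submoduleD(1)[OF lin_module1[OF assms(1)] assms(2)] assms(1)
  unfolding lin_def by (auto simp: subset_iff Pi_iff)

lemma lin_into_submodule:
  assumes "lin R M N f" "submodule H R N" "\<And>x. x \<in> carrier M \<Longrightarrow> f x \<in> H"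
  shows "lin R M (N\<lparr>carrier := H\<rparr>) f"
  using submodule_module[OF lin_module2[OF assms(1)] assms(2)] assms(1,3)
  unfolding lin_def by auto

lemma submodule_of_submodule:
  assumes "module R M" "submodule H R M" "submodule K R M" "K \<subseteq> H"
  shows "submodule K R (M\<lparr>carrier := H\<rparr>)"
  by (rule submodule_intro[OF submodule_module[OF assms(1,2)]])
     (auto simp: submoduleD[OF assms(1,3)] assms(4) subsetD[OF assms(4)])

lemma submodule_in_submodule:
  assumes "module R M" "submodule H R M" "submodule K R (M\<lparr>carrier := H\<rparr>)"
  shows "submodule K R M"
  using submoduleD[OF submodule_module[OF assms(1,2)] assms(3)] submoduleD(1)[OF assms(1,2)]
  by (intro submodule_intro[OF assms(1)]) auto

lemma submodule_carrier: "module R M \<Longrightarrow> submodule (carrier M) R M"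
  by (rule module.carrier_is_submodule)

lemma submodule_zero: "module R M \<Longrightarrow> submodule {\<zero>\<^bsub>M\<^esub>} R M"
proof -
  assume a: "module R M"
  interpret module R M by fact
  show ?thesis by (rule submodule_intro[OF a]) auto
qed

lemma submodule_Inter:
  assumes "module R M" "\<And>H. H \<in> S \<Longrightarrow> submodule H R M" "S \<noteq> {}"
  shows "submodule (\<Inter>S) R M"
proof (rule submodule_intro[OF assms(1)])
  show "\<Inter>S \<subseteq> carrier M" using submoduleD(1)[OF assms(1) assms(2)] assms(3) by blast
qed (use submoduleD[OF assms(1) assms(2)] in auto)

lemma submodule_Int: "module R M \<Longrightarrow> submodule H R M \<Longrightarrow> submodule K R M \<Longrightarrow> submodule (H \<inter> K) R M"
  using submodule_Inter[of R M "{H, K}"] by auto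

lemma submodule_vimage:
  assumes f: "lin R M N f" and "submodule H R N"
  shows "submodule {x \<in> carrier M. f x \<in> H} R M"
proof -
  note M = lin_module1[OF f] and N = lin_module2[OF f]
  interpret M: module R M by fact
  show ?thesis using submoduleD[OF N assms(2)]
    by (intro submodule_intro[OF M]) (auto simp: lin_zero[OF f] lin_add[OF f] lin_smult[OF f])
qed

lemma submodule_kernel:
  assumes f: "lin R M N f"
  shows "submodule {x \<in> carrier M. f x = \<zero>\<^bsub>N\<^esub>} R M"
  using submodule_vimage[OF f submodule_zero[OF lin_module2[OF f]]] by simp

lemma submodule_image:
  assumes f: "lin R M N f" and "submodule H R M"
  shows "submodule (f ` H) R N"
proof -
  note M = lin_module1[OF f] and N = lin_module2[OF f]
  note D = submoduleD[OF M assms(2)]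
  show ?thesis
  proof (rule submodule_intro[OF N])
    show "f ` H \<subseteq> carrier N" using D lin_closed[OF f] by auto
    show "\<zero>\<^bsub>N\<^esub> \<in> f ` H" using D(2) lin_zero[OF f] by force
  next
    fix x y assume "x \<in> f ` H" "y \<in> f ` H"
    then obtain a b where ab: "a \<in> H" "b \<in> H" "x = f a" "y = f b" by auto
    then have "x \<oplus>\<^bsub>N\<^esub> y = f (a \<oplus>\<^bsub>M\<^esub> b)" using D(1) by (auto simp: lin_add[OF f] subset_iff)
    then show "x \<oplus>\<^bsub>N\<^esub> y \<in> f ` H" using ab D by auto
  next
    fix r x assume "r \<in> carrier R" "x \<in> f ` H"
    then obtain a where ab: "a \<in> H" "x = f a" by auto
    then have "r \<odot>\<^bsub>N\<^esub> x = f (r \<odot>\<^bsub>M\<^esub> a)" using D(1) \<open>r \<in> carrier R\<close> by (auto simp: lin_smult[OF f] subset_iff)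
    then show "r \<odot>\<^bsub>N\<^esub> x \<in> f ` H" using ab D \<open>r \<in> carrier R\<close> by auto
  qed
qed

lemma submodule_range: "lin R M N f \<Longrightarrow> submodule (f ` carrier M) R N"
  by (rule submodule_image[OF _ submodule_carrier]) (auto simp: lin_def)

lemma submodule_sum:
  assumes M: "module R M" and H: "submodule H R M" and K: "submodule K R M"
  shows "submodule {x \<oplus>\<^bsub>M\<^esub> y | x y. x \<in> H \<and> y \<in> K} R M" (is "submodule ?S R M")
proof -
  interpret module R M by fact
  note HD = submoduleD[OF M H] and KD = submoduleD[OF M K]
  show ?thesis
  proof (rule submodule_intro[OF M])
    show "?S \<subseteq> carrier M" using HD(1) KD(1) by auto
    show "\<zero>\<^bsub>M\<^esub> \<in> ?S" using HD(2) KD(2) by force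
  next
    fix x y assume "x \<in> ?S" "y \<in> ?S"
    then obtain a b c d where *: "a \<in> H" "b \<in> K" "c \<in> H" "d \<in> K" "x = a \<oplus>\<^bsub>M\<^esub> b" "y = c \<oplus>\<^bsub>M\<^esub> d" by auto
    then have "x \<oplus>\<^bsub>M\<^esub> y = (a \<oplus>\<^bsub>M\<^esub> c) \<oplus>\<^bsub>M\<^esub> (b \<oplus>\<^bsub>M\<^esub> d)"
      using HD(1) KD(1) by (auto simp: subset_iff M.add.m_ac)
    then show "x \<oplus>\<^bsub>M\<^esub> y \<in> ?S" using * HD(3) KD(3) by blast
  next
    fix r x assume r: "r \<in> carrier R" and "x \<in> ?S"
    then obtain a b where *: "a \<in> H" "b \<in> K" "x = a \<oplus>\<^bsub>M\<^esub> b" by auto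
    then have "r \<odot>\<^bsub>M\<^esub> x = r \<odot>\<^bsub>M\<^esub> a \<oplus>\<^bsub>M\<^esub> r \<odot>\<^bsub>M\<^esub> b"
      using HD(1) KD(1) r by (auto simp: subset_iff smult_r_distr)
    then show "r \<odot>\<^bsub>M\<^esub> x \<in> ?S" using * HD(4) KD(4) r by blast
  qed
qed

lemma submodule_multiples:
  assumes M: "module R M" and x: "x \<in> carrier M"
  shows "submodule ((\<lambda>r. r \<odot>\<^bsub>M\<^esub> x) ` carrier R) R M" (is "submodule ?S R M")
proof -
  interpret module R M by fact
  show ?thesis
  proof (rule submodule_intro[OF M])
    show "?S \<subseteq> carrier M" using x by auto
    show "\<zero>\<^bsub>M\<^esub> \<in> ?S" using x smult_l_null[of x] by force
  next
    fix u v assume "u \<in> ?S" "v \<in> ?S"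
    then obtain a b where *: "a \<in> carrier R" "b \<in> carrier R" "u = a \<odot>\<^bsub>M\<^esub> x" "v = b \<odot>\<^bsub>M\<^esub> x" by auto
    then have "u \<oplus>\<^bsub>M\<^esub> v = (a \<oplus>\<^bsub>R\<^esub> b) \<odot>\<^bsub>M\<^esub> x" using x by (simp add: smult_l_distr)
    then show "u \<oplus>\<^bsub>M\<^esub> v \<in> ?S" using * by auto
  next
    fix r u assume r: "r \<in> carrier R" and "u \<in> ?S"
    then obtain a where *: "a \<in> carrier R" "u = a \<odot>\<^bsub>M\<^esub> x" by auto
    then have "r \<odot>\<^bsub>M\<^esub> u = (r \<otimes>\<^bsub>R\<^esub> a) \<odot>\<^bsub>M\<^esub> x" using x r by (simp add: smult_assoc1)
    then show "r \<odot>\<^bsub>M\<^esub> u \<in> ?S" using * r by auto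
  qed
qed


section \<open>Constructions of modules\<close>

text \<open>A module structure descends along compatible maps \<open>\<pi> n\<close> out of modules \<open>E n\<close> whose images
  exhaust \<open>T\<close> and grow with \<open>n\<close>, because each module axiom involves finitely many elements.\<close>

lemma module_directed:
  fixes E :: "nat \<Rightarrow> ('a, 'e) module" and \<pi> :: "nat \<Rightarrow> 'e \<Rightarrow> 't"
  assumes E: "\<And>n. module R (E n)"
    and carrier: "carrier T = (\<Union>n. \<pi> n ` carrier (E n))"
    and mono: "\<And>n m. n \<le> m \<Longrightarrow> \<pi> n ` carrier (E n) \<subseteq> \<pi> m ` carrier (E m)"
    and add: "\<And>n x y. x \<in> carrier (E n) \<Longrightarrow> y \<in> carrier (E n) \<Longrightarrow>
      \<pi> n x \<oplus>\<^bsub>T\<^esub> \<pi> n y = \<pi> n (x \<oplus>\<^bsub>E n\<^esub> y)"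
    and smult: "\<And>n r x. r \<in> carrier R \<Longrightarrow> x \<in> carrier (E n) \<Longrightarrow> r \<odot>\<^bsub>T\<^esub> \<pi> n x = \<pi> n (r \<odot>\<^bsub>E n\<^esub> x)"
    and zero: "\<And>n. \<zero>\<^bsub>T\<^esub> = \<pi> n \<zero>\<^bsub>E n\<^esub>"
  shows "module R T"
proof -
  have ex3: "\<exists>n a b c. a \<in> carrier (E n) \<and> b \<in> carrier (E n) \<and> c \<in> carrier (E n) \<and>
      x = \<pi> n a \<and> y = \<pi> n b \<and> z = \<pi> n c"
    if xyz: "x \<in> carrier T" "y \<in> carrier T" "z \<in> carrier T" for x y z
  proof -
    obtain i j k where "x \<in> \<pi> i ` carrier (E i)" "y \<in> \<pi> j ` carrier (E j)" "z \<in> \<pi> k ` carrier (E k)"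
      using xyz carrier by auto
    moreover define n where "n = max i (max j k)"
    ultimately have "i \<le> n" "j \<le> n" "k \<le> n"
      and "x \<in> \<pi> i ` carrier (E i)" "y \<in> \<pi> j ` carrier (E j)" "z \<in> \<pi> k ` carrier (E k)" by simp_all
    then have "x \<in> \<pi> n ` carrier (E n)" "y \<in> \<pi> n ` carrier (E n)" "z \<in> \<pi> n ` carrier (E n)"
      using mono by blast+
    then show ?thesis by blast
  qed
  have inT: "\<pi> n x \<in> carrier T" if "x \<in> carrier (E n)" for n x using that carrier by auto
  have cr: "cring R" using E[of 0] by (rule module_cring)
  interpret E: module R "E n" for n by (rule E)
  have ag: "abelian_group T"
  proof (rule abelian_groupI)
    fix x y assume "x \<in> carrier T" "y \<in> carrier T"
    with ex3[of x y y] obtain n a b where "a \<in> carrier (E n)" "b \<in> carrier (E n)" "x = \<pi> n a" "y = \<pi> n b"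
      by blast
    then show "x \<oplus>\<^bsub>T\<^esub> y \<in> carrier T" "x \<oplus>\<^bsub>T\<^esub> y = y \<oplus>\<^bsub>T\<^esub> x"
      by (auto simp: add inT E.add.m_comm)
  next
    show "\<zero>\<^bsub>T\<^esub> \<in> carrier T" using zero inT[of "\<zero>\<^bsub>E 0\<^esub>" 0] by simp
  next
    fix x y z assume "x \<in> carrier T" "y \<in> carrier T" "z \<in> carrier T"
    with ex3[of x y z] obtain n a b c where "a \<in> carrier (E n)" "b \<in> carrier (E n)" "c \<in> carrier (E n)"
        "x = \<pi> n a" "y = \<pi> n b" "z = \<pi> n c" by blast
    then show "(x \<oplus>\<^bsub>T\<^esub> y) \<oplus>\<^bsub>T\<^esub> z = x \<oplus>\<^bsub>T\<^esub> (y \<oplus>\<^bsub>T\<^esub> z)"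
      by (simp add: add E.add.m_assoc)
  next
    fix x assume "x \<in> carrier T"
    with ex3[of x x x] obtain n a where a: "a \<in> carrier (E n)" "x = \<pi> n a" by blast
    then show "\<zero>\<^bsub>T\<^esub> \<oplus>\<^bsub>T\<^esub> x = x" by (simp add: add zero[of n])
    have "\<pi> n (\<ominus>\<^bsub>E n\<^esub> a) \<oplus>\<^bsub>T\<^esub> x = \<zero>\<^bsub>T\<^esub>" using a by (simp add: add zero[of n] E.l_neg)
    then show "\<exists>y\<in>carrier T. y \<oplus>\<^bsub>T\<^esub> x = \<zero>\<^bsub>T\<^esub>" using a inT by blast
  qed
  show ?thesis
  proof (rule moduleI[OF cr ag])
    fix r x assume r: "r \<in> carrier R" and x: "x \<in> carrier T"
    with ex3[of x x x] obtain n a where a: "a \<in> carrier (E n)" "x = \<pi> n a" by blast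
    then show "r \<odot>\<^bsub>T\<^esub> x \<in> carrier T" using r by (simp add: smult inT)
    fix s assume s: "s \<in> carrier R"
    show "(r \<oplus>\<^bsub>R\<^esub> s) \<odot>\<^bsub>T\<^esub> x = (r \<odot>\<^bsub>T\<^esub> x) \<oplus>\<^bsub>T\<^esub> (s \<odot>\<^bsub>T\<^esub> x)"
      using a r s by (simp add: smult add E.smult_l_distr)
    show "(r \<otimes>\<^bsub>R\<^esub> s) \<odot>\<^bsub>T\<^esub> x = r \<odot>\<^bsub>T\<^esub> (s \<odot>\<^bsub>T\<^esub> x)"
      using a r s by (simp add: smult add E.smult_assoc1)
  next
    fix x assume x: "x \<in> carrier T"
    with ex3[of x x x] obtain n a where a: "a \<in> carrier (E n)" "x = \<pi> n a" by blast
    then show "\<one>\<^bsub>R\<^esub> \<odot>\<^bsub>T\<^esub> x = x" by (simp add: smult)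
  next
    fix r x y assume r: "r \<in> carrier R" and "x \<in> carrier T" "y \<in> carrier T"
    with ex3[of x y y] obtain n a b where "a \<in> carrier (E n)" "b \<in> carrier (E n)" "x = \<pi> n a" "y = \<pi> n b"
      by blast
    then show "r \<odot>\<^bsub>T\<^esub> (x \<oplus>\<^bsub>T\<^esub> y) = (r \<odot>\<^bsub>T\<^esub> x) \<oplus>\<^bsub>T\<^esub> (r \<odot>\<^bsub>T\<^esub> y)"
      using r by (simp add: smult add E.smult_r_distr)
  qed
qed

lemma module_surjective:
  assumes E: "module R E" and "carrier T = \<pi> ` carrier E"
    and "\<And>x y. x \<in> carrier E \<Longrightarrow> y \<in> carrier E \<Longrightarrow> \<pi> x \<oplus>\<^bsub>T\<^esub> \<pi> y = \<pi> (x \<oplus>\<^bsub>E\<^esub> y)"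
    and "\<And>r x. r \<in> carrier R \<Longrightarrow> x \<in> carrier E \<Longrightarrow> r \<odot>\<^bsub>T\<^esub> \<pi> x = \<pi> (r \<odot>\<^bsub>E\<^esub> x)"
    and "\<zero>\<^bsub>T\<^esub> = \<pi> \<zero>\<^bsub>E\<^esub>"
  shows "module R T" "lin R E T \<pi>"
proof -
  show T: "module R T"
    by (rule module_directed[of R "\<lambda>_. E" T "\<lambda>_. \<pi>"]) (use assms in auto)
  show "lin R E T \<pi>" using assms T by (intro linI) auto
qed

lemma regular_module_simps [simp]:
  "carrier (regular_module R) = carrier R" "add (regular_module R) = add R"
  "zero (regular_module R) = zero R" "smult (regular_module R) = monoid.mult R"
  by (auto simp: regular_module_def)

text \<open>Finite sums depend on the additive monoid alone, which the regular module shares with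
  the ring; the same holds for negation and subtraction.\<close>

lemma finsum_regular [simp]: "finsum (regular_module R) = finsum R"
  by (simp add: finsum_def finprod_def fun_eq_iff)

lemma a_inv_regular [simp]: "a_inv (regular_module R) = a_inv R"
  by (simp add: a_inv_def m_inv_def fun_eq_iff)

lemma a_minus_regular [simp]: "a_minus (regular_module R) = a_minus R"
  by (simp add: a_minus_def fun_eq_iff)

lemma module_regular: "cring R \<Longrightarrow> module R (regular_module R)"
proof -
  assume "cring R"
  interpret cring R by fact
  show ?thesis
  proof (rule moduleI)
    show "abelian_group (regular_module R)"
      by (rule abelian_groupI)
         (auto simp: a_ac intro: bexI[of _ "\<ominus>\<^bsub>R\<^esub> x" for x] l_neg)
  qed (auto simp: l_distr r_distr m_assoc cring_axioms)
qed

text \<open>Passing from submodules to ideals is what lets the Noetherian condition and the prime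
  ideals of the ring enter arguments about modules.\<close>

lemma submodule_regular_iff:
  assumes "cring R"
  shows "submodule J R (regular_module R) \<longleftrightarrow> ideal J R"
proof
  interpret cring R by fact
  note M = module_regular[OF \<open>cring R\<close>]
  {
    assume J: "submodule J R (regular_module R)"
    note D = submoduleD[OF M J, simplified]
    show "ideal J R"
    proof (rule idealI)
      show "subgroup J (add_monoid R)"
        using submodule.axioms(1)[OF J] by (simp add: subgroup_def m_inv_def)
      show "x \<otimes>\<^bsub>R\<^esub> a \<in> J" if "a \<in> J" "x \<in> carrier R" for a x using D that by auto
      then show "a \<otimes>\<^bsub>R\<^esub> x \<in> J" if "a \<in> J" "x \<in> carrier R" for a x
        using that m_comm[of a x] D(1) by auto
    qed (rule ring_axioms)
  }
  {
    assume "ideal J R"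
    then interpret J: ideal J R .
    show "submodule J R (regular_module R)"
      by (rule submodule_intro[OF M]) (auto intro: J.I_l_closed)
  }
qed

definition prod_module :: "('a, 'q) module \<Rightarrow> ('a, 'p) module \<Rightarrow> ('a, 'q \<times> 'p) module" where
  "prod_module Q P =
     \<lparr>carrier = carrier Q \<times> carrier P, monoid.mult = undefined, one = undefined,
      zero = (\<zero>\<^bsub>Q\<^esub>, \<zero>\<^bsub>P\<^esub>),
      add = (\<lambda>u v. (fst u \<oplus>\<^bsub>Q\<^esub> fst v, snd u \<oplus>\<^bsub>P\<^esub> snd v)),
      smult = (\<lambda>r u. (r \<odot>\<^bsub>Q\<^esub> fst u, r \<odot>\<^bsub>P\<^esub> snd u))\<rparr>"

lemma prod_module_simps [simp]:
  "carrier (prod_module Q P) = carrier Q \<times> carrier P"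
  "\<zero>\<^bsub>prod_module Q P\<^esub> = (\<zero>\<^bsub>Q\<^esub>, \<zero>\<^bsub>P\<^esub>)"
  "u \<oplus>\<^bsub>prod_module Q P\<^esub> v = (fst u \<oplus>\<^bsub>Q\<^esub> fst v, snd u \<oplus>\<^bsub>P\<^esub> snd v)"
  "r \<odot>\<^bsub>prod_module Q P\<^esub> u = (r \<odot>\<^bsub>Q\<^esub> fst u, r \<odot>\<^bsub>P\<^esub> snd u)"
  by (auto simp: prod_module_def)

lemma module_prod:
  assumes "module R Q" "module R P"
  shows "module R (prod_module Q P)"
proof -
  interpret Q: module R Q by fact
  interpret P: module R P by fact
  show ?thesis
  proof (rule moduleI)
    show "abelian_group (prod_module Q P)"
    proof (rule abelian_groupI)
      fix u assume "u \<in> carrier (prod_module Q P)"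
      then show "\<exists>v\<in>carrier (prod_module Q P). v \<oplus>\<^bsub>prod_module Q P\<^esub> u = \<zero>\<^bsub>prod_module Q P\<^esub>"
        by (intro bexI[of _ "(\<ominus>\<^bsub>Q\<^esub> fst u, \<ominus>\<^bsub>P\<^esub> snd u)"]) (auto simp: Q.l_neg P.l_neg)
    qed (auto simp: Q.add.m_ac P.add.m_ac)
  qed (auto simp: Q.smult_l_distr P.smult_l_distr Q.smult_r_distr P.smult_r_distr
      Q.smult_assoc1 P.smult_assoc1 Q.R.cring_axioms)
qed

lemma lin_fst: "module R Q \<Longrightarrow> module R P \<Longrightarrow> lin R (prod_module Q P) Q fst"
  and lin_snd: "module R Q \<Longrightarrow> module R P \<Longrightarrow> lin R (prod_module Q P) P snd"
  by (auto intro!: linI module_prod)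

lemma lin_inl: "module R Q \<Longrightarrow> module R P \<Longrightarrow> lin R Q (prod_module Q P) (\<lambda>q. (q, \<zero>\<^bsub>P\<^esub>))"
proof -
  assume a: "module R Q" "module R P"
  interpret P: module R P by fact
  show ?thesis using a by (intro linI module_prod) auto
qed

lemma lin_inr: "module R Q \<Longrightarrow> module R P \<Longrightarrow> lin R P (prod_module Q P) (\<lambda>p. (\<zero>\<^bsub>Q\<^esub>, p))"
proof -
  assume a: "module R Q" "module R P"
  interpret Q: module R Q by fact
  show ?thesis using a by (intro linI module_prod) auto
qed

lemma lin_pair:
  assumes "lin R X Q f" "lin R X P g"
  shows "lin R X (prod_module Q P) (\<lambda>x. (f x, g x))"
  using assms by (intro linI module_prod) (auto simp: lin_def Pi_iff)

lemma Hom_module_simps [simp]: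
  "carrier (Hom_module R M N) = mod_hom R M N"
  "\<zero>\<^bsub>Hom_module R M N\<^esub> = (\<lambda>x\<in>carrier M. \<zero>\<^bsub>N\<^esub>)"
  "f \<oplus>\<^bsub>Hom_module R M N\<^esub> g = (\<lambda>x\<in>carrier M. f x \<oplus>\<^bsub>N\<^esub> g x)"
  "r \<odot>\<^bsub>Hom_module R M N\<^esub> f = (\<lambda>x\<in>carrier M. r \<odot>\<^bsub>N\<^esub> f x)"
  by (auto simp: Hom_module_def)

lemma module_Hom:
  assumes M: "module R M" and N: "module R N"
  shows "module R (Hom_module R M N)"
proof -
  interpret M: module R M by fact
  interpret N: module R N by fact
  note iff = mod_hom_iff[OF M N]
  have ext: "f = restrict g (carrier M)" if "f \<in> mod_hom R M N" "\<And>x. x \<in> carrier M \<Longrightarrow> f x = g x" for f g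
    using that by (auto simp: iff extensional_def fun_eq_iff)
  have cl: "f x \<in> carrier N" if "f \<in> mod_hom R M N" "x \<in> carrier M" for f x
    using that by (auto simp: iff intro: lin_closed)
  show ?thesis
  proof (rule moduleI)
    show "abelian_group (Hom_module R M N)"
    proof (rule abelian_groupI)
      show "\<zero>\<^bsub>Hom_module R M N\<^esub> \<in> carrier (Hom_module R M N)"
        using restrict_mod_hom[OF lin_const_zero[OF M N]] by simp
    next
      fix f g assume "f \<in> carrier (Hom_module R M N)" "g \<in> carrier (Hom_module R M N)"
      then show "f \<oplus>\<^bsub>Hom_module R M N\<^esub> g \<in> carrier (Hom_module R M N)"
        using restrict_mod_hom[OF lin_plus, of R M N f g] by (simp add: iff)
    next
      fix f assume f: "f \<in> carrier (Hom_module R M N)"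
      then show "\<exists>g\<in>carrier (Hom_module R M N). g \<oplus>\<^bsub>Hom_module R M N\<^esub> f = \<zero>\<^bsub>Hom_module R M N\<^esub>"
        using restrict_mod_hom[OF lin_uminus, of R M N f]
        by (intro bexI[of _ "\<lambda>x\<in>carrier M. \<ominus>\<^bsub>N\<^esub> f x"]) (auto simp: iff fun_eq_iff N.l_neg lin_closed)
    next
      fix f assume f: "f \<in> carrier (Hom_module R M N)"
      then show "\<zero>\<^bsub>Hom_module R M N\<^esub> \<oplus>\<^bsub>Hom_module R M N\<^esub> f = f"
        by (simp, intro ext[symmetric]) (auto simp: cl)
    qed (auto simp: fun_eq_iff cl N.add.m_ac)
  next
    fix r f assume r: "r \<in> carrier R" and "f \<in> carrier (Hom_module R M N)"
    then show "r \<odot>\<^bsub>Hom_module R M N\<^esub> f \<in> carrier (Hom_module R M N)"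
      using restrict_mod_hom[OF lin_scale, of R M N f r] by (simp add: iff)
  next
    fix f assume f: "f \<in> carrier (Hom_module R M N)"
    then show "\<one>\<^bsub>R\<^esub> \<odot>\<^bsub>Hom_module R M N\<^esub> f = f"
      by (simp, intro ext[symmetric]) (auto simp: cl)
  qed (auto simp: fun_eq_iff cl N.smult_l_distr N.smult_r_distr N.smult_assoc1 M.R.cring_axioms)
qed


section \<open>Quotient modules\<close>

lemma quot_module_simps:
  "carrier (quot_module M K) = (\<lambda>x. K +>\<^bsub>M\<^esub> x) ` carrier M"
  "\<zero>\<^bsub>quot_module M K\<^esub> = K"
  "X \<oplus>\<^bsub>quot_module M K\<^esub> Y = X <+>\<^bsub>M\<^esub> Y"
  "r \<odot>\<^bsub>quot_module M K\<^esub> X = (\<Union>x\<in>X. K +>\<^bsub>M\<^esub> (r \<odot>\<^bsub>M\<^esub> x))"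
  by (auto simp: quot_module_def A_RCOSETS_def')

text \<open>Kept outside the context that fixes \<open>M\<close> and \<open>K\<close>, because
  \<open>quot_map_eq\<close> needs it for a second module as well.\<close>

lemma rcoset_eq_iff_gen:
  assumes "module R M" "submodule K R M" "x \<in> carrier M" "y \<in> carrier M"
  shows "K +>\<^bsub>M\<^esub> x = K +>\<^bsub>M\<^esub> y \<longleftrightarrow> x \<ominus>\<^bsub>M\<^esub> y \<in> K"
proof -
  interpret M: module R M by fact
  interpret K: abelian_subgroup K M
    using submodule.axioms(1)[OF assms(2)] M.abelian_group_axioms
    by (auto intro!: abelian_subgroupI3 additive_subgroup.intro)
  show ?thesis
    using K.a_rcos_module[OF assms(4,3)] K.a_repr_independence'[of x y, OF _ assms(4)]
      K.a_repr_independenceD[of x y, OF assms(3)] unfolding M.minus_eq by metis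
qed

context
  fixes R :: "('a, 'r) ring_scheme" and M :: "('a, 'm) module" and K :: "'m set"
  assumes M: "module R M" and K: "submodule K R M"
begin

interpretation M: module R M by (rule M)

lemma abelian_subgroup_submodule: "abelian_subgroup K M"
  using submodule.axioms(1)[OF K] M.abelian_group_axioms
  by (auto intro!: abelian_subgroupI3 additive_subgroup.intro)

interpretation K: abelian_subgroup K M by (rule abelian_subgroup_submodule)

lemmas rcoset_eq_iff = rcoset_eq_iff_gen[OF M K]

lemma rcoset_mem_iff:
  assumes "x \<in> carrier M"
  shows "y \<in> K +>\<^bsub>M\<^esub> x \<longleftrightarrow> y \<in> carrier M \<and> K +>\<^bsub>M\<^esub> y = K +>\<^bsub>M\<^esub> x"
  using K.a_repr_independence'[of y x] K.a_repr_independenceD[of y x] assms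
    M.a_r_coset_subset_G[OF K.a_subset assms] by auto

lemma rcoset_eq_iff_zero: "x \<in> carrier M \<Longrightarrow> K +>\<^bsub>M\<^esub> x = K \<longleftrightarrow> x \<in> K"
  using rcoset_eq_iff[of x "\<zero>\<^bsub>M\<^esub>"] M.a_coset_add_zero[OF K.a_subset]
    lin_zero[OF lin_uminus[OF lin_ident[OF M]]] by (simp add: M.minus_eq)

lemma quot_add: "x \<in> carrier M \<Longrightarrow> y \<in> carrier M \<Longrightarrow>
    (K +>\<^bsub>M\<^esub> x) \<oplus>\<^bsub>quot_module M K\<^esub> (K +>\<^bsub>M\<^esub> y) = K +>\<^bsub>M\<^esub> (x \<oplus>\<^bsub>M\<^esub> y)"
  by (simp add: quot_module_simps K.a_rcos_sum)

text \<open>Scalar multiplication in \<open>quot_module\<close> and the induced maps are unions over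
  the representatives of a coset; if the choice of representative does not matter, the union
  collapses to one term.\<close>

lemma union_rcoset:
  assumes x: "x \<in> carrier M" and h: "\<And>y. y \<in> carrier M \<Longrightarrow> K +>\<^bsub>M\<^esub> y = K +>\<^bsub>M\<^esub> x \<Longrightarrow> h y = h x"
  shows "(\<Union>y\<in>K +>\<^bsub>M\<^esub> x. h y) = h x"
  using rcoset_mem_iff[OF x] h x by blast

lemma quot_smult:
  assumes r: "r \<in> carrier R" and x: "x \<in> carrier M"
  shows "r \<odot>\<^bsub>quot_module M K\<^esub> (K +>\<^bsub>M\<^esub> x) = K +>\<^bsub>M\<^esub> (r \<odot>\<^bsub>M\<^esub> x)"
proof -
  have "K +>\<^bsub>M\<^esub> (r \<odot>\<^bsub>M\<^esub> y) = K +>\<^bsub>M\<^esub> (r \<odot>\<^bsub>M\<^esub> x)" if y: "y \<in> carrier M" "K +>\<^bsub>M\<^esub> y = K +>\<^bsub>M\<^esub> x" for y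
  proof -
    have "r \<odot>\<^bsub>M\<^esub> (y \<ominus>\<^bsub>M\<^esub> x) \<in> K"
      using rcoset_eq_iff[of y x] x y submoduleD(4)[OF M K] r by auto
    also have "r \<odot>\<^bsub>M\<^esub> (y \<ominus>\<^bsub>M\<^esub> x) = r \<odot>\<^bsub>M\<^esub> y \<ominus>\<^bsub>M\<^esub> r \<odot>\<^bsub>M\<^esub> x"
      using x y r by (simp add: M.minus_eq M.smult_r_distr M.smult_r_minus)
    finally show ?thesis using x y r by (simp add: rcoset_eq_iff)
  qed
  then show ?thesis unfolding quot_module_simps by (intro union_rcoset x)
qed

lemma lin_quot: "lin R M (quot_module M K) (\<lambda>x. K +>\<^bsub>M\<^esub> x)"
  and module_quot: "module R (quot_module M K)"
proof -
  have z: "\<zero>\<^bsub>quot_module M K\<^esub> = K +>\<^bsub>M\<^esub> \<zero>\<^bsub>M\<^esub>"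
    using rcoset_eq_iff_zero[of "\<zero>\<^bsub>M\<^esub>"] by (simp add: quot_module_simps)
  show "lin R M (quot_module M K) (\<lambda>x. K +>\<^bsub>M\<^esub> x)"
    by (rule module_surjective(2)[OF M]) (auto simp: quot_add quot_smult z quot_module_simps(1))
  then show "module R (quot_module M K)" by (rule lin_module2)
qed

text \<open>\<open>Ext_map\<close>, its analogues for complexes and the maps between the quotients
  \<open>M/I^n M\<close> all have this union form, so their values on cosets are computed here
  once.\<close>

lemma quot_map_eq:
  assumes f: "lin R M N f" and K': "submodule K' R N" and "\<And>x. x \<in> K \<Longrightarrow> f x \<in> K'"
    and x: "x \<in> carrier M"
  shows "(\<Union>y\<in>K +>\<^bsub>M\<^esub> x. K' +>\<^bsub>N\<^esub> f y) = K' +>\<^bsub>N\<^esub> f x"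
proof (rule union_rcoset[OF x])
  fix y assume y: "y \<in> carrier M" "K +>\<^bsub>M\<^esub> y = K +>\<^bsub>M\<^esub> x"
  then have "f y \<ominus>\<^bsub>N\<^esub> f x \<in> K'"
    using assms(3)[of "y \<ominus>\<^bsub>M\<^esub> x"] x by (simp add: rcoset_eq_iff lin_diff[OF f])
  then show "K' +>\<^bsub>N\<^esub> f y = K' +>\<^bsub>N\<^esub> f x"
    using rcoset_eq_iff_gen[OF lin_module2[OF f] K'] x y by (simp add: lin_closed[OF f])
qed

end


section \<open>Finitely generated modules over Noetherian rings\<close>

lemma span_submodule: "module R M \<Longrightarrow> A \<subseteq> carrier M \<Longrightarrow> submodule (module_span R M A) R M"
  unfolding module_span_def
  by (rule submodule_Inter) (auto intro: submodule_carrier)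

lemma span_incl: "A \<subseteq> module_span R M A"
  by (auto simp: module_span_def)

lemma span_least: "submodule H R M \<Longrightarrow> A \<subseteq> H \<Longrightarrow> module_span R M A \<subseteq> H"
  by (auto simp: module_span_def)

lemma span_mono: "A \<subseteq> B \<Longrightarrow> module_span R M A \<subseteq> module_span R M B"
  by (auto simp: module_span_def)

lemma span_subset_carrier: "module R M \<Longrightarrow> A \<subseteq> carrier M \<Longrightarrow> module_span R M A \<subseteq> carrier M"
  by (rule span_least[OF submodule_carrier])

lemma span_in_submodule:
  assumes M: "module R M" and H: "submodule H R M" and A: "A \<subseteq> H"
  shows "module_span R (M\<lparr>carrier := H\<rparr>) A = module_span R M A"
proof
  have AM: "A \<subseteq> carrier M" using A submoduleD(1)[OF M H] by auto
  show "module_span R (M\<lparr>carrier := H\<rparr>) A \<subseteq> module_span R M A"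
    using submodule_of_submodule[OF M H span_submodule[OF M AM] span_least[OF H A]]
    by (rule span_least) (rule span_incl)
  show "module_span R M A \<subseteq> module_span R (M\<lparr>carrier := H\<rparr>) A"
    using submodule_in_submodule[OF M H span_submodule[OF submodule_module[OF M H], of A]] A
    by (intro span_least span_incl) auto
qed

lemma fin_gen_submodule_iff:
  assumes M: "module R M" and H: "submodule H R M"
  shows "fin_gen R (M\<lparr>carrier := H\<rparr>) \<longleftrightarrow> (\<exists>A. finite A \<and> A \<subseteq> H \<and> module_span R M A = H)"
  unfolding fin_gen_def using span_in_submodule[OF M H] by auto

lemma span_image:
  assumes f: "lin R M N f" and A: "A \<subseteq> carrier M"
  shows "f ` module_span R M A = module_span R N (f ` A)"
proof
  have fA: "f ` A \<subseteq> carrier N" using A lin_closed[OF f] by auto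
  have "module_span R M A \<subseteq> {x \<in> carrier M. f x \<in> module_span R N (f ` A)}"
    using A span_incl[of "f ` A" R N]
    by (intro span_least submodule_vimage[OF f] span_submodule[OF lin_module2[OF f] fA]) auto
  then show "f ` module_span R M A \<subseteq> module_span R N (f ` A)" by auto
  show "module_span R N (f ` A) \<subseteq> f ` module_span R M A"
    using span_incl[of A R M]
    by (intro span_least submodule_image[OF f] span_submodule[OF lin_module1[OF f] A]) auto
qed

lemma fin_gen_image:
  assumes f: "lin R M N f" and "f ` carrier M = carrier N" and "fin_gen R M"
  shows "fin_gen R N"
proof -
  obtain A where A: "finite A" "A \<subseteq> carrier M" "module_span R M A = carrier M"
    using assms(3) by (auto simp: fin_gen_def)
  then have "module_span R N (f ` A) = carrier N"
    using span_image[OF f A(2)] assms(2) by simp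
  then show ?thesis
    using A lin_closed[OF f] unfolding fin_gen_def by (intro exI[of _ "f ` A"]) auto
qed

lemma fin_gen_zero: "module R M \<Longrightarrow> carrier M = {\<zero>\<^bsub>M\<^esub>} \<Longrightarrow> fin_gen R M"
  unfolding fin_gen_def using span_subset_carrier[of R M "{}"] submoduleD(2)[OF _ span_submodule[of R M "{}"]]
  by (intro exI[of _ "{}"]) auto

lemma lin_multiples: "module R M \<Longrightarrow> x \<in> carrier M \<Longrightarrow> lin R (regular_module R) M (\<lambda>r. r \<odot>\<^bsub>M\<^esub> x)"
proof -
  assume a: "module R M" "x \<in> carrier M"
  interpret module R M by fact
  show ?thesis
    using a by (intro linI) (auto simp: module_regular R.cring_axioms smult_l_distr smult_assoc1)
qed

lemma lin_scalar: "module R M \<Longrightarrow> r \<in> carrier R \<Longrightarrow> lin R M M (\<lambda>x. r \<odot>\<^bsub>M\<^esub> x)"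
  by (rule lin_scale[OF lin_ident])

lemma span_insert_subset:
  assumes M: "module R M" and "a \<in> carrier M" "A \<subseteq> carrier M"
  shows "module_span R M (insert a A) \<subseteq>
    {u \<oplus>\<^bsub>M\<^esub> v | u v. u \<in> (\<lambda>r. r \<odot>\<^bsub>M\<^esub> a) ` carrier R \<and> v \<in> module_span R M A}"
proof (rule span_least[OF submodule_sum[OF M submodule_multiples span_submodule]])
  interpret module R M by fact
  note D = submoduleD[OF M span_submodule[OF M assms(3)]]
  have "a = \<one>\<^bsub>R\<^esub> \<odot>\<^bsub>M\<^esub> a \<oplus>\<^bsub>M\<^esub> \<zero>\<^bsub>M\<^esub>" using assms by simp
  moreover have "x = \<zero>\<^bsub>R\<^esub> \<odot>\<^bsub>M\<^esub> a \<oplus>\<^bsub>M\<^esub> x" if "x \<in> A" for x using assms that by auto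
  ultimately show "insert a A \<subseteq> {u \<oplus>\<^bsub>M\<^esub> v |u v. u \<in> (\<lambda>r. r \<odot>\<^bsub>M\<^esub> a) ` carrier R \<and> v \<in> module_span R M A}"
    using span_incl[of A R M] D(2) by blast
qed (use assms in auto)

text \<open>Generation is phrased as \<open>J\<close> lying in every submodule around
  \<open>C\<close>, since it will be applied to preimages of submodules under maps
  \<open>r \<mapsto> r x\<close>.\<close>

lemma noetherian_ideal:
  assumes R: "cring R" "noetherian_ring R" and J: "submodule J R (regular_module R)"
  obtains C where "finite C" "C \<subseteq> J" "\<And>J'. submodule J' R (regular_module R) \<Longrightarrow> C \<subseteq> J' \<Longrightarrow> J \<subseteq> J'"
proof -
  interpret noetherian_ring R by fact
  note iff = submodule_regular_iff[OF R(1)]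
  obtain C where C: "finite C" "C \<subseteq> carrier R" "J = Idl\<^bsub>R\<^esub> C"
    using finetely_gen[of J] J iff by auto
  show thesis
  proof (rule that[OF C(1)])
    show "C \<subseteq> J" using C genideal_self by auto
    show "J \<subseteq> J'" if "submodule J' R (regular_module R)" "C \<subseteq> J'" for J'
      using that C(3) genideal_minimal[of J' C] iff by auto
  qed
qed

text \<open>Induction on the number of generators. With \<open>T\<close> spanned by the others,
  \<open>H\<close> is controlled by \<open>H \<inter> T\<close> and by the ideal of coefficients
  that \<open>a\<close> can have in elements of \<open>H\<close>. The first is finitely generated by
  induction, the second because \<open>R\<close> is Noetherian.\<close>

lemma noetherian_submodule_of_span:
  assumes R: "cring R" "noetherian_ring R" and M: "module R M"
    and "finite A" "A \<subseteq> carrier M" "submodule H R M" "H \<subseteq> module_span R M A"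
  shows "\<exists>B. finite B \<and> B \<subseteq> H \<and> module_span R M B = H"
  using assms(4-7)
proof (induction A arbitrary: H)
  case empty
  then show ?case by (intro exI[of _ "{}"]) (auto dest: span_least[of H R M "{}"])
next
  case (insert a A)
  interpret module R M by fact
  have a: "a \<in> carrier M" and A: "A \<subseteq> carrier M" using insert by auto
  define T where "T = module_span R M A"
  have T: "submodule T R M" unfolding T_def by (rule span_submodule[OF M A])
  note H = \<open>submodule H R M\<close>
  note TD = submoduleD[OF M T] and HD = submoduleD[OF M H]
  \<comment> \<open>The coefficients of \<open>a\<close> in elements of \<open>H\<close>, taken
    modulo \<open>T\<close>.\<close>
  define J where "J = {r \<in> carrier R. r \<odot>\<^bsub>M\<^esub> a \<in> {x \<oplus>\<^bsub>M\<^esub> y | x y. x \<in> H \<and> y \<in> T}}"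
  have J: "submodule J R (regular_module R)"
    using submodule_vimage[OF lin_multiples[OF M a] submodule_sum[OF M H T]] by (simp add: J_def)
  obtain C where C: "finite C" "C \<subseteq> J" "\<And>J'. submodule J' R (regular_module R) \<Longrightarrow> C \<subseteq> J' \<Longrightarrow> J \<subseteq> J'"
    using noetherian_ideal[OF R J] by blast
  have "\<forall>c\<in>C. \<exists>h\<in>H. \<exists>y\<in>T. c \<odot>\<^bsub>M\<^esub> a = h \<oplus>\<^bsub>M\<^esub> y" using C(2) unfolding J_def by blast
  then obtain h where h: "\<And>c. c \<in> C \<Longrightarrow> h c \<in> H \<and> (\<exists>y\<in>T. c \<odot>\<^bsub>M\<^esub> a = h c \<oplus>\<^bsub>M\<^esub> y)" by metis
  obtain B where B: "finite B" "B \<subseteq> H \<inter> T" "module_span R M B = H \<inter> T"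
    using insert.IH[OF A submodule_Int[OF M H T]] by (auto simp: T_def)
  define S where "S = module_span R M (h ` C \<union> B)"
  have sub: "h ` C \<union> B \<subseteq> H" using h B by auto
  have S: "submodule S R M" unfolding S_def by (rule span_submodule[OF M]) (use sub HD(1) in auto)
  note SD = submoduleD[OF M S]
  have SH: "S \<subseteq> H" unfolding S_def by (rule span_least[OF H sub])
  \<comment> \<open>The finitely many \<open>h c\<close> in \<open>S\<close> already realize every
    coefficient in \<open>J\<close>.\<close>
  have "J \<subseteq> {r \<in> carrier (regular_module R). r \<odot>\<^bsub>M\<^esub> a \<in> {x \<oplus>\<^bsub>M\<^esub> y | x y. x \<in> S \<and> y \<in> T}}"
  proof (rule C(3)[OF submodule_vimage[OF lin_multiples[OF M a] submodule_sum[OF M S T]]])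
    have hS: "h c \<in> S" if "c \<in> C" for c
      using that span_incl[of "h ` C \<union> B" R M] by (auto simp: S_def)
    show "C \<subseteq> {r \<in> carrier (regular_module R). r \<odot>\<^bsub>M\<^esub> a \<in> {x \<oplus>\<^bsub>M\<^esub> y | x y. x \<in> S \<and> y \<in> T}}"
    proof
      fix c assume c: "c \<in> C"
      then obtain y where "y \<in> T" "c \<odot>\<^bsub>M\<^esub> a = h c \<oplus>\<^bsub>M\<^esub> y" using h by blast
      moreover have "c \<in> carrier R" using c C(2) by (auto simp: J_def)
      ultimately show "c \<in> {r \<in> carrier (regular_module R). r \<odot>\<^bsub>M\<^esub> a \<in> {x \<oplus>\<^bsub>M\<^esub> y | x y. x \<in> S \<and> y \<in> T}}"
        using hS[OF c] by auto
    qed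
  qed
  note JS = this
  have "H \<subseteq> S"
  proof
    fix x assume x: "x \<in> H"
    then have "x \<in> module_span R M (insert a A)" using insert.prems(3) by auto
    from subsetD[OF span_insert_subset[OF M a A] this]
    obtain r y where r: "r \<in> carrier R" "y \<in> T" "x = r \<odot>\<^bsub>M\<^esub> a \<oplus>\<^bsub>M\<^esub> y"
      unfolding T_def by blast
    have xc: "x \<in> carrier M" "y \<in> carrier M" using x HD(1) r TD(1) by auto
    \<comment> \<open>So \<open>r\<close> lies in \<open>J\<close>, and subtracting an
      \<open>s\<close> in \<open>S\<close> with the same coefficient moves \<open>x\<close> into
      \<open>H \<inter> T\<close>.\<close>
    have "r \<odot>\<^bsub>M\<^esub> a = x \<oplus>\<^bsub>M\<^esub> \<ominus>\<^bsub>M\<^esub> y"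
      using r a xc by (simp add: M.a_assoc M.r_neg)
    then have "r \<in> J" using x r TD(5) by (auto simp: J_def)
    then obtain s t where st: "s \<in> S" "t \<in> T" "r \<odot>\<^bsub>M\<^esub> a = s \<oplus>\<^bsub>M\<^esub> t" using JS by auto
    have c: "s \<in> carrier M" "t \<in> carrier M" using st SD(1) TD(1) by auto
    have xs: "x = s \<oplus>\<^bsub>M\<^esub> (t \<oplus>\<^bsub>M\<^esub> y)" using r st c xc by (simp add: M.a_assoc)
    have "x = (t \<oplus>\<^bsub>M\<^esub> y) \<oplus>\<^bsub>M\<^esub> s" using xs c xc by (simp add: M.add.m_ac)
    then have "x \<ominus>\<^bsub>M\<^esub> s = t \<oplus>\<^bsub>M\<^esub> y"
      using c xc by (simp add: M.minus_eq M.a_assoc M.r_neg)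
    moreover have "x \<ominus>\<^bsub>M\<^esub> s \<in> H" using x st SH HD(6) by auto
    ultimately have "t \<oplus>\<^bsub>M\<^esub> y \<in> H \<inter> T" using st r TD(3) by auto
    then have "t \<oplus>\<^bsub>M\<^esub> y \<in> S" using B(3) span_mono[of B "h ` C \<union> B" R M] by (auto simp: S_def)
    then show "x \<in> S" using xs st SD(3) by auto
  qed
  then have "S = H" using SH by auto
  then show ?case using sub C(1) B(1) by (intro exI[of _ "h ` C \<union> B"]) (auto simp: S_def)
qed

lemma fin_gen_submodule:
  assumes R: "cring R" "noetherian_ring R" and M: "module R M" "fin_gen R M" and H: "submodule H R M"
  shows "fin_gen R (M\<lparr>carrier := H\<rparr>)"
proof -
  obtain A where A: "finite A" "A \<subseteq> carrier M" "module_span R M A = carrier M"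
    using M by (auto simp: fin_gen_def)
  then show ?thesis
    using noetherian_submodule_of_span[OF R M(1) A(1,2) H] submoduleD(1)[OF M(1) H]
    by (auto simp: fin_gen_submodule_iff[OF M(1) H])
qed

text \<open>Exactness in the middle is what the sequence of Ext modules offers. The image of
  \<open>\<beta>\<close> is finitely generated because \<open>R\<close> is Noetherian, and lifts of
  its generators together with the images of the generators of \<open>X\<close> generate
  \<open>Y\<close>.\<close>

lemma fin_gen_middle:
  assumes R: "cring R" "noetherian_ring R"
    and \<alpha>: "lin R X Y \<alpha>" and \<beta>: "lin R Y Z \<beta>"
    and ker: "\<And>y. y \<in> carrier Y \<Longrightarrow> \<beta> y = \<zero>\<^bsub>Z\<^esub> \<Longrightarrow> y \<in> \<alpha> ` carrier X"
    and X: "fin_gen R X" and Z: "fin_gen R Z"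
  shows "fin_gen R Y"
proof -
  note MX = lin_module1[OF \<alpha>] and MY = lin_module2[OF \<alpha>] and MZ = lin_module2[OF \<beta>]
  interpret Y: module R Y by fact
  obtain A where A: "finite A" "A \<subseteq> carrier X" "module_span R X A = carrier X"
    using X by (auto simp: fin_gen_def)
  note im = submodule_range[OF \<beta>]
  obtain B where B: "finite B" "B \<subseteq> \<beta> ` carrier Y" "module_span R Z B = \<beta> ` carrier Y"
    using fin_gen_submodule[OF R MZ Z im] by (auto simp: fin_gen_submodule_iff[OF MZ im])
  obtain C where C: "finite C" "C \<subseteq> carrier Y" "B = \<beta> ` C"
    using finite_subset_image[OF B(1,2)] by auto
  have \<alpha>A: "\<alpha> ` A \<subseteq> carrier Y" using A lin_closed[OF \<alpha>] by auto
  define S where "S = module_span R Y (C \<union> \<alpha> ` A)"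
  have S: "submodule S R Y" unfolding S_def using C \<alpha>A by (intro span_submodule MY) auto
  note SD = submoduleD[OF MY S]
  have "carrier Y \<subseteq> S"
  proof
    fix y assume y: "y \<in> carrier Y"
    then have "\<beta> y \<in> \<beta> ` module_span R Y C"
      using B C span_image[OF \<beta> C(2)] by auto
    then obtain w where w: "w \<in> module_span R Y C" "\<beta> y = \<beta> w" by auto
    have wY: "w \<in> carrier Y" using w span_subset_carrier[OF MY C(2)] by auto
    have wS: "w \<in> S" using w span_mono[of C "C \<union> \<alpha> ` A" R Y] by (auto simp: S_def)
    have "\<beta> (y \<ominus>\<^bsub>Y\<^esub> w) = \<beta> y \<ominus>\<^bsub>Z\<^esub> \<beta> w" using y wY by (simp add: lin_diff[OF \<beta>])
    also have "\<dots> = \<zero>\<^bsub>Z\<^esub>"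
      using w lin_closed[OF \<beta> wY] abelian_group.r_neg[OF module_abelian_group[OF MZ]] by (simp add: a_minus_def)
    finally have "y \<ominus>\<^bsub>Y\<^esub> w \<in> \<alpha> ` module_span R X A" using ker[of "y \<ominus>\<^bsub>Y\<^esub> w"] y wY A by auto
    then have "y \<ominus>\<^bsub>Y\<^esub> w \<in> S"
      using span_image[OF \<alpha> A(2)] span_mono[of "\<alpha> ` A" "C \<union> \<alpha> ` A" R Y] by (auto simp: S_def)
    then have "(y \<ominus>\<^bsub>Y\<^esub> w) \<oplus>\<^bsub>Y\<^esub> w \<in> S" using wS SD by auto
    also have "(y \<ominus>\<^bsub>Y\<^esub> w) \<oplus>\<^bsub>Y\<^esub> w = y" using y wY by (simp add: Y.minus_eq Y.a_assoc Y.l_neg)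
    finally show "y \<in> S" .
  qed
  then have "S = carrier Y" using SD by auto
  then show ?thesis using A C \<alpha>A unfolding fin_gen_def S_def
    by (intro exI[of _ "C \<union> \<alpha> ` A"]) auto
qed

text \<open>Zorn's lemma applies because the union of a chain is finitely generated, and its
  finitely many generators lie in one member, which is then the whole union.\<close>

lemma maximal_submodule:
  assumes R: "cring R" "noetherian_ring R" and M: "module R M" "fin_gen R M"
    and S: "\<S> \<noteq> {}" "\<And>Q. Q \<in> \<S> \<Longrightarrow> submodule Q R M"
  obtains Q where "Q \<in> \<S>" "\<And>Q'. Q' \<in> \<S> \<Longrightarrow> Q \<subseteq> Q' \<Longrightarrow> Q' = Q"
proof -
  have "\<Union>C \<in> \<S>" if C: "C \<noteq> {}" "subset.chain \<S> C" for C
  proof -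
    have sub: "submodule Q R M" if "Q \<in> C" for Q using that C(2) S(2) by (auto simp: subset.chain_def)
    note D = submoduleD[OF M(1) sub]
    obtain Q0 where Q0: "Q0 \<in> C" using C(1) by auto
    have U: "submodule (\<Union>C) R M"
    proof (rule submodule_intro[OF M(1)])
      show "\<Union>C \<subseteq> carrier M" using D(1) by blast
      show "\<zero>\<^bsub>M\<^esub> \<in> \<Union>C" using D(2) Q0 by blast
    next
      fix x y assume "x \<in> \<Union>C" "y \<in> \<Union>C"
      then obtain P Q where PQ: "P \<in> C" "Q \<in> C" "x \<in> P" "y \<in> Q" by blast
      then have "P \<subseteq> Q \<or> Q \<subseteq> P" using C(2) by (auto simp: subset.chain_def)
      then show "x \<oplus>\<^bsub>M\<^esub> y \<in> \<Union>C" using PQ D(3)[of P x y] D(3)[of Q x y] by auto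
    next
      fix r x assume "r \<in> carrier R" "x \<in> \<Union>C"
      then show "r \<odot>\<^bsub>M\<^esub> x \<in> \<Union>C" using D(4) by blast
    qed
    obtain B where B: "finite B" "B \<subseteq> \<Union>C" "module_span R M B = \<Union>C"
      using fin_gen_submodule[OF R M U] by (auto simp: fin_gen_submodule_iff[OF M(1) U])
    obtain Q where Q: "Q \<in> C" "B \<subseteq> Q" using finite_subset_Union_chain[OF B(1,2) C] by blast
    have "\<Union>C = Q" using span_least[OF sub[OF Q(1)] Q(2)] B(3) Q(1) by auto
    then show ?thesis using Q(1) C(2) by (auto simp: subset.chain_def)
  qed
  from subset_Zorn_nonempty[OF S(1) this] that show thesis by blast
qed

lemma fin_gen_regular: "cring R \<Longrightarrow> fin_gen R (regular_module R)"
proof -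
  assume R: "cring R"
  interpret cring R by fact
  note M = module_regular[OF R]
  have "carrier R \<subseteq> module_span R (regular_module R) {\<one>\<^bsub>R\<^esub>}"
  proof
    fix r assume "r \<in> carrier R"
    then show "r \<in> module_span R (regular_module R) {\<one>\<^bsub>R\<^esub>}"
      using submoduleD(4)[OF M span_submodule[OF M, of "{\<one>\<^bsub>R\<^esub>}"], of r "\<one>\<^bsub>R\<^esub>"]
        span_incl[of "{\<one>\<^bsub>R\<^esub>}" R "regular_module R"] by simp
  qed
  then show ?thesis unfolding fin_gen_def
    using span_subset_carrier[OF M, of "{\<one>\<^bsub>R\<^esub>}"] by (intro exI[of _ "{\<one>\<^bsub>R\<^esub>}"]) auto
qed


section \<open>Cohomology of dual complexes\<close>

definition exact_seq ::
    "('a, 'r) ring_scheme \<Rightarrow> ('a, 'x) module \<Rightarrow> ('x \<Rightarrow> 'y) \<Rightarrow> ('a, 'y) module \<Rightarrow> ('y \<Rightarrow> 'z) \<Rightarrow>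
      ('a, 'z) module \<Rightarrow> bool" where
  "exact_seq R X f Y g Z \<longleftrightarrow>
     lin R X Y f \<and> lin R Y Z g \<and> {y \<in> carrier Y. g y = \<zero>\<^bsub>Z\<^esub>} = f ` carrier X"

lemma exact_seqI:
  assumes "lin R X Y f" "lin R Y Z g" "\<And>x. x \<in> carrier X \<Longrightarrow> g (f x) = \<zero>\<^bsub>Z\<^esub>"
    "\<And>y. y \<in> carrier Y \<Longrightarrow> g y = \<zero>\<^bsub>Z\<^esub> \<Longrightarrow> y \<in> f ` carrier X"
  shows "exact_seq R X f Y g Z"
  using assms lin_closed[OF assms(1)] by (auto simp: exact_seq_def)

text \<open>The constructions behind \<open>Ext\<close> and \<open>Ext_map\<close>, for an arbitrary
  complex: mapping cones of functorial resolutions are not functorial resolutions, but their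
  cohomology is needed just as much.\<close>

definition cocyc ::
    "('a, 'r) ring_scheme \<Rightarrow> (nat \<Rightarrow> ('a, 'p) module) \<Rightarrow> (nat \<Rightarrow> 'p \<Rightarrow> 'p) \<Rightarrow> ('a, 'n) module \<Rightarrow> nat \<Rightarrow>
      ('p \<Rightarrow> 'n) set" where
  "cocyc R P d N i = {c \<in> mod_hom R (P i) N. \<forall>u\<in>carrier (P (Suc i)). c (d i u) = \<zero>\<^bsub>N\<^esub>}"

fun cobound ::
    "('a, 'r) ring_scheme \<Rightarrow> (nat \<Rightarrow> ('a, 'p) module) \<Rightarrow> (nat \<Rightarrow> 'p \<Rightarrow> 'p) \<Rightarrow> ('a, 'n) module \<Rightarrow> nat \<Rightarrow>
      ('p \<Rightarrow> 'n) set" where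
  "cobound R P d N 0 = {\<lambda>u\<in>carrier (P 0). \<zero>\<^bsub>N\<^esub>}"
| "cobound R P d N (Suc i) = (\<lambda>c. \<lambda>u\<in>carrier (P (Suc i)). c (d i u)) ` mod_hom R (P i) N"

abbreviation cocyc_module where
  "cocyc_module R P d N i \<equiv> (Hom_module R (P i) N)\<lparr>carrier := cocyc R P d N i\<rparr>"

definition coh where
  "coh R P d N i = quot_module (cocyc_module R P d N i) (cobound R P d N i)"

definition ccls where
  "ccls R P d N i c = cobound R P d N i +>\<^bsub>Hom_module R (P i) N\<^esub> c"

definition coh_pull where
  "coh_pull R P d N i h X =
     (\<Union>c\<in>X. cobound R P d N i +>\<^bsub>Hom_module R (P i) N\<^esub> (\<lambda>u\<in>carrier (P i). c (h u)))"

locale chain_complex =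
  fixes R :: "('a, 'r) ring_scheme" and P :: "nat \<Rightarrow> ('a, 'p) module" and d :: "nat \<Rightarrow> 'p \<Rightarrow> 'p"
  assumes module_P: "module R (P i)"
    and lin_d: "lin R (P (Suc i)) (P i) (d i)"
    and dd: "u \<in> carrier (P (Suc (Suc i))) \<Longrightarrow> d i (d (Suc i) u) = \<zero>\<^bsub>P i\<^esub>"

lemma cobound_SucI:
  "c \<in> mod_hom R (P i) N \<Longrightarrow> (\<lambda>u\<in>carrier (P (Suc i)). c (d i u)) \<in> cobound R P d N (Suc i)"
  by simp

lemma mod_hom_ext:
  assumes "c \<in> mod_hom R M N" "c' \<in> mod_hom R M N" "\<And>x. x \<in> carrier M \<Longrightarrow> c x = c' x"
  shows "c = c'"
  using assms by (auto simp: mod_hom_def intro: PiE_ext)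

lemma lin_precomp:
  assumes h: "lin R P' P h" and N: "module R N"
  shows "lin R (Hom_module R P N) (Hom_module R P' N) (\<lambda>c. \<lambda>u\<in>carrier P'. c (h u))"
proof (rule linI)
  note P = lin_module2[OF h] and P' = lin_module1[OF h]
  interpret P': module R P' by fact
  interpret N: module R N by fact
  show "module R (Hom_module R P N)" "module R (Hom_module R P' N)"
    by (intro module_Hom P P' N)+
  fix c assume c: "c \<in> carrier (Hom_module R P N)"
  then show "(\<lambda>u\<in>carrier P'. c (h u)) \<in> carrier (Hom_module R P' N)"
    using restrict_mod_hom[OF lin_comp[OF h mod_hom_lin[OF P N, of c]]] by simp
qed (auto simp: fun_eq_iff lin_closed[OF h])

text \<open>Cosets see only the addition, so a class formed inside the module of cocycles is the
  coset formed in the full Hom module, as in \<open>Ext_map\<close>.\<close>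

lemma coset_carrier_update [simp]: "K +>\<^bsub>M\<lparr>carrier := H\<rparr>\<^esub> x = K +>\<^bsub>M\<^esub> x"
  by (simp add: a_r_coset_def')

context chain_complex
begin

context
  fixes N :: "('a, 'n) module"
  assumes N: "module R N"
begin

interpretation N: module R N by (rule N)

lemma submodule_cocyc: "submodule (cocyc R P d N i) R (Hom_module R (P i) N)"
proof -
  have eq: "cocyc R P d N i =
      {c \<in> carrier (Hom_module R (P i) N).
         (\<lambda>u\<in>carrier (P (Suc i)). c (d i u)) = \<zero>\<^bsub>Hom_module R (P (Suc i)) N\<^esub>}"
    by (auto simp: cocyc_def fun_eq_iff)
  show ?thesis unfolding eq by (rule submodule_kernel[OF lin_precomp[OF lin_d N]])
qed

lemma module_cocyc: "module R (cocyc_module R P d N i)"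
  by (rule submodule_module[OF module_Hom[OF module_P N] submodule_cocyc])

lemma cobound_subset: "cobound R P d N i \<subseteq> cocyc R P d N i"
proof (cases i)
  case 0
  then show ?thesis using submoduleD(2)[OF module_Hom[OF module_P N] submodule_cocyc, of 0] by simp
next
  case (Suc j)
  have "(\<lambda>u\<in>carrier (P (Suc j)). c (d j u)) \<in> cocyc R P d N (Suc j)" if c: "c \<in> mod_hom R (P j) N" for c
    using restrict_mod_hom[OF lin_comp[OF lin_d mod_hom_lin[OF module_P N c]]]
      lin_zero[OF mod_hom_lin[OF module_P N c]] lin_closed[OF lin_d]
    by (auto simp: cocyc_def dd)
  then show ?thesis using Suc by auto
qed

lemma submodule_cobound: "submodule (cobound R P d N i) R (cocyc_module R P d N i)"
proof -
  have "submodule (cobound R P d N i) R (Hom_module R (P i) N)"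
  proof (cases i)
    case 0
    then show ?thesis using submodule_zero[OF module_Hom[OF module_P[of 0] N]] by simp
  next
    case (Suc j)
    then show ?thesis using submodule_range[OF lin_precomp[OF lin_d N]] by simp
  qed
  then show ?thesis
    by (rule submodule_of_submodule[OF module_Hom[OF module_P N] submodule_cocyc _ cobound_subset])
qed

lemma module_coh: "module R (coh R P d N i)"
  unfolding coh_def by (rule module_quot[OF module_cocyc submodule_cobound])

lemma lin_ccls: "lin R (cocyc_module R P d N i) (coh R P d N i) (ccls R P d N i)"
  using lin_quot[OF module_cocyc[of i] submodule_cobound[of i]] by (simp add: coh_def ccls_def[abs_def])

lemma carrier_coh: "carrier (coh R P d N i) = ccls R P d N i ` cocyc R P d N i"
  by (simp add: coh_def quot_module_simps ccls_def[abs_def])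

lemma ccls_closed: "c \<in> cocyc R P d N i \<Longrightarrow> ccls R P d N i c \<in> carrier (coh R P d N i)"
  by (simp add: carrier_coh)

lemma ccls_zero_iff: "c \<in> cocyc R P d N i \<Longrightarrow> ccls R P d N i c = \<zero>\<^bsub>coh R P d N i\<^esub> \<longleftrightarrow> c \<in> cobound R P d N i"
  using rcoset_eq_iff_zero[OF module_cocyc[of i] submodule_cobound[of i], of c]
  by (simp add: coh_def quot_module_simps ccls_def)

lemma ccls_zeroI: "c \<in> cobound R P d N i \<Longrightarrow> ccls R P d N i c = \<zero>\<^bsub>coh R P d N i\<^esub>"
  using ccls_zero_iff[of c i] cobound_subset[of i] by blast

lemma ccls_eqI:
  assumes "c \<in> cocyc R P d N i" "c' \<in> cocyc R P d N i" "e \<in> cobound R P d N i"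
    "\<And>u. u \<in> carrier (P i) \<Longrightarrow> c u = c' u \<oplus>\<^bsub>N\<^esub> e u"
  shows "ccls R P d N i c = ccls R P d N i c'"
proof -
  have e: "e \<in> cocyc R P d N i" using assms(3) cobound_subset by auto
  have H: "module R (Hom_module R (P i) N)" by (rule module_Hom[OF module_P N])
  have "c = c' \<oplus>\<^bsub>Hom_module R (P i) N\<^esub> e"
  proof (rule mod_hom_ext)
    show "c' \<oplus>\<^bsub>Hom_module R (P i) N\<^esub> e \<in> mod_hom R (P i) N"
      using abelian_monoid.a_closed[of "Hom_module R (P i) N" c' e]
        module_abelian_group[OF H] assms e by (auto simp: abelian_group_def cocyc_def)
  qed (use assms in \<open>auto simp: cocyc_def\<close>)
  then have "ccls R P d N i c = ccls R P d N i c' \<oplus>\<^bsub>coh R P d N i\<^esub> ccls R P d N i e"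
    using lin_add[OF lin_ccls, of c' i e] assms e by simp
  also have "ccls R P d N i e = \<zero>\<^bsub>coh R P d N i\<^esub>" using ccls_zero_iff[OF e] assms by simp
  finally show ?thesis
    using ccls_closed[OF assms(2)] module_abelian_group[OF module_coh]
    by (simp add: abelian_group_def abelian_monoid.r_zero)
qed

end
end

text \<open>The conditions under which composition with \<open>h : P' i' \<rightarrow> P i\<close> induces a map in cohomology;
  the degrees differ for connecting maps.\<close>

definition coh_mor where
  "coh_mor R P d i P' d' i' N h \<longleftrightarrow> lin R (P' i') (P i) h \<and>
     (\<forall>c\<in>cocyc R P d N i. (\<lambda>u\<in>carrier (P' i'). c (h u)) \<in> cocyc R P' d' N i') \<and>
     (\<forall>c\<in>cobound R P d N i. (\<lambda>u\<in>carrier (P' i'). c (h u)) \<in> cobound R P' d' N i')"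

context
  fixes R :: "('a, 'r) ring_scheme" and P :: "nat \<Rightarrow> ('a, 'p) module" and d
    and P' :: "nat \<Rightarrow> ('a, 'q) module" and d' and N :: "('a, 'n) module" and h i i'
  assumes P: "chain_complex R P d" and P': "chain_complex R P' d'" and N: "module R N"
    and h: "coh_mor R P d i P' d' i' N h"
begin

interpretation P: chain_complex R P d by (rule P)
interpretation P': chain_complex R P' d' by (rule P')

lemma coh_pull_ccls:
  assumes c: "c \<in> cocyc R P d N i"
  shows "coh_pull R P' d' N i' h (ccls R P d N i c) = ccls R P' d' N i' (\<lambda>u\<in>carrier (P' i'). c (h u))"
proof -
  have f: "lin R (cocyc_module R P d N i) (cocyc_module R P' d' N i') (\<lambda>c. \<lambda>u\<in>carrier (P' i'). c (h u))"
    using h lin_submodule[OF lin_precomp[OF _ N] P.submodule_cocyc[OF N]]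
    by (intro lin_into_submodule P'.submodule_cocyc[OF N]) (auto simp: coh_mor_def)
  show ?thesis
    using quot_map_eq[OF P.module_cocyc[OF N] P.submodule_cobound[OF N] f P'.submodule_cobound[OF N]] h c
    by (auto simp: coh_pull_def ccls_def coh_mor_def)
qed

lemma lin_coh_pull: "lin R (coh R P d N i) (coh R P' d' N i') (coh_pull R P' d' N i' h)"
proof -
  have f: "lin R (cocyc_module R P d N i) (cocyc_module R P' d' N i') (\<lambda>c. \<lambda>u\<in>carrier (P' i'). c (h u))"
    using h lin_submodule[OF lin_precomp[OF _ N] P.submodule_cocyc[OF N]]
    by (intro lin_into_submodule P'.submodule_cocyc[OF N]) (auto simp: coh_mor_def)
  note L = P.lin_ccls[OF N, of i] and L' = P'.lin_ccls[OF N, of i']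
  have cl: "(\<lambda>u\<in>carrier (P' i'). c (h u)) \<in> cocyc R P' d' N i'" if "c \<in> cocyc R P d N i" for c
    using h that by (auto simp: coh_mor_def)
  note D = submoduleD[OF module_Hom[OF P.module_P N] P.submodule_cocyc[OF N]]
  show ?thesis
  proof (rule linI[OF P.module_coh[OF N] P'.module_coh[OF N]])
    fix X assume "X \<in> carrier (coh R P d N i)"
    then obtain c where c: "c \<in> cocyc R P d N i" "X = ccls R P d N i c" by (auto simp: P.carrier_coh[OF N])
    then show "coh_pull R P' d' N i' h X \<in> carrier (coh R P' d' N i')"
      by (simp add: coh_pull_ccls P'.ccls_closed[OF N] cl)
    fix r assume r: "r \<in> carrier R"
    have "r \<odot>\<^bsub>coh R P d N i\<^esub> X = ccls R P d N i (r \<odot>\<^bsub>Hom_module R (P i) N\<^esub> c)"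
      using lin_smult[OF L r, of c] c by simp
    then show "coh_pull R P' d' N i' h (r \<odot>\<^bsub>coh R P d N i\<^esub> X)
        = r \<odot>\<^bsub>coh R P' d' N i'\<^esub> coh_pull R P' d' N i' h X"
      using c r D(4)[OF r c(1)] lin_smult[OF f r, of c] lin_smult[OF L' r, of "\<lambda>u\<in>carrier (P' i'). c (h u)"]
      by (simp add: coh_pull_ccls cl del: Hom_module_simps)
  next
    fix X Y assume "X \<in> carrier (coh R P d N i)"
    then obtain c where c: "c \<in> cocyc R P d N i" "X = ccls R P d N i c" by (auto simp: P.carrier_coh[OF N])
    assume "Y \<in> carrier (coh R P d N i)"
    then obtain e where e: "e \<in> cocyc R P d N i" "Y = ccls R P d N i e" by (auto simp: P.carrier_coh[OF N])
    have "X \<oplus>\<^bsub>coh R P d N i\<^esub> Y = ccls R P d N i (c \<oplus>\<^bsub>Hom_module R (P i) N\<^esub> e)"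
      using lin_add[OF L, of c e] c e by simp
    then show "coh_pull R P' d' N i' h (X \<oplus>\<^bsub>coh R P d N i\<^esub> Y)
        = coh_pull R P' d' N i' h X \<oplus>\<^bsub>coh R P' d' N i'\<^esub> coh_pull R P' d' N i' h Y"
      using c e D(3)[OF c(1) e(1)] lin_add[OF f, of c e]
        lin_add[OF L', of "\<lambda>u\<in>carrier (P' i'). c (h u)" "\<lambda>u\<in>carrier (P' i'). e (h u)"]
      by (simp add: coh_pull_ccls cl del: Hom_module_simps)
  qed
qed

end

lemma coh_pull_comp:
  assumes "chain_complex R P d" "chain_complex R P' d'" "chain_complex R P'' d''" "module R N"
    and h: "coh_mor R P d i P' d' i' N h" and h': "coh_mor R P' d' i' P'' d'' i'' N h'"
    and h'': "coh_mor R P d i P'' d'' i'' N h''"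
    and eq: "\<And>u. u \<in> carrier (P'' i'') \<Longrightarrow> h (h' u) = h'' u" and X: "X \<in> carrier (coh R P d N i)"
  shows "coh_pull R P'' d'' N i'' h' (coh_pull R P' d' N i' h X) = coh_pull R P'' d'' N i'' h'' X"
proof -
  obtain c where c: "c \<in> cocyc R P d N i" "X = ccls R P d N i c"
    using X chain_complex.carrier_coh[OF assms(1,4)] by auto
  have "(\<lambda>u\<in>carrier (P' i'). c (h u)) \<in> cocyc R P' d' N i'" using h c by (auto simp: coh_mor_def)
  moreover have "h' u \<in> carrier (P' i')" if "u \<in> carrier (P'' i'')" for u
    using h' that lin_closed by (fastforce simp: coh_mor_def)
  ultimately show ?thesis using c
    by (simp add: coh_pull_ccls[OF assms(1,2,4) h] coh_pull_ccls[OF assms(2,3,4) h']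
       coh_pull_ccls[OF assms(1,3,4) h''] eq cong: restrict_cong)
qed

text \<open>The two legs may pass through different degrees, so squares that contain a connecting
  map are covered too.\<close>

lemma coh_pull_square:
  assumes "chain_complex R P d" "chain_complex R P' d'" "chain_complex R Q e" "chain_complex R P'' d''"
    "module R N"
    and h: "coh_mor R P d i P' d' i' N h" and h': "coh_mor R P' d' i' P'' d'' i'' N h'"
    and g: "coh_mor R P d i Q e j N g" and g': "coh_mor R Q e j P'' d'' i'' N g'"
    and eq: "\<And>u. u \<in> carrier (P'' i'') \<Longrightarrow> h (h' u) = g (g' u)" and X: "X \<in> carrier (coh R P d N i)"
  shows "coh_pull R P'' d'' N i'' h' (coh_pull R P' d' N i' h X) =
    coh_pull R P'' d'' N i'' g' (coh_pull R Q e N j g X)"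
proof -
  obtain c where c: "c \<in> cocyc R P d N i" "X = ccls R P d N i c"
    using X chain_complex.carrier_coh[OF assms(1,5)] by auto
  have "(\<lambda>u\<in>carrier (P' i'). c (h u)) \<in> cocyc R P' d' N i'" "(\<lambda>u\<in>carrier (Q j). c (g u)) \<in> cocyc R Q e N j"
    using h g c by (auto simp: coh_mor_def)
  moreover have "h' u \<in> carrier (P' i')" "g' u \<in> carrier (Q j)" if "u \<in> carrier (P'' i'')" for u
    using h' g' that lin_closed by (fastforce simp: coh_mor_def)+
  ultimately show ?thesis using c
    by (simp add: coh_pull_ccls[OF assms(1,2,5) h] coh_pull_ccls[OF assms(2,4,5) h']
       coh_pull_ccls[OF assms(1,3,5) g] coh_pull_ccls[OF assms(3,4,5) g'] eq cong: restrict_cong)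
qed

definition chain_map where
  "chain_map R P d Q d' f \<longleftrightarrow> (\<forall>i. lin R (P i) (Q i) (f i)) \<and>
     (\<forall>i. \<forall>u\<in>carrier (P (Suc i)). f i (d i u) = d' i (f (Suc i) u))"

lemma coh_mor_chain_map:
  assumes P: "chain_complex R P d" and P': "chain_complex R P' d'" and N: "module R N"
    and f: "chain_map R P' d' P d f"
  shows "coh_mor R P d i P' d' i N (f i)"
proof -
  interpret P: chain_complex R P d by (rule P)
  interpret P': chain_complex R P' d' by (rule P')
  have lf: "lin R (P' i) (P i) (f i)" for i using f by (simp add: chain_map_def)
  have fd: "f i (d' i u) = d i (f (Suc i) u)" if "u \<in> carrier (P' (Suc i))" for u i
    using f that by (auto simp: chain_map_def)
  show ?thesis unfolding coh_mor_def
  proof (intro conjI ballI lf)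
    fix c assume c: "c \<in> cocyc R P d N i"
    then show "(\<lambda>u\<in>carrier (P' i). c (f i u)) \<in> cocyc R P' d' N i"
      using restrict_mod_hom[OF lin_comp[OF lf mod_hom_lin[OF P.module_P N]]] lin_closed[OF P'.lin_d]
        lin_closed[OF lf]
      by (auto simp: cocyc_def fd)
  next
    fix c assume c: "c \<in> cobound R P d N i"
    show "(\<lambda>u\<in>carrier (P' i). c (f i u)) \<in> cobound R P' d' N i"
    proof (cases i)
      case 0
      then show ?thesis using c lin_closed[OF lf] by (auto simp: fun_eq_iff)
    next
      case (Suc j)
      then obtain e where e: "e \<in> mod_hom R (P j) N" "c = (\<lambda>u\<in>carrier (P (Suc j)). e (d j u))"
        using c by auto
      have "(\<lambda>u\<in>carrier (P' i). c (f i u)) =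
          (\<lambda>u\<in>carrier (P' (Suc j)). (\<lambda>u\<in>carrier (P' j). e (f j u)) (d' j u))"
        using Suc lin_closed[OF lf, of _ "Suc j"] lin_closed[OF P'.lin_d]
        by (auto simp: fun_eq_iff e fd)
      then show ?thesis
        using Suc restrict_mod_hom[OF lin_comp[OF lf mod_hom_lin[OF P.module_P N e(1)]]]
        unfolding Suc cobound.simps by (intro image_eqI) simp_all
    qed
  qed
qed


section \<open>Mapping cones\<close>

text \<open>Degree 0 is the zero submodule of \<open>P 0\<close> rather than a separate zero module,
  so that all degrees share one type.\<close>

definition shift :: "(nat \<Rightarrow> ('a, 'p) module) \<Rightarrow> nat \<Rightarrow> ('a, 'p) module" where
  "shift P j = (case j of 0 \<Rightarrow> (P 0)\<lparr>carrier := {\<zero>\<^bsub>P 0\<^esub>}\<rparr> | Suc k \<Rightarrow> P k)"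

definition cone where
  "cone P Q j = prod_module (Q j) (shift P j)"

text \<open>Index \<open>j\<close> leads from degree \<open>j + 1\<close> to degree
  \<open>j\<close>. The sign on the second component makes the two terms that involve both
  \<open>\<theta>\<close> and a differential cancel when the map is applied twice. For
  \<open>j = 0\<close> the second target is the zero module.\<close>

definition cone_d where
  "cone_d P d Q d' \<theta> j u =
     (d' j (fst u) \<oplus>\<^bsub>Q j\<^esub> \<theta> j (snd u), case j of 0 \<Rightarrow> \<zero>\<^bsub>P 0\<^esub> | Suc k \<Rightarrow> \<ominus>\<^bsub>P k\<^esub> d k (snd u))"

lemma shift_Suc [simp]: "shift P (Suc j) = P j"
  by (simp add: shift_def)

lemma module_shift: "(\<And>j. module R (P j)) \<Longrightarrow> module R (shift P j)"
  by (auto simp: shift_def submodule_module submodule_zero split: nat.split)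

lemma carrier_cone_0: "carrier (cone P Q 0) = carrier (Q 0) \<times> {\<zero>\<^bsub>P 0\<^esub>}"
  and carrier_cone_Suc: "carrier (cone P Q (Suc j)) = carrier (Q (Suc j)) \<times> carrier (P j)"
  by (auto simp: cone_def shift_def)

lemma zero_shift_0 [simp]: "\<zero>\<^bsub>shift P 0\<^esub> = \<zero>\<^bsub>P 0\<^esub>" "carrier (shift P 0) = {\<zero>\<^bsub>P 0\<^esub>}"
  by (auto simp: shift_def)

locale cone_setup = P: chain_complex R P d + Q: chain_complex R Q d'
  for R :: "('a, 'r) ring_scheme" and P :: "nat \<Rightarrow> ('a, 'p) module" and d :: "nat \<Rightarrow> 'p \<Rightarrow> 'p"
    and Q :: "nat \<Rightarrow> ('a, 'q) module" and d' :: "nat \<Rightarrow> 'q \<Rightarrow> 'q" +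
  fixes \<theta> :: "nat \<Rightarrow> 'p \<Rightarrow> 'q"
  assumes \<theta>: "chain_map R P d Q d' \<theta>"
begin

abbreviation "C \<equiv> cone P Q"
abbreviation "D \<equiv> cone_d P d Q d' \<theta>"

lemma lin_\<theta>: "lin R (P i) (Q i) (\<theta> i)"
  and \<theta>_d: "u \<in> carrier (P (Suc i)) \<Longrightarrow> \<theta> i (d i u) = d' i (\<theta> (Suc i) u)"
  using \<theta> by (auto simp: chain_map_def)

lemmas module_S = module_shift[of R P, OF P.module_P]

lemma module_C: "module R (C j)"
  unfolding cone_def by (rule module_prod[OF Q.module_P module_S])

lemma lin_D: "lin R (C (Suc j)) (C j) (D j)"
proof -
  have f: "lin R (C (Suc j)) (Q (Suc j)) fst"
    unfolding cone_def by (rule lin_fst[OF Q.module_P module_S])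
  have s: "lin R (C (Suc j)) (P j) snd"
    unfolding cone_def shift_Suc by (rule lin_snd[OF Q.module_P P.module_P])
  have 1: "lin R (C (Suc j)) (Q j) (\<lambda>u. d' j (fst u) \<oplus>\<^bsub>Q j\<^esub> \<theta> j (snd u))"
    by (intro lin_plus lin_comp[OF f Q.lin_d] lin_comp[OF s lin_\<theta>])
  have 2: "lin R (C (Suc j)) (shift P j) (\<lambda>u. case j of 0 \<Rightarrow> \<zero>\<^bsub>P 0\<^esub> | Suc k \<Rightarrow> \<ominus>\<^bsub>P k\<^esub> d k (snd u))"
  proof (cases j)
    case 0
    then show ?thesis using lin_const_zero[OF module_C module_S, of "Suc j" 0] by simp
  next
    case (Suc k)
    then show ?thesis using lin_uminus[OF lin_comp[OF s[unfolded Suc] P.lin_d]] by simp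
  qed
  show ?thesis using lin_pair[OF 1 2] by (simp add: cone_def[of _ _ j] cone_d_def[abs_def])
qed

lemma DD:
  assumes u: "u \<in> carrier (C (Suc (Suc j)))"
  shows "D j (D (Suc j) u) = \<zero>\<^bsub>C j\<^esub>"
proof -
  interpret Qm: module R "Q i" for i by (rule Q.module_P)
  interpret Pm: module R "P i" for i by (rule P.module_P)
  obtain q p where u: "u = (q, p)" "q \<in> carrier (Q (Suc (Suc j)))" "p \<in> carrier (P (Suc j))"
    using u by (auto simp: carrier_cone_Suc)
  note cl = lin_closed[OF Q.lin_d] lin_closed[OF P.lin_d] lin_closed[OF lin_\<theta>]
  have "d' j (d' (Suc j) q \<oplus>\<^bsub>Q (Suc j)\<^esub> \<theta> (Suc j) p) \<oplus>\<^bsub>Q j\<^esub> \<theta> j (\<ominus>\<^bsub>P j\<^esub> d j p) = \<zero>\<^bsub>Q j\<^esub>"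
    using u by (simp add: lin_add[OF Q.lin_d] lin_neg[OF lin_\<theta>] cl Q.dd \<theta>_d Qm.r_neg)
  moreover have "\<ominus>\<^bsub>P k\<^esub> d k (\<ominus>\<^bsub>P (Suc k)\<^esub> d (Suc k) p) = \<zero>\<^bsub>P k\<^esub>" if "j = Suc k" for k
    using u that lin_zero[OF lin_uminus[OF lin_ident[OF P.module_P]]]
    by (simp add: lin_neg[OF P.lin_d] cl P.dd)
  ultimately show ?thesis
    by (auto simp: u cone_d_def cone_def split: nat.split)
qed

lemma complex_C: "chain_complex R C D"
  by (rule chain_complex.intro) (rule module_C lin_D DD, assumption?)+

sublocale C: chain_complex R C D by (rule complex_C)

end


lemma (in abelian_group) diff_cancel_left:
  assumes "x \<in> carrier G" "y \<in> carrier G" "t \<in> carrier G"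
  shows "(y \<oplus> x) \<oplus> \<ominus> (y \<oplus> t) = x \<oplus> \<ominus> t"
proof -
  have "(y \<oplus> x) \<oplus> (\<ominus> y \<oplus> \<ominus> t) = (y \<oplus> \<ominus> y) \<oplus> (x \<oplus> \<ominus> t)"
    using assms by (simp add: a_ac)
  then show ?thesis using assms by (simp add: minus_add r_neg)
qed

lemma (in abelian_group) diff_zero_iff:
  assumes "x \<in> carrier G" "y \<in> carrier G"
  shows "x \<ominus> y = \<zero> \<longleftrightarrow> x = y"
proof
  assume *: "x \<ominus> y = \<zero>"
  have "x = (x \<ominus> y) \<oplus> y" using assms by (simp add: minus_eq a_assoc l_neg)
  then show "x = y" using * assms by simp
qed (use assms in \<open>simp add: minus_eq r_neg\<close>)

context cone_setup
begin

interpretation Qm: module R "Q i" for i by (rule Q.module_P)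
interpretation Pm: module R "P i" for i by (rule P.module_P)

definition "inl i = (\<lambda>q. (q, \<zero>\<^bsub>shift P i\<^esub>))"
definition "inr i = (\<lambda>p. (\<zero>\<^bsub>Q (Suc i)\<^esub>, p))"

lemma lin_inl_C: "lin R (Q i) (C i) (inl i)"
  unfolding inl_def cone_def by (rule lin_inl[OF Q.module_P module_S])

lemma lin_inr_C: "lin R (P i) (C (Suc i)) (inr i)"
  unfolding inr_def cone_def shift_Suc by (rule lin_inr[OF Q.module_P P.module_P])

lemma lin_fst_C: "lin R (C i) (Q i) fst"
  unfolding cone_def by (rule lin_fst[OF Q.module_P module_S])

lemma lin_snd_C: "lin R (C (Suc i)) (P i) snd"
  unfolding cone_def shift_Suc by (rule lin_snd[OF Q.module_P P.module_P])

lemma minus_zero_P [simp]: "\<ominus>\<^bsub>P i\<^esub> \<zero>\<^bsub>P i\<^esub> = \<zero>\<^bsub>P i\<^esub>"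
  using lin_zero[OF lin_uminus[OF lin_ident[OF P.module_P[of i]]]] .

lemma D_inl: "q \<in> carrier (Q (Suc i)) \<Longrightarrow> D i (inl (Suc i) q) = inl i (d' i q)"
  by (auto simp: inl_def cone_d_def lin_zero[OF lin_\<theta>] lin_zero[OF P.lin_d] lin_closed[OF Q.lin_d]
      split: nat.split)

lemma D_inr_0: "p \<in> carrier (P 0) \<Longrightarrow> D 0 (inr 0 p) = inl 0 (\<theta> 0 p)"
  by (auto simp: inl_def inr_def cone_d_def lin_zero[OF Q.lin_d] lin_closed[OF lin_\<theta>])

text \<open>Moving the term with \<open>d\<close> to the left avoids a negative. A cocycle of the
  cone vanishes on the first summand, which leaves the identity in \<open>w_inr\<close>.\<close>

lemma D_inr_Suc:
  "p \<in> carrier (P (Suc i)) \<Longrightarrow> D (Suc i) (inr (Suc i) p) \<oplus>\<^bsub>C (Suc i)\<^esub> inr i (d i p) = inl (Suc i) (\<theta> (Suc i) p)"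
  by (auto simp: inl_def inr_def cone_d_def cone_def lin_zero[OF Q.lin_d] lin_closed[OF lin_\<theta>]
      lin_closed[OF P.lin_d] Pm.l_neg)

lemma chain_map_inl: "chain_map R Q d' C D inl"
  unfolding chain_map_def by (auto simp: lin_inl_C D_inl)

lemma split_C: "u \<in> carrier (C (Suc i)) \<Longrightarrow> u = inl (Suc i) (fst u) \<oplus>\<^bsub>C (Suc i)\<^esub> inr i (snd u)"
  by (auto simp: inl_def inr_def cone_def)

context
  fixes N :: "('a, 'n) module"
  assumes N: "module R N"
begin

interpretation N: module R N by (rule N)

lemmas mor_\<alpha> = coh_mor_chain_map[OF Q.chain_complex_axioms P.chain_complex_axioms N \<theta>]
lemmas mor_\<gamma> = coh_mor_chain_map[OF complex_C Q.chain_complex_axioms N chain_map_inl]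

lemma coch_lin: "a \<in> cocyc R P d N i \<Longrightarrow> lin R (P i) N a"
  "c \<in> cocyc R Q d' N i \<Longrightarrow> lin R (Q i) N c"
  "w \<in> cocyc R C D N i \<Longrightarrow> lin R (C i) N w"
  by (auto simp: cocyc_def intro: mod_hom_lin P.module_P Q.module_P module_C N)

text \<open>The projection onto the shifted \<open>P\<close> commutes with the differentials up to a
  sign, and a sign affects neither cocycles nor coboundaries.\<close>

lemma mor_\<beta>: "coh_mor R P d i C D (Suc i) N snd"
  unfolding coh_mor_def
proof (intro conjI ballI lin_snd_C)
  fix a assume a: "a \<in> cocyc R P d N i"
  note la = coch_lin(1)[OF a]
  have "a (\<ominus>\<^bsub>P i\<^esub> d i p) = \<zero>\<^bsub>N\<^esub>" if "p \<in> carrier (P (Suc i))" for p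
    using that a lin_zero[OF lin_uminus[OF lin_ident[OF N]]]
    by (simp add: lin_neg[OF la] lin_closed[OF P.lin_d] cocyc_def)
  then have "a (snd (D (Suc i) u)) = \<zero>\<^bsub>N\<^esub>" if "u \<in> carrier (C (Suc (Suc i)))" for u
    using that by (auto simp: cone_d_def carrier_cone_Suc)
  then show "(\<lambda>u\<in>carrier (C (Suc i)). a (snd u)) \<in> cocyc R C D N (Suc i)"
    using restrict_mod_hom[OF lin_comp[OF lin_snd_C la]] lin_closed[OF lin_D]
    by (simp add: cocyc_def)
next
  fix a assume a: "a \<in> cobound R P d N i"
  show "(\<lambda>u\<in>carrier (C (Suc i)). a (snd u)) \<in> cobound R C D N (Suc i)"
  proof (cases i)
    case 0
    then have "(\<lambda>u\<in>carrier (C (Suc i)). a (snd u)) = (\<lambda>u\<in>carrier (C (Suc i)). (\<lambda>u\<in>carrier (C i). \<zero>\<^bsub>N\<^esub>) (D i u))"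
      using a lin_closed[OF lin_D] by (auto simp: fun_eq_iff carrier_cone_Suc)
    then show ?thesis using restrict_mod_hom[OF lin_const_zero[OF module_C[of i] N]]
      unfolding cobound.simps by (intro image_eqI)
  next
    case (Suc j)
    then obtain e where e: "e \<in> mod_hom R (P j) N" "a = (\<lambda>u\<in>carrier (P i). e (d j u))" using a by auto
    note le = mod_hom_lin[OF P.module_P N e(1)]
    \<comment> \<open>The sign compensates the one in the second component of the cone
      differential.\<close>
    let ?w = "\<lambda>u\<in>carrier (C (Suc j)). \<ominus>\<^bsub>N\<^esub> e (snd u)"
    have "?w \<in> mod_hom R (C (Suc j)) N"
      by (rule restrict_mod_hom[OF lin_uminus[OF lin_comp[OF lin_snd_C le]]])
    moreover have "?w (D i u) = a (snd u)" if u: "u \<in> carrier (C (Suc i))" for u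
    proof -
      have s: "snd u \<in> carrier (P (Suc j))" "snd u \<in> carrier (P i)"
        using u by (auto simp: carrier_cone_Suc Suc)
      have "D i u \<in> carrier (C (Suc j))" using lin_closed[OF lin_D u] Suc by simp
      then show ?thesis
        using lin_closed[OF P.lin_d s(1)] s lin_closed[OF le] by (simp add: e Suc cone_d_def lin_neg[OF le])
    qed
    ultimately show ?thesis using cobound_SucI[of ?w R C "Suc j" N D] Suc by (simp cong: restrict_cong)
  qed
qed

abbreviation "\<alpha> i \<equiv> coh_pull R P d N i (\<theta> i)"
abbreviation "\<beta> i \<equiv> coh_pull R C D N (Suc i) snd"
abbreviation "\<gamma> i \<equiv> coh_pull R Q d' N i (inl i)"

lemmas lin_\<alpha> = lin_coh_pull[OF Q.chain_complex_axioms P.chain_complex_axioms N mor_\<alpha>]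
lemmas lin_\<beta> = lin_coh_pull[OF P.chain_complex_axioms complex_C N mor_\<beta>]
lemmas lin_\<gamma> = lin_coh_pull[OF complex_C Q.chain_complex_axioms N mor_\<gamma>]

lemmas \<alpha>_ccls = coh_pull_ccls[OF Q.chain_complex_axioms P.chain_complex_axioms N mor_\<alpha>]
lemmas \<beta>_ccls = coh_pull_ccls[OF P.chain_complex_axioms complex_C N mor_\<beta>]
lemmas \<gamma>_ccls = coh_pull_ccls[OF complex_C Q.chain_complex_axioms N mor_\<gamma>]

lemma pull_cocyc:
  "c \<in> cocyc R Q d' N i \<Longrightarrow> (\<lambda>u\<in>carrier (P i). c (\<theta> i u)) \<in> cocyc R P d N i"
  "a \<in> cocyc R P d N i \<Longrightarrow> (\<lambda>u\<in>carrier (C (Suc i)). a (snd u)) \<in> cocyc R C D N (Suc i)"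
  "w \<in> cocyc R C D N i \<Longrightarrow> (\<lambda>u\<in>carrier (Q i). w (inl i u)) \<in> cocyc R Q d' N i"
  using mor_\<alpha> mor_\<beta> mor_\<gamma> by (auto simp: coh_mor_def)

text \<open>In other words, a cocycle of the cone restricts on \<open>P\<close> to a cochain whose
  coboundary is the pullback along \<open>\<theta>\<close> of its restriction to \<open>Q\<close>.
  This is why the composite of \<open>\<gamma>\<close> and \<open>\<alpha>\<close> vanishes.\<close>

lemma w_inr:
  assumes w: "w \<in> cocyc R C D N (Suc i)" and p: "p \<in> carrier (P (Suc i))"
  shows "w (inr i (d i p)) = w (inl (Suc i) (\<theta> (Suc i) p))"
proof -
  note lw = coch_lin(3)[OF w]
  have i: "inr (Suc i) p \<in> carrier (C (Suc (Suc i)))" "inr i (d i p) \<in> carrier (C (Suc i))"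
    using p lin_closed[OF lin_inr_C] lin_closed[OF P.lin_d] by auto
  have "w (inl (Suc i) (\<theta> (Suc i) p)) = w (D (Suc i) (inr (Suc i) p)) \<oplus>\<^bsub>N\<^esub> w (inr i (d i p))"
    using i p by (simp add: D_inr_Suc[symmetric] lin_add[OF lw] lin_closed[OF lin_D])
  also have "w (D (Suc i) (inr (Suc i) p)) = \<zero>\<^bsub>N\<^esub>" using w i by (auto simp: cocyc_def)
  finally show ?thesis using i lin_closed[OF lw] by simp
qed

text \<open>A pair \<open>(c, e)\<close> of cochains on \<open>Q\<close> and \<open>P\<close> is a
  cocycle of the cone exactly when \<open>c\<close> is a cocycle whose pullback along
  \<open>\<theta>\<close> is the coboundary of \<open>e\<close>. So a cocycle of \<open>Q\<close>
  extends to the cone if and only if its pullback bounds.\<close>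

lemma cone_exact_Q: "exact_seq R (coh R C D N i) (\<gamma> i) (coh R Q d' N i) (\<alpha> i) (coh R P d N i)"
proof (rule exact_seqI[OF lin_\<gamma> lin_\<alpha>])
  fix X assume "X \<in> carrier (coh R C D N i)"
  then obtain w where w: "w \<in> cocyc R C D N i" "X = ccls R C D N i w" by (auto simp: C.carrier_coh[OF N])
  note lw = coch_lin(3)[OF w(1)]
  have eq: "\<alpha> i (\<gamma> i X) = ccls R P d N i (\<lambda>u\<in>carrier (P i). (\<lambda>u\<in>carrier (Q i). w (inl i u)) (\<theta> i u))"
    by (simp add: w \<gamma>_ccls \<alpha>_ccls pull_cocyc)
  have "(\<lambda>u\<in>carrier (P i). (\<lambda>u\<in>carrier (Q i). w (inl i u)) (\<theta> i u)) \<in> cobound R P d N i"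
  proof (cases i)
    case 0
    have "w (inl 0 (\<theta> 0 p)) = \<zero>\<^bsub>N\<^esub>" if "p \<in> carrier (P 0)" for p
      using w(1) that lin_closed[OF lin_inr_C] by (auto simp: cocyc_def D_inr_0[symmetric] 0)
    then show ?thesis using 0 lin_closed[OF lin_\<theta>] by (auto simp: fun_eq_iff)
  next
    case (Suc j)
    let ?a = "\<lambda>p\<in>carrier (P j). w (inr j p)"
    have "?a \<in> mod_hom R (P j) N"
      using restrict_mod_hom[OF lin_comp[OF lin_inr_C lw[unfolded Suc]]] by simp
    moreover have "(\<lambda>u\<in>carrier (P i). (\<lambda>u\<in>carrier (Q i). w (inl i u)) (\<theta> i u)) = (\<lambda>u\<in>carrier (P i). ?a (d j u))"
      using lin_closed[OF lin_\<theta>] lin_closed[OF P.lin_d] w_inr[OF w(1)[unfolded Suc]] Suc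
      by (auto simp: fun_eq_iff)
    ultimately show ?thesis unfolding Suc cobound.simps by (intro image_eqI)
  qed
  then show "\<alpha> i (\<gamma> i X) = \<zero>\<^bsub>coh R P d N i\<^esub>"
    unfolding eq by (rule P.ccls_zeroI[OF N])
next
  fix X assume X: "X \<in> carrier (coh R Q d' N i)" "\<alpha> i X = \<zero>\<^bsub>coh R P d N i\<^esub>"
  then obtain c where c: "c \<in> cocyc R Q d' N i" "X = ccls R Q d' N i c" by (auto simp: Q.carrier_coh[OF N])
  note lc = coch_lin(2)[OF c(1)]
  have cb: "(\<lambda>u\<in>carrier (P i). c (\<theta> i u)) \<in> cobound R P d N i"
    using X(2) P.ccls_zero_iff[OF N pull_cocyc(1)[OF c(1)]] c by (simp add: \<alpha>_ccls)
  have "\<exists>w\<in>cocyc R C D N i. \<forall>q\<in>carrier (Q i). w (inl i q) = c q"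
  proof (cases i)
    case 0
    \<comment> \<open>A coboundary in degree 0 is zero, so \<open>c\<close> vanishes on the image of
      \<open>\<theta>\<close> and extends without a second component.\<close>
    let ?w = "\<lambda>u\<in>carrier (C i). c (fst u)"
    have "c (\<theta> i p) = \<zero>\<^bsub>N\<^esub>" if "p \<in> carrier (P i)" for p
    proof -
      have "(\<lambda>u\<in>carrier (P i). c (\<theta> i u)) = (\<lambda>u\<in>carrier (P 0). \<zero>\<^bsub>N\<^esub>)" using cb 0 by simp
      from fun_cong[OF this, of p] show ?thesis using that 0 by simp
    qed
    moreover have "c (d' i q) = \<zero>\<^bsub>N\<^esub>" if "q \<in> carrier (Q (Suc i))" for q using c that by (auto simp: cocyc_def)
    ultimately have "?w \<in> cocyc R C D N i"
      using restrict_mod_hom[OF lin_comp[OF lin_fst_C lc]] lin_closed[OF lin_D]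
      by (auto simp: cocyc_def cone_d_def carrier_cone_Suc lin_add[OF lc] lin_closed[OF Q.lin_d] lin_closed[OF lin_\<theta>])
    moreover have "?w (inl i q) = c q" if "q \<in> carrier (Q i)" for q
      using that lin_closed[OF lin_inl_C] by (simp add: inl_def)
    ultimately show ?thesis by blast
  next
    case (Suc j)
    then obtain e where e: "e \<in> mod_hom R (P j) N" "(\<lambda>u\<in>carrier (P i). c (\<theta> i u)) = (\<lambda>u\<in>carrier (P i). e (d j u))"
      using cb by auto
    note le = mod_hom_lin[OF P.module_P N e(1)]
    have ed: "c (\<theta> i p) = e (d j p)" if "p \<in> carrier (P i)" for p
      using fun_cong[OF e(2), of p] that by simp
    let ?w = "\<lambda>u\<in>carrier (C i). c (fst u) \<oplus>\<^bsub>N\<^esub> e (snd u)"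
    have lw: "lin R (C i) N (\<lambda>u. c (fst u) \<oplus>\<^bsub>N\<^esub> e (snd u))"
      using lin_plus[OF lin_comp[OF lin_fst_C lc] lin_comp[OF lin_snd_C le, folded Suc]] .
    have cd: "c (d' i q) = \<zero>\<^bsub>N\<^esub>" if "q \<in> carrier (Q (Suc i))" for q using c that by (auto simp: cocyc_def)
    have "?w (D i u) = \<zero>\<^bsub>N\<^esub>" if u: "u \<in> carrier (C (Suc i))" for u
    proof -
      have fs: "fst u \<in> carrier (Q (Suc i))" "snd u \<in> carrier (P i)" using u by (auto simp: carrier_cone_Suc)
      have ds: "d j (snd u) \<in> carrier (P j)" using fs lin_closed[OF P.lin_d] Suc by auto
      have "?w (D i u) = c (d' i (fst u) \<oplus>\<^bsub>Q i\<^esub> \<theta> i (snd u)) \<oplus>\<^bsub>N\<^esub> e (\<ominus>\<^bsub>P j\<^esub> d j (snd u))"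
        using lin_closed[OF lin_D u] Suc by (simp add: cone_d_def)
      also have "\<dots> = c (\<theta> i (snd u)) \<oplus>\<^bsub>N\<^esub> \<ominus>\<^bsub>N\<^esub> e (d j (snd u))"
        using fs ds by (simp add: lin_add[OF lc] lin_closed[OF Q.lin_d] lin_closed[OF lin_\<theta>] cd
            lin_neg[OF le] lin_closed[OF lc])
      also have "\<dots> = \<zero>\<^bsub>N\<^esub>" using fs ds by (simp add: ed N.r_neg lin_closed[OF le])
      finally show ?thesis .
    qed
    then have "?w \<in> cocyc R C D N i"
      using restrict_mod_hom[OF lw] by (auto simp: cocyc_def)
    moreover have "?w (inl i q) = c q" if "q \<in> carrier (Q i)" for q
      using that lin_closed[OF lin_inl_C that] Suc by (simp add: inl_def lin_zero[OF le] lin_closed[OF lc])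
    ultimately show ?thesis by blast
  qed
  then obtain w where w: "w \<in> cocyc R C D N i" "\<forall>q\<in>carrier (Q i). w (inl i q) = c q" by blast
  have "(\<lambda>u\<in>carrier (Q i). w (inl i u)) = c"
    using w c pull_cocyc(3)[OF w(1)] by (intro mod_hom_ext[of _ R "Q i" N]) (auto simp: cocyc_def)
  then have "\<gamma> i (ccls R C D N i w) = X" using w c by (simp add: \<gamma>_ccls)
  then show "X \<in> \<gamma> i ` carrier (coh R C D N i)" using C.ccls_closed[OF N w(1)] by blast
qed

text \<open>For a cocycle \<open>c\<close> of \<open>Q\<close>, the coboundary of \<open>c\<close>
  composed with \<open>fst\<close> is the pullback of \<open>c\<close> composed with
  \<open>snd\<close>. Conversely, if \<open>a\<close> composed with \<open>snd\<close> is the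
  coboundary of \<open>w\<close>, then \<open>w\<close> restricts to a cocycle of \<open>Q\<close>
  whose pullback is \<open>a\<close> plus the coboundary of the restriction of \<open>w\<close> to
  \<open>P\<close>.\<close>

lemma cone_exact_P: "exact_seq R (coh R Q d' N i) (\<alpha> i) (coh R P d N i) (\<beta> i) (coh R C D N (Suc i))"
proof (rule exact_seqI[OF lin_\<alpha> lin_\<beta>])
  fix X assume "X \<in> carrier (coh R Q d' N i)"
  then obtain c where c: "c \<in> cocyc R Q d' N i" "X = ccls R Q d' N i c" by (auto simp: Q.carrier_coh[OF N])
  note lc = coch_lin(2)[OF c(1)]
  have eq: "\<beta> i (\<alpha> i X) = ccls R C D N (Suc i) (\<lambda>u\<in>carrier (C (Suc i)). (\<lambda>u\<in>carrier (P i). c (\<theta> i u)) (snd u))"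
    by (simp add: c \<beta>_ccls \<alpha>_ccls pull_cocyc)
  let ?w = "\<lambda>u\<in>carrier (C i). c (fst u)"
  have cd: "c (d' i q) = \<zero>\<^bsub>N\<^esub>" if "q \<in> carrier (Q (Suc i))" for q using c that by (auto simp: cocyc_def)
  have "(\<lambda>u\<in>carrier (C (Suc i)). (\<lambda>u\<in>carrier (P i). c (\<theta> i u)) (snd u)) = (\<lambda>u\<in>carrier (C (Suc i)). ?w (D i u))"
    using lin_closed[OF lin_D]
    by (auto simp: fun_eq_iff cone_d_def carrier_cone_Suc lin_add[OF lc] lin_closed[OF Q.lin_d]
        lin_closed[OF lin_\<theta>] cd lin_closed[OF lc])
  then have "(\<lambda>u\<in>carrier (C (Suc i)). (\<lambda>u\<in>carrier (P i). c (\<theta> i u)) (snd u)) \<in> cobound R C D N (Suc i)"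
    using restrict_mod_hom[OF lin_comp[OF lin_fst_C lc]] unfolding cobound.simps by (intro image_eqI)
  then show "\<beta> i (\<alpha> i X) = \<zero>\<^bsub>coh R C D N (Suc i)\<^esub>"
    unfolding eq by (rule C.ccls_zeroI[OF N])
next
  fix X assume X: "X \<in> carrier (coh R P d N i)" "\<beta> i X = \<zero>\<^bsub>coh R C D N (Suc i)\<^esub>"
  then obtain a where a: "a \<in> cocyc R P d N i" "X = ccls R P d N i a" by (auto simp: P.carrier_coh[OF N])
  note la = coch_lin(1)[OF a(1)]
  have "(\<lambda>u\<in>carrier (C (Suc i)). a (snd u)) \<in> cobound R C D N (Suc i)"
    using X(2) C.ccls_zero_iff[OF N pull_cocyc(2)[OF a(1)]] a by (simp add: \<beta>_ccls)
  then obtain w where w: "w \<in> mod_hom R (C i) N"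
    "(\<lambda>u\<in>carrier (C (Suc i)). a (snd u)) = (\<lambda>u\<in>carrier (C (Suc i)). w (D i u))" by auto
  note lw = mod_hom_lin[OF module_C N w(1)]
  have wD: "w (D i u) = a (snd u)" if "u \<in> carrier (C (Suc i))" for u
    using fun_cong[OF w(2), of u] that by simp
  let ?c = "\<lambda>q\<in>carrier (Q i). w (inl i q)"
  have "w (inl i (d' i q)) = \<zero>\<^bsub>N\<^esub>" if "q \<in> carrier (Q (Suc i))" for q
    using wD[of "inl (Suc i) q"] that lin_closed[OF lin_inl_C that]
    by (simp add: D_inl) (simp add: inl_def lin_zero[OF la])
  then have c: "?c \<in> cocyc R Q d' N i"
    using restrict_mod_hom[OF lin_comp[OF lin_inl_C lw]] lin_closed[OF Q.lin_d] by (auto simp: cocyc_def)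
  have "\<exists>e\<in>cobound R P d N i. \<forall>p\<in>carrier (P i). w (inl i (\<theta> i p)) = a p \<oplus>\<^bsub>N\<^esub> e p"
  proof (cases i)
    case 0
    have "w (inl i (\<theta> i p)) = a p" if "p \<in> carrier (P i)" for p
      using wD[of "inr i p"] that lin_closed[OF lin_inr_C that] D_inr_0 0 by (auto simp: inr_def)
    then show ?thesis using 0 lin_closed[OF la] by auto
  next
    case (Suc j)
    let ?e = "\<lambda>p\<in>carrier (P j). w (inr j p)"
    have e: "?e \<in> mod_hom R (P j) N"
      using restrict_mod_hom[OF lin_comp[OF lin_inr_C lw[unfolded Suc]]] by simp
    have "w (inl i (\<theta> i p)) = a p \<oplus>\<^bsub>N\<^esub> ?e (d j p)" if p: "p \<in> carrier (P i)" for p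
    proof -
      have i: "inr i p \<in> carrier (C (Suc i))" "inr j (d j p) \<in> carrier (C i)" "d j p \<in> carrier (P j)"
        using p Suc lin_closed[OF lin_inr_C] lin_closed[OF P.lin_d] by auto
      have "w (inl i (\<theta> i p)) = w (D i (inr i p)) \<oplus>\<^bsub>N\<^esub> w (inr j (d j p))"
        using i p Suc D_inr_Suc[of p j] lin_add[OF lw, of "D i (inr i p)" "inr j (d j p)"] lin_closed[OF lin_D i(1)]
        by simp
      also have "w (D i (inr i p)) = a p" using wD[OF i(1)] by (simp add: inr_def)
      finally show ?thesis using i by simp
    qed
    then show ?thesis using cobound_SucI[where P = P and d = d and i = j, OF e] Suc
      by (intro bexI[of _ "\<lambda>u\<in>carrier (P i). ?e (d j u)"]) auto
  qed
  then obtain e where e: "e \<in> cobound R P d N i" "\<And>p. p \<in> carrier (P i) \<Longrightarrow> w (inl i (\<theta> i p)) = a p \<oplus>\<^bsub>N\<^esub> e p"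
    by blast
  have "\<alpha> i (ccls R Q d' N i ?c) = X"
    unfolding \<alpha>_ccls[OF c] a(2)
    by (rule P.ccls_eqI[OF N pull_cocyc(1)[OF c] a(1) e(1)]) (simp add: e lin_closed[OF lin_\<theta>])
  then show "X \<in> \<alpha> i ` carrier (coh R Q d' N i)" using Q.ccls_closed[OF N c] by blast
qed

text \<open>If \<open>w\<close> restricts on \<open>Q\<close> to the coboundary of \<open>c\<close>,
  subtracting the coboundary of \<open>c\<close> composed with \<open>fst\<close> gives a cocycle
  that vanishes on \<open>Q\<close> and so comes from \<open>P\<close>.\<close>

lemma cone_exact_C:
  "exact_seq R (coh R P d N i) (\<beta> i) (coh R C D N (Suc i)) (\<gamma> (Suc i)) (coh R Q d' N (Suc i))"
proof (rule exact_seqI[OF lin_\<beta> lin_\<gamma>])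
  fix X assume "X \<in> carrier (coh R P d N i)"
  then obtain a where a: "a \<in> cocyc R P d N i" "X = ccls R P d N i a" by (auto simp: P.carrier_coh[OF N])
  note la = coch_lin(1)[OF a(1)]
  have eq: "\<gamma> (Suc i) (\<beta> i X) = ccls R Q d' N (Suc i)
      (\<lambda>u\<in>carrier (Q (Suc i)). (\<lambda>u\<in>carrier (C (Suc i)). a (snd u)) (inl (Suc i) u))"
    by (simp add: a \<beta>_ccls \<gamma>_ccls pull_cocyc)
  have "(\<lambda>u\<in>carrier (Q (Suc i)). (\<lambda>u\<in>carrier (C (Suc i)). a (snd u)) (inl (Suc i) u))
      = (\<lambda>u\<in>carrier (Q (Suc i)). (\<lambda>u\<in>carrier (Q i). \<zero>\<^bsub>N\<^esub>) (d' i u))"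
    using lin_closed[OF Q.lin_d] lin_zero[OF la] by (auto simp: fun_eq_iff inl_def carrier_cone_Suc)
  then have "(\<lambda>u\<in>carrier (Q (Suc i)). (\<lambda>u\<in>carrier (C (Suc i)). a (snd u)) (inl (Suc i) u))
      \<in> cobound R Q d' N (Suc i)"
    using restrict_mod_hom[OF lin_const_zero[OF Q.module_P[of i] N]] unfolding cobound.simps by (intro image_eqI)
  then show "\<gamma> (Suc i) (\<beta> i X) = \<zero>\<^bsub>coh R Q d' N (Suc i)\<^esub>"
    unfolding eq by (rule Q.ccls_zeroI[OF N])
next
  fix X assume X: "X \<in> carrier (coh R C D N (Suc i))" "\<gamma> (Suc i) X = \<zero>\<^bsub>coh R Q d' N (Suc i)\<^esub>"
  then obtain w where w: "w \<in> cocyc R C D N (Suc i)" "X = ccls R C D N (Suc i) w" by (auto simp: C.carrier_coh[OF N])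
  note lw = coch_lin(3)[OF w(1)]
  have "(\<lambda>u\<in>carrier (Q (Suc i)). w (inl (Suc i) u)) \<in> cobound R Q d' N (Suc i)"
    using X(2) Q.ccls_zero_iff[OF N pull_cocyc(3)[OF w(1)]] w by (simp add: \<gamma>_ccls)
  then obtain c where c: "c \<in> mod_hom R (Q i) N"
    "(\<lambda>u\<in>carrier (Q (Suc i)). w (inl (Suc i) u)) = (\<lambda>u\<in>carrier (Q (Suc i)). c (d' i u))" by auto
  note lc = mod_hom_lin[OF Q.module_P N c(1)]
  have wc: "w (inl (Suc i) q) = c (d' i q)" if "q \<in> carrier (Q (Suc i))" for q
    using fun_cong[OF c(2), of q] that by simp
  \<comment> \<open>The difference of \<open>w\<close> and the coboundary of \<open>c\<close>
    composed with \<open>fst\<close>, evaluated on the summand \<open>P\<close>.\<close>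
  let ?a = "\<lambda>p\<in>carrier (P i). w (inr i p) \<ominus>\<^bsub>N\<^esub> c (\<theta> i p)"
  have "?a (d i p) = \<zero>\<^bsub>N\<^esub>" if p: "p \<in> carrier (P (Suc i))" for p
  proof -
    have "?a (d i p) = w (inl (Suc i) (\<theta> (Suc i) p)) \<ominus>\<^bsub>N\<^esub> c (d' i (\<theta> (Suc i) p))"
      using p lin_closed[OF P.lin_d] w_inr[OF w(1) p] by (simp add: \<theta>_d)
    also have "\<dots> = \<zero>\<^bsub>N\<^esub>"
      using p lin_closed[OF lin_\<theta> p] by (simp add: wc lin_closed[OF lc] lin_closed[OF Q.lin_d] N.minus_eq N.r_neg)
    finally show ?thesis .
  qed
  then have a: "?a \<in> cocyc R P d N i"
    using restrict_mod_hom[OF lin_minus[OF lin_comp[OF lin_inr_C lw] lin_comp[OF lin_\<theta> lc]]]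
    by (auto simp: cocyc_def)
  let ?e = "\<lambda>u\<in>carrier (C (Suc i)). (\<lambda>u\<in>carrier (C i). \<ominus>\<^bsub>N\<^esub> c (fst u)) (D i u)"
  have e: "?e \<in> cobound R C D N (Suc i)"
    by (rule cobound_SucI[where P = C and d = D and i = i, OF restrict_mod_hom[OF lin_uminus[OF lin_comp[OF lin_fst_C lc]]]])
  have "\<beta> i (ccls R P d N i ?a) = X"
    unfolding \<beta>_ccls[OF a] w(2)
  proof (rule C.ccls_eqI[OF N pull_cocyc(2)[OF a] w(1) e])
    fix u assume u: "u \<in> carrier (C (Suc i))"
    have fs: "fst u \<in> carrier (Q (Suc i))" "snd u \<in> carrier (P i)" using u by (auto simp: carrier_cone_Suc)
    have cl: "inr i (snd u) \<in> carrier (C (Suc i))" "inl (Suc i) (fst u) \<in> carrier (C (Suc i))"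
      "d' i (fst u) \<in> carrier (Q i)" "\<theta> i (snd u) \<in> carrier (Q i)"
      using fs lin_closed[OF lin_inr_C] lin_closed[OF lin_inl_C] lin_closed[OF Q.lin_d] lin_closed[OF lin_\<theta>] by auto
    have cn: "w (inr i (snd u)) \<in> carrier N" "c (d' i (fst u)) \<in> carrier N" "c (\<theta> i (snd u)) \<in> carrier N"
      using cl lin_closed[OF lc] lin_closed[OF lw] by auto
    have wu: "w u = c (d' i (fst u)) \<oplus>\<^bsub>N\<^esub> w (inr i (snd u))"
      using cl fs by (subst split_C[OF u]) (simp add: lin_add[OF lw] wc)
    have "?e u = \<ominus>\<^bsub>N\<^esub> (c (d' i (fst u)) \<oplus>\<^bsub>N\<^esub> c (\<theta> i (snd u)))"
      using u lin_closed[OF lin_D u] cl by (simp add: cone_d_def lin_add[OF lc])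
    then show "(\<lambda>u\<in>carrier (C (Suc i)). ?a (snd u)) u = w u \<oplus>\<^bsub>N\<^esub> ?e u"
      unfolding wu using u fs N.diff_cancel_left[OF cn(1,2,3)] by (simp add: N.minus_eq)
  qed
  then show "X \<in> \<beta> i ` carrier (coh R P d N i)" using P.ccls_closed[OF N a] by blast
qed

text \<open>In degree 0 the cone is \<open>Q 0\<close> with a zero summand, so a cocycle is
  determined by its restriction to \<open>Q\<close>; the long exact sequence starts here.\<close>

lemma cone_inj_0:
  assumes X: "X \<in> carrier (coh R C D N 0)" "\<gamma> 0 X = \<zero>\<^bsub>coh R Q d' N 0\<^esub>"
  shows "X = \<zero>\<^bsub>coh R C D N 0\<^esub>"
proof -
  obtain w where w: "w \<in> cocyc R C D N 0" "X = ccls R C D N 0 w" using X by (auto simp: C.carrier_coh[OF N])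
  have "(\<lambda>u\<in>carrier (Q 0). w (inl 0 u)) \<in> cobound R Q d' N 0"
    using X(2) Q.ccls_zero_iff[OF N pull_cocyc(3)[OF w(1)]] w by (simp add: \<gamma>_ccls)
  then have *: "(\<lambda>u\<in>carrier (Q 0). w (inl 0 u)) = (\<lambda>u\<in>carrier (Q 0). \<zero>\<^bsub>N\<^esub>)" by simp
  have "w (inl 0 q) = \<zero>\<^bsub>N\<^esub>" if "q \<in> carrier (Q 0)" for q using fun_cong[OF *, of q] that by simp
  then have "w = (\<lambda>u\<in>carrier (C 0). \<zero>\<^bsub>N\<^esub>)"
    using w(1) restrict_mod_hom[OF lin_const_zero[OF module_C[of 0] N]]
    by (intro mod_hom_ext[of _ R "C 0" N]) (auto simp: cocyc_def carrier_cone_0 inl_def)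
  then have "w \<in> cobound R C D N 0" by simp
  then show ?thesis using C.ccls_zero_iff[OF N w(1)] w(2) by simp
qed

end
end


section \<open>Direct limits\<close>

locale direct_system =
  fixes R :: "('a, 'r) ring_scheme" and E :: "nat \<Rightarrow> ('a, 'e) module" and \<phi> :: "nat \<Rightarrow> nat \<Rightarrow> 'e \<Rightarrow> 'e"
  assumes lin_\<phi>: "n \<le> k \<Longrightarrow> lin R (E n) (E k) (\<phi> n k)"
    and \<phi>\<phi>: "n \<le> m \<Longrightarrow> m \<le> k \<Longrightarrow> x \<in> carrier (E n) \<Longrightarrow> \<phi> m k (\<phi> n m x) = \<phi> n k x"
begin

lemma module_E: "module R (E n)"
  using lin_module1[OF lin_\<phi>[of n n]] by simp

lemma \<phi>_closed: "n \<le> k \<Longrightarrow> x \<in> carrier (E n) \<Longrightarrow> \<phi> n k x \<in> carrier (E k)"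
  by (rule lin_closed[OF lin_\<phi>])

lemma germ_subset:
  assumes x: "x \<in> carrier (E n)" and y: "y \<in> carrier (E m)"
    and k: "n \<le> k" "m \<le> k" "\<phi> n k x = \<phi> m k y"
  shows "germ E \<phi> n x \<subseteq> germ E \<phi> m y"
proof -
  have "\<exists>l. m \<le> l \<and> j \<le> l \<and> \<phi> m l y = \<phi> j l z"
    if z: "z \<in> carrier (E j)" "n \<le> i" "j \<le> i" "\<phi> n i x = \<phi> j i z" for j z i
  proof -
    define l where "l = max k i"
    have "\<phi> m l y = \<phi> k l (\<phi> m k y)" using k y by (simp add: \<phi>\<phi> l_def)
    also have "\<dots> = \<phi> n l x" using k(1) x by (simp add: k(3)[symmetric] \<phi>\<phi> l_def)
    also have "\<dots> = \<phi> i l (\<phi> n i x)" using z x by (intro \<phi>\<phi>[symmetric]) (auto simp: l_def)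
    also have "\<dots> = \<phi> j l z" using z(1,3) unfolding z(4) by (simp add: \<phi>\<phi> l_def)
    finally show ?thesis using k z by (intro exI[of _ l]) (auto simp: l_def)
  qed
  then show ?thesis by (auto simp: germ_def)
qed

lemma germ_self: "x \<in> carrier (E n) \<Longrightarrow> (n, x) \<in> germ E \<phi> n x"
  by (auto simp: germ_def)

lemma germ_eq_iff:
  assumes x: "x \<in> carrier (E n)" and y: "y \<in> carrier (E m)"
  shows "germ E \<phi> n x = germ E \<phi> m y \<longleftrightarrow> (\<exists>k. n \<le> k \<and> m \<le> k \<and> \<phi> n k x = \<phi> m k y)"
proof
  assume "germ E \<phi> n x = germ E \<phi> m y"
  then have "(m, y) \<in> germ E \<phi> n x" using germ_self[OF y] by simp
  then show "\<exists>k. n \<le> k \<and> m \<le> k \<and> \<phi> n k x = \<phi> m k y" by (auto simp: germ_def)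
next
  assume "\<exists>k. n \<le> k \<and> m \<le> k \<and> \<phi> n k x = \<phi> m k y"
  then show "germ E \<phi> n x = germ E \<phi> m y"
    using germ_subset[OF x y] germ_subset[OF y x] by (metis subset_antisym)
qed

lemma germ_eqE:
  assumes "germ E \<phi> n x = germ E \<phi> m y" "x \<in> carrier (E n)" "y \<in> carrier (E m)"
  obtains k where "n \<le> k" "m \<le> k" "\<phi> n k x = \<phi> m k y"
  using germ_eq_iff[OF assms(2,3)] assms(1) by auto

lemma germ_mem_iff:
  "x \<in> carrier (E n) \<Longrightarrow> (m, y) \<in> germ E \<phi> n x \<longleftrightarrow> y \<in> carrier (E m) \<and> germ E \<phi> m y = germ E \<phi> n x"
  using germ_eq_iff[of x n y m] by (auto simp: germ_def)

lemma germ_\<phi>: "n \<le> k \<Longrightarrow> x \<in> carrier (E n) \<Longrightarrow> germ E \<phi> k (\<phi> n k x) = germ E \<phi> n x"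
  by (subst germ_eq_iff) (auto simp: \<phi>_closed \<phi>\<phi>)

abbreviation "L \<equiv> direct_limit E \<phi>"

lemma carrier_limit: "carrier L = (\<Union>n. germ E \<phi> n ` carrier (E n))"
  by (auto simp: direct_limit_def)

lemma germ_closed: "x \<in> carrier (E n) \<Longrightarrow> germ E \<phi> n x \<in> carrier L"
  by (auto simp: carrier_limit)

text \<open>The counterpart of \<open>union_rcoset\<close>: the operations of
  \<open>direct_limit\<close> are unions over all representatives of a germ.\<close>

lemma union_germ:
  assumes x: "x \<in> carrier (E n)"
    and "\<And>m y. y \<in> carrier (E m) \<Longrightarrow> germ E \<phi> m y = germ E \<phi> n x \<Longrightarrow> h m y = h n x"
  shows "(\<Union>(m, y)\<in>germ E \<phi> n x. h m y) = h n x"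
proof -
  have "(case p of (m, y) \<Rightarrow> h m y) = h n x" if "p \<in> germ E \<phi> n x" for p
    using that germ_mem_iff[OF x] assms(2) by (cases p) auto
  then have "(\<Union>(m, y)\<in>germ E \<phi> n x. h m y) = (\<Union>p\<in>germ E \<phi> n x. h n x)" by simp
  then show ?thesis using germ_self[OF x] by auto
qed

lemma limit_smult:
  assumes r: "r \<in> carrier R" and x: "x \<in> carrier (E n)"
  shows "r \<odot>\<^bsub>L\<^esub> germ E \<phi> n x = germ E \<phi> n (r \<odot>\<^bsub>E n\<^esub> x)"
proof -
  interpret E: module R "E i0" for i0 by (rule module_E)
  have "germ E \<phi> m (r \<odot>\<^bsub>E m\<^esub> y) = germ E \<phi> n (r \<odot>\<^bsub>E n\<^esub> x)"
    if y: "y \<in> carrier (E m)" "germ E \<phi> m y = germ E \<phi> n x" for m y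
  proof -
    obtain k where k: "m \<le> k" "n \<le> k" "\<phi> m k y = \<phi> n k x" using iffD1[OF germ_eq_iff[OF y(1) x] y(2)] by blast
    then have "\<phi> m k (r \<odot>\<^bsub>E m\<^esub> y) = \<phi> n k (r \<odot>\<^bsub>E n\<^esub> x)"
      using lin_smult[OF lin_\<phi>] r x y by simp
    then show ?thesis using k r x y by (auto simp: germ_eq_iff)
  qed
  then show ?thesis unfolding direct_limit_def by (simp add: union_germ[OF x, of "\<lambda>m y. germ E \<phi> m (r \<odot>\<^bsub>E m\<^esub> y)"])
qed

lemma limit_add:
  assumes x: "x \<in> carrier (E n)" and y: "y \<in> carrier (E n)"
  shows "germ E \<phi> n x \<oplus>\<^bsub>L\<^esub> germ E \<phi> n y = germ E \<phi> n (x \<oplus>\<^bsub>E n\<^esub> y)"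
proof -
  interpret E: module R "E i0" for i0 by (rule module_E)
  let ?h = "\<lambda>i u j v. germ E \<phi> (max i j) (\<phi> i (max i j) u \<oplus>\<^bsub>E (max i j)\<^esub> \<phi> j (max i j) v)"
  have *: "?h i u j v = germ E \<phi> n (x \<oplus>\<^bsub>E n\<^esub> y)"
    if u: "u \<in> carrier (E i)" "germ E \<phi> i u = germ E \<phi> n x"
      and v: "v \<in> carrier (E j)" "germ E \<phi> j v = germ E \<phi> n y" for i u j v
  proof -
    obtain k where k: "i \<le> k" "n \<le> k" "\<phi> i k u = \<phi> n k x" using iffD1[OF germ_eq_iff[OF u(1) x] u(2)] by blast
    obtain l where l: "j \<le> l" "n \<le> l" "\<phi> j l v = \<phi> n l y" using iffD1[OF germ_eq_iff[OF v(1) y] v(2)] by blast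
    \<comment> \<open>A stage at which both pairs of representatives have become equal; it lies
      beyond \<open>max i j\<close>, where the sum was formed.\<close>
    define p where "p = max k l"
    have up: "\<phi> i p u = \<phi> n p x"
      by (metis \<phi>\<phi> k u(1) x max.cobounded1 p_def)
    have vp: "\<phi> j p v = \<phi> n p y"
      by (metis \<phi>\<phi> l v(1) y max.cobounded2 p_def)
    have le: "max i j \<le> p" "n \<le> p" using k l by (auto simp: p_def)
    have cl: "\<phi> i (max i j) u \<in> carrier (E (max i j))" "\<phi> j (max i j) v \<in> carrier (E (max i j))"
      using u v by (auto intro: \<phi>_closed)
    have "\<phi> (max i j) p (\<phi> i (max i j) u \<oplus>\<^bsub>E (max i j)\<^esub> \<phi> j (max i j) v) = \<phi> n p x \<oplus>\<^bsub>E p\<^esub> \<phi> n p y"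
      using le u v cl by (simp add: lin_add[OF lin_\<phi>] \<phi>\<phi> up vp)
    also have "\<dots> = \<phi> n p (x \<oplus>\<^bsub>E n\<^esub> y)" using le x y by (simp add: lin_add[OF lin_\<phi>])
    finally show ?thesis using le cl x y by (subst germ_eq_iff) auto
  qed
  have xx: "germ E \<phi> n x \<oplus>\<^bsub>L\<^esub> germ E \<phi> n y = (\<Union>(i, u)\<in>germ E \<phi> n x. \<Union>(j, v)\<in>germ E \<phi> n y. ?h i u j v)"
    by (simp add: direct_limit_def)
  have inner: "(\<Union>(j, v)\<in>germ E \<phi> n y. ?h i u j v) = germ E \<phi> n (x \<oplus>\<^bsub>E n\<^esub> y)"
    if u: "u \<in> carrier (E i)" "germ E \<phi> i u = germ E \<phi> n x" for i u
    using union_germ[OF y, of "?h i u"] *[OF u] *[OF u y refl] by auto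
  show ?thesis unfolding xx
    using union_germ[OF x, of "\<lambda>i u. \<Union>(j, v)\<in>germ E \<phi> n y. ?h i u j v"] inner inner[OF x refl] by auto
qed

lemma limit_zero: "\<zero>\<^bsub>L\<^esub> = germ E \<phi> n \<zero>\<^bsub>E n\<^esub>"
proof -
  have "germ E \<phi> 0 \<zero>\<^bsub>E 0\<^esub> = germ E \<phi> n \<zero>\<^bsub>E n\<^esub>"
    using lin_zero[OF lin_\<phi>] by (subst germ_eq_iff) (auto intro!: exI[of _ n] simp: module_zero_closed[OF module_E])
  then show ?thesis by (simp add: direct_limit_def)
qed

lemma module_limit: "module R L"
proof (rule module_directed[of R E L "germ E \<phi>"])
  show "germ E \<phi> n ` carrier (E n) \<subseteq> germ E \<phi> m ` carrier (E m)" if "n \<le> m" for n m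
  proof
    fix X assume "X \<in> germ E \<phi> n ` carrier (E n)"
    then obtain x where "x \<in> carrier (E n)" "X = germ E \<phi> n x" by auto
    then show "X \<in> germ E \<phi> m ` carrier (E m)"
      using germ_\<phi>[OF that] \<phi>_closed[OF that] by (metis image_eqI)
  qed
qed (auto simp: module_E carrier_limit limit_add limit_smult limit_zero)

lemma limitE:
  assumes "X \<in> carrier L"
  obtains n x where "x \<in> carrier (E n)" "X = germ E \<phi> n x"
  using assms by (auto simp: carrier_limit)

lemma limitE2:
  assumes "X \<in> carrier L" "Y \<in> carrier L"
  obtains n x y where "x \<in> carrier (E n)" "X = germ E \<phi> n x" "y \<in> carrier (E n)" "Y = germ E \<phi> n y"
proof -
  obtain i x where x: "x \<in> carrier (E i)" "X = germ E \<phi> i x" using assms(1) by (rule limitE)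
  obtain j y where y: "y \<in> carrier (E j)" "Y = germ E \<phi> j y" using assms(2) by (rule limitE)
  show thesis
    using that[of "\<phi> i (max i j) x" "max i j" "\<phi> j (max i j) y"] x y by (simp add: \<phi>_closed germ_\<phi>)
qed

lemma germ_zero_iff:
  "x \<in> carrier (E n) \<Longrightarrow> germ E \<phi> n x = \<zero>\<^bsub>L\<^esub> \<longleftrightarrow> (\<exists>k\<ge>n. \<phi> n k x = \<zero>\<^bsub>E k\<^esub>)"
  unfolding limit_zero[of n] using lin_zero[OF lin_\<phi>]
  by (subst germ_eq_iff) (auto simp: module_zero_closed[OF module_E])

end

definition limit_map where
  "limit_map E' \<phi>' f X = (\<Union>(n, x)\<in>X. germ E' \<phi>' n (f n x))"

locale direct_system_map = E: direct_system R E \<phi> + E': direct_system R E' \<phi>'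
  for R :: "('a, 'r) ring_scheme" and E :: "nat \<Rightarrow> ('a, 'e) module" and \<phi> :: "nat \<Rightarrow> nat \<Rightarrow> 'e \<Rightarrow> 'e"
    and E' :: "nat \<Rightarrow> ('a, 'f) module" and \<phi>' :: "nat \<Rightarrow> nat \<Rightarrow> 'f \<Rightarrow> 'f" +
  fixes f :: "nat \<Rightarrow> 'e \<Rightarrow> 'f"
  assumes lin_f: "lin R (E n) (E' n) (f n)"
    and f_\<phi>: "n \<le> k \<Longrightarrow> x \<in> carrier (E n) \<Longrightarrow> f k (\<phi> n k x) = \<phi>' n k (f n x)"
begin

lemma limit_map_germ:
  assumes x: "x \<in> carrier (E n)"
  shows "limit_map E' \<phi>' f (germ E \<phi> n x) = germ E' \<phi>' n (f n x)"
  unfolding limit_map_def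
proof (rule E.union_germ[OF x])
  fix m y assume y: "y \<in> carrier (E m)" "germ E \<phi> m y = germ E \<phi> n x"
  obtain k where k: "m \<le> k" "n \<le> k" "\<phi> m k y = \<phi> n k x" by (rule E.germ_eqE[OF y(2,1) x])
  then have "\<phi>' m k (f m y) = \<phi>' n k (f n x)" using x y f_\<phi> by metis
  then show "germ E' \<phi>' m (f m y) = germ E' \<phi>' n (f n x)"
    using k x y by (subst E'.germ_eq_iff) (auto simp: lin_closed[OF lin_f])
qed

lemma lin_limit_map: "lin R E.L E'.L (limit_map E' \<phi>' f)"
proof (rule linI[OF E.module_limit E'.module_limit])
  fix X assume "X \<in> carrier E.L"
  then obtain n x where x: "x \<in> carrier (E n)" "X = germ E \<phi> n x" by (rule E.limitE)
  then show "limit_map E' \<phi>' f X \<in> carrier E'.L"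
    by (simp add: limit_map_germ E'.germ_closed lin_closed[OF lin_f])
next
  interpret Em: module R "E i0" for i0 by (rule E.module_E)
  fix X r assume "X \<in> carrier E.L" and r: "r \<in> carrier R"
  then obtain n x where x: "x \<in> carrier (E n)" "X = germ E \<phi> n x" using E.limitE by blast
  then show "limit_map E' \<phi>' f (r \<odot>\<^bsub>E.L\<^esub> X) = r \<odot>\<^bsub>E'.L\<^esub> limit_map E' \<phi>' f X"
    using r by (simp add: limit_map_germ E.limit_smult E'.limit_smult lin_closed[OF lin_f] lin_smult[OF lin_f])
next
  interpret Em: module R "E i0" for i0 by (rule E.module_E)
  fix X Y assume "X \<in> carrier E.L" "Y \<in> carrier E.L"
  then obtain n x y where "x \<in> carrier (E n)" "X = germ E \<phi> n x" "y \<in> carrier (E n)" "Y = germ E \<phi> n y"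
    by (rule E.limitE2)
  then show "limit_map E' \<phi>' f (X \<oplus>\<^bsub>E.L\<^esub> Y) = limit_map E' \<phi>' f X \<oplus>\<^bsub>E'.L\<^esub> limit_map E' \<phi>' f Y"
    by (simp add: limit_map_germ E.limit_add E'.limit_add lin_closed[OF lin_f] lin_add[OF lin_f])
qed

text \<open>Covers the start of the long exact sequence, where no term stands on the left.\<close>

lemma limit_map_inj:
  assumes inj: "\<And>n x. x \<in> carrier (E n) \<Longrightarrow> f n x = \<zero>\<^bsub>E' n\<^esub> \<Longrightarrow> x = \<zero>\<^bsub>E n\<^esub>"
    and X: "X \<in> carrier E.L" "limit_map E' \<phi>' f X = \<zero>\<^bsub>E'.L\<^esub>"
  shows "X = \<zero>\<^bsub>E.L\<^esub>"
proof -
  obtain n x where x: "x \<in> carrier (E n)" "X = germ E \<phi> n x" using X by (auto elim: E.limitE)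
  then have "germ E' \<phi>' n (f n x) = \<zero>\<^bsub>E'.L\<^esub>" using X by (simp add: limit_map_germ)
  then obtain k where k: "k \<ge> n" "\<phi>' n k (f n x) = \<zero>\<^bsub>E' k\<^esub>"
    using E'.germ_zero_iff[OF lin_closed[OF lin_f x(1)]] by auto
  then have "\<phi> n k x = \<zero>\<^bsub>E k\<^esub>" using x by (intro inj) (auto simp: f_\<phi> E.\<phi>_closed)
  then show ?thesis using k x E.germ_zero_iff by auto
qed

end

text \<open>Being zero in the limit is witnessed at a finite stage, and exactness at that stage
  supplies the preimage.\<close>

lemma limit_exact:
  assumes "direct_system_map R E \<phi> E' \<phi>' f" "direct_system_map R E' \<phi>' E'' \<phi>'' g"
    and ex: "\<And>n. exact_seq R (E n) (f n) (E' n) (g n) (E'' n)"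
  shows "exact_seq R (direct_limit E \<phi>) (limit_map E' \<phi>' f) (direct_limit E' \<phi>')
    (limit_map E'' \<phi>'' g) (direct_limit E'' \<phi>'')"
proof -
  interpret f: direct_system_map R E \<phi> E' \<phi>' f by fact
  interpret g: direct_system_map R E' \<phi>' E'' \<phi>'' g by fact
  show ?thesis
  proof (rule exact_seqI[OF f.lin_limit_map g.lin_limit_map])
    fix X assume "X \<in> carrier f.E.L"
    then obtain n x where x: "x \<in> carrier (E n)" "X = germ E \<phi> n x" by (rule f.E.limitE)
    then have "g n (f n x) = \<zero>\<^bsub>E'' n\<^esub>" using ex[of n] by (auto simp: exact_seq_def)
    then show "limit_map E'' \<phi>'' g (limit_map E' \<phi>' f X) = \<zero>\<^bsub>g.E'.L\<^esub>"
      using x by (simp add: f.limit_map_germ g.limit_map_germ lin_closed[OF f.lin_f] g.E'.limit_zero[of n])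
  next
    fix Y assume "Y \<in> carrier f.E'.L" and Y: "limit_map E'' \<phi>'' g Y = \<zero>\<^bsub>g.E'.L\<^esub>"
    then obtain n y where y: "y \<in> carrier (E' n)" "Y = germ E' \<phi>' n y" using f.E'.limitE by blast
    then obtain k where k: "k \<ge> n" "\<phi>'' n k (g n y) = \<zero>\<^bsub>E'' k\<^esub>"
      using Y g.E'.germ_zero_iff[OF lin_closed[OF g.lin_f y(1)]] by (auto simp: g.limit_map_germ)
    then have "g k (\<phi>' n k y) = \<zero>\<^bsub>E'' k\<^esub>" using y by (simp add: g.f_\<phi>)
    then obtain x where x: "x \<in> carrier (E k)" "\<phi>' n k y = f k x"
      using ex[of k] k y f.E'.\<phi>_closed[of n k y] by (auto simp: exact_seq_def)
    have "Y = limit_map E' \<phi>' f (germ E \<phi> k x)"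
      using x y k by (simp add: f.limit_map_germ x(2)[symmetric] f.E'.germ_\<phi>)
    then show "Y \<in> limit_map E' \<phi>' f ` carrier f.E.L" using f.E.germ_closed[OF x(1)] by blast
  qed
qed


section \<open>Inverse systems of complexes\<close>

definition coh_lim where
  "coh_lim R P d \<tau> N i =
     direct_limit (\<lambda>n. coh R (P n) (d n) N i) (\<lambda>n k. coh_pull R (P k) (d k) N i (\<tau> n k i))"

text \<open>Composition holds on the nose and not merely up to homotopy, so that cones of maps
  between such systems form a system again.\<close>

locale inverse_system =
  fixes R :: "('a, 'r) ring_scheme" and P :: "nat \<Rightarrow> nat \<Rightarrow> ('a, 'p) module"
    and d :: "nat \<Rightarrow> nat \<Rightarrow> 'p \<Rightarrow> 'p" and \<tau> :: "nat \<Rightarrow> nat \<Rightarrow> nat \<Rightarrow> 'p \<Rightarrow> 'p"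
  assumes complex: "chain_complex R (P n) (d n)"
    and \<tau>: "n \<le> k \<Longrightarrow> chain_map R (P k) (d k) (P n) (d n) (\<tau> n k)"
    and \<tau>\<tau>: "n \<le> m \<Longrightarrow> m \<le> k \<Longrightarrow> u \<in> carrier (P k i) \<Longrightarrow> \<tau> n m i (\<tau> m k i u) = \<tau> n k i u"
begin

sublocale complex: chain_complex R "P n" "d n" for n by (rule complex)

lemma lin_\<tau>: "n \<le> k \<Longrightarrow> lin R (P k i) (P n i) (\<tau> n k i)"
  and \<tau>_d: "n \<le> k \<Longrightarrow> u \<in> carrier (P k (Suc i)) \<Longrightarrow> \<tau> n k i (d k i u) = d n i (\<tau> n k (Suc i) u)"
  using \<tau>[of n k] by (auto simp: chain_map_def)

lemma direct_system_coh:
  assumes N: "module R N"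
  shows "direct_system R (\<lambda>n. coh R (P n) (d n) N i) (\<lambda>n k. coh_pull R (P k) (d k) N i (\<tau> n k i))"
proof
  note mor = coh_mor_chain_map[OF complex complex N \<tau>]
  show "lin R (coh R (P n) (d n) N i) (coh R (P k) (d k) N i) (coh_pull R (P k) (d k) N i (\<tau> n k i))"
    if "n \<le> k" for n k using lin_coh_pull[OF complex complex N mor[OF that]] .
  show "coh_pull R (P k) (d k) N i (\<tau> m k i) (coh_pull R (P m) (d m) N i (\<tau> n m i) X) =
      coh_pull R (P k) (d k) N i (\<tau> n k i) X"
    if "n \<le> m" "m \<le> k" "X \<in> carrier (coh R (P n) (d n) N i)" for n m k X
    using that by (intro coh_pull_comp[OF complex complex complex N mor mor mor]) (auto simp: \<tau>\<tau>)
qed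

end

text \<open>Projectivity tested on modules over one type \<open>'w\<close>, which the
  \<open>itself\<close> argument names because a proposition cannot quantify over types. Asking that
  \<open>h\<close> land in the image of \<open>g\<close> spares passing to that image as a
  module.\<close>

definition lifts :: "('a, 'r) ring_scheme \<Rightarrow> ('a, 'p) module \<Rightarrow> 'w itself \<Rightarrow> bool" where
  "lifts R P T \<longleftrightarrow> (\<forall>(X :: ('a, 'w) module) (Y :: ('a, 'w) module) g h.
     lin R X Y g \<longrightarrow> lin R P Y h \<longrightarrow> h ` carrier P \<subseteq> g ` carrier X \<longrightarrow>
     (\<exists>k. lin R P X k \<and> (\<forall>p\<in>carrier P. g (k p) = h p)))"

text \<open>One \<open>m\<close> serves all degrees; for the cones used later it comes from a single
  Artin-Rees bound.\<close>

locale pro_acyclic = inverse_system R P d \<tau>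
  for R :: "('a, 'r) ring_scheme" and P :: "nat \<Rightarrow> nat \<Rightarrow> ('a, 'p) module"
    and d :: "nat \<Rightarrow> nat \<Rightarrow> 'p \<Rightarrow> 'p" and \<tau> :: "nat \<Rightarrow> nat \<Rightarrow> nat \<Rightarrow> 'p \<Rightarrow> 'p" +
  assumes lifts: "lifts R (P n i) TYPE('p)"
    and kill: "\<exists>m\<ge>n. (\<forall>u\<in>carrier (P m 0). \<tau> n m 0 u \<in> d n 0 ` carrier (P n (Suc 0))) \<and>
      (\<forall>i. \<forall>u\<in>carrier (P m (Suc i)). d m i u = \<zero>\<^bsub>P m i\<^esub> \<longrightarrow>
         \<tau> n m (Suc i) u \<in> d n (Suc i) ` carrier (P n (Suc (Suc i))))"
begin

lemma lift:
  assumes "lin R (P m i) (P n j) h" "\<And>u. u \<in> carrier (P m i) \<Longrightarrow> h u \<in> d n j ` carrier (P n (Suc j))"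
  obtains k where "lin R (P m i) (P n (Suc j)) k" "\<And>u. u \<in> carrier (P m i) \<Longrightarrow> d n j (k u) = h u"
  using lifts[of m i] assms complex.lin_d[of n j] unfolding lifts_def by (metis image_subsetI)

text \<open>The usual construction of a contracting homotopy by successive lifting, except that each
  degree costs a transition, because a cycle becomes a boundary only after moving to an earlier
  stage. Hence the bound \<open>k\<close>, on which \<open>m\<close> depends, and the generality in
  \<open>n\<close>.\<close>

lemma null_homotopy:
  "\<exists>m\<ge>n. \<exists>h. (\<forall>j\<le>k. lin R (P m j) (P n (Suc j)) (h j)) \<and>
     (\<forall>u\<in>carrier (P m 0). d n 0 (h 0 u) = \<tau> n m 0 u) \<and>
     (\<forall>j<k. \<forall>u\<in>carrier (P m (Suc j)). d n (Suc j) (h (Suc j) u) = \<tau> n m (Suc j) u \<ominus>\<^bsub>P n (Suc j)\<^esub> h j (d m j u))"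
proof (induction k arbitrary: n)
  case 0
  obtain m where m: "m \<ge> n" "\<forall>u\<in>carrier (P m 0). \<tau> n m 0 u \<in> d n 0 ` carrier (P n (Suc 0))"
    using kill[of n] by auto
  obtain h where "lin R (P m 0) (P n (Suc 0)) h" "\<And>u. u \<in> carrier (P m 0) \<Longrightarrow> d n 0 (h u) = \<tau> n m 0 u"
    by (rule lift[OF lin_\<tau>[OF m(1), of 0]]) (use m(2) in auto)
  then show ?case using m(1) by (intro exI[of _ m] conjI exI[of _ "\<lambda>_. h"]) auto
next
  case (Suc k)
  \<comment> \<open>The induction hypothesis is used between \<open>m\<close> and \<open>l\<close>;
    the passage from \<open>l\<close> to \<open>n\<close> is reserved for turning the new cycles
    into boundaries.\<close>
  obtain l where l: "l \<ge> n" and kl: "\<And>i u. u \<in> carrier (P l (Suc i)) \<Longrightarrow> d l i u = \<zero>\<^bsub>P l i\<^esub> \<Longrightarrow>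
         \<tau> n l (Suc i) u \<in> d n (Suc i) ` carrier (P n (Suc (Suc i)))"
    using kill[of n] by blast
  obtain m h where m: "m \<ge> l" and h: "\<And>j. j \<le> k \<Longrightarrow> lin R (P m j) (P l (Suc j)) (h j)"
    "\<And>u. u \<in> carrier (P m 0) \<Longrightarrow> d l 0 (h 0 u) = \<tau> l m 0 u"
    "\<And>j u. j < k \<Longrightarrow> u \<in> carrier (P m (Suc j)) \<Longrightarrow>
       d l (Suc j) (h (Suc j) u) = \<tau> l m (Suc j) u \<ominus>\<^bsub>P l (Suc j)\<^esub> h j (d m j u)"
    using Suc.IH[of l] by metis
  have nm: "n \<le> m" using l m by simp
  interpret Pm: module R "P i0 j0" for i0 j0 by (rule complex.module_P)
  \<comment> \<open>The obstruction in degree \<open>k + 1\<close>. By the homotopy identity in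
    degree \<open>k\<close> its values are cycles, so after \<open>\<tau> n l\<close> it can be
    lifted through the differential.\<close>
  let ?g = "\<lambda>u. \<tau> l m (Suc k) u \<ominus>\<^bsub>P l (Suc k)\<^esub> h k (d m k u)"
  have lg: "lin R (P m (Suc k)) (P l (Suc k)) ?g"
    by (intro lin_minus lin_\<tau> m lin_comp[OF complex.lin_d h(1)]) simp
  have dg: "d l k (?g u) = \<zero>\<^bsub>P l k\<^esub>" if u: "u \<in> carrier (P m (Suc k))" for u
  proof -
    note du = lin_closed[OF complex.lin_d u]
    have dh: "d l k (h k (d m k u)) = \<tau> l m k (d m k u)"
    proof (cases k)
      case 0
      then show ?thesis using h(2) du by simp
    next
      case (Suc j)
      have "d m j (d m k u) = \<zero>\<^bsub>P m j\<^esub>" using complex.dd u Suc by simp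
      then show ?thesis
        using h(3)[of j "d m k u"] h(1)[of j] du Suc lin_closed[OF lin_\<tau>[OF m], of "d m k u" k]
          lin_zero[OF lin_uminus[OF lin_ident[OF complex.module_P]]]
        by (simp add: lin_zero Pm.minus_eq)
    qed
    have "d l k (?g u) = \<tau> l m k (d m k u) \<ominus>\<^bsub>P l k\<^esub> d l k (h k (d m k u))"
      using u du m lin_closed[OF lin_\<tau>] lin_closed[OF h(1)]
      by (simp add: lin_diff[OF complex.lin_d] \<tau>_d)
    then show ?thesis using dh lin_closed[OF lin_\<tau>[OF m] du] by (simp add: Pm.minus_eq Pm.r_neg)
  qed
  obtain e where e: "lin R (P m (Suc k)) (P n (Suc (Suc k))) e"
    "\<And>u. u \<in> carrier (P m (Suc k)) \<Longrightarrow> d n (Suc k) (e u) = \<tau> n l (Suc k) (?g u)"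
    by (rule lift[OF lin_comp[OF lg lin_\<tau>[OF l]]]) (use kl[OF lin_closed[OF lg] dg] in auto)
  \<comment> \<open>The earlier homotopies are pushed along \<open>\<tau> n l\<close>, so that all
    of them end at stage \<open>n\<close>.\<close>
  define h' where "h' = (\<lambda>j. if j \<le> k then (\<lambda>u. \<tau> n l (Suc j) (h j u)) else e)"
  have 1: "lin R (P m j) (P n (Suc j)) (h' j)" if "j \<le> Suc k" for j
    using that lin_comp[OF h(1) lin_\<tau>[OF l], of j] e(1) by (cases "j = Suc k") (auto simp: h'_def)
  have 2: "d n 0 (h' 0 u) = \<tau> n m 0 u" if u: "u \<in> carrier (P m 0)" for u
    using u h(2)[OF u] lin_closed[OF h(1) u] \<tau>_d[OF l, of "h 0 u" 0] l m by (simp add: h'_def \<tau>\<tau>)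
  have 3: "d n (Suc j) (h' (Suc j) u) = \<tau> n m (Suc j) u \<ominus>\<^bsub>P n (Suc j)\<^esub> h' j (d m j u)"
    if j: "j < Suc k" and u: "u \<in> carrier (P m (Suc j))" for j u
  proof -
    have cl: "\<tau> l m (Suc j) u \<in> carrier (P l (Suc j))" "h j (d m j u) \<in> carrier (P l (Suc j))"
      using j u lin_closed[OF lin_\<tau>[OF m]] lin_closed[OF h(1)] lin_closed[OF complex.lin_d] by auto
    have "d n (Suc j) (h' (Suc j) u) = \<tau> n l (Suc j) (\<tau> l m (Suc j) u \<ominus>\<^bsub>P l (Suc j)\<^esub> h j (d m j u))"
    proof (cases "j = k")
      case True
      then show ?thesis using e(2) u by (simp add: h'_def)
    next
      case False
      then have jk: "j < k" using j by simp
      then have "d n (Suc j) (h' (Suc j) u) = \<tau> n l (Suc j) (d l (Suc j) (h (Suc j) u))"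
        using \<tau>_d[OF l, of "h (Suc j) u" "Suc j"] lin_closed[OF h(1) u] by (simp add: h'_def)
      then show ?thesis using h(3)[OF jk u] by simp
    qed
    then show ?thesis using cl j u l m by (simp add: lin_diff[OF lin_\<tau>[OF l]] \<tau>\<tau> h'_def)
  qed
  show ?case using nm 1 2 3 by (intro exI[of _ m] conjI exI[of _ h']) auto
qed

text \<open>For a cocycle \<open>c\<close> and a homotopy \<open>h\<close> for the transition map
  \<open>\<tau>\<close>, one has \<open>c \<tau> = c d h + c h d\<close> and \<open>c d = 0\<close>.
  So every class becomes a coboundary at a later stage.\<close>

lemma coh_lim_trivial:
  assumes N: "module R N"
  shows "carrier (coh_lim R P d \<tau> N i) = {\<zero>\<^bsub>coh_lim R P d \<tau> N i\<^esub>}"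
proof -
  interpret N: module R N by fact
  interpret Pm: module R "P i0 j0" for i0 j0 by (rule complex.module_P)
  interpret ds: direct_system R "\<lambda>n. coh R (P n) (d n) N i" "\<lambda>n k. coh_pull R (P k) (d k) N i (\<tau> n k i)"
    by (rule direct_system_coh[OF N])
  have "X = \<zero>\<^bsub>ds.L\<^esub>" if X: "X \<in> carrier ds.L" for X
  proof -
    obtain n x where x: "x \<in> carrier (coh R (P n) (d n) N i)"
      "X = germ (\<lambda>n. coh R (P n) (d n) N i) (\<lambda>n k. coh_pull R (P k) (d k) N i (\<tau> n k i)) n x"
      by (rule ds.limitE[OF X])
    then obtain c where c: "c \<in> cocyc R (P n) (d n) N i" "x = ccls R (P n) (d n) N i c"
      by (auto simp: complex.carrier_coh[OF N])
    obtain m h where m: "m \<ge> n" and h: "\<And>j. j \<le> i \<Longrightarrow> lin R (P m j) (P n (Suc j)) (h j)"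
      "\<And>u. u \<in> carrier (P m 0) \<Longrightarrow> d n 0 (h 0 u) = \<tau> n m 0 u"
      "\<And>j u. j < i \<Longrightarrow> u \<in> carrier (P m (Suc j)) \<Longrightarrow>
         d n (Suc j) (h (Suc j) u) = \<tau> n m (Suc j) u \<ominus>\<^bsub>P n (Suc j)\<^esub> h j (d m j u)"
      using null_homotopy[of n i] by metis
    have lc: "lin R (P n i) N c" using c by (auto simp: cocyc_def intro: mod_hom_lin complex.module_P N)
    have cd: "c (d n i v) = \<zero>\<^bsub>N\<^esub>" if "v \<in> carrier (P n (Suc i))" for v
      using c that by (auto simp: cocyc_def)
    have "(\<lambda>u\<in>carrier (P m i). c (\<tau> n m i u)) \<in> cobound R (P m) (d m) N i"
    proof (cases i)
      case 0
      have "c (\<tau> n m i u) = \<zero>\<^bsub>N\<^esub>" if u: "u \<in> carrier (P m i)" for u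
        using h(2)[of u] u cd[of "h 0 u"] lin_closed[OF h(1), of 0 u] 0 by simp
      then show ?thesis using 0 by (auto simp: fun_eq_iff)
    next
      case (Suc j)
      have le: "lin R (P m j) N (\<lambda>u. c (h j u))"
        using lin_comp[OF h(1)[of j]] lc Suc by simp
      have "c (\<tau> n m i u) = c (h j (d m j u))" if u: "u \<in> carrier (P m i)" for u
      proof -
        have cl: "\<tau> n m i u \<in> carrier (P n i)" "h j (d m j u) \<in> carrier (P n i)" "h i u \<in> carrier (P n (Suc i))"
          "d m j u \<in> carrier (P m j)"
          using u Suc lin_closed[OF lin_\<tau>[OF m]] lin_closed[OF h(1)[of j]] lin_closed[OF h(1)[of i]]
            lin_closed[OF complex.lin_d[of m j]] by simp_all
        have "\<zero>\<^bsub>N\<^esub> = c (\<tau> n m i u \<ominus>\<^bsub>P n i\<^esub> h j (d m j u))"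
          using h(3)[of j u] u cd[OF cl(3)] Suc by simp
        also have "\<dots> = c (\<tau> n m i u) \<ominus>\<^bsub>N\<^esub> c (h j (d m j u))" using cl by (simp add: lin_diff[OF lc])
        finally show ?thesis
          using N.diff_zero_iff[OF lin_closed[OF lc cl(1)] lin_closed[OF lc cl(2)]] by simp
      qed
      then have "(\<lambda>u\<in>carrier (P m i). c (\<tau> n m i u)) =
          (\<lambda>u\<in>carrier (P m (Suc j)). (\<lambda>v\<in>carrier (P m j). c (h j v)) (d m j u))"
        using Suc lin_closed[OF complex.lin_d[of m j]] by (auto simp: fun_eq_iff)
      then show ?thesis using cobound_SucI[where P = "P m" and d = "d m" and i = j, OF restrict_mod_hom[OF le]] Suc by simp
    qed
    then have "coh_pull R (P m) (d m) N i (\<tau> n m i) x = \<zero>\<^bsub>coh R (P m) (d m) N i\<^esub>"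
      using coh_pull_ccls[OF complex complex N coh_mor_chain_map[OF complex complex N \<tau>[OF m]] c(1)] c(2)
        complex.ccls_zeroI[OF N] by simp
    then have "\<exists>k\<ge>n. coh_pull R (P k) (d k) N i (\<tau> n k i) x = \<zero>\<^bsub>coh R (P k) (d k) N i\<^esub>"
      using m by blast
    then show ?thesis unfolding x(2) by (rule iffD2[OF ds.germ_zero_iff[OF x(1)]])
  qed
  then have "carrier ds.L \<subseteq> {\<zero>\<^bsub>ds.L\<^esub>}" by (intro subsetI) (simp only: singleton_iff)
  moreover have "{\<zero>\<^bsub>ds.L\<^esub>} \<subseteq> carrier ds.L"
    using module_zero_closed[OF ds.module_limit] by (intro subsetI) (elim singletonE, simp only:)
  ultimately show ?thesis unfolding coh_lim_def by (rule subset_antisym)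
qed

end

section \<open>Cones of maps between inverse systems and their long exact sequence in the
  limit\<close>

locale inverse_system_map = P: inverse_system R P d \<tau> + Q: inverse_system R Q d' \<tau>'
  for R :: "('a, 'r) ring_scheme" and P :: "nat \<Rightarrow> nat \<Rightarrow> ('a, 'p) module"
    and d :: "nat \<Rightarrow> nat \<Rightarrow> 'p \<Rightarrow> 'p" and \<tau> :: "nat \<Rightarrow> nat \<Rightarrow> nat \<Rightarrow> 'p \<Rightarrow> 'p"
    and Q :: "nat \<Rightarrow> nat \<Rightarrow> ('a, 'q) module"
    and d' :: "nat \<Rightarrow> nat \<Rightarrow> 'q \<Rightarrow> 'q" and \<tau>' :: "nat \<Rightarrow> nat \<Rightarrow> nat \<Rightarrow> 'q \<Rightarrow> 'q" +
  fixes \<theta> :: "nat \<Rightarrow> nat \<Rightarrow> 'p \<Rightarrow> 'q"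
  assumes \<theta>: "chain_map R (P n) (d n) (Q n) (d' n) (\<theta> n)"
    and \<theta>_\<tau>: "n \<le> k \<Longrightarrow> u \<in> carrier (P k i) \<Longrightarrow> \<theta> n i (\<tau> n k i u) = \<tau>' n k i (\<theta> k i u)"
begin

sublocale cs: cone_setup R "P n" "d n" "Q n" "d' n" "\<theta> n" for n
  by (intro cone_setup.intro cone_setup_axioms.intro P.complex Q.complex \<theta>)

text \<open>The second component in degree \<open>j\<close> belongs to degree \<open>j - 1\<close>
  of \<open>P\<close>. The truncated difference at \<open>j = 0\<close> is harmless, since that
  component is zero there.\<close>

definition cone_\<tau> where
  "cone_\<tau> n k j u = (\<tau>' n k j (fst u), \<tau> n k (j - 1) (snd u))"

lemma lin_cone_\<tau>: "n \<le> k \<Longrightarrow> lin R (cs.C k j) (cs.C n j) (cone_\<tau> n k j)"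
proof -
  assume nk: "n \<le> k"
  have 2: "lin R (cs.C k j) (shift (P n) j) (\<lambda>u. \<tau> n k (j - 1) (snd u))"
  proof (cases j)
    case 0
    show ?thesis unfolding 0
    proof (rule lin_cong[OF lin_const_zero[OF cs.module_C cs.module_S]])
      fix u assume "u \<in> carrier (cs.C k 0)"
      then show "\<zero>\<^bsub>shift (P n) 0\<^esub> = \<tau> n k (0 - 1) (snd u)"
        using lin_zero[OF P.lin_\<tau>[OF nk, of 0]] by (auto simp: carrier_cone_0)
    qed
  next
    case (Suc i)
    then show ?thesis using lin_comp[OF cs.lin_snd_C P.lin_\<tau>[OF nk]] by simp
  qed
  show ?thesis unfolding cone_\<tau>_def[abs_def]
    using lin_pair[OF lin_comp[OF cs.lin_fst_C Q.lin_\<tau>[OF nk]] 2] by (simp add: cone_def[of "P n"])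
qed

lemma inverse_system_cone:
  "inverse_system R (\<lambda>n. cs.C n) (\<lambda>n. cs.D n) cone_\<tau>"
proof
  show "chain_map R (cs.C k) (cs.D k) (cs.C n) (cs.D n) (cone_\<tau> n k)" if nk: "n \<le> k" for n k
    unfolding chain_map_def
  proof (intro conjI allI ballI lin_cone_\<tau> nk)
    fix i u assume u: "u \<in> carrier (cs.C k (Suc i))"
    then have fs: "fst u \<in> carrier (Q k (Suc i))" "snd u \<in> carrier (P k i)" by (auto simp: carrier_cone_Suc)
    have cl: "d' k i (fst u) \<in> carrier (Q k i)" "\<theta> k i (snd u) \<in> carrier (Q k i)"
      using fs lin_closed[OF Q.complex.lin_d] lin_closed[OF cs.lin_\<theta>] by auto
    have 1: "fst (cone_\<tau> n k i (cs.D k i u)) = fst (cs.D n i (cone_\<tau> n k (Suc i) u))"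
      using fs cl nk by (simp add: cone_\<tau>_def cone_d_def lin_add[OF Q.lin_\<tau>[OF nk]] Q.\<tau>_d \<theta>_\<tau>)
    have 2: "snd (cone_\<tau> n k i (cs.D k i u)) = snd (cs.D n i (cone_\<tau> n k (Suc i) u))"
    proof (cases i)
      case 0
      then show ?thesis using lin_zero[OF P.lin_\<tau>[OF nk, of 0]] by (simp add: cone_\<tau>_def cone_d_def)
    next
      case (Suc j)
      then show ?thesis
        using fs nk lin_closed[OF P.complex.lin_d[of k j]]
        by (simp add: cone_\<tau>_def cone_d_def lin_neg[OF P.lin_\<tau>[OF nk]] P.\<tau>_d)
    qed
    show "cone_\<tau> n k i (cs.D k i u) = cs.D n i (cone_\<tau> n k (Suc i) u)" using 1 2 by (rule prod_eqI)
  qed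
  show "cone_\<tau> n m i (cone_\<tau> m k i u) = cone_\<tau> n k i u"
    if "n \<le> m" "m \<le> k" "u \<in> carrier (cs.C k i)" for n m k i u
    using that module_zero_closed[OF P.complex.module_P]
    by (cases i) (auto simp: cone_\<tau>_def carrier_cone_0 carrier_cone_Suc P.\<tau>\<tau> Q.\<tau>\<tau>)
qed

sublocale C: inverse_system R "\<lambda>n. cs.C n" "\<lambda>n. cs.D n" cone_\<tau>
  by (rule inverse_system_cone)

theorem cone_long_exact:
  assumes N: "module R N"
  obtains \<alpha> \<beta> \<gamma> where
    "\<And>i. exact_seq R (coh_lim R cs.C cs.D cone_\<tau> N i) (\<gamma> i) (coh_lim R Q d' \<tau>' N i) (\<alpha> i) (coh_lim R P d \<tau> N i)"
    "\<And>i. exact_seq R (coh_lim R Q d' \<tau>' N i) (\<alpha> i) (coh_lim R P d \<tau> N i) (\<beta> i) (coh_lim R cs.C cs.D cone_\<tau> N (Suc i))"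
    "\<And>i. exact_seq R (coh_lim R P d \<tau> N i) (\<beta> i) (coh_lim R cs.C cs.D cone_\<tau> N (Suc i)) (\<gamma> (Suc i))
      (coh_lim R Q d' \<tau>' N (Suc i))"
    "\<And>x. x \<in> carrier (coh_lim R cs.C cs.D cone_\<tau> N 0) \<Longrightarrow> \<gamma> 0 x = \<zero>\<^bsub>coh_lim R Q d' \<tau>' N 0\<^esub> \<Longrightarrow>
       x = \<zero>\<^bsub>coh_lim R cs.C cs.D cone_\<tau> N 0\<^esub>"
proof -
  let ?a = "\<lambda>i n. coh_pull R (P n) (d n) N i (\<theta> n i)"
  let ?b = "\<lambda>i n. coh_pull R (cs.C n) (cs.D n) N (Suc i) snd"
  let ?c = "\<lambda>i n. coh_pull R (Q n) (d' n) N i (cs.inl n i)"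
  let ?EP = "\<lambda>i n. coh R (P n) (d n) N i" and ?\<phi>P = "\<lambda>i n k. coh_pull R (P k) (d k) N i (\<tau> n k i)"
  let ?EQ = "\<lambda>i n. coh R (Q n) (d' n) N i" and ?\<phi>Q = "\<lambda>i n k. coh_pull R (Q k) (d' k) N i (\<tau>' n k i)"
  let ?EC = "\<lambda>i n. coh R (cs.C n) (cs.D n) N i" and ?\<phi>C = "\<lambda>i n k. coh_pull R (cs.C k) (cs.D k) N i (cone_\<tau> n k i)"
  note moP = coh_mor_chain_map[OF P.complex P.complex N P.\<tau>]
    and moQ = coh_mor_chain_map[OF Q.complex Q.complex N Q.\<tau>]
    and moC = coh_mor_chain_map[OF C.complex C.complex N C.\<tau>]
  have A: "direct_system_map R (?EQ i) (?\<phi>Q i) (?EP i) (?\<phi>P i) (?a i)" for i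
  proof (intro direct_system_map.intro direct_system_map_axioms.intro
      Q.direct_system_coh[OF N] P.direct_system_coh[OF N] cs.lin_\<alpha>[OF N])
    fix n k x assume "n \<le> k" "x \<in> carrier (?EQ i n)"
    then show "?a i k (?\<phi>Q i n k x) = ?\<phi>P i n k (?a i n x)"
      by (intro coh_pull_square[OF Q.complex Q.complex P.complex P.complex N moQ cs.mor_\<alpha>[OF N] cs.mor_\<alpha>[OF N] moP])
         (auto simp: \<theta>_\<tau>)
  qed
  have B: "direct_system_map R (?EP i) (?\<phi>P i) (?EC (Suc i)) (?\<phi>C (Suc i)) (?b i)" for i
  proof (intro direct_system_map.intro direct_system_map_axioms.intro
      C.direct_system_coh[OF N] P.direct_system_coh[OF N] cs.lin_\<beta>[OF N])
    fix n k x assume "n \<le> k" "x \<in> carrier (?EP i n)"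
    then show "?b i k (?\<phi>P i n k x) = ?\<phi>C (Suc i) n k (?b i n x)"
      by (intro coh_pull_square[OF P.complex P.complex C.complex C.complex N moP cs.mor_\<beta>[OF N] cs.mor_\<beta>[OF N] moC])
         (auto simp: cone_\<tau>_def)
  qed
  have G: "direct_system_map R (?EC i) (?\<phi>C i) (?EQ i) (?\<phi>Q i) (?c i)" for i
  proof (intro direct_system_map.intro direct_system_map_axioms.intro
      C.direct_system_coh[OF N] Q.direct_system_coh[OF N] cs.lin_\<gamma>[OF N])
    fix n k x assume nk: "n \<le> k" and x: "x \<in> carrier (?EC i n)"
    have "cone_\<tau> n k i (cs.inl k i u) = cs.inl n i (\<tau>' n k i u)" for u
      using lin_zero[OF P.lin_\<tau>[OF nk]] by (cases i) (auto simp: cone_\<tau>_def cs.inl_def)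
    with nk x show "?c i k (?\<phi>C i n k x) = ?\<phi>Q i n k (?c i n x)"
      by (intro coh_pull_square[OF C.complex C.complex Q.complex Q.complex N moC cs.mor_\<gamma>[OF N] cs.mor_\<gamma>[OF N] moQ])
         auto
  qed
  show thesis
  proof (rule that[of "\<lambda>i. limit_map (?EQ i) (?\<phi>Q i) (?c i)" "\<lambda>i. limit_map (?EP i) (?\<phi>P i) (?a i)"
        "\<lambda>i. limit_map (?EC (Suc i)) (?\<phi>C (Suc i)) (?b i)"], goal_cases)
    case (1 i)
    show ?case unfolding coh_lim_def by (rule limit_exact[OF G A cs.cone_exact_Q[OF N]])
  next
    case (2 i)
    show ?case unfolding coh_lim_def by (rule limit_exact[OF A B cs.cone_exact_P[OF N]])
  next
    case (3 i)
    show ?case unfolding coh_lim_def by (rule limit_exact[OF B G cs.cone_exact_C[OF N]])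
  next
    case (4 x)
    then show ?case unfolding coh_lim_def
      using direct_system_map.limit_map_inj[OF G[of 0] cs.cone_inj_0[OF N]] by blast
  qed
qed

end


section \<open>Free modules\<close>

lemma free_module_simps [simp]:
  "\<zero>\<^bsub>free_module R B\<^esub> = (\<lambda>_. \<zero>\<^bsub>R\<^esub>)"
  "u \<oplus>\<^bsub>free_module R B\<^esub> v = (\<lambda>b. u b \<oplus>\<^bsub>R\<^esub> v b)"
  "r \<odot>\<^bsub>free_module R B\<^esub> u = (\<lambda>b. r \<otimes>\<^bsub>R\<^esub> u b)"
  by (auto simp: free_module_def)

lemma carrier_free: "carrier (free_module R B) =
    {u. (\<forall>b. u b \<in> carrier R) \<and> finite {b. u b \<noteq> \<zero>\<^bsub>R\<^esub>} \<and> {b. u b \<noteq> \<zero>\<^bsub>R\<^esub>} \<subseteq> B}"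
  by (auto simp: free_module_def)

definition unit_vec :: "('a, 'r) ring_scheme \<Rightarrow> 'b \<Rightarrow> 'b \<Rightarrow> 'a" where
  "unit_vec R b = (\<lambda>x. if x = b then \<one>\<^bsub>R\<^esub> else \<zero>\<^bsub>R\<^esub>)"

definition linext where
  "linext R Y \<beta> u = (\<Oplus>\<^bsub>Y\<^esub> b \<in> {b. u b \<noteq> \<zero>\<^bsub>R\<^esub>}. u b \<odot>\<^bsub>Y\<^esub> \<beta> b)"

text \<open>Lets the two recursive clauses of \<open>res_basis\<close> be treated as one; in degree
  0 the augmentation takes the place of the boundary.\<close>

definition is_cycle where
  "is_cycle R M n u \<longleftrightarrow> (case n of 0 \<Rightarrow> augmentation R M u = \<zero>\<^bsub>M\<^esub> | Suc _ \<Rightarrow> boundary R u = (\<lambda>_. \<zero>\<^bsub>R\<^esub>))"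

definition rpush where
  "rpush R f n = push R (res_map R f n)"

context
  fixes R :: "('a, 'r) ring_scheme"
  assumes R: "cring R"
begin

interpretation R: cring R by (rule R)

lemma module_free: "module R (free_module R B)"
proof (rule moduleI[OF R])
  show "abelian_group (free_module R B)"
  proof (rule abelian_groupI)
    fix u v assume uv: "u \<in> carrier (free_module R B)" "v \<in> carrier (free_module R B)"
    have "{b. u b \<oplus>\<^bsub>R\<^esub> v b \<noteq> \<zero>\<^bsub>R\<^esub>} \<subseteq> {b. u b \<noteq> \<zero>\<^bsub>R\<^esub>} \<union> {b. v b \<noteq> \<zero>\<^bsub>R\<^esub>}" by auto
    then show "u \<oplus>\<^bsub>free_module R B\<^esub> v \<in> carrier (free_module R B)"
      using uv finite_subset[of "{b. u b \<oplus>\<^bsub>R\<^esub> v b \<noteq> \<zero>\<^bsub>R\<^esub>}"] by (auto simp: carrier_free)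
  next
    fix u assume u: "u \<in> carrier (free_module R B)"
    have "{b. \<ominus>\<^bsub>R\<^esub> u b \<noteq> \<zero>\<^bsub>R\<^esub>} \<subseteq> {b. u b \<noteq> \<zero>\<^bsub>R\<^esub>}" by auto
    then have "(\<lambda>b. \<ominus>\<^bsub>R\<^esub> u b) \<in> carrier (free_module R B)"
      using u finite_subset[of "{b. \<ominus>\<^bsub>R\<^esub> u b \<noteq> \<zero>\<^bsub>R\<^esub>}"] by (auto simp: carrier_free)
    then show "\<exists>v\<in>carrier (free_module R B). v \<oplus>\<^bsub>free_module R B\<^esub> u = \<zero>\<^bsub>free_module R B\<^esub>"
      using u by (intro bexI[of _ "\<lambda>b. \<ominus>\<^bsub>R\<^esub> u b"]) (auto simp: carrier_free R.l_neg)
  qed (auto simp: carrier_free R.a_ac)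
next
  fix r u assume r: "r \<in> carrier R" and u: "u \<in> carrier (free_module R B)"
  have "{b. r \<otimes>\<^bsub>R\<^esub> u b \<noteq> \<zero>\<^bsub>R\<^esub>} \<subseteq> {b. u b \<noteq> \<zero>\<^bsub>R\<^esub>}" using r by auto
  then show "r \<odot>\<^bsub>free_module R B\<^esub> u \<in> carrier (free_module R B)"
    using r u finite_subset[of "{b. r \<otimes>\<^bsub>R\<^esub> u b \<noteq> \<zero>\<^bsub>R\<^esub>}"] by (auto simp: carrier_free)
qed (auto simp: carrier_free R.l_distr R.r_distr R.m_assoc)

lemma unit_vec_closed: "b \<in> B \<Longrightarrow> unit_vec R b \<in> carrier (free_module R B)"
  by (auto simp: carrier_free unit_vec_def intro: finite_subset[of _ "{b}"])

text \<open>The finite support loses one element at a time, and what is added back is a multiple of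
  a basis vector.\<close>

lemma free_induct [consumes 1, case_names zero add]:
  assumes u: "u \<in> carrier (free_module R B)"
    and zero: "Q (\<lambda>_. \<zero>\<^bsub>R\<^esub>)"
    and add: "\<And>v b r. v \<in> carrier (free_module R B) \<Longrightarrow> Q v \<Longrightarrow> b \<in> B \<Longrightarrow> r \<in> carrier R \<Longrightarrow>
      Q (v \<oplus>\<^bsub>free_module R B\<^esub> (r \<odot>\<^bsub>free_module R B\<^esub> unit_vec R b))"
  shows "Q u"
proof -
  have "\<forall>u\<in>carrier (free_module R B). {b. u b \<noteq> \<zero>\<^bsub>R\<^esub>} = S \<longrightarrow> Q u" if "finite S" for S
    using that
  proof induction
    case empty
    then show ?case using zero by (auto simp: fun_eq_iff[symmetric])
  next
    case (insert b S)
    show ?case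
    proof (intro ballI impI)
      fix u assume u: "u \<in> carrier (free_module R B)" "{b. u b \<noteq> \<zero>\<^bsub>R\<^esub>} = insert b S"
      define v where "v = u(b := \<zero>\<^bsub>R\<^esub>)"
      have vS: "{b. v b \<noteq> \<zero>\<^bsub>R\<^esub>} = S" using u(2) insert(2) by (auto simp: v_def)
      have b: "b \<in> B" "u b \<in> carrier R" using u by (auto simp: carrier_free)
      have v: "v \<in> carrier (free_module R B)"
        using u insert(1) unfolding carrier_free mem_Collect_eq vS by (auto simp: v_def)
      have "u = v \<oplus>\<^bsub>free_module R B\<^esub> (u b \<odot>\<^bsub>free_module R B\<^esub> unit_vec R b)"
        using u(1) by (auto simp: fun_eq_iff v_def unit_vec_def carrier_free)
      then show "Q u" using add[OF v _ b] insert.IH v vS by metis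
    qed
  qed
  then show ?thesis using u by (auto simp: carrier_free)
qed

lemma free_eqI:
  assumes f: "lin R (free_module R B) Y f" and g: "lin R (free_module R B) Y g"
    and eq: "\<And>b. b \<in> B \<Longrightarrow> f (unit_vec R b) = g (unit_vec R b)" and u: "u \<in> carrier (free_module R B)"
  shows "f u = g u"
  using u
proof (induction rule: free_induct)
  case zero
  then show ?case using lin_zero[OF f] lin_zero[OF g] by simp
next
  case (add v b r)
  interpret F: module R "free_module R B" by (rule module_free)
  note v = add.hyps(1) and b = unit_vec_closed[OF add.hyps(2)] and r = add.hyps(3)
  have c: "r \<odot>\<^bsub>free_module R B\<^esub> unit_vec R b \<in> carrier (free_module R B)"
    using F.smult_closed[OF r b] .
  show ?case
    unfolding lin_add[OF f v c] lin_add[OF g v c] lin_smult[OF f r b] lin_smult[OF g r b]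
    using add.IH eq[OF add.hyps(2)] by simp
qed

text \<open>\<open>linext\<close> sums over the support, which changes under addition and scaling;
  sums over a common finite superset can be compared termwise.\<close>

lemma linext_superset:
  assumes Y: "module R Y" and S: "finite S" "{b. u b \<noteq> \<zero>\<^bsub>R\<^esub>} \<subseteq> S"
    and u: "\<And>b. b \<in> S \<Longrightarrow> u b \<in> carrier R" and \<beta>: "\<And>b. b \<in> S \<Longrightarrow> \<beta> b \<in> carrier Y"
  shows "linext R Y \<beta> u = (\<Oplus>\<^bsub>Y\<^esub> b \<in> S. u b \<odot>\<^bsub>Y\<^esub> \<beta> b)"
proof -
  interpret Y: module R Y by fact
  show ?thesis unfolding linext_def
    by (rule Y.add.finprod_mono_neutral_cong_left) (use S u \<beta> in auto)
qed

lemma lin_linext: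
  assumes Y: "module R Y" and \<beta>: "\<And>b. b \<in> B \<Longrightarrow> \<beta> b \<in> carrier Y"
  shows "lin R (free_module R B) Y (linext R Y \<beta>)"
proof (rule linI[OF module_free Y])
  interpret Y: module R Y by fact
  fix u assume u: "u \<in> carrier (free_module R B)"
  let ?S = "{b. u b \<noteq> \<zero>\<^bsub>R\<^esub>}"
  have fin: "finite ?S" "?S \<subseteq> B" and uR: "u b \<in> carrier R" for b using u by (auto simp: carrier_free)
  have cl: "\<beta> b \<in> carrier Y" if "b \<in> ?S" for b using \<beta> fin that by auto
  then show "linext R Y \<beta> u \<in> carrier Y" unfolding linext_def using uR by (intro Y.finsum_closed) auto
  {
    fix r assume r: "r \<in> carrier R"
    have "linext R Y \<beta> (r \<odot>\<^bsub>free_module R B\<^esub> u) = (\<Oplus>\<^bsub>Y\<^esub> b \<in> ?S. (r \<otimes>\<^bsub>R\<^esub> u b) \<odot>\<^bsub>Y\<^esub> \<beta> b)"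
      using fin r uR cl by (simp, intro linext_superset Y) auto
    also have "\<dots> = (\<Oplus>\<^bsub>Y\<^esub> b \<in> ?S. r \<odot>\<^bsub>Y\<^esub> (u b \<odot>\<^bsub>Y\<^esub> \<beta> b))"
      using r uR cl by (intro Y.finsum_cong') (auto simp: Y.smult_assoc1)
    also have "\<dots> = r \<odot>\<^bsub>Y\<^esub> linext R Y \<beta> u"
      unfolding linext_def using r uR cl fin by (subst Y.finsum_smult_ldistr) auto
    finally show "linext R Y \<beta> (r \<odot>\<^bsub>free_module R B\<^esub> u) = r \<odot>\<^bsub>Y\<^esub> linext R Y \<beta> u" .
  }
  fix v assume v: "v \<in> carrier (free_module R B)"
  let ?T = "?S \<union> {b. v b \<noteq> \<zero>\<^bsub>R\<^esub>}"
  have finT: "finite ?T" "?T \<subseteq> B" and vR: "v b \<in> carrier R" for b using u v by (auto simp: carrier_free)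
  have cT: "\<beta> b \<in> carrier Y" if "b \<in> ?T" for b using \<beta> finT that by blast
  have "linext R Y \<beta> (u \<oplus>\<^bsub>free_module R B\<^esub> v) = (\<Oplus>\<^bsub>Y\<^esub> b \<in> ?T. (u b \<oplus>\<^bsub>R\<^esub> v b) \<odot>\<^bsub>Y\<^esub> \<beta> b)"
    using finT uR vR cT by (simp, intro linext_superset Y) auto
  also have "\<dots> = (\<Oplus>\<^bsub>Y\<^esub> b \<in> ?T. u b \<odot>\<^bsub>Y\<^esub> \<beta> b \<oplus>\<^bsub>Y\<^esub> v b \<odot>\<^bsub>Y\<^esub> \<beta> b)"
    using uR vR cT by (intro Y.finsum_cong') (auto simp: Y.smult_l_distr)
  also have "\<dots> = (\<Oplus>\<^bsub>Y\<^esub> b \<in> ?T. u b \<odot>\<^bsub>Y\<^esub> \<beta> b) \<oplus>\<^bsub>Y\<^esub> (\<Oplus>\<^bsub>Y\<^esub> b \<in> ?T. v b \<odot>\<^bsub>Y\<^esub> \<beta> b)"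
    using uR vR cT by (intro Y.finsum_addf) auto
  also have "(\<Oplus>\<^bsub>Y\<^esub> b \<in> ?T. u b \<odot>\<^bsub>Y\<^esub> \<beta> b) = linext R Y \<beta> u"
    by (rule linext_superset[OF Y finT(1), symmetric]) (use uR cT in auto)
  also have "(\<Oplus>\<^bsub>Y\<^esub> b \<in> ?T. v b \<odot>\<^bsub>Y\<^esub> \<beta> b) = linext R Y \<beta> v"
    by (rule linext_superset[OF Y finT(1), symmetric]) (use vR cT in auto)
  finally show "linext R Y \<beta> (u \<oplus>\<^bsub>free_module R B\<^esub> v) = linext R Y \<beta> u \<oplus>\<^bsub>Y\<^esub> linext R Y \<beta> v" .
qed

lemma linext_unit:
  assumes Y: "module R Y" and b: "\<beta> b \<in> carrier Y"
  shows "linext R Y \<beta> (unit_vec R b) = \<beta> b"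
proof -
  interpret Y: module R Y by fact
  have "linext R Y \<beta> (unit_vec R b) = (\<Oplus>\<^bsub>Y\<^esub> x \<in> {b}. unit_vec R b x \<odot>\<^bsub>Y\<^esub> \<beta> x)"
    using b by (intro linext_superset Y) (auto simp: unit_vec_def)
  then show ?thesis using b by (simp add: unit_vec_def)
qed

lemma free_lift:
  assumes g: "lin R X Y g" and h: "lin R (free_module R B) Y h"
    and sub: "h ` carrier (free_module R B) \<subseteq> g ` carrier X"
  shows "\<exists>k. lin R (free_module R B) X k \<and> (\<forall>p\<in>carrier (free_module R B). g (k p) = h p)"
proof -
  have "\<forall>b\<in>B. \<exists>x\<in>carrier X. h (unit_vec R b) = g x" using sub unit_vec_closed by fast
  then obtain \<beta> where \<beta>: "\<And>b. b \<in> B \<Longrightarrow> \<beta> b \<in> carrier X \<and> h (unit_vec R b) = g (\<beta> b)" by metis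
  note X = lin_module1[OF g]
  have k: "lin R (free_module R B) X (linext R X \<beta>)" using \<beta> by (intro lin_linext X) auto
  have "g (linext R X \<beta> p) = h p" if "p \<in> carrier (free_module R B)" for p
    by (rule free_eqI[OF lin_comp[OF k g] h _ that]) (simp add: linext_unit[OF X] \<beta>)
  then show ?thesis using k by blast
qed

lemma lifts_free: "lifts R (free_module R B) T"
  unfolding lifts_def using free_lift by blast

text \<open>\<open>boundary\<close> and \<open>push\<close> are given by coordinates, each of which
  is a linear extension into \<open>R\<close>. Linearity is checked coordinate by coordinate; that
  the values have finite support in \<open>B'\<close> follows by \<open>free_induct\<close> from the
  values on basis vectors.\<close>

lemma lin_pointwise:
  assumes \<gamma>: "\<And>b. b \<in> B \<Longrightarrow> \<gamma> b \<in> carrier (free_module R B')"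
    and G: "\<And>u x. G u x = linext R (regular_module R) (\<lambda>b. \<gamma> b x) u"
  shows "lin R (free_module R B) (free_module R B') G"
    and "b \<in> B \<Longrightarrow> G (unit_vec R b) = \<gamma> b"
proof -
  note M = module_regular[OF R]
  have \<gamma>R: "\<gamma> b x \<in> carrier R" if "b \<in> B" for b x using \<gamma>[OF that] by (auto simp: carrier_free)
  have l: "lin R (free_module R B) (regular_module R) (\<lambda>u. G u x)" for x
    unfolding G using \<gamma>R by (intro lin_linext M) auto
  show unit: "G (unit_vec R b) = \<gamma> b" if "b \<in> B" for b
  proof
    show "G (unit_vec R b) x = \<gamma> b x" for x
      unfolding G using linext_unit[OF M, of "\<lambda>b. \<gamma> b x" b] \<gamma>R[OF that] by simp
  qed
  interpret F: module R "free_module R B" by (rule module_free)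
  interpret F': module R "free_module R B'" by (rule module_free)
  have G_add: "G (u \<oplus>\<^bsub>free_module R B\<^esub> v) = G u \<oplus>\<^bsub>free_module R B'\<^esub> G v"
    if "u \<in> carrier (free_module R B)" "v \<in> carrier (free_module R B)" for u v
    using lin_add[OF l that] by (auto simp: fun_eq_iff)
  have smult: "G (r \<odot>\<^bsub>free_module R B\<^esub> u) = r \<odot>\<^bsub>free_module R B'\<^esub> G u"
    if "r \<in> carrier R" "u \<in> carrier (free_module R B)" for u r
    using lin_smult[OF l that] by (auto simp: fun_eq_iff)
  show "lin R (free_module R B) (free_module R B') G"
  proof (rule linI[OF module_free module_free])
    fix u assume "u \<in> carrier (free_module R B)"
    then show "G u \<in> carrier (free_module R B')"
    proof (induction rule: free_induct)
      case zero
      have "G (\<lambda>_. \<zero>\<^bsub>R\<^esub>) = \<zero>\<^bsub>free_module R B'\<^esub>" using lin_zero[OF l] by (simp add: fun_eq_iff)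
      then show ?case by (metis F'.zero_closed)
    next
      case (add v b r)
      note v = add.hyps(1) and u = unit_vec_closed[OF add.hyps(2)] and r = add.hyps(3)
      have "G (v \<oplus>\<^bsub>free_module R B\<^esub> (r \<odot>\<^bsub>free_module R B\<^esub> unit_vec R b))
          = G v \<oplus>\<^bsub>free_module R B'\<^esub> (r \<odot>\<^bsub>free_module R B'\<^esub> \<gamma> b)"
        unfolding G_add[OF v F.smult_closed[OF r u]] smult[OF r u] unit[OF add.hyps(2)] ..
      then show ?case using F'.a_closed[OF add.IH F'.smult_closed[OF r \<gamma>[OF add.hyps(2)]]] by metis
    qed
  qed (rule G_add smult; assumption)+
qed


section \<open>The functorial resolution\<close>

lemma boundary_linext: "boundary R u x = linext R (regular_module R) (\<lambda>b. decode R b x) u"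
  by (simp add: boundary_def linext_def)

lemma push_linext:
  assumes u: "u \<in> carrier (free_module R B)"
  shows "push R \<beta> u x = linext R (regular_module R) (\<lambda>b. unit_vec R (\<beta> b) x) u"
proof -
  have "push R \<beta> u x = (\<Oplus>\<^bsub>R\<^esub> b \<in> {b. u b \<noteq> \<zero>\<^bsub>R\<^esub>}. u b \<otimes>\<^bsub>R\<^esub> unit_vec R (\<beta> b) x)"
    unfolding push_def using u
    by (intro R.add.finprod_mono_neutral_cong_left) (auto simp: unit_vec_def carrier_free)
  then show ?thesis by (simp add: linext_def)
qed

lemma lin_push:
  assumes \<beta>: "\<And>b. b \<in> B \<Longrightarrow> \<beta> b \<in> B'"
  shows "lin R (free_module R B) (free_module R B') (push R \<beta>)"
    and "b \<in> B \<Longrightarrow> push R \<beta> (unit_vec R b) = unit_vec R (\<beta> b)"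
proof -
  define G where "G u x = linext R (regular_module R) (\<lambda>b. unit_vec R (\<beta> b) x) u" for u x
  have u: "unit_vec R (\<beta> b) \<in> carrier (free_module R B')" if "b \<in> B" for b
    using \<beta> that by (intro unit_vec_closed)
  have P1: "lin R (free_module R B) (free_module R B') G"
    by (rule lin_pointwise(1)[OF u G_def])
  have P2: "G (unit_vec R b) = unit_vec R (\<beta> b)" if "b \<in> B" for b
    by (rule lin_pointwise(2)[OF u G_def that])
  have eq: "G u = push R \<beta> u" if "u \<in> carrier (free_module R B)" for u
    by (rule ext) (simp add: G_def push_linext[OF that])
  show "lin R (free_module R B) (free_module R B') (push R \<beta>)" by (rule lin_cong[OF P1 eq])
  show "push R \<beta> (unit_vec R b) = unit_vec R (\<beta> b)" if "b \<in> B"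
    using P2[OF that] eq[OF unit_vec_closed[OF that]] by simp
qed

lemma res_basis_Suc:
  "res_basis R M (Suc n) = encode R ` {u \<in> carrier (res R M n). is_cycle R M n u}"
  by (cases n) (auto simp: res_def is_cycle_def)

lemma decode_encode_res: "u \<in> carrier (res R M n) \<Longrightarrow> decode R (encode R u) = u"
  by (intro decode_encode) (auto simp: res_def carrier_free)

lemma decode_basis:
  assumes "b \<in> res_basis R M (Suc n)"
  shows "decode R b \<in> carrier (res R M n)" "is_cycle R M n (decode R b)"
proof -
  obtain u where u: "b = encode R u" "u \<in> carrier (res R M n)" "is_cycle R M n u"
    using assms by (auto simp: res_basis_Suc)
  then show "decode R b \<in> carrier (res R M n)" "is_cycle R M n (decode R b)"
    using decode_encode_res[OF u(2)] by simp_all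
qed

lemma module_res: "module R (res R M n)"
  unfolding res_def by (rule module_free)

lemma lin_boundary: "lin R (res R M (Suc n)) (res R M n) (boundary R)"
  and boundary_unit: "b \<in> res_basis R M (Suc n) \<Longrightarrow> boundary R (unit_vec R b) = decode R b"
  unfolding res_def
  by (rule lin_pointwise[where \<gamma> = "decode R"];
      use decode_basis[of _ M n] boundary_linext in \<open>auto simp: res_def\<close>)+

context
  fixes M :: "('a, 'm) module"
  assumes M: "module R M"
begin

interpretation M: module R M by (rule M)

lemma augmentation_linext: "augmentation R M = linext R M the_gen"
  by (simp add: augmentation_def linext_def fun_eq_iff)

lemma lin_augmentation: "lin R (res R M 0) M (augmentation R M)"
  unfolding augmentation_linext res_def by (rule lin_linext[OF M]) auto

lemma augmentation_unit: "m \<in> carrier M \<Longrightarrow> augmentation R M (unit_vec R (Gen m)) = m"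
  unfolding augmentation_linext by (subst linext_unit[OF M]) auto

lemma unit_gen: "m \<in> carrier M \<Longrightarrow> unit_vec R (Gen m) \<in> carrier (res R M 0)"
  unfolding res_def by (rule unit_vec_closed) auto

lemma augmentation_boundary:
  assumes u: "u \<in> carrier (res R M (Suc 0))"
  shows "augmentation R M (boundary R u) = \<zero>\<^bsub>M\<^esub>"
proof (rule free_eqI[rotated -1, OF u[unfolded res_def]])
  show "lin R (free_module R (res_basis R M (Suc 0))) M (\<lambda>u. augmentation R M (boundary R u))"
    using lin_comp[OF lin_boundary lin_augmentation] by (simp only: res_def)
  show "lin R (free_module R (res_basis R M (Suc 0))) M (\<lambda>u. \<zero>\<^bsub>M\<^esub>)"
    by (rule lin_const_zero[OF module_free M])
  fix b assume b: "b \<in> res_basis R M (Suc 0)"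
  show "augmentation R M (boundary R (unit_vec R b)) = \<zero>\<^bsub>M\<^esub>"
    using decode_basis(2)[OF b] boundary_unit[OF b] by (simp add: is_cycle_def)
qed

lemma res_dd:
  assumes u: "u \<in> carrier (res R M (Suc (Suc n)))"
  shows "boundary R (boundary R u) = \<zero>\<^bsub>res R M n\<^esub>"
proof (rule free_eqI[rotated -1, OF u[unfolded res_def]])
  show "lin R (free_module R (res_basis R M (Suc (Suc n)))) (res R M n) (\<lambda>u. boundary R (boundary R u))"
    using lin_comp[OF lin_boundary[of M "Suc n"] lin_boundary[of M n]] by (simp only: res_def)
  show "lin R (free_module R (res_basis R M (Suc (Suc n)))) (res R M n) (\<lambda>u. \<zero>\<^bsub>res R M n\<^esub>)"
    by (rule lin_const_zero[OF module_free module_res])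
  fix b assume b: "b \<in> res_basis R M (Suc (Suc n))"
  show "boundary R (boundary R (unit_vec R b)) = \<zero>\<^bsub>res R M n\<^esub>"
    using decode_basis(2)[OF b] boundary_unit[OF b] by (simp add: is_cycle_def res_def)
qed

lemma complex_res: "chain_complex R (res R M) (\<lambda>_. boundary R)"
  by (rule chain_complex.intro) (rule module_res lin_boundary res_dd, assumption?)+

text \<open>Exactness is built into the basis: a cycle \<open>u\<close> names the basis element
  \<open>encode R u\<close>, and the boundary of its unit vector is \<open>u\<close>.\<close>

lemma res_exact:
  assumes u: "u \<in> carrier (res R M n)" "is_cycle R M n u"
  shows "u \<in> boundary R ` carrier (res R M (Suc n))"
proof -
  have b: "encode R u \<in> res_basis R M (Suc n)" using u by (auto simp: res_basis_Suc)
  then have "boundary R (unit_vec R (encode R u)) = u"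
    using u(1) by (simp add: boundary_unit[OF b] decode_encode_res)
  moreover have "unit_vec R (encode R u) \<in> carrier (res R M (Suc n))"
    unfolding res_def by (rule unit_vec_closed[OF b])
  ultimately show ?thesis by (metis image_eqI)
qed

end

section \<open>Functoriality of the resolution\<close>

context
  fixes X :: "('a, 'x) module" and Y :: "('a, 'y) module" and f
  assumes f: "lin R X Y f"
begin

text \<open>That \<open>res_map\<close> preserves the bases is a hypothesis here and in the next two
  lemmas, because the proof of that fact in \<open>res_map_closed\<close> uses these lemmas in lower
  degrees.\<close>

lemma rpush_step:
  assumes \<beta>: "\<And>b. b \<in> res_basis R X n \<Longrightarrow> res_map R f n b \<in> res_basis R Y n"
  shows "lin R (res R X n) (res R Y n) (rpush R f n)"
    and "b \<in> res_basis R X n \<Longrightarrow> rpush R f n (unit_vec R b) = unit_vec R (res_map R f n b)"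
  unfolding res_def rpush_def using lin_push[of "res_basis R X n" "res_map R f n" "res_basis R Y n", OF \<beta>] by auto

lemma aug_rpush_step:
  assumes \<beta>: "\<And>b. b \<in> res_basis R X 0 \<Longrightarrow> res_map R f 0 b \<in> res_basis R Y 0"
    and u: "u \<in> carrier (res R X 0)"
  shows "augmentation R Y (rpush R f 0 u) = f (augmentation R X u)"
proof -
  note X = lin_module1[OF f] and Y = lin_module2[OF f]
  show ?thesis
    using u unfolding res_def
  proof (rule free_eqI[rotated -1])
    show "lin R (free_module R (res_basis R X 0)) Y (\<lambda>u. augmentation R Y (rpush R f 0 u))"
      using lin_comp[OF rpush_step(1)[OF \<beta>] lin_augmentation[OF Y]] by (simp add: res_def)
    show "lin R (free_module R (res_basis R X 0)) Y (\<lambda>u. f (augmentation R X u))"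
      using lin_comp[OF lin_augmentation[OF X] f] by (simp add: res_def)
    fix b assume b: "b \<in> res_basis R X 0"
    then obtain m where m: "m \<in> carrier X" "b = Gen m" by auto
    show "augmentation R Y (rpush R f 0 (unit_vec R b)) = f (augmentation R X (unit_vec R b))"
      using rpush_step(2)[OF \<beta> b] m lin_closed[OF f m(1)] by (simp add: augmentation_unit[OF X] augmentation_unit[OF Y])
  qed
qed

lemma boundary_rpush_step:
  assumes \<beta>: "\<And>b. b \<in> res_basis R X n \<Longrightarrow> res_map R f n b \<in> res_basis R Y n"
    and \<beta>': "\<And>b. b \<in> res_basis R X (Suc n) \<Longrightarrow> res_map R f (Suc n) b \<in> res_basis R Y (Suc n)"
    and u: "u \<in> carrier (res R X (Suc n))"
  shows "boundary R (rpush R f (Suc n) u) = rpush R f n (boundary R u)"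
  using u unfolding res_def
proof (rule free_eqI[rotated -1])
  show "lin R (free_module R (res_basis R X (Suc n))) (res R Y n) (\<lambda>u. boundary R (rpush R f (Suc n) u))"
    using lin_comp[OF rpush_step(1)[OF \<beta>'] lin_boundary] by (simp add: res_def)
  show "lin R (free_module R (res_basis R X (Suc n))) (res R Y n) (\<lambda>u. rpush R f n (boundary R u))"
    using lin_comp[OF lin_boundary rpush_step(1)[OF \<beta>]] by (simp add: res_def)
  fix b assume b: "b \<in> res_basis R X (Suc n)"
  have "rpush R f n (decode R b) \<in> carrier (res R Y n)"
    using lin_closed[OF rpush_step(1)[OF \<beta>]] decode_basis(1)[OF b] by simp
  then have "decode R (res_map R f (Suc n) b) = rpush R f n (decode R b)"
    using decode_encode_res by (simp add: rpush_def)
  then show "boundary R (rpush R f (Suc n) (unit_vec R b)) = rpush R f n (boundary R (unit_vec R b))"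
    using rpush_step(2)[OF \<beta>' b] boundary_unit[OF b] boundary_unit[OF \<beta>'[OF b]] by simp
qed

text \<open>A basis element of degree \<open>m + 1\<close> encodes a cycle, and its image encodes a
  cycle because \<open>rpush\<close> commutes with the boundary from degree \<open>m\<close> to
  degree \<open>m - 1\<close>. This uses the claim in both of these degrees, hence strong
  induction.\<close>

lemma res_map_closed: "b \<in> res_basis R X n \<Longrightarrow> res_map R f n b \<in> res_basis R Y n"
proof (induction n arbitrary: b rule: less_induct)
  case (less n)
  show ?case
  proof (cases n)
    case 0
    then show ?thesis using less.prems lin_closed[OF f] by auto
  next
    case (Suc m)
    have IH: "\<And>b. b \<in> res_basis R X m \<Longrightarrow> res_map R f m b \<in> res_basis R Y m" using less.IH Suc by simp
    note b = decode_basis[OF less.prems[unfolded Suc]]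
    have "is_cycle R Y m (rpush R f m (decode R b))"
    proof (cases m)
      case 0
      then show ?thesis
        using aug_rpush_step[of "decode R b"] IH b lin_zero[OF f] by (simp add: is_cycle_def)
    next
      case (Suc l)
      have IH': "\<And>b. b \<in> res_basis R X l \<Longrightarrow> res_map R f l b \<in> res_basis R Y l"
        using less.IH Suc \<open>n = Suc m\<close> by simp
      show ?thesis
        using boundary_rpush_step[OF IH' IH[unfolded Suc], of "decode R b"] b Suc
          lin_zero[OF rpush_step(1)[OF IH']]
        by (simp add: is_cycle_def res_def)
    qed
    moreover have "rpush R f m (decode R b) \<in> carrier (res R Y m)"
      using lin_closed[OF rpush_step(1)[OF IH]] b by simp
    ultimately show ?thesis unfolding Suc res_basis_Suc by (auto simp: rpush_def)
  qed
qed

lemma lin_rpush: "lin R (res R X n) (res R Y n) (rpush R f n)"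
  by (rule rpush_step(1)) (rule res_map_closed)

lemma rpush_unit: "b \<in> res_basis R X n \<Longrightarrow> rpush R f n (unit_vec R b) = unit_vec R (res_map R f n b)"
  by (rule rpush_step(2)) (rule res_map_closed)

lemma augmentation_rpush:
  "u \<in> carrier (res R X 0) \<Longrightarrow> augmentation R Y (rpush R f 0 u) = f (augmentation R X u)"
  by (rule aug_rpush_step) (rule res_map_closed)

lemma boundary_rpush:
  "u \<in> carrier (res R X (Suc n)) \<Longrightarrow> boundary R (rpush R f (Suc n) u) = rpush R f n (boundary R u)"
  by (rule boundary_rpush_step; (rule res_map_closed)?; assumption)

lemma chain_map_rpush: "chain_map R (res R X) (\<lambda>_. boundary R) (res R Y) (\<lambda>_. boundary R) (rpush R f)"
  unfolding chain_map_def by (simp add: lin_rpush boundary_rpush)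

end

text \<open>The two claims feed each other: \<open>res_map\<close> in degree \<open>n + 1\<close> is
  \<open>rpush\<close> in degree \<open>n\<close>, encoded, and \<open>rpush\<close> is determined
  by \<open>res_map\<close> on basis vectors. The map \<open>h\<close> is compared with the
  composite on \<open>carrier X\<close> only, since all basis elements are built from there.\<close>

lemma res_map_comp:
  assumes f: "lin R X Y f" and g: "lin R Y Z g"
    and h: "\<And>x. x \<in> carrier X \<Longrightarrow> h x = g (f x)"
  shows "b \<in> res_basis R X n \<Longrightarrow> res_map R h n b = res_map R g n (res_map R f n b)"
    and "u \<in> carrier (res R X n) \<Longrightarrow> rpush R h n u = rpush R g n (rpush R f n u)"
proof -
  have lh: "lin R X Z h" using lin_cong[OF lin_comp[OF f g]] h by simp
  have push: "rpush R h n u = rpush R g n (rpush R f n u)"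
    if *: "\<And>b. b \<in> res_basis R X n \<Longrightarrow> res_map R h n b = res_map R g n (res_map R f n b)"
      and u: "u \<in> carrier (res R X n)" for n u
    using u unfolding res_def
  proof (rule free_eqI[rotated -1])
    show "lin R (free_module R (res_basis R X n)) (res R Z n) (rpush R h n)"
      using lin_rpush[OF lh] by (simp add: res_def)
    show "lin R (free_module R (res_basis R X n)) (res R Z n) (\<lambda>u. rpush R g n (rpush R f n u))"
      using lin_comp[OF lin_rpush[OF f] lin_rpush[OF g]] by (simp add: res_def)
  qed (simp add: rpush_unit[OF f] rpush_unit[OF g] rpush_unit[OF lh] res_map_closed[OF f] *)
  show 1: "res_map R h n b = res_map R g n (res_map R f n b)" if "b \<in> res_basis R X n" for b n
    using that
  proof (induction n arbitrary: b)
    case 0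
    then show ?case by (auto simp: h)
  next
    case (Suc n)
    note b = decode_basis(1)[OF Suc.prems]
    have "decode R (res_map R f (Suc n) b) = rpush R f n (decode R b)"
      using decode_encode_res lin_closed[OF lin_rpush[OF f] b] by (simp add: rpush_def)
    then have "res_map R g (Suc n) (res_map R f (Suc n) b) = encode R (rpush R g n (rpush R f n (decode R b)))"
      by (simp add: rpush_def)
    also have "\<dots> = res_map R h (Suc n) b" using push[OF Suc.IH b] by (simp add: rpush_def)
    finally show ?case by simp
  qed
  show "rpush R h n u = rpush R g n (rpush R f n u)" if "u \<in> carrier (res R X n)"
    by (rule push[OF 1 that])
qed

end

section \<open>Ext and its limits as cohomology of dual complexes\<close>

lemma Ext_eq_coh: "Ext R i M N = coh R (res R M) (\<lambda>_. boundary R) N i"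
proof -
  have "cocycles R i M N = cocyc R (res R M) (\<lambda>_. boundary R) N i"
    by (auto simp: cocycles_def cocyc_def)
  moreover have "coboundaries R i M N = cobound R (res R M) (\<lambda>_. boundary R) N i"
    by (cases i) auto
  ultimately show ?thesis by (simp add: Ext_def coh_def)
qed

lemma Ext_map_eq_coh_pull:
  "Ext_map R i f M M' N = coh_pull R (res R M) (\<lambda>_. boundary R) N i (push R (res_map R f i))"
proof -
  have "coboundaries R i M N = cobound R (res R M) (\<lambda>_. boundary R) N i"
    by (cases i) auto
  then show ?thesis by (simp add: fun_eq_iff Ext_map_def coh_pull_def)
qed

lemma lim_Ext_eq_coh_lim:
  "lim_Ext R i X S N = coh_lim R (\<lambda>n. res R (quot_module X (S n))) (\<lambda>_ _. boundary R)
     (\<lambda>n k. rpush R (\<lambda>C. S n <+>\<^bsub>X\<^esub> C)) N i"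
  by (simp add: lim_Ext_def coh_lim_def Ext_eq_coh Ext_map_eq_coh_pull rpush_def)


section \<open>Functoriality of Ext in the second argument\<close>

lemma lin_factor:
  assumes \<pi>: "lin R M Q \<pi>" "\<pi> ` carrier M = carrier Q" and g: "lin R M T g"
    and h: "\<And>x. x \<in> carrier M \<Longrightarrow> h (\<pi> x) = g x"
  shows "lin R Q T h"
proof (rule linI[OF lin_module2[OF \<pi>(1)] lin_module2[OF g]])
  interpret M: module R M by (rule lin_module1[OF g])
  fix u assume "u \<in> carrier Q"
  then obtain x where x: "x \<in> carrier M" "u = \<pi> x" using \<pi>(2) by auto
  then show "h u \<in> carrier T" using lin_closed[OF g] h by simp
next
  interpret M: module R M by (rule lin_module1[OF g])
  fix u v assume "u \<in> carrier Q" "v \<in> carrier Q"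
  then obtain x y where x: "x \<in> carrier M" "u = \<pi> x" "y \<in> carrier M" "v = \<pi> y" using \<pi>(2) by blast
  then have "h (\<pi> (x \<oplus>\<^bsub>M\<^esub> y)) = h (\<pi> x) \<oplus>\<^bsub>T\<^esub> h (\<pi> y)" by (simp add: h lin_add[OF g])
  then show "h (u \<oplus>\<^bsub>Q\<^esub> v) = h u \<oplus>\<^bsub>T\<^esub> h v" using x by (simp add: lin_add[OF \<pi>(1)])
next
  interpret M: module R M by (rule lin_module1[OF g])
  fix r u assume r: "r \<in> carrier R" and "u \<in> carrier Q"
  then obtain x where x: "x \<in> carrier M" "u = \<pi> x" using \<pi>(2) by blast
  then have "h (\<pi> (r \<odot>\<^bsub>M\<^esub> x)) = r \<odot>\<^bsub>T\<^esub> h (\<pi> x)" using r by (simp add: h lin_smult[OF g])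
  then show "h (r \<odot>\<^bsub>Q\<^esub> u) = r \<odot>\<^bsub>T\<^esub> h u" using x r by (simp add: lin_smult[OF \<pi>(1)])
qed

lemma lin_lift_inj:
  assumes f: "lin R X Y f" "inj_on f (carrier X)" and h: "lin R P Y h"
    and sub: "\<And>p. p \<in> carrier P \<Longrightarrow> h p \<in> f ` carrier X"
  obtains k where "lin R P X k" "\<And>p. p \<in> carrier P \<Longrightarrow> f (k p) = h p"
proof -
  interpret X: module R X by (rule lin_module1[OF f(1)])
  interpret P: module R P by (rule lin_module1[OF h])
  obtain k where k: "\<And>p. p \<in> carrier P \<Longrightarrow> k p \<in> carrier X" "\<And>p. p \<in> carrier P \<Longrightarrow> f (k p) = h p"
  proof -
    have "\<forall>p\<in>carrier P. \<exists>x. x \<in> carrier X \<and> f x = h p" 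
    proof
      fix p assume "p \<in> carrier P"
      from sub[OF this] obtain x where "x \<in> carrier X" "h p = f x" by blast
      then show "\<exists>x. x \<in> carrier X \<and> f x = h p" by auto
    qed
    from bchoice[OF this] show thesis using that by blast
  qed
  have "lin R P X k"
  proof (rule linI[OF P.module_axioms X.module_axioms k(1)])
    fix p q assume "p \<in> carrier P" "q \<in> carrier P"
    then show "k (p \<oplus>\<^bsub>P\<^esub> q) = k p \<oplus>\<^bsub>X\<^esub> k q"
      by (intro inj_onD[OF f(2)]) (auto simp: k lin_add[OF f(1)] lin_add[OF h])
  next
    fix r p assume "r \<in> carrier R" "p \<in> carrier P"
    then show "k (r \<odot>\<^bsub>P\<^esub> p) = r \<odot>\<^bsub>X\<^esub> k p"
      by (intro inj_onD[OF f(2)]) (auto simp: k lin_smult[OF f(1)] lin_smult[OF h])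
  qed
  with k(2) show thesis using that by blast
qed

lemma lin_inj_onI:
  assumes f: "lin R X Y f" and ker: "\<And>x. x \<in> carrier X \<Longrightarrow> f x = \<zero>\<^bsub>Y\<^esub> \<Longrightarrow> x = \<zero>\<^bsub>X\<^esub>"
  shows "inj_on f (carrier X)"
proof (rule inj_onI)
  interpret X: module R X by (rule lin_module1[OF f])
  interpret Y: module R Y by (rule lin_module2[OF f])
  fix x y assume xy: "x \<in> carrier X" "y \<in> carrier X" "f x = f y"
  then have "f (x \<ominus>\<^bsub>X\<^esub> y) = \<zero>\<^bsub>Y\<^esub>"
    using Y.diff_zero_iff[OF lin_closed[OF f xy(1)] lin_closed[OF f xy(2)]] by (simp add: lin_diff[OF f])
  then have "x \<ominus>\<^bsub>X\<^esub> y = \<zero>\<^bsub>X\<^esub>" using xy by (intro ker) auto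
  then show "x = y" using X.diff_zero_iff xy by simp
qed

lemma lin_postcomp:
  assumes f: "lin R X Y f" and P: "module R P"
  shows "lin R (Hom_module R P X) (Hom_module R P Y) (\<lambda>c. \<lambda>u\<in>carrier P. f (c u))"
proof (rule linI)
  note X = lin_module1[OF f] and Y = lin_module2[OF f]
  interpret P: module R P by fact
  show "module R (Hom_module R P X)" "module R (Hom_module R P Y)" by (intro module_Hom P X Y)+
  note cl = lin_closed[OF mod_hom_lin[OF P X]]
  {
    fix c assume c: "c \<in> carrier (Hom_module R P X)"
    then show "(\<lambda>u\<in>carrier P. f (c u)) \<in> carrier (Hom_module R P Y)"
      using restrict_mod_hom[OF lin_comp[OF mod_hom_lin[OF P X] f]] by simp
    fix r assume "r \<in> carrier R"
    then show "(\<lambda>u\<in>carrier P. f ((r \<odot>\<^bsub>Hom_module R P X\<^esub> c) u)) = r \<odot>\<^bsub>Hom_module R P Y\<^esub> (\<lambda>u\<in>carrier P. f (c u))"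
      using c by (auto simp: fun_eq_iff lin_smult[OF f] cl)
  }
  fix c c' assume "c \<in> carrier (Hom_module R P X)" "c' \<in> carrier (Hom_module R P X)"
  then show "(\<lambda>u\<in>carrier P. f ((c \<oplus>\<^bsub>Hom_module R P X\<^esub> c') u))
      = (\<lambda>u\<in>carrier P. f (c u)) \<oplus>\<^bsub>Hom_module R P Y\<^esub> (\<lambda>u\<in>carrier P. f (c' u))"
    by (auto simp: fun_eq_iff lin_add[OF f] cl)
qed

text \<open>The other variance of \<open>coh_pull\<close>: the complex stays and the coefficients
  vary.\<close>

definition coh_push where
  "coh_push R P d Y i f C =
     (\<Union>c\<in>C. cobound R P d Y i +>\<^bsub>Hom_module R (P i) Y\<^esub> (\<lambda>u\<in>carrier (P i). f (c u)))"

context chain_complex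
begin

lemma post_cocyc:
  assumes f: "lin R X Y f" and c: "c \<in> cocyc R P d X i"
  shows "(\<lambda>u\<in>carrier (P i). f (c u)) \<in> cocyc R P d Y i"
  using c restrict_mod_hom[OF lin_comp[OF mod_hom_lin[OF module_P lin_module1[OF f]] f]] lin_closed[OF lin_d]
    lin_zero[OF f] by (auto simp: cocyc_def)

lemma post_cobound:
  assumes f: "lin R X Y f" and c: "c \<in> cobound R P d X i"
  shows "(\<lambda>u\<in>carrier (P i). f (c u)) \<in> cobound R P d Y i"
proof (cases i)
  case 0
  then show ?thesis using c lin_zero[OF f] by (auto simp: fun_eq_iff)
next
  case (Suc j)
  then obtain e where e: "e \<in> mod_hom R (P j) X" "c = (\<lambda>u\<in>carrier (P (Suc j)). e (d j u))" using c by auto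
  have "(\<lambda>u\<in>carrier (P i). f (c u)) = (\<lambda>u\<in>carrier (P (Suc j)). (\<lambda>v\<in>carrier (P j). f (e v)) (d j u))"
    using Suc e lin_closed[OF lin_d] by (auto simp: fun_eq_iff)
  then show ?thesis
    using cobound_SucI[where P = P and d = d and i = j,
        OF restrict_mod_hom[OF lin_comp[OF mod_hom_lin[OF module_P lin_module1[OF f] e(1)] f]]] Suc by simp
qed

lemma coh_push_ccls:
  assumes f: "lin R X Y f" and c: "c \<in> cocyc R P d X i"
  shows "coh_push R P d Y i f (ccls R P d X i c) = ccls R P d Y i (\<lambda>u\<in>carrier (P i). f (c u))"
    and lin_coh_push: "lin R (coh R P d X i) (coh R P d Y i) (coh_push R P d Y i f)"
proof -
  note X = lin_module1[OF f] and Y = lin_module2[OF f]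
  have l: "lin R (cocyc_module R P d X i) (cocyc_module R P d Y i) (\<lambda>c. \<lambda>u\<in>carrier (P i). f (c u))"
    using lin_submodule[OF lin_postcomp[OF f module_P] submodule_cocyc[OF X]] post_cocyc[OF f]
    by (intro lin_into_submodule submodule_cocyc[OF Y]) auto
  have *: "coh_push R P d Y i f (ccls R P d X i c) = ccls R P d Y i (\<lambda>u\<in>carrier (P i). f (c u))"
    if c: "c \<in> cocyc R P d X i" for c
    using quot_map_eq[OF module_cocyc[OF X] submodule_cobound[OF X] l submodule_cobound[OF Y], of c]
      post_cobound[OF f] c by (simp add: coh_push_def ccls_def)
  from *[OF c] show "coh_push R P d Y i f (ccls R P d X i c) = ccls R P d Y i (\<lambda>u\<in>carrier (P i). f (c u))" .
  show "lin R (coh R P d X i) (coh R P d Y i) (coh_push R P d Y i f)"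
    by (rule lin_factor[OF lin_ccls[OF X] _ lin_comp[OF l lin_ccls[OF Y]]])
       (simp_all add: carrier_coh[OF X] *)
qed

end

lemma (in chain_complex) lin_coh_push':
  assumes f: "lin R X Y f"
  shows "lin R (coh R P d X i) (coh R P d Y i) (coh_push R P d Y i f)"
  using lin_coh_push[OF f] submoduleD(2)[OF module_Hom[OF module_P lin_module1[OF f]] submodule_cocyc[OF lin_module1[OF f]]]
  by blast

text \<open>If \<open>g\<close> composed with \<open>c\<close> is the coboundary of
  \<open>e\<close>, freeness lifts \<open>e\<close> through \<open>g\<close> to a cochain with
  values in \<open>Y\<close>. After subtracting the coboundary of that lift, \<open>c\<close> takes
  values in the kernel of \<open>g\<close> and hence comes from \<open>X\<close>.\<close>

lemma Ext_middle_exact: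
  assumes R: "cring R" and Q: "module R Q" and f: "lin R X Y f" "inj_on f (carrier X)"
    and g: "lin R Y Z g" "g ` carrier Y = carrier Z"
    and ker: "\<And>y. y \<in> carrier Y \<Longrightarrow> g y = \<zero>\<^bsub>Z\<^esub> \<Longrightarrow> y \<in> f ` carrier X"
    and C: "C \<in> carrier (Ext R i Q Y)" "coh_push R (res R Q) (\<lambda>_. boundary R) Z i g C = \<zero>\<^bsub>Ext R i Q Z\<^esub>"
  shows "C \<in> coh_push R (res R Q) (\<lambda>_. boundary R) Y i f ` carrier (Ext R i Q X)"
proof -
  interpret P: chain_complex R "res R Q" "\<lambda>_. boundary R" by (rule complex_res[OF R Q])
  note X = lin_module1[OF f(1)] and Y = lin_module2[OF f(1)] and Z = lin_module2[OF g(1)]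
  interpret Y: module R Y by fact
  interpret Z: module R Z by fact
  let ?P = "res R Q" and ?d = "\<lambda>_::nat. boundary R"
  obtain c where c: "c \<in> cocyc R ?P ?d Y i" "C = ccls R ?P ?d Y i c"
    using C(1) by (auto simp: Ext_eq_coh P.carrier_coh[OF Y])
  have lc: "lin R (?P i) Y c" using c by (auto simp: cocyc_def intro: mod_hom_lin P.module_P Y)
  have gc: "(\<lambda>u\<in>carrier (?P i). g (c u)) \<in> cobound R ?P ?d Z i"
    using C(2) P.ccls_zero_iff[OF Z P.post_cocyc[OF g(1) c(1)]] c by (simp add: Ext_eq_coh P.coh_push_ccls[OF g(1)])
  have "\<exists>b\<in>cobound R ?P ?d Y i. \<forall>u\<in>carrier (?P i). g (c u) = g (b u)"
  proof (cases i)
    case 0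
    have eq: "(\<lambda>u\<in>carrier (?P i). g (c u)) = (\<lambda>u\<in>carrier (?P 0). \<zero>\<^bsub>Z\<^esub>)" using gc 0 by simp
    have "g (c u) = \<zero>\<^bsub>Z\<^esub>" if "u \<in> carrier (?P i)" for u using fun_cong[OF eq, of u] that 0 by simp
    then show ?thesis using 0 by (simp add: lin_zero[OF g(1)])
  next
    case (Suc j)
    then obtain e where e: "e \<in> mod_hom R (?P j) Z"
      "(\<lambda>u\<in>carrier (?P i). g (c u)) = (\<lambda>u\<in>carrier (?P (Suc j)). e (boundary R u))" using gc by auto
    note le = mod_hom_lin[OF P.module_P Z e(1)]
    obtain k where k: "lin R (?P j) Y k" "\<And>p. p \<in> carrier (?P j) \<Longrightarrow> g (k p) = e p"
      using free_lift[OF R g(1) le[unfolded res_def]] lin_closed[OF le] g(2) unfolding res_def by blast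
    let ?b = "\<lambda>u\<in>carrier (?P (Suc j)). (\<lambda>v\<in>carrier (?P j). k v) (boundary R u)"
    have b: "?b \<in> cobound R ?P ?d Y (Suc j)"
      using cobound_SucI[where P = ?P and d = ?d and i = j, OF restrict_mod_hom[OF k(1)]] .
    have "g (c u) = g (?b u)" if u: "u \<in> carrier (?P (Suc j))" for u
      using fun_cong[OF e(2), of u] u Suc lin_closed[OF P.lin_d u] by (simp add: k(2))
    then show ?thesis using b Suc by blast
  qed
  then obtain b where b: "b \<in> cobound R ?P ?d Y i" "\<And>u. u \<in> carrier (?P i) \<Longrightarrow> g (c u) = g (b u)" by blast
  have bc: "b \<in> cocyc R ?P ?d Y i" using b(1) P.cobound_subset[OF Y, of i] by blast
  have lb: "lin R (?P i) Y b" using bc by (auto simp: cocyc_def intro: mod_hom_lin P.module_P Y)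
  have "c u \<ominus>\<^bsub>Y\<^esub> b u \<in> f ` carrier X" if u: "u \<in> carrier (?P i)" for u
  proof (rule ker)
    have cl: "c u \<in> carrier Y" "b u \<in> carrier Y" using lin_closed[OF lc u] lin_closed[OF lb u] .
    then show "c u \<ominus>\<^bsub>Y\<^esub> b u \<in> carrier Y" by simp
    show "g (c u \<ominus>\<^bsub>Y\<^esub> b u) = \<zero>\<^bsub>Z\<^esub>"
      using cl b(2)[OF u] Z.diff_zero_iff[OF lin_closed[OF g(1) cl(1)] lin_closed[OF g(1) cl(2)]]
      by (simp add: lin_diff[OF g(1)])
  qed
  from lin_lift_inj[OF f lin_minus[OF lc lb] this] obtain c' where
    c': "lin R (?P i) X c'" "\<And>u. u \<in> carrier (?P i) \<Longrightarrow> f (c' u) = c u \<ominus>\<^bsub>Y\<^esub> b u" by blast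
  \<comment> \<open>Injectivity of \<open>f\<close> carries the cocycle condition from
    \<open>Y\<close> back to \<open>X\<close>.\<close>
  have "c' (boundary R u) = \<zero>\<^bsub>X\<^esub>" if u: "u \<in> carrier (?P (Suc i))" for u
  proof (rule inj_onD[OF f(2)])
    note du = lin_closed[OF P.lin_d u]
    have "c (boundary R u) = \<zero>\<^bsub>Y\<^esub>" "b (boundary R u) = \<zero>\<^bsub>Y\<^esub>" using c(1) bc u by (auto simp: cocyc_def)
    then show "f (c' (boundary R u)) = f \<zero>\<^bsub>X\<^esub>"
      using c'(2)[OF du] Y.diff_zero_iff[of "\<zero>\<^bsub>Y\<^esub>" "\<zero>\<^bsub>Y\<^esub>"] by (simp add: lin_zero[OF f(1)])
    show "c' (boundary R u) \<in> carrier X" using lin_closed[OF c'(1) du] .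
  qed (use module_zero_closed[OF X] in simp)
  then have cc: "restrict c' (carrier (?P i)) \<in> cocyc R ?P ?d X i"
    using restrict_mod_hom[OF c'(1)] lin_closed[OF P.lin_d] by (auto simp: cocyc_def)
  have "C = coh_push R ?P ?d Y i f (ccls R ?P ?d X i (restrict c' (carrier (?P i))))"
    unfolding P.coh_push_ccls[OF f(1) cc] c(2)
  proof (rule P.ccls_eqI[OF Y c(1) P.post_cocyc[OF f(1) cc] b(1)])
    fix u assume u: "u \<in> carrier (?P i)"
    have cl: "c u \<in> carrier Y" "b u \<in> carrier Y" using lin_closed[OF lc u] lin_closed[OF lb u] .
    then show "c u = (\<lambda>u\<in>carrier (?P i). f (restrict c' (carrier (?P i)) u)) u \<oplus>\<^bsub>Y\<^esub> b u"
      using u c'(2)[OF u] by (simp add: Y.minus_eq Y.a_assoc Y.l_neg)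
  qed
  then show ?thesis using P.ccls_closed[OF X cc] by (auto simp: Ext_eq_coh)
qed


section \<open>Cofinite modules\<close>

lemma smult_kill:
  assumes "module R X" "v \<in> carrier R" "w \<in> carrier R" "x \<in> carrier X" "w \<odot>\<^bsub>X\<^esub> x = \<zero>\<^bsub>X\<^esub>"
  shows "(v \<otimes>\<^bsub>R\<^esub> w) \<odot>\<^bsub>X\<^esub> x = \<zero>\<^bsub>X\<^esub>" "(w \<otimes>\<^bsub>R\<^esub> v) \<odot>\<^bsub>X\<^esub> x = \<zero>\<^bsub>X\<^esub>"
proof -
  interpret X: module R X by fact
  show "(v \<otimes>\<^bsub>R\<^esub> w) \<odot>\<^bsub>X\<^esub> x = \<zero>\<^bsub>X\<^esub>" using assms by (simp add: X.smult_assoc1)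
  then show "(w \<otimes>\<^bsub>R\<^esub> v) \<odot>\<^bsub>X\<^esub> x = \<zero>\<^bsub>X\<^esub>" using assms X.R.m_comm[of w v] by simp
qed

lemma prime_complement:
  assumes "primeideal P R"
  shows "\<one>\<^bsub>R\<^esub> \<in> carrier R - P"
    and "\<And>v w. v \<in> carrier R - P \<Longrightarrow> w \<in> carrier R - P \<Longrightarrow> v \<otimes>\<^bsub>R\<^esub> w \<in> carrier R - P"
proof -
  interpret primeideal P R by fact
  show "\<one>\<^bsub>R\<^esub> \<in> carrier R - P" using I_notcarr one_imp_carrier by auto
  show "v \<otimes>\<^bsub>R\<^esub> w \<in> carrier R - P" if "v \<in> carrier R - P" "w \<in> carrier R - P" for v w
    using that I_prime[of v w] by auto
qed

text \<open>The localization at \<open>P\<close> is zero exactly when each element is killed by some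
  element outside \<open>P\<close>; in this form no fractions are needed from here on.\<close>

lemma Supp_subset_iff:
  assumes X: "module R X"
  shows "Supp R X \<subseteq> prime_variety R I \<longleftrightarrow>
    (\<forall>P. primeideal P R \<longrightarrow> \<not> I \<subseteq> P \<longrightarrow> (\<forall>x\<in>carrier X. \<exists>w\<in>carrier R - P. w \<odot>\<^bsub>X\<^esub> x = \<zero>\<^bsub>X\<^esub>))"
proof -
  interpret X: module R X by fact
  have "localization R P X = {loc_frac R P X \<zero>\<^bsub>X\<^esub> \<one>\<^bsub>R\<^esub>} \<longleftrightarrow>
      (\<forall>x\<in>carrier X. \<exists>w\<in>carrier R - P. w \<odot>\<^bsub>X\<^esub> x = \<zero>\<^bsub>X\<^esub>)" if P: "primeideal P R" for P
  proof
    note one = prime_complement(1)[OF P] and mult = prime_complement(2)[OF P]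
    {
      assume L: "localization R P X = {loc_frac R P X \<zero>\<^bsub>X\<^esub> \<one>\<^bsub>R\<^esub>}"
      show "\<forall>x\<in>carrier X. \<exists>w\<in>carrier R - P. w \<odot>\<^bsub>X\<^esub> x = \<zero>\<^bsub>X\<^esub>"
      proof
        fix x assume x: "x \<in> carrier X"
        have "loc_frac R P X x \<one>\<^bsub>R\<^esub> \<in> localization R P X" using x one by (auto simp: localization_def)
        then have "loc_frac R P X x \<one>\<^bsub>R\<^esub> = loc_frac R P X \<zero>\<^bsub>X\<^esub> \<one>\<^bsub>R\<^esub>" using L by simp
        moreover have "(x, \<one>\<^bsub>R\<^esub>) \<in> loc_frac R P X x \<one>\<^bsub>R\<^esub>" using x one by (auto simp: loc_frac_def)
        ultimately have "(x, \<one>\<^bsub>R\<^esub>) \<in> loc_frac R P X \<zero>\<^bsub>X\<^esub> \<one>\<^bsub>R\<^esub>" by simp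
        then obtain w where "w \<in> carrier R - P" "w \<odot>\<^bsub>X\<^esub> \<zero>\<^bsub>X\<^esub> = w \<odot>\<^bsub>X\<^esub> x"
          using x by (auto simp: loc_frac_def)
        then show "\<exists>w\<in>carrier R - P. w \<odot>\<^bsub>X\<^esub> x = \<zero>\<^bsub>X\<^esub>" by (metis DiffD1 X.smult_r_null)
      qed
    }
    assume tor: "\<forall>x\<in>carrier X. \<exists>w\<in>carrier R - P. w \<odot>\<^bsub>X\<^esub> x = \<zero>\<^bsub>X\<^esub>"
    \<comment> \<open>If every element is killed from outside \<open>P\<close>, the product of two
      killers identifies any two fractions, so there is a single class.\<close>
    have "loc_frac R P X x s = carrier X \<times> (carrier R - P)"
      if x: "x \<in> carrier X" and s: "s \<in> carrier R - P" for x s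
    proof -
      have "\<exists>w\<in>carrier R - P. w \<odot>\<^bsub>X\<^esub> (t \<odot>\<^bsub>X\<^esub> x) = w \<odot>\<^bsub>X\<^esub> (s \<odot>\<^bsub>X\<^esub> y)"
        if y: "y \<in> carrier X" and t: "t \<in> carrier R - P" for y t
      proof -
        obtain v w where v: "v \<in> carrier R - P" "v \<odot>\<^bsub>X\<^esub> (t \<odot>\<^bsub>X\<^esub> x) = \<zero>\<^bsub>X\<^esub>"
          and w: "w \<in> carrier R - P" "w \<odot>\<^bsub>X\<^esub> (s \<odot>\<^bsub>X\<^esub> y) = \<zero>\<^bsub>X\<^esub>"
          using tor x y s t X.smult_closed by (metis DiffD1)
        have "(v \<otimes>\<^bsub>R\<^esub> w) \<odot>\<^bsub>X\<^esub> (t \<odot>\<^bsub>X\<^esub> x) = \<zero>\<^bsub>X\<^esub>" "(v \<otimes>\<^bsub>R\<^esub> w) \<odot>\<^bsub>X\<^esub> (s \<odot>\<^bsub>X\<^esub> y) = \<zero>\<^bsub>X\<^esub>"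
          using smult_kill[OF X] v w x y s t by auto
        then show ?thesis using mult[OF v(1) w(1)] by (intro bexI[of _ "v \<otimes>\<^bsub>R\<^esub> w"]) auto
      qed
      then show ?thesis by (auto simp: loc_frac_def)
    qed
    then show "localization R P X = {loc_frac R P X \<zero>\<^bsub>X\<^esub> \<one>\<^bsub>R\<^esub>}"
      using one by (auto simp: localization_def intro!: exI[of _ "\<zero>\<^bsub>X\<^esub>"] exI[of _ "\<one>\<^bsub>R\<^esub>"])
  qed
  note key = this
  have Supp: "P \<in> Supp R X \<longleftrightarrow> primeideal P R \<and>
      \<not> (\<forall>x\<in>carrier X. \<exists>w\<in>carrier R - P. w \<odot>\<^bsub>X\<^esub> x = \<zero>\<^bsub>X\<^esub>)" for P
    by (cases "primeideal P R") (use key[of P] in \<open>simp_all add: Supp_def\<close>)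
  have pv: "P \<in> prime_variety R I \<longleftrightarrow> primeideal P R \<and> I \<subseteq> P" for P
    by (simp add: prime_variety_def)
  show ?thesis unfolding subset_iff[of "Supp R X"] Supp pv by meson
qed

lemma cofinite_torsion:
  assumes "cofinite_module R I X" "primeideal P R" "\<not> I \<subseteq> P" "x \<in> carrier X"
  obtains w where "w \<in> carrier R - P" "w \<odot>\<^bsub>X\<^esub> x = \<zero>\<^bsub>X\<^esub>"
proof -
  have "module R X" "Supp R X \<subseteq> prime_variety R I" using assms(1) by (auto simp: cofinite_module_def)
  then have "\<forall>P. primeideal P R \<longrightarrow> \<not> I \<subseteq> P \<longrightarrow> (\<forall>x\<in>carrier X. \<exists>w\<in>carrier R - P. w \<odot>\<^bsub>X\<^esub> x = \<zero>\<^bsub>X\<^esub>)"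
    by (simp only: Supp_subset_iff)
  then have "\<exists>w\<in>carrier R - P. w \<odot>\<^bsub>X\<^esub> x = \<zero>\<^bsub>X\<^esub>" using assms(2-4) by simp
  then show thesis using that by (elim bexE)
qed

text \<open>For the support, one element outside \<open>P\<close> moves \<open>y\<close> into the
  image of \<open>X\<close> and another kills it there; their product is outside \<open>P\<close>
  because \<open>P\<close> is prime. The Ext modules of \<open>Y\<close> sit in the middle of an
  exact sequence with finitely generated ends.\<close>

lemma cofinite_extension:
  assumes R: "cring R" "noetherian_ring R" and I: "ideal I R"
    and f: "lin R X Y f" "inj_on f (carrier X)" and g: "lin R Y Z g" "g ` carrier Y = carrier Z"
    and ker: "\<And>y. y \<in> carrier Y \<Longrightarrow> g y = \<zero>\<^bsub>Z\<^esub> \<Longrightarrow> y \<in> f ` carrier X"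
    and X: "cofinite_module R I X" and Z: "cofinite_module R I Z"
  shows "cofinite_module R I Y"
proof -
  note MX = lin_module1[OF f(1)] and MY = lin_module2[OF f(1)] and MZ = lin_module2[OF g(1)]
  interpret Y: module R Y by fact
  let ?Q = "quot_module (regular_module R) I"
  have Q: "module R ?Q"
    using module_quot[OF module_regular[OF R(1)]] I submodule_regular_iff[OF R(1)] by blast
  interpret P: chain_complex R "res R ?Q" "\<lambda>_. boundary R" by (rule complex_res[OF R(1) Q])
  have "Supp R Y \<subseteq> prime_variety R I" unfolding Supp_subset_iff[OF MY]
  proof (intro allI impI ballI)
    fix P y assume P: "primeideal P R" "\<not> I \<subseteq> P" and y: "y \<in> carrier Y"
    obtain w where w: "w \<in> carrier R - P" "w \<odot>\<^bsub>Z\<^esub> g y = \<zero>\<^bsub>Z\<^esub>"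
      by (rule cofinite_torsion[OF Z P lin_closed[OF g(1) y]])
    then have "w \<odot>\<^bsub>Y\<^esub> y \<in> f ` carrier X" using y by (intro ker) (auto simp: lin_smult[OF g(1)])
    then obtain x where x: "x \<in> carrier X" "w \<odot>\<^bsub>Y\<^esub> y = f x" by auto
    obtain v where v: "v \<in> carrier R - P" "v \<odot>\<^bsub>X\<^esub> x = \<zero>\<^bsub>X\<^esub>"
      by (rule cofinite_torsion[OF X P x(1)])
    have "(v \<otimes>\<^bsub>R\<^esub> w) \<odot>\<^bsub>Y\<^esub> y = f (v \<odot>\<^bsub>X\<^esub> x)"
      using v w x y lin_smult[OF f(1), of v x] by (simp add: Y.smult_assoc1)
    then show "\<exists>w\<in>carrier R - P. w \<odot>\<^bsub>Y\<^esub> y = \<zero>\<^bsub>Y\<^esub>"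
      using v prime_complement(2)[OF P(1) v(1) w(1)] by (auto simp: lin_zero[OF f(1)])
  qed
  moreover have "fin_gen R (Ext R i ?Q Y)" for i
    by (rule fin_gen_middle[OF R P.lin_coh_push'[OF f(1), of i, folded Ext_eq_coh]
          P.lin_coh_push'[OF g(1), of i, folded Ext_eq_coh]])
       (use Ext_middle_exact[OF R(1) Q f g ker, of _ i] X Z in \<open>auto simp: cofinite_module_def\<close>)
  ultimately show ?thesis using MY by (simp add: cofinite_module_def)
qed

lemma cofinite_zero:
  assumes R: "cring R" and I: "ideal I R" and Z: "module R Z" "carrier Z = {\<zero>\<^bsub>Z\<^esub>}"
  shows "cofinite_module R I Z"
proof -
  interpret Z: module R Z by fact
  let ?Q = "quot_module (regular_module R) I"
  have Q: "module R ?Q"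
    using module_quot[OF module_regular[OF R(1)]] I submodule_regular_iff[OF R(1)] by blast
  interpret P: chain_complex R "res R ?Q" "\<lambda>_. boundary R" by (rule complex_res[OF R(1) Q])
  have "Supp R Z \<subseteq> prime_variety R I"
    unfolding Supp_subset_iff[OF Z(1)] using Z(2) prime_complement(1) by fastforce
  moreover have "fin_gen R (Ext R i ?Q Z)" for i
  proof -
    have "c = (\<lambda>u\<in>carrier (res R ?Q i). \<zero>\<^bsub>Z\<^esub>)" if "c \<in> cocyc R (res R ?Q) (\<lambda>_. boundary R) Z i" for c
    proof (rule mod_hom_ext)
      show "c \<in> mod_hom R (res R ?Q i) Z" using that by (simp add: cocyc_def)
      show "(\<lambda>u\<in>carrier (res R ?Q i). \<zero>\<^bsub>Z\<^esub>) \<in> mod_hom R (res R ?Q i) Z"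
        by (rule restrict_mod_hom[OF lin_const_zero[OF P.module_P Z(1)]])
      fix u assume u: "u \<in> carrier (res R ?Q i)"
      have "c u \<in> carrier Z"
        using that u lin_closed[OF mod_hom_lin[OF P.module_P Z(1)]] by (auto simp: cocyc_def)
      then show "c u = (\<lambda>u\<in>carrier (res R ?Q i). \<zero>\<^bsub>Z\<^esub>) u" using Z(2) u by simp
    qed
    then have "carrier (Ext R i ?Q Z) \<subseteq> {ccls R (res R ?Q) (\<lambda>_. boundary R) Z i (\<lambda>u\<in>carrier (res R ?Q i). \<zero>\<^bsub>Z\<^esub>)}"
      unfolding Ext_eq_coh P.carrier_coh[OF Z(1)] by auto
    then have "carrier (Ext R i ?Q Z) = {\<zero>\<^bsub>Ext R i ?Q Z\<^esub>}"
      using module_zero_closed[OF P.module_coh[OF Z(1), of i]] unfolding Ext_eq_coh by blast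
    then show ?thesis using fin_gen_zero P.module_coh[OF Z(1), of i] by (simp add: Ext_eq_coh)
  qed
  ultimately show ?thesis using Z by (simp add: cofinite_module_def)
qed

text \<open>An isomorphism presents \<open>Y\<close> as an extension with zero quotient. This moves
  cofiniteness between modules whose carriers have different types.\<close>

lemma cofinite_iso:
  assumes R: "cring R" "noetherian_ring R" and I: "ideal I R"
    and f: "lin R X Y f" "inj_on f (carrier X)" "f ` carrier X = carrier Y" and X: "cofinite_module R I X"
  shows "cofinite_module R I Y"
proof -
  note MY = lin_module2[OF f(1)]
  let ?Z = "Y\<lparr>carrier := {\<zero>\<^bsub>Y\<^esub>}\<rparr>"
  have Z: "module R ?Z" by (rule submodule_module[OF MY submodule_zero[OF MY]])
  have g: "lin R Y ?Z (\<lambda>_. \<zero>\<^bsub>Y\<^esub>)" using lin_const_zero[OF MY Z] by simp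
  show ?thesis
    by (rule cofinite_extension[OF R I f(1,2) g _ _ X cofinite_zero[OF R(1) I Z]])
       (use f(3) module_zero_closed[OF MY] in auto)
qed


section \<open>Torsion\<close>

text \<open>This is \<open>(0 :_X I^n)\<close>, built by one factor \<open>I\<close> at a time, so
  that inductions on \<open>n\<close> multiply by single elements of \<open>I\<close>.\<close>

primrec tor :: "('a, 'r) ring_scheme \<Rightarrow> 'a set \<Rightarrow> ('a, 'x) module \<Rightarrow> nat \<Rightarrow> 'x set" where
  "tor R I X 0 = {\<zero>\<^bsub>X\<^esub>}"
| "tor R I X (Suc n) = {x \<in> carrier X. \<forall>a\<in>I. a \<odot>\<^bsub>X\<^esub> x \<in> tor R I X n}"

lemma submodule_tor:
  assumes X: "module R X" and I: "I \<subseteq> carrier R"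
  shows "submodule (tor R I X n) R X"
proof (induction n)
  case 0
  then show ?case by (simp add: submodule_zero[OF X])
next
  case (Suc n)
  interpret X: module R X by fact
  note D = submoduleD[OF X Suc]
  have "a \<odot>\<^bsub>X\<^esub> (r \<odot>\<^bsub>X\<^esub> x) \<in> tor R I X n"
    if "a \<in> I" "r \<in> carrier R" "x \<in> carrier X" "a \<odot>\<^bsub>X\<^esub> x \<in> tor R I X n" for a r x
  proof -
    have "a \<odot>\<^bsub>X\<^esub> (r \<odot>\<^bsub>X\<^esub> x) = r \<odot>\<^bsub>X\<^esub> (a \<odot>\<^bsub>X\<^esub> x)"
      using that I X.R.m_comm[of a r] by (auto simp: X.smult_assoc1[symmetric])
    then show ?thesis using D(4) that by simp
  qed
  then show ?case using I D
    by (intro submodule_intro[OF X]) (auto simp: X.smult_r_distr subset_iff)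
qed

lemma tor_mono:
  assumes X: "module R X" and I: "I \<subseteq> carrier R" and "n \<le> m"
  shows "tor R I X n \<subseteq> tor R I X m"
proof -
  have "tor R I X n \<subseteq> tor R I X (Suc n)" for n
  proof (induction n)
    case 0
    interpret X: module R X by fact
    show ?case using I by auto
  next
    case (Suc n)
    then show ?case by auto
  qed
  then show ?thesis using \<open>n \<le> m\<close> by (rule lift_Suc_mono_le)
qed

text \<open>The products of \<open>y\<close> with finitely many generators of \<open>I\<close> are
  torsion; one exponent serves all of them, and the next one serves \<open>y\<close>.\<close>

lemma tor_step:
  assumes X: "module R X" and I: "I \<subseteq> carrier R"
    and A: "finite A" "A \<subseteq> I" and y: "y \<in> carrier X"
    and AI: "\<And>J. submodule J R (regular_module R) \<Longrightarrow> A \<subseteq> J \<Longrightarrow> I \<subseteq> J"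
    and tors: "\<And>a. a \<in> A \<Longrightarrow> \<exists>n. a \<odot>\<^bsub>X\<^esub> y \<in> tor R I X n"
  shows "\<exists>n. y \<in> tor R I X n"
proof -
  have "\<exists>n. \<forall>a\<in>B. a \<odot>\<^bsub>X\<^esub> y \<in> tor R I X n" if "B \<subseteq> A" "finite B" for B
    using that(2,1)
  proof induction
    case (insert a B)
    then obtain n where "\<forall>a\<in>B. a \<odot>\<^bsub>X\<^esub> y \<in> tor R I X n" by auto
    moreover obtain m where "a \<odot>\<^bsub>X\<^esub> y \<in> tor R I X m" using tors[of a] insert.prems by auto
    ultimately show ?case
      using tor_mono[OF X I, of n "max n m"] tor_mono[OF X I, of m "max n m"]
      by (intro exI[of _ "max n m"]) auto
  qed simp
  then obtain n where n: "\<forall>a\<in>A. a \<odot>\<^bsub>X\<^esub> y \<in> tor R I X n" using A by blast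
  have "I \<subseteq> {r \<in> carrier (regular_module R). r \<odot>\<^bsub>X\<^esub> y \<in> tor R I X n}"
    by (rule AI[OF submodule_vimage[OF lin_multiples[OF X y] submodule_tor[OF X I]]]) (use A I n in auto)
  then show ?thesis using y by (intro exI[of _ "Suc n"]) auto
qed

text \<open>A maximal member \<open>P\<close> of the set of ideals \<open>(X\<^sub>\<infinity> : y)\<close>, where \<open>X\<^sub>\<infinity>\<close> is the union of the
  \<open>tor R I X n\<close> and \<open>y\<close> lies outside it, is a prime ideal not containing \<open>I\<close>.\<close>

lemma torsion_exhaustion:
  assumes R: "cring R" "noetherian_ring R" and I: "ideal I R" and X: "module R X"
    and loc: "\<And>P x. primeideal P R \<Longrightarrow> \<not> I \<subseteq> P \<Longrightarrow> x \<in> carrier X \<Longrightarrow>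
      \<exists>w\<in>carrier R - P. w \<odot>\<^bsub>X\<^esub> x = \<zero>\<^bsub>X\<^esub>"
  shows "carrier X = (\<Union>n. tor R I X n)"
proof -
  interpret X: module R X by fact
  have IR: "I \<subseteq> carrier R" using I by (simp add: ideal.axioms(1) additive_subgroup.a_subset)
  define T where "T = (\<Union>n. tor R I X n)"
  note ts = submodule_tor[OF X IR]
  note D = submoduleD[OF X ts]
  have T: "submodule T R X"
  proof (rule submodule_intro[OF X])
    show "T \<subseteq> carrier X" using D(1) by (auto simp: T_def)
    show "\<zero>\<^bsub>X\<^esub> \<in> T" using D(2) by (auto simp: T_def)
  next
    fix x y assume "x \<in> T" "y \<in> T"
    then obtain n m where "x \<in> tor R I X n" "y \<in> tor R I X m" by (auto simp: T_def)
    then have "x \<in> tor R I X (max n m)" "y \<in> tor R I X (max n m)"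
      using tor_mono[OF X IR, of n "max n m"] tor_mono[OF X IR, of m "max n m"] by auto
    then have "x \<oplus>\<^bsub>X\<^esub> y \<in> tor R I X (max n m)" by (rule D(3))
    then show "x \<oplus>\<^bsub>X\<^esub> y \<in> T" unfolding T_def by blast
  next
    fix r x assume "r \<in> carrier R" "x \<in> T"
    then show "r \<odot>\<^bsub>X\<^esub> x \<in> T" using D(4) unfolding T_def by blast
  qed
  note TD = submoduleD[OF X T]
  obtain A where A: "finite A" "A \<subseteq> I" "\<And>J. submodule J R (regular_module R) \<Longrightarrow> A \<subseteq> J \<Longrightarrow> I \<subseteq> J"
    using noetherian_ideal[OF R] I submodule_regular_iff[OF R(1)] by blast
  define ann where "ann y = {r \<in> carrier R. r \<odot>\<^bsub>X\<^esub> y \<in> T}" for y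
  have ann: "submodule (ann y) R (regular_module R)" if "y \<in> carrier X" for y
    using submodule_vimage[OF lin_multiples[OF X that] T] by (simp add: ann_def)
  have "carrier X \<subseteq> T"
  proof (rule ccontr)
    assume "\<not> carrier X \<subseteq> T"
    then have ne: "ann ` (carrier X - T) \<noteq> {}" by auto
    obtain P where P: "P \<in> ann ` (carrier X - T)" "\<And>Q. Q \<in> ann ` (carrier X - T) \<Longrightarrow> P \<subseteq> Q \<Longrightarrow> Q = P"
      using maximal_submodule[OF R module_regular[OF R(1)] fin_gen_regular[OF R(1)] ne] ann by blast
    then obtain y where y: "y \<in> carrier X" "y \<notin> T" "P = ann y" by auto
    have idP: "ideal P R" using ann y submodule_regular_iff[OF R(1)] by auto
    have "primeideal P R"
    proof (rule primeidealI[OF idP R(1)])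
      have "\<one>\<^bsub>R\<^esub> \<notin> P" using y by (simp add: ann_def)
      then show "carrier R \<noteq> P" by auto
      fix a b assume ab: "a \<in> carrier R" "b \<in> carrier R" "a \<otimes>\<^bsub>R\<^esub> b \<in> P"
      show "a \<in> P \<or> b \<in> P"
      proof (rule disjCI)
        assume "b \<notin> P"
        then have byT: "b \<odot>\<^bsub>X\<^esub> y \<in> carrier X - T" using ab y by (auto simp: ann_def)
        \<comment> \<open>Since \<open>b y\<close> is again outside \<open>T\<close>, maximality
          turns this inclusion into an equality, and \<open>a\<close> lies in the right-hand
          side.\<close>
        have "P \<subseteq> ann (b \<odot>\<^bsub>X\<^esub> y)"
        proof
          fix r assume r: "r \<in> P"
          then have rR: "r \<in> carrier R" "r \<odot>\<^bsub>X\<^esub> y \<in> T" by (auto simp: y ann_def)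
          have "r \<odot>\<^bsub>X\<^esub> (b \<odot>\<^bsub>X\<^esub> y) = b \<odot>\<^bsub>X\<^esub> (r \<odot>\<^bsub>X\<^esub> y)"
            using rR ab y X.R.m_comm[of r b] by (simp add: X.smult_assoc1[symmetric])
          then show "r \<in> ann (b \<odot>\<^bsub>X\<^esub> y)" using rR ab TD(4) by (simp add: ann_def)
        qed
        then have "ann (b \<odot>\<^bsub>X\<^esub> y) = P" using P(2) byT by blast
        moreover have "a \<in> ann (b \<odot>\<^bsub>X\<^esub> y)" using ab y by (simp add: ann_def X.smult_assoc1)
        ultimately show "a \<in> P" by simp
      qed
    qed
    moreover have "\<not> I \<subseteq> P"
    proof
      assume IP: "I \<subseteq> P"
      have tors: "\<exists>n. a \<odot>\<^bsub>X\<^esub> y \<in> tor R I X n" if "a \<in> A" for a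
        using that A(2) IP y(3) by (auto simp: ann_def T_def)
      have "\<exists>n. y \<in> tor R I X n"
        by (rule tor_step[OF X IR A(1,2) y(1)]) (rule A(3), assumption+, rule tors)
      then show False using y by (auto simp: T_def)
    qed
    \<comment> \<open>Zero lies in \<open>T\<close>, so any \<open>w\<close> that kills
      \<open>y\<close> belongs to \<open>ann y = P\<close>, whereas \<open>loc\<close> supplies one
      outside \<open>P\<close>.\<close>
    ultimately obtain w where "w \<in> carrier R - P" "w \<odot>\<^bsub>X\<^esub> y = \<zero>\<^bsub>X\<^esub>" using loc y(1) by blast
    then show False using TD(2) by (auto simp: y ann_def)
  qed
  then show ?thesis using TD(1) by (auto simp: T_def)
qed

lemma quot_lift:
  assumes f: "lin R M N f" and K: "submodule K R M" and fK: "\<And>x. x \<in> K \<Longrightarrow> f x = \<zero>\<^bsub>N\<^esub>"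
  obtains h where "lin R (quot_module M K) N h" "\<And>x. x \<in> carrier M \<Longrightarrow> h (K +>\<^bsub>M\<^esub> x) = f x"
proof -
  note M = lin_module1[OF f]
  interpret M: module R M by fact
  interpret N: module R N by (rule lin_module2[OF f])
  have eq: "f x = f y" if "x \<in> carrier M" "y \<in> carrier M" "K +>\<^bsub>M\<^esub> x = K +>\<^bsub>M\<^esub> y" for x y
  proof -
    have "f (x \<ominus>\<^bsub>M\<^esub> y) = \<zero>\<^bsub>N\<^esub>" using that rcoset_eq_iff[OF M K] by (intro fK) auto
    then show ?thesis
      using that N.diff_zero_iff[OF lin_closed[OF f that(1)] lin_closed[OF f that(2)]] by (simp add: lin_diff[OF f])
  qed
  define h where "h C = f (SOME x. x \<in> carrier M \<and> C = K +>\<^bsub>M\<^esub> x)" for C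
  have h: "h (K +>\<^bsub>M\<^esub> x) = f x" if "x \<in> carrier M" for x
  proof -
    have "\<exists>y. y \<in> carrier M \<and> K +>\<^bsub>M\<^esub> x = K +>\<^bsub>M\<^esub> y" using that by blast
    from someI_ex[OF this] show ?thesis unfolding h_def using eq[OF that] by metis
  qed
  have "lin R (quot_module M K) N h"
    by (rule lin_factor[OF lin_quot[OF M K] _ f h]) (simp_all add: quot_module_simps)
  with h show thesis using that by blast
qed

text \<open>\<open>(0 :_X I)\<close> is \<open>Hom(R/I, X)\<close>, which is Ext in degree 0.
  Concretely, a cocycle of degree 0 is evaluated at the basis vector of the class of 1, and this
  maps the cocycles onto \<open>(0 :_X I)\<close>.\<close>

lemma fin_gen_tor_1:
  assumes R: "cring R" "noetherian_ring R" and I: "ideal I R" and X: "cofinite_module R I X"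
  shows "fin_gen R (X\<lparr>carrier := tor R I X (Suc 0)\<rparr>)"
proof -
  let ?G = "regular_module R"
  let ?Q = "quot_module ?G I"
  let ?P = "res R ?Q" and ?d = "\<lambda>_::nat. boundary R"
  have MX: "module R X" using X by (simp add: cofinite_module_def)
  interpret X: module R X by fact
  note G = module_regular[OF R(1)]
  have IR: "I \<subseteq> carrier R" using I by (simp add: ideal.axioms(1) additive_subgroup.a_subset)
  have Is: "submodule I R ?G" using I submodule_regular_iff[OF R(1)] by blast
  note Q = module_quot[OF G Is]
  interpret Q: module R ?Q by (rule Q)
  interpret P: chain_complex R ?P ?d by (rule complex_res[OF R(1) Q])
  let ?Z = "cocyc_module R ?P ?d X 0"
  have lz: "lin R (?Z\<lparr>carrier := {\<zero>\<^bsub>?Z\<^esub>}\<rparr>) ?Z (\<lambda>x. x)"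
    using lin_submodule[OF lin_ident submodule_zero] P.module_cocyc[OF MX] by blast
  \<comment> \<open>In degree 0 the only coboundary is zero, so the cocycles inherit finite
    generation from Ext.\<close>
  have "fin_gen R ?Z"
  proof (rule fin_gen_middle[OF R lz P.lin_ccls[OF MX]])
    show "fin_gen R (?Z\<lparr>carrier := {\<zero>\<^bsub>?Z\<^esub>}\<rparr>)"
      using fin_gen_zero[OF lin_module1[OF lz]] by simp
    show "fin_gen R (coh R ?P ?d X 0)" using X by (simp add: cofinite_module_def Ext_eq_coh)
    fix c assume c: "c \<in> carrier ?Z" "ccls R ?P ?d X 0 c = \<zero>\<^bsub>coh R ?P ?d X 0\<^esub>"
    then have "c \<in> cobound R ?P ?d X 0" using P.ccls_zero_iff[OF MX, of c 0] by simp
    then show "c \<in> (\<lambda>x. x) ` carrier (?Z\<lparr>carrier := {\<zero>\<^bsub>?Z\<^esub>}\<rparr>)" by simp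
  qed
  let ?u = "unit_vec R (Gen (I +>\<^bsub>?G\<^esub> \<one>\<^bsub>R\<^esub>))"
  have 1: "I +>\<^bsub>?G\<^esub> \<one>\<^bsub>R\<^esub> \<in> carrier ?Q" by (simp add: quot_module_simps)
  have u: "?u \<in> carrier (?P 0)" by (rule unit_gen[OF R(1) Q 1])
  have ev: "lin R (Hom_module R (?P 0) X) X (\<lambda>c. c ?u)"
    using u lin_closed[OF mod_hom_lin[OF P.module_P MX]]
    by (intro linI module_Hom P.module_P MX) auto
  have lin_c: "lin R (?P 0) X c" if "c \<in> cocyc R ?P ?d X 0" for c
    using that mod_hom_lin[OF P.module_P MX] by (simp add: cocyc_def)
  interpret P0: module R "?P 0" by (rule P.module_P)
  have in_tor: "c ?u \<in> tor R I X (Suc 0)" if c: "c \<in> cocyc R ?P ?d X 0" for c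
  proof -
    \<comment> \<open>The product of \<open>a\<close> with the basis vector of the class of 1 has
      augmentation zero, hence is a boundary, and \<open>c\<close> vanishes on boundaries.\<close>
    have "a \<odot>\<^bsub>X\<^esub> c ?u = \<zero>\<^bsub>X\<^esub>" if a: "a \<in> I" for a
    proof -
      have aR: "a \<in> carrier R" using a IR by auto
      have "augmentation R ?Q (a \<odot>\<^bsub>?P 0\<^esub> ?u) = a \<odot>\<^bsub>?Q\<^esub> (I +>\<^bsub>?G\<^esub> \<one>\<^bsub>R\<^esub>)"
        using lin_smult[OF lin_augmentation[OF R(1) Q] aR u] augmentation_unit[OF R(1) Q 1] by simp
      also have "\<dots> = I +>\<^bsub>?G\<^esub> a" using quot_smult[OF G Is aR, of "\<one>\<^bsub>R\<^esub>"] aR by simp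
      also have "\<dots> = \<zero>\<^bsub>?Q\<^esub>" using rcoset_eq_iff_zero[OF G Is, of a] a aR by (simp add: quot_module_simps)
      finally have "is_cycle R ?Q 0 (a \<odot>\<^bsub>?P 0\<^esub> ?u)" by (simp add: is_cycle_def)
      then obtain v where v: "v \<in> carrier (?P (Suc 0))" "a \<odot>\<^bsub>?P 0\<^esub> ?u = boundary R v"
        using res_exact[OF R(1) Q, of "a \<odot>\<^bsub>?P 0\<^esub> ?u" 0] aR u by blast
      have "a \<odot>\<^bsub>X\<^esub> c ?u = c (boundary R v)" using lin_smult[OF lin_c[OF c] aR u] v by simp
      then show ?thesis using c v by (simp add: cocyc_def)
    qed
    then show ?thesis using lin_closed[OF lin_c[OF c] u] by simp
  qed
  have ev': "lin R ?Z (X\<lparr>carrier := tor R I X (Suc 0)\<rparr>) (\<lambda>c. c ?u)"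
    using in_tor by (intro lin_into_submodule[OF lin_submodule[OF ev P.submodule_cocyc[OF MX]] submodule_tor[OF MX IR]]) simp
  show ?thesis
  proof (rule fin_gen_image[OF ev' _ \<open>fin_gen R ?Z\<close>])
    have "x \<in> (\<lambda>c. c ?u) ` cocyc R ?P ?d X 0" if x: "x \<in> tor R I X (Suc 0)" for x
    proof -
      have xX: "x \<in> carrier X" and Ix: "\<And>a. a \<in> I \<Longrightarrow> a \<odot>\<^bsub>X\<^esub> x = \<zero>\<^bsub>X\<^esub>" using x by auto
      obtain h where h: "lin R ?Q X h" "\<And>r. r \<in> carrier ?G \<Longrightarrow> h (I +>\<^bsub>?G\<^esub> r) = r \<odot>\<^bsub>X\<^esub> x"
        using quot_lift[OF lin_multiples[OF MX xX] Is Ix] by blast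
      let ?c = "\<lambda>u\<in>carrier (?P 0). h (augmentation R ?Q u)"
      have "?c \<in> mod_hom R (?P 0) X"
        by (rule restrict_mod_hom[OF lin_comp[OF lin_augmentation[OF R(1) Q] h(1)]])
      then have "?c \<in> cocyc R ?P ?d X 0"
        using lin_closed[OF P.lin_d[of 0]] by (simp add: cocyc_def augmentation_boundary[OF R(1) Q] lin_zero[OF h(1)])
      moreover have "?c ?u = x" using u h(2)[of "\<one>\<^bsub>R\<^esub>"] xX by (simp add: augmentation_unit[OF R(1) Q 1])
      ultimately show ?thesis by (metis (no_types, lifting) image_eqI)
    qed
    then show "(\<lambda>c. c ?u) ` carrier ?Z = carrier (X\<lparr>carrier := tor R I X (Suc 0)\<rparr>)" using in_tor by auto
  qed
qed

text \<open>Let \<open>A\<close> generate \<open>I\<close>. Multiplication by one generator maps the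
  part of \<open>tor R I X (Suc n)\<close> killed by \<open>B\<close> into
  \<open>tor R I X n\<close>, with kernel the part killed by one generator more. The part killed by
  all of \<open>A\<close> is \<open>tor R I X (Suc 0)\<close>, and from there generators are dropped
  one by one.\<close>

lemma fin_gen_tor:
  assumes R: "cring R" "noetherian_ring R" and I: "ideal I R" and X: "cofinite_module R I X"
  shows "fin_gen R (X\<lparr>carrier := tor R I X n\<rparr>)"
proof (induction n)
  case 0
  have MX: "module R X" using X by (simp add: cofinite_module_def)
  show ?case using fin_gen_zero[OF submodule_module[OF MX submodule_zero[OF MX]]] by simp
next
  case (Suc n)
  have MX: "module R X" using X by (simp add: cofinite_module_def)
  interpret X: module R X by fact
  have IR: "I \<subseteq> carrier R" using I by (simp add: ideal.axioms(1) additive_subgroup.a_subset)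
  note ts = submodule_tor[OF MX IR]
  obtain A where A: "finite A" "A \<subseteq> I" "\<And>J. submodule J R (regular_module R) \<Longrightarrow> A \<subseteq> J \<Longrightarrow> I \<subseteq> J"
    using noetherian_ideal[OF R] I submodule_regular_iff[OF R(1)] by blast
  let ?K = "\<lambda>B. {x \<in> tor R I X (Suc n). \<forall>a\<in>B. a \<odot>\<^bsub>X\<^esub> x = \<zero>\<^bsub>X\<^esub>}"
  have K: "submodule (?K B) R X" if "B \<subseteq> I" for B
  proof (cases "B = {}")
    case True
    then show ?thesis using ts[of "Suc n"] by simp
  next
    case False
    have "?K B = \<Inter> ((\<lambda>a. tor R I X (Suc n) \<inter> {x \<in> carrier X. a \<odot>\<^bsub>X\<^esub> x = \<zero>\<^bsub>X\<^esub>}) ` B)"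
      using False by auto
    also have "submodule \<dots> R X"
      using False that IR
      by (intro submodule_Inter[OF MX])
          (auto intro!: submodule_Int[OF MX ts] submodule_kernel[OF lin_scalar[OF MX]] simp del: tor.simps)
    finally show ?thesis .
  qed
  have "fin_gen R (X\<lparr>carrier := ?K B\<rparr>) \<Longrightarrow> fin_gen R (X\<lparr>carrier := ?K {}\<rparr>)" if "finite B" "B \<subseteq> I" for B
    using that
  proof induction
    case (insert a B)
    have a: "a \<in> I" "a \<in> carrier R" and B: "B \<subseteq> I" using insert.prems IR by auto
    note K1 = K[OF insert.prems(2)] and K2 = K[OF B]
    have "?K (insert a B) \<subseteq> ?K B" by auto
    then have \<alpha>: "lin R (X\<lparr>carrier := ?K (insert a B)\<rparr>) (X\<lparr>carrier := ?K B\<rparr>) (\<lambda>x. x)"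
      by (intro lin_into_submodule[OF lin_submodule[OF lin_ident[OF MX] K1] K2]) auto
    have \<beta>: "lin R (X\<lparr>carrier := ?K B\<rparr>) (X\<lparr>carrier := tor R I X n\<rparr>) (\<lambda>x. a \<odot>\<^bsub>X\<^esub> x)"
      using a by (intro lin_into_submodule[OF lin_submodule[OF lin_scalar[OF MX a(2)] K2] ts]) auto
    have "fin_gen R (X\<lparr>carrier := ?K B\<rparr>)"
      by (rule fin_gen_middle[OF R \<alpha> \<beta> _ insert.prems(1) Suc]) auto
    then show ?case by (rule insert.IH) (rule B)
  qed
  moreover have "?K A = tor R I X (Suc 0)"
  proof
    show "tor R I X (Suc 0) \<subseteq> ?K A" using tor_mono[OF MX IR, of "Suc 0" "Suc n"] A(2) by auto
    show "?K A \<subseteq> tor R I X (Suc 0)"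
    proof
      fix x assume x: "x \<in> ?K A"
      then have xX: "x \<in> carrier X" using submoduleD(1)[OF MX ts[of "Suc n"]] by auto
      have "I \<subseteq> {r \<in> carrier (regular_module R). r \<odot>\<^bsub>X\<^esub> x \<in> {\<zero>\<^bsub>X\<^esub>}}"
        by (rule A(3)[OF submodule_vimage[OF lin_multiples[OF MX xX] submodule_zero[OF MX]]])
           (use x A(2) IR in auto)
      then show "x \<in> tor R I X (Suc 0)" using xX by auto
    qed
  qed
  ultimately show ?case using fin_gen_tor_1[OF R I X] A(1,2) by (simp del: tor.simps)
qed


section \<open>Cofinite modules with carrier in the type of lists\<close>

text \<open>Finite lists of coefficients against a sequence of generators: this is how
  \<open>'a list\<close> comes to cover every countably generated module.\<close>

primrec lincomb :: "('a, 'x) module \<Rightarrow> (nat \<Rightarrow> 'x) \<Rightarrow> 'a list \<Rightarrow> 'x" where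
  "lincomb X s [] = \<zero>\<^bsub>X\<^esub>"
| "lincomb X s (r # rs) = r \<odot>\<^bsub>X\<^esub> s 0 \<oplus>\<^bsub>X\<^esub> lincomb X (\<lambda>n. s (Suc n)) rs"

lemma span_lincomb:
  assumes X: "module R X" and s: "\<And>n. s n \<in> carrier X"
  shows "module_span R X (range s) \<subseteq> lincomb X s ` lists (carrier R)"
proof (rule span_least)
  interpret X: module R X by fact
  have cl: "lincomb X s rs \<in> carrier X" if "rs \<in> lists (carrier R)" "\<And>n. s n \<in> carrier X" for rs s
    using that by (induction rs arbitrary: s) auto
  show "submodule (lincomb X s ` lists (carrier R)) R X"
  proof (rule submodule_intro[OF X])
    show "lincomb X s ` lists (carrier R) \<subseteq> carrier X" using cl s by auto
    have "lincomb X s [] = \<zero>\<^bsub>X\<^esub>" by simp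
    then show "\<zero>\<^bsub>X\<^esub> \<in> lincomb X s ` lists (carrier R)" by (metis image_eqI lists.Nil)
  next
    \<comment> \<open>Lists of different lengths are added as if padded with zeros. Both lists
      shrink together while the sequence is shifted, so the claim is needed for all
      \<open>s\<close>.\<close>
    have sum: "\<exists>ts\<in>lists (carrier R). lincomb X s rs \<oplus>\<^bsub>X\<^esub> lincomb X s qs = lincomb X s ts"
      if "rs \<in> lists (carrier R)" "qs \<in> lists (carrier R)" "\<And>n. s n \<in> carrier X" for rs qs s
      using that
    proof (induction rs arbitrary: qs s rule: list.induct)
      case Nil
      then show ?case using cl[of qs s] by (intro bexI[of _ qs]) auto
    next
      case (Cons r rs)
      have sX: "\<And>n. s n \<in> carrier X" and rrs: "r # rs \<in> lists (carrier R)" and qsR: "qs \<in> lists (carrier R)"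
        using Cons.prems by auto
      show ?case
      proof (cases qs)
        case Nil
        have "lincomb X s (r # rs) \<oplus>\<^bsub>X\<^esub> lincomb X s qs = lincomb X s (r # rs)"
          using X.M.r_zero[OF cl[OF rrs sX]] by (simp only: Nil lincomb.simps(1))
        then show ?thesis using rrs by blast
      next
        case q: (Cons q qs')
        have m: "rs \<in> lists (carrier R)" "qs' \<in> lists (carrier R)" "r \<in> carrier R" "q \<in> carrier R"
          using rrs qsR q by auto
        let ?s = "\<lambda>n. s (Suc n)"
        obtain ts where ts: "ts \<in> lists (carrier R)"
          "lincomb X ?s rs \<oplus>\<^bsub>X\<^esub> lincomb X ?s qs' = lincomb X ?s ts"
          using Cons.IH[OF m(1,2), of ?s] sX by blast
        have c: "lincomb X ?s rs \<in> carrier X" "lincomb X ?s qs' \<in> carrier X" using cl m sX by auto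
        have "lincomb X s (r # rs) \<oplus>\<^bsub>X\<^esub> lincomb X s qs =
            (r \<odot>\<^bsub>X\<^esub> s 0 \<oplus>\<^bsub>X\<^esub> q \<odot>\<^bsub>X\<^esub> s 0) \<oplus>\<^bsub>X\<^esub> (lincomb X ?s rs \<oplus>\<^bsub>X\<^esub> lincomb X ?s qs')"
          using c m sX q by (simp add: X.M.add.m_ac)
        also have "\<dots> = lincomb X s ((r \<oplus>\<^bsub>R\<^esub> q) # ts)"
          using m sX by (simp add: ts(2) X.smult_l_distr)
        finally show ?thesis using ts(1) m by (intro bexI[of _ "(r \<oplus>\<^bsub>R\<^esub> q) # ts"]) auto
      qed
    qed
    fix x y assume "x \<in> lincomb X s ` lists (carrier R)" "y \<in> lincomb X s ` lists (carrier R)"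
    then obtain rs qs where rq: "rs \<in> lists (carrier R)" "qs \<in> lists (carrier R)"
      and xy: "x = lincomb X s rs" "y = lincomb X s qs" by blast
    obtain ts where "ts \<in> lists (carrier R)" "lincomb X s rs \<oplus>\<^bsub>X\<^esub> lincomb X s qs = lincomb X s ts"
      using sum[of rs qs s] rq s by blast
    then show "x \<oplus>\<^bsub>X\<^esub> y \<in> lincomb X s ` lists (carrier R)" using xy by simp
  next
    have scale: "r \<odot>\<^bsub>X\<^esub> lincomb X s rs = lincomb X s (map (\<lambda>q. r \<otimes>\<^bsub>R\<^esub> q) rs)"
      if "r \<in> carrier R" "rs \<in> lists (carrier R)" "\<And>n. s n \<in> carrier X" for r rs s
      using that by (induction rs arbitrary: s) (auto simp: X.smult_r_distr X.smult_assoc1 cl)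
    fix r x assume r: "r \<in> carrier R" and "x \<in> lincomb X s ` lists (carrier R)"
    then obtain rs where rs: "rs \<in> lists (carrier R)" "x = lincomb X s rs" by blast
    have "map (\<lambda>q. r \<otimes>\<^bsub>R\<^esub> q) rs \<in> lists (carrier R)" using r rs(1) by auto
    then show "r \<odot>\<^bsub>X\<^esub> x \<in> lincomb X s ` lists (carrier R)"
      unfolding rs(2) scale[OF r rs(1) s] by (rule imageI)
  qed
  \<comment> \<open>The list with a one behind \<open>n\<close> zeros picks out the generator with
    index \<open>n\<close>.\<close>
  have unit: "lincomb X s (replicate n \<zero>\<^bsub>R\<^esub> @ [\<one>\<^bsub>R\<^esub>]) = s n" if "\<And>n. s n \<in> carrier X" for n s
    using that by (induction n arbitrary: s) auto
  have "replicate n \<zero>\<^bsub>R\<^esub> @ [\<one>\<^bsub>R\<^esub>] \<in> lists (carrier R)" for n by (auto simp: in_lists_conv_set)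
  from imageI[OF this, of "lincomb X s"] show "range s \<subseteq> lincomb X s ` lists (carrier R)"
    unfolding unit[OF s] by auto
qed

text \<open>\<open>X\<close> is the union of its finitely generated submodules
  \<open>tor R I X n\<close>, so countably many generators suffice, and each element can be assigned
  a list of coefficients.\<close>

lemma cofinite_inj_list:
  fixes R :: "('a, 'r) ring_scheme" and X :: "('a, 'x) module"
  assumes R: "cring R" "noetherian_ring R" and I: "ideal I R" and X: "cofinite_module R I X"
  obtains e :: "'x \<Rightarrow> 'a list" where "inj_on e (carrier X)"
proof -
  have MX: "module R X" using X by (simp add: cofinite_module_def)
  have IR: "I \<subseteq> carrier R" using I by (simp add: ideal.axioms(1) additive_subgroup.a_subset)
  note ts = submodule_tor[OF MX IR]
  have "\<exists>A. finite A \<and> A \<subseteq> tor R I X n \<and> module_span R X A = tor R I X n" for n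
    using fin_gen_tor[OF R I X] fin_gen_submodule_iff[OF MX ts] by blast
  then obtain A where A: "\<And>n. finite (A n)" "\<And>n. A n \<subseteq> tor R I X n" "\<And>n. module_span R X (A n) = tor R I X n"
    by metis
  \<comment> \<open>Inserting zero keeps \<open>U\<close> nonempty, so that
    \<open>from_nat_into\<close> enumerates exactly \<open>U\<close>.\<close>
  define U where "U = insert \<zero>\<^bsub>X\<^esub> (\<Union>n. A n)"
  have U: "countable U" "U \<noteq> {}" using A(1) by (auto simp: U_def intro: countable_finite)
  have "A n \<subseteq> carrier X" for n using A(2)[of n] submoduleD(1)[OF MX ts[of n]] by auto
  then have UX: "U \<subseteq> carrier X" using module_zero_closed[OF MX] by (auto simp: U_def)
  have sp: "tor R I X n \<subseteq> module_span R X U" for n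
    using span_mono[of "A n" U R X] A(3)[of n] by (auto simp: U_def)
  have "carrier X = (\<Union>n. tor R I X n)"
    using cofinite_torsion[OF X] by (intro torsion_exhaustion[OF R I MX]) blast
  then have "carrier X \<subseteq> module_span R X U" using sp by auto
  moreover define s where "s = from_nat_into U"
  ultimately have "carrier X \<subseteq> module_span R X (range s)" using range_from_nat_into[OF U(2,1)] by simp
  also have "\<dots> \<subseteq> lincomb X s ` lists (carrier R)"
    using from_nat_into[OF U(2)] UX by (intro span_lincomb[OF MX]) (auto simp: s_def)
  finally have sub: "carrier X \<subseteq> lincomb X s ` lists (carrier R)" .
  have "inj_on (inv_into (lists (carrier R)) (lincomb X s)) (carrier X)"
    by (rule inj_on_inv_into[OF sub])
  then show thesis by (rule that)
qed

section \<open>Copies of cofinite modules in other types\<close>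

lemma module_transport:
  fixes X :: "('a, 'x) module" and e :: "'x \<Rightarrow> 'y"
  assumes X: "module R X" and e: "inj_on e (carrier X)"
  obtains T :: "('a, 'y) module" where "lin R X T e" "e ` carrier X = carrier T"
proof -
  let ?i = "inv_into (carrier X) e"
  define T :: "('a, 'y) module" where
    "T = \<lparr>carrier = e ` carrier X, monoid.mult = undefined, one = undefined, zero = e \<zero>\<^bsub>X\<^esub>,
    add = (\<lambda>u v. e (?i u \<oplus>\<^bsub>X\<^esub> ?i v)), smult = (\<lambda>r u. e (r \<odot>\<^bsub>X\<^esub> ?i u))\<rparr>"
  have "lin R X T e"
    by (rule module_surjective(2)[OF X]) (use e in \<open>auto simp: T_def inv_into_f_f\<close>)
  then show thesis by (rule that) (simp add: T_def)
qed

lemma lin_inverse: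
  assumes f: "lin R X Y f" "inj_on f (carrier X)" "f ` carrier X = carrier Y"
  obtains g where "lin R Y X g" "inj_on g (carrier Y)" "g ` carrier Y = carrier X"
    "\<And>x. x \<in> carrier X \<Longrightarrow> g (f x) = x" "\<And>y. y \<in> carrier Y \<Longrightarrow> f (g y) = y"
proof -
  have Y: "module R Y" by (rule lin_module2[OF f(1)])
  obtain g where g: "lin R Y X g" "\<And>y. y \<in> carrier Y \<Longrightarrow> f (g y) = y"
    using lin_lift_inj[OF f(1,2) lin_ident[OF Y]] f(3) by blast
  have gf: "g (f x) = x" if "x \<in> carrier X" for x
    using that g lin_closed[OF f(1)] lin_closed[OF g(1)] by (intro inj_onD[OF f(2)]) auto
  show thesis
  proof (rule that[OF g(1) _ _ gf g(2)])
    show "inj_on g (carrier Y)" using g(2) by (metis inj_on_inverseI)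
    show "g ` carrier Y = carrier X"
    proof
      show "g ` carrier Y \<subseteq> carrier X" using lin_closed[OF g(1)] by auto
      show "carrier X \<subseteq> g ` carrier Y" using gf lin_closed[OF f(1)] by (metis image_eqI subsetI)
    qed
  qed
qed

lemma cofinite_list_copy:
  fixes R :: "('a, 'r) ring_scheme" and X :: "('a, 'x) module"
  assumes R: "cring R" "noetherian_ring R" and I: "ideal I R" and X: "cofinite_module R I X"
  obtains T :: "('a, 'a list) module" and e where "cofinite_module R I T" "lin R X T e"
    "inj_on e (carrier X)" "e ` carrier X = carrier T"
proof -
  have MX: "module R X" using X by (simp add: cofinite_module_def)
  obtain e :: "'x \<Rightarrow> 'a list" where e: "inj_on e (carrier X)" by (rule cofinite_inj_list[OF R I X])
  obtain T where T: "lin R X T e" "e ` carrier X = carrier T" by (rule module_transport[OF MX e])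
  have "cofinite_module R I T" by (rule cofinite_iso[OF R I T(1) e T(2) X])
  then show thesis using T e that by blast
qed

text \<open>\<open>cofinite_category_abelian\<close> speaks of carriers in \<open>'a list\<close>
  only. The map is conjugated with isomorphisms onto list copies of both modules, and kernel and
  cokernel are carried back.\<close>

lemma cofinite_kernel_cokernel:
  fixes R :: "('a, 'r) ring_scheme"
  assumes R: "cring R" "noetherian_ring R" and I: "ideal I R" and ab: "cofinite_category_abelian R I"
    and X: "cofinite_module R I X" and Y: "cofinite_module R I Y" and f: "lin R X Y f"
  shows "cofinite_module R I (X\<lparr>carrier := {x \<in> carrier X. f x = \<zero>\<^bsub>Y\<^esub>}\<rparr>)"
    and "cofinite_module R I (quot_module Y (f ` carrier X))"
proof -
  note MX = lin_module1[OF f] and MY = lin_module2[OF f]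
  obtain S :: "('a, 'a list) module" and e where S: "cofinite_module R I S" "lin R X S e"
    "inj_on e (carrier X)" "e ` carrier X = carrier S" by (rule cofinite_list_copy[OF R I X])
  obtain T :: "('a, 'a list) module" and e' where T: "cofinite_module R I T" "lin R Y T e'"
    "inj_on e' (carrier Y)" "e' ` carrier Y = carrier T" by (rule cofinite_list_copy[OF R I Y])
  obtain g where g: "lin R S X g" "inj_on g (carrier S)" "g ` carrier S = carrier X"
    "\<And>x. x \<in> carrier X \<Longrightarrow> g (e x) = x" "\<And>y. y \<in> carrier S \<Longrightarrow> e (g y) = y"
    using lin_inverse[OF S(2-4)] by metis
  obtain g' where g': "lin R T Y g'" "inj_on g' (carrier T)" "g' ` carrier T = carrier Y"
    "\<And>x. x \<in> carrier Y \<Longrightarrow> g' (e' x) = x" "\<And>y. y \<in> carrier T \<Longrightarrow> e' (g' y) = y"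
    using lin_inverse[OF T(2-4)] by metis
  \<comment> \<open>Restricted, since \<open>mod_hom\<close> asks for extensional maps.\<close>
  define h where "h = restrict (\<lambda>s. e' (f (g s))) (carrier S)"
  have lh: "lin R S T (\<lambda>s. e' (f (g s)))" using lin_comp[OF lin_comp[OF g(1) f] T(2)] .
  have hm: "h \<in> mod_hom R S T" unfolding h_def by (rule restrict_mod_hom[OF lh])
  have lh': "lin R S T h" by (rule mod_hom_lin[OF lin_module1[OF lh] lin_module2[OF lh] hm])
  note c = ab[unfolded cofinite_category_abelian_def, rule_format, OF S(1) T(1) hm]
  note ks = submodule_kernel[OF lh'] and kx = submodule_kernel[OF f]
  have hk: "h s = \<zero>\<^bsub>T\<^esub> \<longleftrightarrow> f (g s) = \<zero>\<^bsub>Y\<^esub>" if s: "s \<in> carrier S" for s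
  proof -
    have "f (g s) \<in> carrier Y" using lin_closed[OF f] lin_closed[OF g(1) s] by simp
    then have "e' (f (g s)) = e' \<zero>\<^bsub>Y\<^esub> \<longleftrightarrow> f (g s) = \<zero>\<^bsub>Y\<^esub>"
      using inj_on_eq_iff[OF T(3)] module_zero_closed[OF MY] by simp
    then show ?thesis using s by (simp add: h_def lin_zero[OF T(2)])
  qed
  show "cofinite_module R I (X\<lparr>carrier := {x \<in> carrier X. f x = \<zero>\<^bsub>Y\<^esub>}\<rparr>)"
  proof (rule cofinite_iso[OF R I _ _ _ conjunct1[OF c]])
    show "lin R (S\<lparr>carrier := {x \<in> carrier S. h x = \<zero>\<^bsub>T\<^esub>}\<rparr>) (X\<lparr>carrier := {x \<in> carrier X. f x = \<zero>\<^bsub>Y\<^esub>}\<rparr>) g"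
      using hk lin_closed[OF g(1)] by (intro lin_into_submodule[OF lin_submodule[OF g(1) ks] kx]) auto
    show "inj_on g (carrier (S\<lparr>carrier := {x \<in> carrier S. h x = \<zero>\<^bsub>T\<^esub>}\<rparr>))"
      by (rule inj_on_subset[OF g(2)]) auto
    have "x \<in> g ` {x \<in> carrier S. h x = \<zero>\<^bsub>T\<^esub>}" if "x \<in> carrier X" "f x = \<zero>\<^bsub>Y\<^esub>" for x
      using that g(4)[OF that(1)] hk[of "e x"] lin_closed[OF S(2) that(1)] by (intro image_eqI[of _ _ "e x"]) auto
    then show "g ` carrier (S\<lparr>carrier := {x \<in> carrier S. h x = \<zero>\<^bsub>T\<^esub>}\<rparr>) =
        carrier (X\<lparr>carrier := {x \<in> carrier X. f x = \<zero>\<^bsub>Y\<^esub>}\<rparr>)"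
      using hk lin_closed[OF g(1)] by auto
  qed
  have qs: "submodule (h ` carrier S) R T" by (rule submodule_range[OF lh'])
  have qy: "submodule (f ` carrier X) R Y" by (rule submodule_range[OF f])
  let ?p = "\<lambda>y. f ` carrier X +>\<^bsub>Y\<^esub> y"
  note lp = lin_quot[OF MY qy]
  have im: "g' t \<in> f ` carrier X \<longleftrightarrow> t \<in> h ` carrier S" if t: "t \<in> carrier T" for t
  proof
    assume "g' t \<in> f ` carrier X"
    then obtain x where x: "x \<in> carrier X" "g' t = f x" by auto
    then have "t = h (e x)" using g'(5)[OF t] g(4)[OF x(1)] lin_closed[OF S(2) x(1)] by (simp add: h_def)
    then show "t \<in> h ` carrier S" using lin_closed[OF S(2) x(1)] by simp
  next
    assume "t \<in> h ` carrier S"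
    then obtain s where "s \<in> carrier S" "t = e' (f (g s))" by (auto simp: h_def)
    then show "g' t \<in> f ` carrier X" using g'(4) lin_closed[OF f] lin_closed[OF g(1)] by auto
  qed
  have lg: "lin R T (quot_module Y (f ` carrier X)) (\<lambda>t. ?p (g' t))" using lin_comp[OF g'(1) lp] .
  have z: "\<zero>\<^bsub>quot_module Y (f ` carrier X)\<^esub> = f ` carrier X" by (simp add: quot_module_simps)
  have ker: "?p (g' t) = \<zero>\<^bsub>quot_module Y (f ` carrier X)\<^esub> \<longleftrightarrow> t \<in> h ` carrier S" if "t \<in> carrier T" for t
    unfolding z using rcoset_eq_iff_zero[OF MY qy lin_closed[OF g'(1) that]] im[OF that] by simp
  have k0: "?p (g' t) = \<zero>\<^bsub>quot_module Y (f ` carrier X)\<^esub>" if t: "t \<in> h ` carrier S" for t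
    using ker[OF subsetD[OF submoduleD(1)[OF lin_module2[OF lh] qs] t]] t by simp
  obtain q where q: "lin R (quot_module T (h ` carrier S)) (quot_module Y (f ` carrier X)) q"
    "\<And>t. t \<in> carrier T \<Longrightarrow> q (h ` carrier S +>\<^bsub>T\<^esub> t) = ?p (g' t)"
    using quot_lift[OF lg qs k0] by blast
  show "cofinite_module R I (quot_module Y (f ` carrier X))"
  proof (rule cofinite_iso[OF R I q(1) _ _ conjunct2[OF c]])
    show "inj_on q (carrier (quot_module T (h ` carrier S)))"
    proof (rule lin_inj_onI[OF q(1)])
      fix C assume C: "C \<in> carrier (quot_module T (h ` carrier S))" "q C = \<zero>\<^bsub>quot_module Y (f ` carrier X)\<^esub>"
      then obtain t where t: "t \<in> carrier T" "C = h ` carrier S +>\<^bsub>T\<^esub> t" by (auto simp: quot_module_simps)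
      then have "t \<in> h ` carrier S" using C q(2) ker by simp
      then show "C = \<zero>\<^bsub>quot_module T (h ` carrier S)\<^esub>"
        using rcoset_eq_iff_zero[OF lin_module2[OF lh] qs t(1)] t(2) by (simp add: quot_module_simps)
    qed
    show "q ` carrier (quot_module T (h ` carrier S)) = carrier (quot_module Y (f ` carrier X))"
    proof
      show "q ` carrier (quot_module T (h ` carrier S)) \<subseteq> carrier (quot_module Y (f ` carrier X))"
        using lin_closed[OF q(1)] by auto
      show "carrier (quot_module Y (f ` carrier X)) \<subseteq> q ` carrier (quot_module T (h ` carrier S))"
      proof
        fix C assume "C \<in> carrier (quot_module Y (f ` carrier X))"
        then obtain y where y: "y \<in> carrier Y" "C = ?p y" by (auto simp: quot_module_simps)
        then have "C = q (h ` carrier S +>\<^bsub>T\<^esub> e' y)" using q(2)[of "e' y"] lin_closed[OF T(2)] g'(4) by simp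
        then show "C \<in> q ` carrier (quot_module T (h ` carrier S))"
          using lin_closed[OF T(2) y(1)] unfolding quot_module_simps(1) by (simp only: imageI)
      qed
    qed
  qed
qed


section \<open>Powers of an ideal\<close>

context
  fixes R :: "('a, 'r) ring_scheme" and I :: "'a set"
  assumes R: "cring R" and I: "ideal I R"
begin

interpretation R: cring R by (rule R)

lemma ideal_power_0: "ideal_power R I 0 = carrier R"
  by (simp add: ideal_power_def nat_pow_def ideals_set_def)

lemma ideal_power_Suc: "ideal_power R I (Suc n) = ideal_prod R (ideal_power R I n) I"
  by (simp add: ideal_power_def nat_pow_def ideals_set_def)

lemma ideal_ideal_power: "ideal (ideal_power R I n) R"
  by (induction n) (simp_all add: ideal_power_0 ideal_power_Suc R.oneideal R.ideal_prod_is_ideal I)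

lemma ideal_power_subset: "ideal_power R I n \<subseteq> carrier R"
  using ideal_ideal_power[of n] by (simp add: ideal.axioms(1) additive_subgroup.a_subset)

lemma ideal_power_antimono: "n \<le> m \<Longrightarrow> ideal_power R I m \<subseteq> ideal_power R I n"
proof (rule lift_Suc_antimono_le)
  show "ideal_power R I (Suc n) \<subseteq> ideal_power R I n" for n
    using R.ideal_prod_inter[OF ideal_ideal_power I, of n] by (simp add: ideal_power_Suc)
qed

lemma pow_in_ideal_power: "a \<in> I \<Longrightarrow> a [^]\<^bsub>R\<^esub> n \<in> ideal_power R I n"
proof (induction n)
  case 0
  then show ?case by (simp add: ideal_power_0)
next
  case (Suc n)
  then show ?case by (simp add: ideal_power_Suc ideal_prod.prod)
qed

text \<open>The next power is built from products \<open>i j\<close> with \<open>j\<close> in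
  \<open>I\<close>, and multiplication by \<open>j\<close> lowers the index of \<open>tor\<close> by
  one.\<close>

lemma ideal_power_kills_tor:
  assumes X: "module R X"
  shows "r \<in> ideal_power R I n \<Longrightarrow> x \<in> tor R I X n \<Longrightarrow> r \<odot>\<^bsub>X\<^esub> x = \<zero>\<^bsub>X\<^esub>"
proof (induction n arbitrary: r x)
  case 0
  interpret X: module R X by fact
  show ?case using 0 by (simp add: ideal_power_0)
next
  case (Suc n)
  interpret X: module R X by fact
  have IR: "I \<subseteq> carrier R" using I by (simp add: ideal.axioms(1) additive_subgroup.a_subset)
  have x: "x \<in> carrier X" using Suc.prems(2) by simp
  have "s \<in> carrier R \<and> s \<odot>\<^bsub>X\<^esub> x = \<zero>\<^bsub>X\<^esub>" if "s \<in> ideal_prod R (ideal_power R I n) I" for s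
    using that
  proof induction
    case (prod i j)
    then have "i \<in> carrier R" "j \<in> carrier R" "i \<odot>\<^bsub>X\<^esub> (j \<odot>\<^bsub>X\<^esub> x) = \<zero>\<^bsub>X\<^esub>"
      using ideal_power_subset IR Suc.IH[of i "j \<odot>\<^bsub>X\<^esub> x"] Suc.prems(2) by auto
    then show ?case using x by (simp add: X.smult_assoc1)
  next
    case (sum s1 s2)
    then show ?case using x by (simp add: X.smult_l_distr)
  qed
  then show ?case using Suc.prems(1) by (simp add: ideal_power_Suc)
qed

abbreviation "pw X n \<equiv> ideal_smult R (ideal_power R I n) X"

lemma submodule_pw:
  assumes X: "module R X"
  shows "submodule (pw X n) R X"
  unfolding ideal_smult_def
proof (rule span_submodule[OF X], clarify)
  fix r x assume "r \<in> ideal_power R I n" "x \<in> carrier X"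
  then show "r \<odot>\<^bsub>X\<^esub> x \<in> carrier X"
    using module.smult_closed[OF X] ideal_power_subset by blast
qed

lemma pw_gen:
  assumes "r \<in> ideal_power R I n" "x \<in> carrier X"
  shows "r \<odot>\<^bsub>X\<^esub> x \<in> pw X n"
proof -
  have "r \<odot>\<^bsub>X\<^esub> x \<in> {r \<odot>\<^bsub>X\<^esub> x | r x. r \<in> ideal_power R I n \<and> x \<in> carrier X}" using assms by auto
  then show ?thesis unfolding ideal_smult_def by (rule subsetD[OF span_incl])
qed

lemma pw_antimono: "n \<le> m \<Longrightarrow> pw X m \<subseteq> pw X n"
  unfolding ideal_smult_def using ideal_power_antimono[of n m] by (intro span_mono) blast

lemma pw_image:
  assumes f: "lin R X Y f"
  shows "x \<in> pw X n \<Longrightarrow> f x \<in> pw Y n"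
proof -
  have "pw X n \<subseteq> {x \<in> carrier X. f x \<in> pw Y n}"
    unfolding ideal_smult_def[of R "ideal_power R I n" X]
  proof (rule span_least[OF submodule_vimage[OF f submodule_pw[OF lin_module2[OF f]]]])
    interpret X: module R X by (rule lin_module1[OF f])
    show "{r \<odot>\<^bsub>X\<^esub> x |r x. r \<in> ideal_power R I n \<and> x \<in> carrier X} \<subseteq> {x \<in> carrier X. f x \<in> pw Y n}"
      using ideal_power_subset[of n] lin_closed[OF f] by (auto simp: lin_smult[OF f] subset_iff intro!: pw_gen)
  qed
  then show "x \<in> pw X n \<Longrightarrow> f x \<in> pw Y n" by blast
qed

lemma pw_surj:
  assumes f: "lin R X Y f" "f ` carrier X = carrier Y" and y: "y \<in> pw Y n"
  shows "y \<in> f ` pw X n"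
proof -
  have "pw Y n \<subseteq> f ` pw X n"
    unfolding ideal_smult_def[of R "ideal_power R I n" Y]
  proof (rule span_least[OF submodule_image[OF f(1) submodule_pw[OF lin_module1[OF f(1)]]]])
    show "{r \<odot>\<^bsub>Y\<^esub> y |r y. r \<in> ideal_power R I n \<and> y \<in> carrier Y} \<subseteq> f ` pw X n"
    proof clarify
      fix r y assume r: "r \<in> ideal_power R I n" and "y \<in> carrier Y"
      then obtain x where x: "x \<in> carrier X" "y = f x" using f(2) by blast
      have "r \<in> carrier R" using r ideal_power_subset by blast
      then have "r \<odot>\<^bsub>Y\<^esub> y = f (r \<odot>\<^bsub>X\<^esub> x)" using x by (simp add: lin_smult[OF f(1)])
      then show "r \<odot>\<^bsub>Y\<^esub> y \<in> f ` pw X n" using pw_gen[OF r x(1)] by blast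
    qed
  qed
  then show ?thesis using y by blast
qed

text \<open>This is why the generalized local cohomology of \<open>R\<close> itself is the ordinary
  one.\<close>

lemma pw_regular: "pw (regular_module R) n = ideal_power R I n"
proof
  note M = module_regular[OF R]
  have s: "submodule (ideal_power R I n) R (regular_module R)"
    using ideal_ideal_power submodule_regular_iff[OF R] by blast
  interpret J: ideal "ideal_power R I n" R by (rule ideal_ideal_power)
  show "pw (regular_module R) n \<subseteq> ideal_power R I n"
    unfolding ideal_smult_def by (rule span_least[OF s]) (auto intro: J.I_r_closed)
  show "ideal_power R I n \<subseteq> pw (regular_module R) n"
    using pw_gen[of _ n "\<one>\<^bsub>R\<^esub>" "regular_module R"] ideal_power_subset by fastforce
qed

text \<open>The submodules \<open>(Q : a^j)\<close> of the finitely generated module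
  \<open>B\<close> increase with \<open>j\<close>, so a maximal one among those with index at least
  \<open>n\<close> is where they become stationary.\<close>

lemma pow_stable:
  assumes N: "noetherian_ring R" and B: "module R B" "fin_gen R B" and Q: "submodule Q R B" and a: "a \<in> carrier R"
  shows "\<exists>j\<ge>n::nat. \<forall>(k::nat) b. b \<in> carrier B \<longrightarrow> (a [^]\<^bsub>R\<^esub> (k + j)) \<odot>\<^bsub>B\<^esub> b \<in> Q \<longrightarrow> (a [^]\<^bsub>R\<^esub> j) \<odot>\<^bsub>B\<^esub> b \<in> Q"
proof -
  interpret B: module R B by fact
  define c where "c j = {b \<in> carrier B. (a [^]\<^bsub>R\<^esub> j) \<odot>\<^bsub>B\<^esub> b \<in> Q}" for j :: nat
  have sub: "submodule (c j) R B" for j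
    unfolding c_def using a by (intro submodule_vimage[OF lin_scalar[OF B(1)] Q]) simp
  have mono: "c j \<subseteq> c (k + j)" for j k
  proof
    fix b assume b: "b \<in> c j"
    have "(a [^]\<^bsub>R\<^esub> (k + j)) \<odot>\<^bsub>B\<^esub> b = (a [^]\<^bsub>R\<^esub> k) \<odot>\<^bsub>B\<^esub> ((a [^]\<^bsub>R\<^esub> j) \<odot>\<^bsub>B\<^esub> b)"
      using a b by (simp add: c_def B.smult_assoc1[symmetric] R.nat_pow_mult)
    then show "b \<in> c (k + j)" using b a submoduleD(4)[OF B(1) Q, of "a [^]\<^bsub>R\<^esub> k"] by (simp add: c_def)
  qed
  obtain Z where Z: "Z \<in> range (\<lambda>i. c (i + n))" "\<And>Z'. Z' \<in> range (\<lambda>i. c (i + n)) \<Longrightarrow> Z \<subseteq> Z' \<Longrightarrow> Z' = Z"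
    using maximal_submodule[OF R N B, of "range (\<lambda>i. c (i + n))"] sub by blast
  then obtain i where i: "Z = c (i + n)" by blast
  have "c (k + (i + n)) = c (i + n)" for k
  proof -
    have "c (k + (i + n)) \<in> range (\<lambda>i. c (i + n))"
      by (rule image_eqI[of _ _ "k + i"]) (simp_all add: add.assoc)
    from Z(2)[OF this] show ?thesis using mono[of "i + n" k] unfolding i by blast
  qed
  then have st: "b \<in> c (k + (i + n)) \<longleftrightarrow> b \<in> c (i + n)" for b k by simp
  show ?thesis
    by (rule exI[of _ "i + n"]) (use st in \<open>auto simp: c_def\<close>)
qed

text \<open>A submodule \<open>Q\<close> that is maximal with \<open>L \<subseteq> Q\<close> and \<open>Q \<inter> K \<subseteq> L\<close> contains a power of every
  element of \<open>I\<close> times \<open>B\<close>, so \<open>B/Q\<close> is \<open>I\<close>-torsion and hence killed by a power of \<open>I\<close>.\<close>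

lemma artin_rees:
  assumes N: "noetherian_ring R" and B: "module R B" "fin_gen R B"
    and K: "submodule K R B" and L: "submodule L R B" "L \<subseteq> K"
    and n: "\<And>r x. r \<in> ideal_power R I n \<Longrightarrow> x \<in> K \<Longrightarrow> r \<odot>\<^bsub>B\<^esub> x \<in> L"
  shows "\<exists>m. pw B m \<inter> K \<subseteq> L"
proof -
  interpret B: module R B by (rule B(1))
  have IR: "I \<subseteq> carrier R" using I by (simp add: ideal.axioms(1) additive_subgroup.a_subset)
  let ?S = "{Q. submodule Q R B \<and> L \<subseteq> Q \<and> Q \<inter> K \<subseteq> L}"
  have "L \<in> ?S" using L by auto
  then have ne: "?S \<noteq> {}" by blast
  obtain Q where Q0: "Q \<in> ?S" and max: "\<And>Q'. Q' \<in> ?S \<Longrightarrow> Q \<subseteq> Q' \<Longrightarrow> Q' = Q"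
    using maximal_submodule[OF R N B ne] by blast
  then have Q: "submodule Q R B" "L \<subseteq> Q" "Q \<inter> K \<subseteq> L" by auto
  note QD = submoduleD[OF B(1) Q(1)]
  \<comment> \<open>For suitable \<open>j\<close> the submodule \<open>Q + a^j B\<close> still meets
    \<open>K\<close> inside \<open>L\<close>, so by maximality it equals \<open>Q\<close>.\<close>
  have power: "\<exists>j. \<forall>b\<in>carrier B. (a [^]\<^bsub>R\<^esub> (j::nat)) \<odot>\<^bsub>B\<^esub> b \<in> Q" if a: "a \<in> I" for a
  proof -
    have aR: "a \<in> carrier R" using a IR by auto
    obtain j where j: "j \<ge> n" "\<And>k b. b \<in> carrier B \<Longrightarrow> (a [^]\<^bsub>R\<^esub> (k + j)) \<odot>\<^bsub>B\<^esub> b \<in> Q \<Longrightarrow> (a [^]\<^bsub>R\<^esub> j) \<odot>\<^bsub>B\<^esub> b \<in> Q"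
      using pow_stable[OF N B Q(1) aR, of n] by blast
    let ?J = "(\<lambda>b. (a [^]\<^bsub>R\<^esub> j) \<odot>\<^bsub>B\<^esub> b) ` carrier B"
    have J: "submodule ?J R B" using aR by (intro submodule_range[OF lin_scalar[OF B(1)]]) simp
    let ?Q' = "{x \<oplus>\<^bsub>B\<^esub> y | x y. x \<in> ?J \<and> y \<in> Q}"
    have Q': "submodule ?Q' R B" by (rule submodule_sum[OF B(1) J Q(1)])
    have QQ': "Q \<subseteq> ?Q'"
    proof
      fix q assume q: "q \<in> Q"
      then have "q = \<zero>\<^bsub>B\<^esub> \<oplus>\<^bsub>B\<^esub> q" using QD(1) by auto
      then show "q \<in> ?Q'" using q submoduleD(2)[OF B(1) J] by blast
    qed
    have JQ': "?J \<subseteq> ?Q'"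
    proof
      fix q assume q: "q \<in> ?J"
      then have "q = q \<oplus>\<^bsub>B\<^esub> \<zero>\<^bsub>B\<^esub>" using submoduleD(1)[OF B(1) J] by auto
      then show "q \<in> ?Q'" using q QD(2) by blast
    qed
    \<comment> \<open>For \<open>u = a^j b + q\<close> in \<open>K\<close>, multiplication by
      \<open>a^n\<close> lands in \<open>L\<close> and hence in \<open>Q\<close>. So
      \<open>a^(n+j) b\<close> is in \<open>Q\<close>, stability puts \<open>a^j b\<close> into
      \<open>Q\<close>, and \<open>u\<close> lies in both \<open>Q\<close> and
      \<open>K\<close>.\<close>
    have "?Q' \<inter> K \<subseteq> L"
    proof
      fix u assume u: "u \<in> ?Q' \<inter> K"
      then obtain b q where b: "b \<in> carrier B" and q: "q \<in> Q" and ub: "u = (a [^]\<^bsub>R\<^esub> j) \<odot>\<^bsub>B\<^esub> b \<oplus>\<^bsub>B\<^esub> q" by blast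
      have qB: "q \<in> carrier B" using q QD(1) by auto
      have p: "a [^]\<^bsub>R\<^esub> n \<in> carrier R" "a [^]\<^bsub>R\<^esub> j \<in> carrier R" using aR by auto
      have "(a [^]\<^bsub>R\<^esub> n) \<odot>\<^bsub>B\<^esub> u \<in> Q" using n[OF pow_in_ideal_power[OF a]] u Q(2) by blast
      moreover have "(a [^]\<^bsub>R\<^esub> n) \<odot>\<^bsub>B\<^esub> u = (a [^]\<^bsub>R\<^esub> (n + j)) \<odot>\<^bsub>B\<^esub> b \<oplus>\<^bsub>B\<^esub> (a [^]\<^bsub>R\<^esub> n) \<odot>\<^bsub>B\<^esub> q"
        using p b qB aR by (simp add: ub B.smult_r_distr B.smult_assoc1[symmetric] R.nat_pow_mult)
      moreover have "(a [^]\<^bsub>R\<^esub> n) \<odot>\<^bsub>B\<^esub> q \<in> Q" using QD(4) p q by blast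
      ultimately have "((a [^]\<^bsub>R\<^esub> (n + j)) \<odot>\<^bsub>B\<^esub> b \<oplus>\<^bsub>B\<^esub> (a [^]\<^bsub>R\<^esub> n) \<odot>\<^bsub>B\<^esub> q) \<ominus>\<^bsub>B\<^esub> (a [^]\<^bsub>R\<^esub> n) \<odot>\<^bsub>B\<^esub> q \<in> Q"
        using QD(6) by simp
      also have "((a [^]\<^bsub>R\<^esub> (n + j)) \<odot>\<^bsub>B\<^esub> b \<oplus>\<^bsub>B\<^esub> (a [^]\<^bsub>R\<^esub> n) \<odot>\<^bsub>B\<^esub> q) \<ominus>\<^bsub>B\<^esub> (a [^]\<^bsub>R\<^esub> n) \<odot>\<^bsub>B\<^esub> q = (a [^]\<^bsub>R\<^esub> (n + j)) \<odot>\<^bsub>B\<^esub> b"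
        using p aR b qB by (simp add: B.minus_eq B.a_assoc B.r_neg)
      finally have "(a [^]\<^bsub>R\<^esub> j) \<odot>\<^bsub>B\<^esub> b \<in> Q" by (rule j(2)[OF b])
      then have "u \<in> Q" using q QD(3) by (simp add: ub)
      then show "u \<in> L" using u Q(3) by blast
    qed
    then have "?Q' = Q" using Q' Q(2) QQ' by (intro max) auto
    then show ?thesis using JQ' by blast
  qed
  let ?X = "quot_module B Q"
  have X: "module R ?X" by (rule module_quot[OF B(1) Q(1)])
  have zero: "r \<odot>\<^bsub>?X\<^esub> (Q +>\<^bsub>B\<^esub> b) = \<zero>\<^bsub>?X\<^esub> \<longleftrightarrow> r \<odot>\<^bsub>B\<^esub> b \<in> Q" if "r \<in> carrier R" "b \<in> carrier B" for r b
    using quot_smult[OF B(1) Q(1) that] rcoset_eq_iff_zero[OF B(1) Q(1), of "r \<odot>\<^bsub>B\<^esub> b"] that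
    by (simp add: quot_module_simps(2))
  have all: "carrier ?X = (\<Union>n. tor R I ?X n)"
  proof (rule torsion_exhaustion[OF R N I X])
    fix P x assume P: "primeideal P R" "\<not> I \<subseteq> P" and "x \<in> carrier ?X"
    then obtain b where b: "b \<in> carrier B" "x = Q +>\<^bsub>B\<^esub> b" by (auto simp: quot_module_simps)
    obtain a where a: "a \<in> I" "a \<in> carrier R - P" using P IR by blast
    obtain j :: nat where j: "\<forall>b\<in>carrier B. (a [^]\<^bsub>R\<^esub> j) \<odot>\<^bsub>B\<^esub> b \<in> Q" using power[OF a(1)] by blast
    \<comment> \<open>An element of \<open>I\<close> outside \<open>P\<close> has all its powers
      outside \<open>P\<close>, and one of them kills \<open>B/Q\<close>.\<close>
    have "a [^]\<^bsub>R\<^esub> k \<in> carrier R - P" for k :: nat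
    proof (induction k)
      case 0
      then show ?case using prime_complement(1)[OF P(1)] by simp
    next
      case (Suc k)
      then show ?case using prime_complement(2)[OF P(1) Suc a(2)] by simp
    qed
    then show "\<exists>w\<in>carrier R - P. w \<odot>\<^bsub>?X\<^esub> x = \<zero>\<^bsub>?X\<^esub>"
      using j b zero by (intro bexI[of _ "a [^]\<^bsub>R\<^esub> j"]) auto
  qed
  have "fin_gen R ?X"
    by (rule fin_gen_image[OF lin_quot[OF B(1) Q(1)] _ B(2)]) (simp add: quot_module_simps)
  then obtain A where A: "finite A" "A \<subseteq> carrier ?X" "module_span R ?X A = carrier ?X"
    by (auto simp: fin_gen_def)
  \<comment> \<open>One exponent for the finitely many generators of \<open>B/Q\<close>.\<close>
  have "\<exists>m. A' \<subseteq> tor R I ?X m" if "finite A'" "A' \<subseteq> carrier ?X" for A'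
    using that
  proof induction
    case (insert x A')
    then obtain m where "A' \<subseteq> tor R I ?X m" by auto
    moreover have "x \<in> (\<Union>n. tor R I ?X n)" using insert.prems all by blast
    then obtain k where "x \<in> tor R I ?X k" by blast
    ultimately show ?case
      using tor_mono[OF X IR, of m "max m k"] tor_mono[OF X IR, of k "max m k"] by (intro exI[of _ "max m k"]) auto
  qed simp
  then obtain m where m: "A \<subseteq> tor R I ?X m" using A by blast
  have Xm: "carrier ?X \<subseteq> tor R I ?X m"
    using span_least[OF submodule_tor[OF X IR] m] A(3) by simp
  have "pw B m \<subseteq> Q"
    unfolding ideal_smult_def
  proof (rule span_least[OF Q(1)], clarify)
    fix r b assume r: "r \<in> ideal_power R I m" and b: "b \<in> carrier B"
    have "Q +>\<^bsub>B\<^esub> b \<in> tor R I ?X m" using Xm b by (auto simp: quot_module_simps)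
    then have "r \<odot>\<^bsub>?X\<^esub> (Q +>\<^bsub>B\<^esub> b) = \<zero>\<^bsub>?X\<^esub>" by (rule ideal_power_kills_tor[OF X r])
    then show "r \<odot>\<^bsub>B\<^esub> b \<in> Q" using zero r b ideal_power_subset by blast
  qed
  then show ?thesis using Q(3) by blast
qed

end


section \<open>Lifting properties of cones\<close>

lemma neg_zero_iff:
  fixes M :: "('a, 'm) module"
  assumes "module R M" "x \<in> carrier M"
  shows "\<ominus>\<^bsub>M\<^esub> x = \<zero>\<^bsub>M\<^esub> \<longleftrightarrow> x = \<zero>\<^bsub>M\<^esub>"
proof -
  interpret M: module R M by fact
  have "\<ominus>\<^bsub>M\<^esub> (\<ominus>\<^bsub>M\<^esub> x) = x" "\<ominus>\<^bsub>M\<^esub> \<zero>\<^bsub>M\<^esub> = \<zero>\<^bsub>M\<^esub>"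
    using assms lin_zero[OF lin_uminus[OF lin_ident[OF assms(1)]]] by auto
  then show ?thesis by metis
qed

lemma lifts_prod:
  assumes Q: "lifts R Q T" "module R Q" and P: "lifts R P T" "module R P"
  shows "lifts R (prod_module Q P) (T :: 'w itself)"
  unfolding lifts_def
proof (intro allI impI)
  fix X Y :: "('a, 'w) module" and g h
  assume g: "lin R X Y g" and h: "lin R (prod_module Q P) Y h" and sub: "h ` carrier (prod_module Q P) \<subseteq> g ` carrier X"
  interpret Q: module R Q by fact
  interpret P: module R P by fact
  have hQ: "lin R Q Y (\<lambda>q. h (q, \<zero>\<^bsub>P\<^esub>))" by (rule lin_comp[OF lin_inl[OF Q(2) P(2)] h])
  have hP: "lin R P Y (\<lambda>p. h (\<zero>\<^bsub>Q\<^esub>, p))" by (rule lin_comp[OF lin_inr[OF Q(2) P(2)] h])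
  have "(\<lambda>q. h (q, \<zero>\<^bsub>P\<^esub>)) ` carrier Q \<subseteq> g ` carrier X" "(\<lambda>p. h (\<zero>\<^bsub>Q\<^esub>, p)) ` carrier P \<subseteq> g ` carrier X"
    using sub by (auto simp: image_subset_iff)
  then obtain k k' where k: "lin R Q X k" "\<forall>q\<in>carrier Q. g (k q) = h (q, \<zero>\<^bsub>P\<^esub>)"
    and k': "lin R P X k'" "\<forall>p\<in>carrier P. g (k' p) = h (\<zero>\<^bsub>Q\<^esub>, p)"
    using Q(1) P(1) g hQ hP unfolding lifts_def by meson
  have "lin R (prod_module Q P) X (\<lambda>u. k (fst u) \<oplus>\<^bsub>X\<^esub> k' (snd u))"
    by (intro lin_plus lin_comp[OF lin_fst[OF Q(2) P(2)] k(1)] lin_comp[OF lin_snd[OF Q(2) P(2)] k'(1)])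
  moreover have "g (k (fst u) \<oplus>\<^bsub>X\<^esub> k' (snd u)) = h u" if u: "u \<in> carrier (prod_module Q P)" for u
  proof -
    have c: "fst u \<in> carrier Q" "snd u \<in> carrier P" using u by auto
    have "g (k (fst u) \<oplus>\<^bsub>X\<^esub> k' (snd u)) = h (fst u, \<zero>\<^bsub>P\<^esub>) \<oplus>\<^bsub>Y\<^esub> h (\<zero>\<^bsub>Q\<^esub>, snd u)"
      using c k k' lin_closed[OF k(1)] lin_closed[OF k'(1)] by (simp add: lin_add[OF g])
    also have "\<dots> = h ((fst u, \<zero>\<^bsub>P\<^esub>) \<oplus>\<^bsub>prod_module Q P\<^esub> (\<zero>\<^bsub>Q\<^esub>, snd u))"
      using c by (subst lin_add[OF h]) auto
    also have "\<dots> = h u" using c by simp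
    finally show ?thesis .
  qed
  ultimately show "\<exists>k. lin R (prod_module Q P) X k \<and> (\<forall>p\<in>carrier (prod_module Q P). g (k p) = h p)" by blast
qed

lemma lifts_zero:
  assumes Z: "module R Z" "carrier Z = {\<zero>\<^bsub>Z\<^esub>}"
  shows "lifts R Z (T :: 'w itself)"
  unfolding lifts_def
proof (intro allI impI)
  fix X Y :: "('a, 'w) module" and g h
  assume g: "lin R X Y g" and h: "lin R Z Y h"
  show "\<exists>k. lin R Z X k \<and> (\<forall>p\<in>carrier Z. g (k p) = h p)"
    using lin_const_zero[OF Z(1) lin_module1[OF g]] Z(2) lin_zero[OF g] lin_zero[OF h] by auto
qed

lemma lifts_cone:
  assumes Q: "\<And>j. lifts R (Q j) T" "\<And>j. module R (Q j)" and P: "\<And>j. lifts R (P j) T" "\<And>j. module R (P j)"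
  shows "lifts R (cone P Q j) T"
proof -
  have "lifts R (shift P j) T"
  proof (cases j)
    case 0
    then show ?thesis using module_shift[of R P, OF P(2)] by (intro lifts_zero) auto
  qed (simp add: P)
  then show ?thesis unfolding cone_def by (intro lifts_prod Q module_shift P)
qed

text \<open>Write the cycle as \<open>(q, p)\<close>. If the image of \<open>p\<close> at stage
  \<open>n\<close> is the boundary of \<open>p'\<close>, then the image of \<open>q\<close> plus
  \<open>\<theta> p'\<close> is a cycle of \<open>Q n\<close>, hence the boundary of some
  \<open>q'\<close>. Then \<open>(q', - p')\<close> is a preimage of the transported cycle; its sign
  answers the one in the cone differential.\<close>

lemma (in inverse_system_map) cone_kill:
  assumes nm: "n \<le> m" and u: "u \<in> carrier (cs.C m (Suc j))" "cs.D m j u = \<zero>\<^bsub>cs.C m j\<^esub>"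
    and p: "\<tau> n m j (snd u) \<in> d n j ` carrier (P n (Suc j))"
    and ex: "\<And>v. v \<in> carrier (Q n (Suc j)) \<Longrightarrow> d' n j v = \<zero>\<^bsub>Q n j\<^esub> \<Longrightarrow> v \<in> d' n (Suc j) ` carrier (Q n (Suc (Suc j)))"
  shows "cone_\<tau> n m (Suc j) u \<in> cs.D n (Suc j) ` carrier (cs.C n (Suc (Suc j)))"
proof -
  interpret Qm: module R "Q i0 j0" for i0 j0 by (rule Q.complex.module_P)
  interpret Pm: module R "P i0 j0" for i0 j0 by (rule P.complex.module_P)
  obtain p' where p': "p' \<in> carrier (P n (Suc j))" "\<tau> n m j (snd u) = d n j p'" using p by blast
  have fs: "fst u \<in> carrier (Q m (Suc j))" "snd u \<in> carrier (P m j)" using u(1) by (auto simp: carrier_cone_Suc)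
  have z: "d' m j (fst u) \<oplus>\<^bsub>Q m j\<^esub> \<theta> m j (snd u) = \<zero>\<^bsub>Q m j\<^esub>" using u(2) by (simp add: cone_d_def cone_def)
  have cl: "d' m j (fst u) \<in> carrier (Q m j)" "\<theta> m j (snd u) \<in> carrier (Q m j)"
    "\<tau>' n m (Suc j) (fst u) \<in> carrier (Q n (Suc j))" "\<theta> n (Suc j) p' \<in> carrier (Q n (Suc j))"
    using fs p' lin_closed[OF Q.complex.lin_d] lin_closed[OF cs.lin_\<theta>] lin_closed[OF Q.lin_\<tau>[OF nm]] by auto
  let ?v = "\<tau>' n m (Suc j) (fst u) \<oplus>\<^bsub>Q n (Suc j)\<^esub> \<theta> n (Suc j) p'"
  have "d' n j ?v = d' n j (\<tau>' n m (Suc j) (fst u)) \<oplus>\<^bsub>Q n j\<^esub> \<theta> n j (d n j p')"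
    using cl p' by (simp add: lin_add[OF Q.complex.lin_d] cs.\<theta>_d)
  also have "\<dots> = \<tau>' n m j (d' m j (fst u) \<oplus>\<^bsub>Q m j\<^esub> \<theta> m j (snd u))"
    using fs cl nm by (simp add: p'(2)[symmetric] \<theta>_\<tau> Q.\<tau>_d lin_add[OF Q.lin_\<tau>[OF nm]])
  also have "\<dots> = \<zero>\<^bsub>Q n j\<^esub>" unfolding z by (rule lin_zero[OF Q.lin_\<tau>[OF nm]])
  finally obtain q' where q': "q' \<in> carrier (Q n (Suc (Suc j)))" "?v = d' n (Suc j) q'"
    using ex[of ?v] cl by blast
  have w: "(q', \<ominus>\<^bsub>P n (Suc j)\<^esub> p') \<in> carrier (cs.C n (Suc (Suc j)))" using q' p' by (simp add: carrier_cone_Suc)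
  have "cs.D n (Suc j) (q', \<ominus>\<^bsub>P n (Suc j)\<^esub> p') =
      (?v \<oplus>\<^bsub>Q n (Suc j)\<^esub> \<ominus>\<^bsub>Q n (Suc j)\<^esub> \<theta> n (Suc j) p', \<ominus>\<^bsub>P n j\<^esub> (\<ominus>\<^bsub>P n j\<^esub> d n j p'))"
    using q' p' by (simp add: cone_d_def lin_neg[OF cs.lin_\<theta>] lin_neg[OF P.complex.lin_d])
  also have "\<dots> = cone_\<tau> n m (Suc j) u"
    using cl p' lin_closed[OF P.complex.lin_d p'(1)] by (simp add: cone_\<tau>_def Qm.a_assoc Qm.r_neg)
  finally have "cs.D n (Suc j) (q', \<ominus>\<^bsub>P n (Suc j)\<^esub> p') = cone_\<tau> n m (Suc j) u" .
  then show ?thesis using imageI[OF w, of "cs.D n (Suc j)"] by simp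
qed


section \<open>Long exact sequences for pro-exact sequences\<close>

locale module_system =
  fixes R :: "('a, 'r) ring_scheme" and A :: "nat \<Rightarrow> ('a, 'x) module" and t :: "nat \<Rightarrow> nat \<Rightarrow> 'x \<Rightarrow> 'x"
  assumes cring_R: "cring R" and module_A: "module R (A n)"
    and lin_t: "n \<le> k \<Longrightarrow> lin R (A k) (A n) (t n k)"
    and tt: "n \<le> m \<Longrightarrow> m \<le> k \<Longrightarrow> x \<in> carrier (A k) \<Longrightarrow> t n m (t m k x) = t n k x"
begin

abbreviation "F n \<equiv> res R (A n)"
abbreviation "bd \<equiv> (\<lambda>(_::nat) (_::nat). boundary R)"
abbreviation "\<sigma> n k \<equiv> rpush R (t n k)"

lemma inverse_system_res: "inverse_system R F bd \<sigma>"
proof (rule inverse_system.intro)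
  show "chain_complex R (F n) (bd n)" for n by (rule complex_res[OF cring_R module_A])
  show "chain_map R (F k) (bd k) (F n) (bd n) (\<sigma> n k)" if "n \<le> k" for n k
    by (rule chain_map_rpush[OF cring_R lin_t[OF that]])
  show "\<sigma> n m i (\<sigma> m k i u) = \<sigma> n k i u" if "n \<le> m" "m \<le> k" "u \<in> carrier (F k i)" for n m k i u
    using res_map_comp(2)[OF cring_R lin_t[OF that(2)] lin_t[OF that(1)], of "t n k"] that tt by simp
qed

sublocale F: inverse_system R F bd \<sigma>
  by (rule inverse_system_res)

end

text \<open>Exact at every stage except for the kernel of \<open>f\<close>, which vanishes only
  after a transition. This is what remains of \<open>0 \<rightarrow> A \<rightarrow> B \<rightarrow>
  C \<rightarrow> 0\<close> modulo the powers of \<open>I\<close>.\<close>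

locale pro_exact = A: module_system R A tA + B: module_system R B tB + C: module_system R C tC
  for R :: "('a, 'r) ring_scheme" and A :: "nat \<Rightarrow> ('a, 'x) module" and tA
    and B :: "nat \<Rightarrow> ('a, 'y) module" and tB and C :: "nat \<Rightarrow> ('a, 'z) module" and tC +
  fixes f :: "nat \<Rightarrow> 'x \<Rightarrow> 'y" and g :: "nat \<Rightarrow> 'y \<Rightarrow> 'z"
  assumes lin_f: "lin R (A n) (B n) (f n)" and lin_g: "lin R (B n) (C n) (g n)"
    and f_t: "n \<le> k \<Longrightarrow> x \<in> carrier (A k) \<Longrightarrow> f n (tA n k x) = tB n k (f k x)"
    and g_t: "n \<le> k \<Longrightarrow> y \<in> carrier (B k) \<Longrightarrow> g n (tB n k y) = tC n k (g k y)"
    and gf: "x \<in> carrier (A n) \<Longrightarrow> g n (f n x) = \<zero>\<^bsub>C n\<^esub>"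
    and ker_g: "y \<in> carrier (B n) \<Longrightarrow> g n y = \<zero>\<^bsub>C n\<^esub> \<Longrightarrow> y \<in> f n ` carrier (A n)"
    and surj_g: "g n ` carrier (B n) = carrier (C n)"
    and pro_inj: "\<exists>m\<ge>n. \<forall>x\<in>carrier (A m). f m x = \<zero>\<^bsub>B m\<^esub> \<longrightarrow> tA n m x = \<zero>\<^bsub>A n\<^esub>"
begin

text \<open>\<open>X \<mapsto> rpush R f\<close> is functorial but not additive in \<open>f\<close>: the zero map induces a nonzero
  chain map, because \<open>\<zero>\<close> itself names a basis element.  Subtracting it makes the composite with
  the map induced by \<open>g\<close> vanish on the nose.\<close>

definition "\<phi> n j u = rpush R (f n) j u \<ominus>\<^bsub>res R (B n) j\<^esub> rpush R (\<lambda>_. \<zero>\<^bsub>B n\<^esub>) j u"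
definition "\<gamma>' n j = rpush R (g n) j"

lemmas cr = A.cring_R

lemma lin_0: "lin R (A n) (B n) (\<lambda>_. \<zero>\<^bsub>B n\<^esub>)"
  by (rule lin_const_zero[OF A.module_A B.module_A])

lemma lin_\<phi>: "lin R (A.F n j) (B.F n j) (\<phi> n j)"
  unfolding \<phi>_def[abs_def] by (intro lin_minus lin_rpush[OF cr] lin_f lin_0)

lemma lin_\<gamma>': "lin R (B.F n j) (C.F n j) (\<gamma>' n j)"
  unfolding \<gamma>'_def by (rule lin_rpush[OF cr lin_g])

lemma rp_closed: "u \<in> carrier (A.F n j) \<Longrightarrow> rpush R (f n) j u \<in> carrier (B.F n j)"
  "u \<in> carrier (A.F n j) \<Longrightarrow> rpush R (\<lambda>_. \<zero>\<^bsub>B n\<^esub>) j u \<in> carrier (B.F n j)"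
  using lin_closed[OF lin_rpush[OF cr lin_f]] lin_closed[OF lin_rpush[OF cr lin_0]] by auto

lemma chain_map_\<phi>: "chain_map R (A.F n) (A.bd n) (B.F n) (B.bd n) (\<phi> n)"
  unfolding chain_map_def
proof (intro conjI allI ballI lin_\<phi>)
  fix i u assume u: "u \<in> carrier (A.F n (Suc i))"
  show "\<phi> n i (boundary R u) = boundary R (\<phi> n (Suc i) u)"
    unfolding \<phi>_def lin_diff[OF B.F.complex.lin_d rp_closed(1)[OF u] rp_closed(2)[OF u]]
    by (simp add: boundary_rpush[OF cr lin_f u] boundary_rpush[OF cr lin_0 u])
qed

lemma \<phi>_\<sigma>:
  assumes nk: "n \<le> k" and u: "u \<in> carrier (A.F k i)"
  shows "\<phi> n i (A.\<sigma> n k i u) = B.\<sigma> n k i (\<phi> k i u)"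
proof -
  have 1: "rpush R (f n) i (A.\<sigma> n k i u) = B.\<sigma> n k i (rpush R (f k) i u)"
    using res_map_comp(2)[OF cr A.lin_t[OF nk] lin_f, of "\<lambda>x. f n (tA n k x)"]
      res_map_comp(2)[OF cr lin_f B.lin_t[OF nk], of "\<lambda>x. f n (tA n k x)"] u f_t[OF nk] by simp
  have 2: "rpush R (\<lambda>_. \<zero>\<^bsub>B n\<^esub>) i (A.\<sigma> n k i u) = B.\<sigma> n k i (rpush R (\<lambda>_. \<zero>\<^bsub>B k\<^esub>) i u)"
    using res_map_comp(2)[OF cr A.lin_t[OF nk] lin_0, of "\<lambda>_. \<zero>\<^bsub>B n\<^esub>"]
      res_map_comp(2)[OF cr lin_0 B.lin_t[OF nk], of "\<lambda>_. \<zero>\<^bsub>B n\<^esub>"] u lin_zero[OF B.lin_t[OF nk]] by simp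
  show ?thesis
    unfolding \<phi>_def lin_diff[OF B.F.lin_\<tau>[OF nk] rp_closed(1)[OF u] rp_closed(2)[OF u]] 1 2 ..
qed

text \<open>By functoriality both terms of \<open>\<phi>\<close> are sent to the chain map induced
  by the zero map, so their difference vanishes.\<close>

lemma \<gamma>'_\<phi>:
  assumes u: "u \<in> carrier (A.F n i)"
  shows "\<gamma>' n i (\<phi> n i u) = \<zero>\<^bsub>C.F n i\<^esub>"
proof -
  interpret Cm: module R "C.F n i" by (rule C.F.complex.module_P)
  have "\<gamma>' n i (rpush R (f n) i u) = rpush R (\<lambda>_. \<zero>\<^bsub>C n\<^esub>) i u"
    "\<gamma>' n i (rpush R (\<lambda>_. \<zero>\<^bsub>B n\<^esub>) i u) = rpush R (\<lambda>_. \<zero>\<^bsub>C n\<^esub>) i u"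
    using res_map_comp(2)[OF cr lin_f lin_g, of n "\<lambda>_. \<zero>\<^bsub>C n\<^esub>"] res_map_comp(2)[OF cr lin_0 lin_g, of n "\<lambda>_. \<zero>\<^bsub>C n\<^esub>"]
      u gf lin_zero[OF lin_g] by (simp_all add: \<gamma>'_def)
  moreover have "rpush R (\<lambda>_. \<zero>\<^bsub>C n\<^esub>) i u \<in> carrier (C.F n i)"
    by (rule lin_closed[OF lin_rpush[OF cr lin_const_zero[OF A.module_A C.module_A]] u])
  ultimately show ?thesis
    unfolding \<phi>_def lin_diff[OF lin_\<gamma>' rp_closed(1)[OF u] rp_closed(2)[OF u]]
    by (simp add: Cm.minus_eq Cm.r_neg)
qed

lemma chain_map_\<gamma>': "chain_map R (B.F n) (B.bd n) (C.F n) (C.bd n) (\<gamma>' n)"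
  unfolding \<gamma>'_def[abs_def] by (rule chain_map_rpush[OF cr lin_g])

lemma \<gamma>'_\<sigma>:
  assumes nk: "n \<le> k" and u: "u \<in> carrier (B.F k i)"
  shows "\<gamma>' n i (B.\<sigma> n k i u) = C.\<sigma> n k i (\<gamma>' k i u)"
  using res_map_comp(2)[OF cr B.lin_t[OF nk] lin_g, of "\<lambda>x. g n (tB n k x)"]
    res_map_comp(2)[OF cr lin_g C.lin_t[OF nk], of "\<lambda>x. g n (tB n k x)"] u g_t[OF nk] by (simp add: \<gamma>'_def)

sublocale U: inverse_system_map R A.F A.bd A.\<sigma> B.F B.bd B.\<sigma> \<phi>
  by (intro inverse_system_map.intro inverse_system_map_axioms.intro
      A.inverse_system_res B.inverse_system_res chain_map_\<phi> \<phi>_\<sigma>)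

text \<open>The comparison of the cone of \<open>\<phi>\<close> with the resolution of
  \<open>C\<close>, a chain map because \<open>\<gamma>'\<close> composed with \<open>\<phi>\<close>
  is zero. Its own cone \<open>W\<close> will be pro-acyclic, so in the limit it becomes an
  isomorphism.\<close>

definition "\<psi> n j u = \<gamma>' n j (fst u)"

lemma chain_map_\<psi>: "chain_map R (U.cs.C n) (U.cs.D n) (C.F n) (C.bd n) (\<psi> n)"
  unfolding chain_map_def
proof (intro conjI allI ballI)
  show "lin R (U.cs.C n i) (C.F n i) (\<psi> n i)" for i
    unfolding \<psi>_def[abs_def] by (rule lin_comp[OF U.cs.lin_fst_C lin_\<gamma>'])
  interpret Cm: module R "C.F n i0" for i0 by (rule C.F.complex.module_P)
  fix i u assume u: "u \<in> carrier (U.cs.C n (Suc i))"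
  then have fs: "fst u \<in> carrier (B.F n (Suc i))" "snd u \<in> carrier (A.F n i)" by (auto simp: carrier_cone_Suc)
  have cl: "boundary R (fst u) \<in> carrier (B.F n i)" "\<phi> n i (snd u) \<in> carrier (B.F n i)"
    "\<gamma>' n (Suc i) (fst u) \<in> carrier (C.F n (Suc i))"
    using lin_closed[OF B.F.complex.lin_d fs(1)] lin_closed[OF lin_\<phi> fs(2)] lin_closed[OF lin_\<gamma>' fs(1)] .
  have "\<psi> n i (U.cs.D n i u) = \<gamma>' n i (boundary R (fst u)) \<oplus>\<^bsub>C.F n i\<^esub> \<gamma>' n i (\<phi> n i (snd u))"
    using lin_add[OF lin_\<gamma>' cl(1,2)] by (simp add: \<psi>_def cone_d_def)
  also have "\<dots> = boundary R (\<gamma>' n (Suc i) (fst u))"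
    using \<gamma>'_\<phi>[OF fs(2)] chain_map_\<gamma>'[of n] fs lin_closed[OF C.F.complex.lin_d cl(3)]
    by (simp add: chain_map_def)
  finally show "\<psi> n i (U.cs.D n i u) = boundary R (\<psi> n (Suc i) u)" by (simp add: \<psi>_def)
qed

sublocale W: inverse_system_map R U.cs.C U.cs.D U.cone_\<tau> C.F C.bd C.\<sigma> \<psi>
proof (intro inverse_system_map.intro inverse_system_map_axioms.intro
      U.inverse_system_cone C.inverse_system_res chain_map_\<psi>)
  fix n k u i assume nk: "n \<le> k" and u: "u \<in> carrier (U.cs.C k i)"
  have "fst u \<in> carrier (B.F k i)" using lin_closed[OF U.cs.lin_fst_C u] .
  then show "\<psi> n i (U.cone_\<tau> n k i u) = C.\<sigma> n k i (\<psi> k i u)"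
    using \<gamma>'_\<sigma>[OF nk] by (simp add: \<psi>_def U.cone_\<tau>_def)
qed

text \<open>The subtracted term has augmentation zero, so \<open>\<phi>\<close> still lies over
  \<open>f\<close>.\<close>

lemma aug_\<phi>: "u \<in> carrier (A.F n 0) \<Longrightarrow> augmentation R (B n) (\<phi> n 0 u) = f n (augmentation R (A n) u)"
proof -
  assume u: "u \<in> carrier (A.F n 0)"
  interpret Bm: module R "B n" by (rule B.module_A)
  have "f n (augmentation R (A n) u) \<in> carrier (B n)"
    using lin_closed[OF lin_f] lin_closed[OF lin_augmentation[OF cr A.module_A] u] by simp
  then show ?thesis
    unfolding \<phi>_def lin_diff[OF lin_augmentation[OF cr B.module_A] rp_closed(1)[OF u] rp_closed(2)[OF u]]
    using lin_zero[OF lin_uminus[OF lin_ident[OF B.module_A[of n]]]]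
    by (simp add: augmentation_rpush[OF cr lin_f u] augmentation_rpush[OF cr lin_0 u] Bm.minus_eq)
qed

lemma exact_0:
  assumes "module R M" "u \<in> carrier (res R M 0)" "augmentation R M u = \<zero>\<^bsub>M\<^esub>"
  shows "u \<in> boundary R ` carrier (res R M (Suc 0))"
  using res_exact[OF cr assms(1,2)] assms(3) by (simp add: is_cycle_def)

lemma exact_Suc:
  assumes "module R M" "u \<in> carrier (res R M (Suc n))" "boundary R u = \<zero>\<^bsub>res R M n\<^esub>"
  shows "u \<in> boundary R ` carrier (res R M (Suc (Suc n)))"
  using res_exact[OF cr assms(1,2)] assms(3) by (simp add: is_cycle_def res_def)

text \<open>In degree 1 the homology of the cone of \<open>\<phi>\<close> is the kernel of
  \<open>f\<close>, and in higher degrees it is zero. A transition that kills the kernel of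
  \<open>f\<close> thus kills all of it.\<close>

lemma U_kill:
  assumes nm: "n \<le> m" and m: "\<And>x. x \<in> carrier (A m) \<Longrightarrow> f m x = \<zero>\<^bsub>B m\<^esub> \<Longrightarrow> tA n m x = \<zero>\<^bsub>A n\<^esub>"
    and u: "u \<in> carrier (U.cs.C m (Suc j))" "U.cs.D m j u = \<zero>\<^bsub>U.cs.C m j\<^esub>"
  shows "U.cone_\<tau> n m (Suc j) u \<in> U.cs.D n (Suc j) ` carrier (U.cs.C n (Suc (Suc j)))"
proof (rule U.cone_kill[OF nm u])
  have fs: "fst u \<in> carrier (B.F m (Suc j))" "snd u \<in> carrier (A.F m j)"
    using u(1) by (auto simp: carrier_cone_Suc)
  show "A.\<sigma> n m j (snd u) \<in> boundary R ` carrier (A.F n (Suc j))"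
  proof (cases j)
    case 0
    note au = lin_augmentation[OF cr A.module_A[of m]] and bu = lin_augmentation[OF cr B.module_A[of m]]
    have s0: "snd u \<in> carrier (A.F m 0)" and f1: "fst u \<in> carrier (B.F m (Suc 0))" using fs 0 by auto
    have z: "boundary R (fst u) \<oplus>\<^bsub>B.F m 0\<^esub> \<phi> m 0 (snd u) = \<zero>\<^bsub>B.F m 0\<^esub>"
      using u(2) 0 by (simp add: cone_d_def cone_def)
    have cl: "boundary R (fst u) \<in> carrier (B.F m 0)" "\<phi> m 0 (snd u) \<in> carrier (B.F m 0)"
      using lin_closed[OF B.F.complex.lin_d f1] lin_closed[OF lin_\<phi> s0] .
    interpret Bm: module R "B m" by (rule B.module_A)
    have fa: "f m (augmentation R (A m) (snd u)) \<in> carrier (B m)"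
      using lin_closed[OF lin_f] lin_closed[OF au s0] by simp
    have "\<zero>\<^bsub>B m\<^esub> = augmentation R (B m) (boundary R (fst u) \<oplus>\<^bsub>B.F m 0\<^esub> \<phi> m 0 (snd u))"
      unfolding z by (rule lin_zero[OF bu, symmetric])
    also have "\<dots> = f m (augmentation R (A m) (snd u))"
      using fa by (simp add: lin_add[OF bu cl] augmentation_boundary[OF cr B.module_A f1] aug_\<phi>[OF s0])
    \<comment> \<open>The cycle condition puts the augmentation of the component in \<open>A\<close>
      into the kernel of \<open>f m\<close>, which the transition to \<open>n\<close> kills.\<close>
    finally have "tA n m (augmentation R (A m) (snd u)) = \<zero>\<^bsub>A n\<^esub>"
      by (intro m lin_closed[OF au s0]) simp
    then have "augmentation R (A n) (A.\<sigma> n m 0 (snd u)) = \<zero>\<^bsub>A n\<^esub>"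
      by (simp add: augmentation_rpush[OF cr A.lin_t[OF nm] s0])
    then show ?thesis unfolding 0
      by (rule exact_0[OF A.module_A lin_closed[OF A.F.lin_\<tau>[OF nm] s0]])
  next
    case (Suc k)
    have s: "snd u \<in> carrier (A.F m (Suc k))" using fs Suc by simp
    have "\<ominus>\<^bsub>A.F m k\<^esub> boundary R (snd u) = \<zero>\<^bsub>A.F m k\<^esub>"
      using u(2) Suc by (simp add: cone_d_def cone_def)
    then have "boundary R (snd u) = \<zero>\<^bsub>A.F m k\<^esub>"
      using neg_zero_iff[OF A.F.complex.module_P lin_closed[OF A.F.complex.lin_d s]] by simp
    then have "boundary R (A.\<sigma> n m (Suc k) (snd u)) = \<zero>\<^bsub>A.F n k\<^esub>"
      using A.F.\<tau>_d[OF nm s] lin_zero[OF A.F.lin_\<tau>[OF nm]] by simp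
    then show ?thesis unfolding Suc
      by (rule exact_Suc[OF A.module_A lin_closed[OF A.F.lin_\<tau>[OF nm] s]])
  qed
qed (rule exact_Suc[OF B.module_A])

text \<open>By surjectivity of \<open>g\<close>, an element of degree 0 differs by a boundary from
  the image of the basis vector of a preimage of its augmentation.\<close>

lemma W_kill_0:
  assumes nm: "n \<le> m" and w: "w \<in> carrier (W.cs.C m 0)"
  shows "W.cone_\<tau> n m 0 w \<in> W.cs.D n 0 ` carrier (W.cs.C n (Suc 0))"
proof -
  interpret Cm: module R "C n" by (rule C.module_A)
  interpret Fm: module R "C.F n 0" by (rule C.F.complex.module_P)
  note cu = lin_augmentation[OF cr C.module_A[of n]]
  have "W.cone_\<tau> n m 0 w \<in> carrier (W.cs.C n 0)" by (rule lin_closed[OF W.lin_cone_\<tau>[OF nm] w])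
  then obtain z where z: "z \<in> carrier (C.F n 0)" "W.cone_\<tau> n m 0 w = (z, \<zero>\<^bsub>U.cs.C n 0\<^esub>)"
    by (auto simp: carrier_cone_0)
  obtain b where b: "b \<in> carrier (B n)" "augmentation R (C n) z = g n b"
    using surj_g[of n] lin_closed[OF cu z(1)] by blast
  let ?b = "unit_vec R (Gen b)"
  have bb: "?b \<in> carrier (B.F n 0)" by (rule unit_gen[OF cr B.module_A b(1)])
  have gb: "\<gamma>' n 0 ?b \<in> carrier (C.F n 0)" by (rule lin_closed[OF lin_\<gamma>' bb])
  have "augmentation R (C n) (z \<ominus>\<^bsub>C.F n 0\<^esub> \<gamma>' n 0 ?b) = g n b \<ominus>\<^bsub>C n\<^esub> g n b"
    unfolding lin_diff[OF cu z(1) gb] b(2)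
    using augmentation_rpush[OF cr lin_g bb] augmentation_unit[OF cr B.module_A b(1)] by (simp add: \<gamma>'_def)
  also have "\<dots> = \<zero>\<^bsub>C n\<^esub>" using lin_closed[OF lin_g b(1)] by (simp add: Cm.minus_eq Cm.r_neg)
  finally obtain z' where z': "z' \<in> carrier (C.F n (Suc 0))" "z \<ominus>\<^bsub>C.F n 0\<^esub> \<gamma>' n 0 ?b = boundary R z'"
    using exact_0[OF C.module_A, of "z \<ominus>\<^bsub>C.F n 0\<^esub> \<gamma>' n 0 ?b" n] z gb by blast
  let ?v = "(z', (?b, \<zero>\<^bsub>A.F n 0\<^esub>))"
  have v: "?v \<in> carrier (W.cs.C n (Suc 0))" using z' bb by (simp add: carrier_cone_Suc carrier_cone_0)
  have eq: "W.cs.D n 0 ?v = W.cone_\<tau> n m 0 w"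
    unfolding z(2) using z(1) gb by (simp add: cone_d_def \<psi>_def z'(2)[symmetric] Fm.minus_eq Fm.a_assoc Fm.l_neg)
  show ?thesis using imageI[OF v, of "W.cs.D n 0"] unfolding eq .
qed

text \<open>By \<open>cone_kill\<close> only the component in the cone of \<open>\<phi>\<close>
  matters. In positive degree \<open>U_kill\<close> applies. In degree 0 its part in
  \<open>B\<close> has augmentation in the kernel of \<open>g\<close>, that is, in the image of
  \<open>f\<close>, so it bounds already at stage \<open>m\<close>.\<close>

lemma W_kill_Suc:
  assumes nm: "n \<le> m" and m: "\<And>x. x \<in> carrier (A m) \<Longrightarrow> f m x = \<zero>\<^bsub>B m\<^esub> \<Longrightarrow> tA n m x = \<zero>\<^bsub>A n\<^esub>"
    and w: "w \<in> carrier (W.cs.C m (Suc j))" "W.cs.D m j w = \<zero>\<^bsub>W.cs.C m j\<^esub>"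
  shows "W.cone_\<tau> n m (Suc j) w \<in> W.cs.D n (Suc j) ` carrier (W.cs.C n (Suc (Suc j)))"
proof (rule W.cone_kill[OF nm w])
  have fs: "fst w \<in> carrier (C.F m (Suc j))" "snd w \<in> carrier (U.cs.C m j)"
    using w(1) by (auto simp: carrier_cone_Suc)
  show "U.cone_\<tau> n m j (snd w) \<in> U.cs.D n j ` carrier (U.cs.C n (Suc j))"
  proof (cases j)
    case (Suc k)
    have s: "snd w \<in> carrier (U.cs.C m (Suc k))" using fs Suc by simp
    have "\<ominus>\<^bsub>U.cs.C m k\<^esub> U.cs.D m k (snd w) = \<zero>\<^bsub>U.cs.C m k\<^esub>"
      using w(2) Suc by (simp add: cone_d_def[of "U.cs.C m"] cone_def[of "U.cs.C m"])
    then have Ds: "U.cs.D m k (snd w) = \<zero>\<^bsub>U.cs.C m k\<^esub>"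
      using neg_zero_iff[OF U.cs.module_C lin_closed[OF U.cs.lin_D s]] by simp
    show ?thesis unfolding Suc by (rule U_kill[OF nm]) (rule m, assumption+, rule s, rule Ds)
  next
    case 0
    interpret Bm: module R "B m" by (rule B.module_A)
    interpret Cm: module R "C m" by (rule C.module_A)
    interpret Fm: module R "B.F m 0" by (rule B.F.complex.module_P)
    note bu = lin_augmentation[OF cr B.module_A[of m]] and cu = lin_augmentation[OF cr C.module_A[of m]]
    have f1: "fst w \<in> carrier (C.F m (Suc 0))" using fs 0 by simp
    obtain y where y: "y \<in> carrier (B.F m 0)" "snd w = (y, \<zero>\<^bsub>A.F m 0\<^esub>)"
      using fs(2) 0 by (auto simp: carrier_cone_0)
    have z: "boundary R (fst w) \<oplus>\<^bsub>C.F m 0\<^esub> \<gamma>' m 0 y = \<zero>\<^bsub>C.F m 0\<^esub>"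
      using w(2) 0 y(2) by (simp add: cone_d_def[of "U.cs.C m"] cone_def[of "U.cs.C m"] \<psi>_def)
    have cl: "boundary R (fst w) \<in> carrier (C.F m 0)" "\<gamma>' m 0 y \<in> carrier (C.F m 0)"
      using lin_closed[OF C.F.complex.lin_d f1] lin_closed[OF lin_\<gamma>' y(1)] .
    have ga: "g m (augmentation R (B m) y) \<in> carrier (C m)"
      using lin_closed[OF lin_g] lin_closed[OF bu y(1)] by simp
    have "\<zero>\<^bsub>C m\<^esub> = augmentation R (C m) (boundary R (fst w) \<oplus>\<^bsub>C.F m 0\<^esub> \<gamma>' m 0 y)"
      unfolding z by (rule lin_zero[OF cu, symmetric])
    also have "\<dots> = g m (augmentation R (B m) y)"
      unfolding lin_add[OF cu cl] using ga augmentation_rpush[OF cr lin_g y(1)]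
      by (simp add: augmentation_boundary[OF cr C.module_A f1] \<gamma>'_def)
    finally obtain a where a: "a \<in> carrier (A m)" "augmentation R (B m) y = f m a"
      using ker_g[OF lin_closed[OF bu y(1)]] by auto
    let ?a = "unit_vec R (Gen a)"
    have aa: "?a \<in> carrier (A.F m 0)" by (rule unit_gen[OF cr A.module_A a(1)])
    have pa: "\<phi> m 0 ?a \<in> carrier (B.F m 0)" by (rule lin_closed[OF lin_\<phi> aa])
    have "augmentation R (B m) (y \<ominus>\<^bsub>B.F m 0\<^esub> \<phi> m 0 ?a) = f m a \<ominus>\<^bsub>B m\<^esub> f m a"
      unfolding lin_diff[OF bu y(1) pa] a(2) aug_\<phi>[OF aa] augmentation_unit[OF cr A.module_A a(1)] ..
    also have "\<dots> = \<zero>\<^bsub>B m\<^esub>" using lin_closed[OF lin_f a(1)] by (simp add: Bm.minus_eq Bm.r_neg)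
    finally obtain y' where y': "y' \<in> carrier (B.F m (Suc 0))" "y \<ominus>\<^bsub>B.F m 0\<^esub> \<phi> m 0 ?a = boundary R y'"
      using exact_0[OF B.module_A, of "y \<ominus>\<^bsub>B.F m 0\<^esub> \<phi> m 0 ?a" m] y pa by blast
    have v: "(y', ?a) \<in> carrier (U.cs.C m (Suc 0))" using y' aa by (simp add: carrier_cone_Suc)
    have "U.cs.D m 0 (y', ?a) = snd w"
      unfolding y(2) using y(1) pa by (simp add: cone_d_def y'(2)[symmetric] Fm.minus_eq Fm.a_assoc Fm.l_neg)
    then have eq: "U.cone_\<tau> n m 0 (snd w) = U.cs.D n 0 (U.cone_\<tau> n m (Suc 0) (y', ?a))"
      using U.C.\<tau>_d[OF nm v] by simp
    show ?thesis unfolding 0 eq by (rule imageI[OF lin_closed[OF U.lin_cone_\<tau>[OF nm] v]])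
  qed
qed (rule exact_Suc[OF C.module_A])

text \<open>The terms of \<open>W\<close> are finite sums of free and zero modules, so maps out of
  them lift; the \<open>m\<close> from \<open>pro_inj\<close> serves every degree.\<close>

lemma pro_acyclic_W: "pro_acyclic R W.cs.C W.cs.D W.cone_\<tau>"
proof (intro pro_acyclic.intro pro_acyclic_axioms.intro W.inverse_system_cone)
  have free: "lifts R (res R M j) T" for M :: "('a, 'm) module" and j and T :: "'w itself"
    unfolding res_def by (rule lifts_free[OF cr])
  show "lifts R (W.cs.C n i) TYPE((('a, 'z) symb \<Rightarrow> 'a) \<times> (('a, 'y) symb \<Rightarrow> 'a) \<times> (('a, 'x) symb \<Rightarrow> 'a))" for n i
    by (intro lifts_cone free A.F.complex.module_P B.F.complex.module_P C.F.complex.module_P U.cs.module_C)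
  fix n
  obtain m where nm: "n \<le> m" and m: "\<And>x. x \<in> carrier (A m) \<Longrightarrow> f m x = \<zero>\<^bsub>B m\<^esub> \<Longrightarrow> tA n m x = \<zero>\<^bsub>A n\<^esub>"
    using pro_inj[of n] by blast
  show "\<exists>m\<ge>n. (\<forall>u\<in>carrier (W.cs.C m 0). W.cone_\<tau> n m 0 u \<in> W.cs.D n 0 ` carrier (W.cs.C n (Suc 0))) \<and>
      (\<forall>i. \<forall>u\<in>carrier (W.cs.C m (Suc i)). W.cs.D m i u = \<zero>\<^bsub>W.cs.C m i\<^esub> \<longrightarrow>
         W.cone_\<tau> n m (Suc i) u \<in> W.cs.D n (Suc i) ` carrier (W.cs.C n (Suc (Suc i))))"
  proof (intro exI[of _ m] conjI ballI allI impI nm)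
    show "W.cone_\<tau> n m 0 u \<in> W.cs.D n 0 ` carrier (W.cs.C n (Suc 0))"
      if "u \<in> carrier (W.cs.C m 0)" for u by (rule W_kill_0[OF nm that])
    show "W.cone_\<tau> n m (Suc i) u \<in> W.cs.D n (Suc i) ` carrier (W.cs.C n (Suc (Suc i)))"
      if "u \<in> carrier (W.cs.C m (Suc i))" "W.cs.D m i u = \<zero>\<^bsub>W.cs.C m i\<^esub>" for i u
      by (rule W_kill_Suc[OF nm]) (rule m, assumption+, rule that, rule that)
  qed
qed

abbreviation "TA N i \<equiv> coh_lim R A.F A.bd A.\<sigma> N i"
abbreviation "TB N i \<equiv> coh_lim R B.F B.bd B.\<sigma> N i"
abbreviation "TC N i \<equiv> coh_lim R C.F C.bd C.\<sigma> N i"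
abbreviation "TU N i \<equiv> coh_lim R U.cs.C U.cs.D U.cone_\<tau> N i"

text \<open>The limit for \<open>W\<close> vanishes, so its long exact sequence makes the map
  induced by \<open>\<psi>\<close> bijective. The cone of \<open>\<phi>\<close> may therefore stand
  in for \<open>C\<close> in the long exact sequence of \<open>\<phi>\<close>.\<close>

lemma cone_iso:
  assumes N: "module R N"
  obtains \<iota> where "\<And>i. lin R (TC N i) (TU N i) (\<iota> i)" "\<And>i. inj_on (\<iota> i) (carrier (TC N i))"
    "\<And>i. \<iota> i ` carrier (TC N i) = carrier (TU N i)"
proof -
  interpret W': pro_acyclic R W.cs.C W.cs.D W.cone_\<tau> by (rule pro_acyclic_W)
  let ?W = "coh_lim R W.cs.C W.cs.D W.cone_\<tau> N"
  note triv = W'.coh_lim_trivial[OF N]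
  show thesis
  proof (rule W.cone_long_exact[OF N])
  fix \<alpha> \<beta> \<gamma>
  assume 1: "\<And>i. exact_seq R (?W i) (\<gamma> i) (TC N i) (\<alpha> i) (TU N i)"
    and 2: "\<And>i. exact_seq R (TC N i) (\<alpha> i) (TU N i) (\<beta> i) (?W (Suc i))"
  have lin: "lin R (TC N i) (TU N i) (\<alpha> i)" for i using 1[of i] by (simp add: exact_seq_def)
  show thesis
  proof (rule that[of \<alpha>, OF lin])
    show "inj_on (\<alpha> i) (carrier (TC N i))" for i
    proof (rule lin_inj_onI[OF lin])
      fix x assume x: "x \<in> carrier (TC N i)" "\<alpha> i x = \<zero>\<^bsub>TU N i\<^esub>"
      have g: "lin R (?W i) (TC N i) (\<gamma> i)" using 1[of i] by (simp add: exact_seq_def)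
      have "x \<in> \<gamma> i ` carrier (?W i)" using 1[of i] x by (auto simp: exact_seq_def)
      then show "x = \<zero>\<^bsub>TC N i\<^esub>" unfolding triv using lin_zero[OF g] by simp
    qed
    show "\<alpha> i ` carrier (TC N i) = carrier (TU N i)" for i
    proof -
      have b: "lin R (TU N i) (?W (Suc i)) (\<beta> i)" using 2[of i] by (simp add: exact_seq_def)
      have bz: "\<beta> i y = \<zero>\<^bsub>?W (Suc i)\<^esub>" if "y \<in> carrier (TU N i)" for y
        using lin_closed[OF b that] unfolding triv by simp
      have im: "\<alpha> i ` carrier (TC N i) = {y \<in> carrier (TU N i). \<beta> i y = \<zero>\<^bsub>?W (Suc i)\<^esub>}"
        using 2[of i] by (simp add: exact_seq_def)
      show ?thesis unfolding im by (auto simp: bz)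
    qed
  qed
  qed
qed

end


section \<open>Cofiniteness along exact sequences\<close>

context
  fixes R :: "('a, 'r) ring_scheme" and I :: "'a set"
  assumes R: "cring R" and N: "noetherian_ring R" and I: "ideal I R"
    and ab: "cofinite_category_abelian R I"
begin

abbreviation "ker_mod X f Y \<equiv> X\<lparr>carrier := {x \<in> carrier X. f x = \<zero>\<^bsub>Y\<^esub>}\<rparr>"
abbreviation "im_mod f X Y \<equiv> Y\<lparr>carrier := f ` carrier X\<rparr>"

text \<open>The image of \<open>g\<close> is \<open>Y\<close> modulo the image of \<open>f\<close>,
  the cokernel of a map between cofinite modules. This gives information on the image before
  \<open>Z\<close> is known to be cofinite.\<close>

lemma cofinite_image:
  assumes ex: "exact_seq R X f Y g Z" and X: "cofinite_module R I X" and Y: "cofinite_module R I Y"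
  shows "cofinite_module R I (im_mod g Y Z)"
proof -
  have f: "lin R X Y f" and g: "lin R Y Z g" and im: "{y \<in> carrier Y. g y = \<zero>\<^bsub>Z\<^esub>} = f ` carrier X"
    using ex by (auto simp: exact_seq_def)
  note MY = lin_module1[OF g]
  have fs: "submodule (f ` carrier X) R Y" and gs: "submodule (g ` carrier Y) R Z"
    using submodule_range[OF f] submodule_range[OF g] .
  have z: "g y = \<zero>\<^bsub>Z\<^esub>" if "y \<in> f ` carrier X" for y using that unfolding im[symmetric] by simp
  obtain h where h: "lin R (quot_module Y (f ` carrier X)) Z h"
    "\<And>y. y \<in> carrier Y \<Longrightarrow> h (f ` carrier X +>\<^bsub>Y\<^esub> y) = g y"
  proof (rule quot_lift[OF g fs z], goal_cases)
    case (2 h)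
    show ?case by (rule 2(1)[OF 2(2) 2(3)])
  qed
  have im_h: "h ` carrier (quot_module Y (f ` carrier X)) = g ` carrier Y"
    by (auto simp: quot_module_simps(1) h(2) image_image)
  show ?thesis
  proof (rule cofinite_iso[OF R N I _ _ _ cofinite_kernel_cokernel(2)[OF R N I ab X Y f]])
    show "lin R (quot_module Y (f ` carrier X)) (im_mod g Y Z) h"
      using im_h by (intro lin_into_submodule[OF h(1) gs]) blast
    show "inj_on h (carrier (quot_module Y (f ` carrier X)))"
    proof (rule lin_inj_onI[OF h(1)])
      fix C assume C: "C \<in> carrier (quot_module Y (f ` carrier X))" "h C = \<zero>\<^bsub>Z\<^esub>"
      then obtain y where y: "y \<in> carrier Y" "C = f ` carrier X +>\<^bsub>Y\<^esub> y" by (auto simp: quot_module_simps(1))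
      then have "y \<in> f ` carrier X" using C h(2) im by auto
      then show "C = \<zero>\<^bsub>quot_module Y (f ` carrier X)\<^esub>"
        using rcoset_eq_iff_zero[OF MY fs y(1)] y(2) by (simp add: quot_module_simps(2))
    qed
  qed (simp add: im_h)
qed

lemma cofinite_glue:
  assumes ex: "exact_seq R X f Y g Z" and X: "cofinite_module R I (im_mod f X Y)"
    and Z: "cofinite_module R I (im_mod g Y Z)"
  shows "cofinite_module R I Y"
proof -
  have f: "lin R X Y f" and g: "lin R Y Z g" and im: "{y \<in> carrier Y. g y = \<zero>\<^bsub>Z\<^esub>} = f ` carrier X"
    using ex by (auto simp: exact_seq_def)
  have fs: "submodule (f ` carrier X) R Y" and gs: "submodule (g ` carrier Y) R Z"
    using submodule_range[OF f] submodule_range[OF g] .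
  have i: "lin R (im_mod f X Y) Y (\<lambda>x. x)" by (rule lin_submodule[OF lin_ident[OF lin_module2[OF f]] fs])
  have p: "lin R Y (im_mod g Y Z) g" by (rule lin_into_submodule[OF g gs]) simp
  show ?thesis
    by (rule cofinite_extension[OF R N I i _ p _ _ X Z]) (use im in auto)
qed

text \<open>A submodule of a cofinite module need not be cofinite, but this much is inherited, and it
  is known about the cohomology of a syzygy before its cofiniteness is.\<close>

definition semi :: "('a, 'y) module \<Rightarrow> bool" where
  "semi Y \<longleftrightarrow> (\<exists>(Z :: ('a, 'a list) module) h. cofinite_module R I Z \<and> lin R Y Z h \<and>
     cofinite_module R I (ker_mod Y h Z))"

text \<open>\<open>semi\<close> has to fix a type for its target. A target of any type is replaced
  by its copy in \<open>'a list\<close>, which does not change the kernel.\<close>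

lemma semiI:
  assumes Z: "cofinite_module R I Z" and h: "lin R Y Z h" and k: "cofinite_module R I (ker_mod Y h Z)"
  shows "semi Y"
proof -
  obtain T :: "('a, 'a list) module" and e where T: "cofinite_module R I T" "lin R Z T e"
    "inj_on e (carrier Z)" by (rule cofinite_list_copy[OF R N I Z])
  have "e (h y) = \<zero>\<^bsub>T\<^esub> \<longleftrightarrow> h y = \<zero>\<^bsub>Z\<^esub>" if "y \<in> carrier Y" for y
    using inj_on_eq_iff[OF T(3) lin_closed[OF h that] module_zero_closed[OF lin_module2[OF h]]] lin_zero[OF T(2)] by simp
  then have "{y \<in> carrier Y. e (h y) = \<zero>\<^bsub>T\<^esub>} = {y \<in> carrier Y. h y = \<zero>\<^bsub>Z\<^esub>}" by blast
  then show ?thesis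
    unfolding semi_def using T(1) lin_comp[OF h T(2)] k by (intro exI[of _ T] exI[of _ "\<lambda>y. e (h y)"]) simp
qed

lemma semi_iso:
  assumes f: "lin R X Y f" "inj_on f (carrier X)" "f ` carrier X = carrier Y" and Y: "semi Y"
  shows "semi X"
proof -
  obtain Z :: "('a, 'a list) module" and h where Z: "cofinite_module R I Z" and h: "lin R Y Z h"
    and k: "cofinite_module R I (ker_mod Y h Z)" using Y by (auto simp: semi_def)
  have hf: "lin R X Z (\<lambda>x. h (f x))" by (rule lin_comp[OF f(1) h])
  show ?thesis
  proof (rule semiI[OF Z hf], rule lin_inverse[OF f])
    fix g assume g: "lin R Y X g" "inj_on g (carrier Y)" "g ` carrier Y = carrier X"
      "\<And>x. x \<in> carrier X \<Longrightarrow> g (f x) = x" "\<And>y. y \<in> carrier Y \<Longrightarrow> f (g y) = y"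
    show "cofinite_module R I (ker_mod X (\<lambda>x. h (f x)) Z)"
    proof (rule cofinite_iso[OF R N I _ _ _ k])
      show "lin R (ker_mod Y h Z) (ker_mod X (\<lambda>x. h (f x)) Z) g"
        using g(5) lin_closed[OF g(1)]
        by (intro lin_into_submodule[OF lin_submodule[OF g(1) submodule_kernel[OF h]] submodule_kernel[OF hf]]) auto
      show "inj_on g (carrier (ker_mod Y h Z))" by (rule inj_on_subset[OF g(2)]) auto
      have "x \<in> g ` {y \<in> carrier Y. h y = \<zero>\<^bsub>Z\<^esub>}" if "x \<in> carrier X" "h (f x) = \<zero>\<^bsub>Z\<^esub>" for x
        using that g(4)[OF that(1)] lin_closed[OF f(1)] by (intro image_eqI[of _ _ "f x"]) auto
      then show "g ` carrier (ker_mod Y h Z) = carrier (ker_mod X (\<lambda>x. h (f x)) Z)"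
        using g(5) lin_closed[OF g(1)] by auto
    qed
  qed
qed

lemma cofinite_semi:
  assumes Y: "cofinite_module R I Y"
  shows "semi Y"
proof -
  have MY: "module R Y" using Y by (simp add: cofinite_module_def)
  have l: "lin R Y Y (\<lambda>x. x)" by (rule lin_ident[OF MY])
  show ?thesis by (rule semiI[OF Y l cofinite_kernel_cokernel(1)[OF R N I ab Y Y l]])
qed

text \<open>With \<open>h\<close> the map from \<open>Y\<close> to a cofinite module, the kernel of
  \<open>f\<close> is the kernel of its restriction \<open>ker (h f) \<rightarrow> ker h\<close>, a
  map between cofinite modules.\<close>

lemma cofinite_kernel_semi:
  assumes X: "cofinite_module R I X" and Y: "semi Y" and f: "lin R X Y f"
  shows "cofinite_module R I (ker_mod X f Y)"
proof -
  obtain Z :: "('a, 'a list) module" and h where Z: "cofinite_module R I Z" and h: "lin R Y Z h"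
    and k: "cofinite_module R I (ker_mod Y h Z)" using Y by (auto simp: semi_def)
  have hf: "lin R X Z (\<lambda>x. h (f x))" by (rule lin_comp[OF f h])
  let ?K = "ker_mod X (\<lambda>x. h (f x)) Z"
  have K: "cofinite_module R I ?K" by (rule cofinite_kernel_cokernel(1)[OF R N I ab X Z hf])
  have fK: "lin R ?K (ker_mod Y h Z) f"
    using lin_closed[OF f]
    by (intro lin_into_submodule[OF lin_submodule[OF f submodule_kernel[OF hf]] submodule_kernel[OF h]]) auto
  have "{x \<in> {x \<in> carrier X. h (f x) = \<zero>\<^bsub>Z\<^esub>}. f x = \<zero>\<^bsub>Y\<^esub>} = {x \<in> carrier X. f x = \<zero>\<^bsub>Y\<^esub>}"
    using lin_zero[OF h] by auto
  then show ?thesis using cofinite_kernel_cokernel(1)[OF R N I ab K k fK] by simp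
qed

section \<open>Transfer of cofiniteness between the terms of a long exact sequence\<close>

context
  fixes A :: "nat \<Rightarrow> ('a, 'x) module" and B :: "nat \<Rightarrow> ('a, 'y) module" and C :: "nat \<Rightarrow> ('a, 'z) module"
    and \<alpha> \<beta> \<gamma>
  assumes exB: "\<And>i. exact_seq R (C i) (\<gamma> i) (B i) (\<alpha> i) (A i)"
    and exA: "\<And>i. exact_seq R (B i) (\<alpha> i) (A i) (\<beta> i) (C (Suc i))"
    and exC: "\<And>i. exact_seq R (A i) (\<beta> i) (C (Suc i)) (\<gamma> (Suc i)) (B (Suc i))"
    and inj0: "\<And>x. x \<in> carrier (C 0) \<Longrightarrow> \<gamma> 0 x = \<zero>\<^bsub>B 0\<^esub> \<Longrightarrow> x = \<zero>\<^bsub>C 0\<^esub>"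
begin

lemma les_lin: "lin R (C i) (B i) (\<gamma> i)" "lin R (B i) (A i) (\<alpha> i)" "lin R (A i) (C (Suc i)) (\<beta> i)"
  using exB[of i] exA[of i] by (auto simp: exact_seq_def)

text \<open>By exactness this kernel is the image of the connecting map, hence isomorphic to the
  cokernel of \<open>\<alpha>\<close> in the previous degree; in degree 0 it is zero.\<close>

lemma les_kernel_\<gamma>:
  assumes prev: "\<And>j. i = Suc j \<Longrightarrow> cofinite_module R I (A j) \<and> cofinite_module R I (B j)"
  shows "cofinite_module R I (ker_mod (C i) (\<gamma> i) (B i))"
proof (cases i)
  case 0
  have MC: "module R (C 0)" by (rule lin_module1[OF les_lin(1)])
  have "{x \<in> carrier (C 0). \<gamma> 0 x = \<zero>\<^bsub>B 0\<^esub>} = {\<zero>\<^bsub>C 0\<^esub>}"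
  proof (intro subset_antisym subsetI)
    fix x assume "x \<in> {x \<in> carrier (C 0). \<gamma> 0 x = \<zero>\<^bsub>B 0\<^esub>}"
    then have "x = \<zero>\<^bsub>C 0\<^esub>" by (intro inj0) simp_all
    then show "x \<in> {\<zero>\<^bsub>C 0\<^esub>}" by simp
  qed (simp add: lin_zero[OF les_lin(1)] module_zero_closed[OF MC])
  then show ?thesis unfolding 0
    using cofinite_zero[OF R I submodule_module[OF MC submodule_zero[OF MC]]] by simp
next
  case (Suc j)
  have "cofinite_module R I (im_mod (\<beta> j) (A j) (C (Suc j)))"
    using cofinite_image[OF exA[of j]] prev[OF Suc] by blast
  then show ?thesis unfolding Suc using exC[of j] by (simp add: exact_seq_def)
qed

lemma les_image_\<gamma>: "carrier (ker_mod (B i) (\<alpha> i) (A i)) = \<gamma> i ` carrier (C i)"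
  using exB[of i] by (simp add: exact_seq_def)

text \<open>\<open>C i\<close> is an extension of \<open>ker \<alpha>\<close> by
  \<open>ker \<gamma>\<close>, and \<open>ker \<alpha>\<close> is cofinite as soon as its target is
  \<open>semi\<close>.\<close>

lemma les_cofinite_C:
  assumes B: "cofinite_module R I (B i)" and A: "semi (A i)"
    and prev: "\<And>j. i = Suc j \<Longrightarrow> cofinite_module R I (A j) \<and> cofinite_module R I (B j)"
  shows "cofinite_module R I (C i)"
proof -
  let ?K = "ker_mod (C i) (\<gamma> i) (B i)"
  note lg = les_lin(1)[of i]
  have k: "lin R ?K (C i) (\<lambda>x. x)" by (rule lin_submodule[OF lin_ident[OF lin_module1[OF lg]] submodule_kernel[OF lg]])
  have p: "lin R (C i) (ker_mod (B i) (\<alpha> i) (A i)) (\<gamma> i)"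
    using les_image_\<gamma>[of i] by (intro lin_into_submodule[OF lg submodule_kernel[OF les_lin(2)]]) auto
  show ?thesis
    by (rule cofinite_extension[OF R N I k _ p _ _ les_kernel_\<gamma>[OF prev] cofinite_kernel_semi[OF B A les_lin(2)]])
       (use les_image_\<gamma>[of i] in auto)
qed

lemma les_semi_C:
  assumes B: "cofinite_module R I (B i)"
    and prev: "\<And>j. i = Suc j \<Longrightarrow> cofinite_module R I (A j) \<and> cofinite_module R I (B j)"
  shows "semi (C i)"
  by (rule semiI[OF B les_lin(1) les_kernel_\<gamma>[OF prev]])

text \<open>Meant for the induction on the rank of a free module, where the outer terms are known.
  The image of \<open>C i\<close> in \<open>B i\<close> is a cokernel (or \<open>C 0\<close>
  itself), and the image of \<open>B i\<close> in \<open>A i\<close> is the kernel of the connecting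
  map.\<close>

lemma les_cofinite_B:
  assumes C: "cofinite_module R I (C i)" "cofinite_module R I (C (Suc i))" and A: "cofinite_module R I (A i)"
    and prev: "\<And>j. i = Suc j \<Longrightarrow> cofinite_module R I (A j)"
  shows "cofinite_module R I (B i)"
proof (rule cofinite_glue[OF exB[of i]])
  show "cofinite_module R I (im_mod (\<gamma> i) (C i) (B i))"
  proof (cases i)
    case 0
    have l: "lin R (C 0) (im_mod (\<gamma> 0) (C 0) (B 0)) (\<gamma> 0)"
      by (rule lin_into_submodule[OF les_lin(1) submodule_range[OF les_lin(1)]]) simp
    show ?thesis unfolding 0
      by (rule cofinite_iso[OF R N I l lin_inj_onI[OF les_lin(1) inj0] _ C(1)[unfolded 0]]) auto
  next
    case (Suc j)
    show ?thesis unfolding Suc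
      by (rule cofinite_image[OF exC[of j] prev[OF Suc] C(1)[unfolded Suc]])
  qed
  have "\<alpha> i ` carrier (B i) = {x \<in> carrier (A i). \<beta> i x = \<zero>\<^bsub>C (Suc i)\<^esub>}"
    using exA[of i] by (simp add: exact_seq_def)
  then show "cofinite_module R I (im_mod (\<alpha> i) (B i) (A i))"
    using cofinite_kernel_cokernel(1)[OF R N I ab A C(2) les_lin(3)] by simp
qed

end


section \<open>Generalized local cohomology\<close>

abbreviation "pq X n \<equiv> quot_module X (pw R I X n)"
abbreviation "pt X n \<equiv> (\<lambda>C. pw R I X n <+>\<^bsub>X\<^esub> C)"

lemma pt_eq:
  assumes X: "module R X" and nk: "n \<le> k" and x: "x \<in> carrier X"
  shows "pt X n (pw R I X k +>\<^bsub>X\<^esub> x) = pw R I X n +>\<^bsub>X\<^esub> x"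
proof -
  \<comment> \<open>As a union of cosets the transition map has the form that
    \<open>quot_map_eq\<close> handles, with the identity as underlying map.\<close>
  have eq: "pt X n C = (\<Union>y\<in>C. pw R I X n +>\<^bsub>X\<^esub> y)" for C
    by (auto simp: set_add_def' a_r_coset_def')
  have sub: "y \<in> pw R I X n" if "y \<in> pw R I X k" for y by (rule subsetD[OF pw_antimono[OF R I nk] that])
  show ?thesis unfolding eq
    by (rule quot_map_eq[OF X submodule_pw[OF R I X] lin_ident[OF X] submodule_pw[OF R I X] sub x])
qed

lemma lin_pq: "module R X \<Longrightarrow> lin R X (pq X n) (\<lambda>x. pw R I X n +>\<^bsub>X\<^esub> x)"
  by (rule lin_quot[OF _ submodule_pw[OF R I]])

lemma pq_surj: "(\<lambda>x. pw R I X n +>\<^bsub>X\<^esub> x) ` carrier X = carrier (pq X n)"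
  by (simp add: quot_module_simps(1))

lemma pq_cases:
  assumes "x' \<in> carrier (pq X n)"
  obtains x where "x \<in> carrier X" "x' = pw R I X n +>\<^bsub>X\<^esub> x"
  using assms by (auto simp: quot_module_simps(1))

lemma module_system_pq:
  assumes X: "module R X"
  shows "module_system R (pq X) (\<lambda>n k. pt X n)"
proof (rule module_system.intro[OF R])
  show "module R (pq X n)" for n by (rule module_quot[OF X submodule_pw[OF R I X]])
  show "lin R (pq X k) (pq X n) (pt X n)" if "n \<le> k" for n k
    by (rule lin_factor[OF lin_pq[OF X] pq_surj lin_pq[OF X] pt_eq[OF X that]])
  show "pt X n (pt X m x) = pt X n x" if nm: "n \<le> m" "m \<le> k" and x: "x \<in> carrier (pq X k)" for n m k x
    using x pt_eq[OF X] nm by (auto elim!: pq_cases)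
qed

definition pf where
  "pf Y n f C = (\<Union>x\<in>C. pw R I Y n +>\<^bsub>Y\<^esub> f x)"

lemma pf_eq:
  assumes f: "lin R X Y f" and x: "x \<in> carrier X"
  shows "pf Y n f (pw R I X n +>\<^bsub>X\<^esub> x) = pw R I Y n +>\<^bsub>Y\<^esub> f x"
  unfolding pf_def
  by (rule quot_map_eq[OF lin_module1[OF f] submodule_pw[OF R I lin_module1[OF f]] f
        submodule_pw[OF R I lin_module2[OF f]] pw_image[OF R I f] x])

lemma lin_pf:
  assumes f: "lin R X Y f"
  shows "lin R (pq X n) (pq Y n) (pf Y n f)"
  using lin_factor[OF lin_pq[OF lin_module1[OF f]] pq_surj lin_comp[OF f lin_pq[OF lin_module2[OF f]]],
      of "pf Y n f" n n] pf_eq[OF f] by blast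

abbreviation "T M K i \<equiv> gen_local_cohomology R I i M K"

lemma T_eq: "T M K i = coh_lim R (\<lambda>n. res R (pq M n)) (\<lambda>_ _. boundary R) (\<lambda>n k. rpush R (pt M n)) K i"
  by (simp add: gen_local_cohomology_def lim_Ext_eq_coh_lim)

text \<open>In the middle, an element of \<open>B\<close> that maps into \<open>I^n C\<close> can be
  corrected by one of \<open>I^n B\<close>, because \<open>I^n B\<close> maps onto
  \<open>I^n C\<close>. On the left, Artin-Rees for the image of \<open>A\<close> in
  \<open>B\<close> applies, which is where finite generation enters.\<close>

lemma pro_exact_pq:
  assumes f: "lin R A B f" "inj_on f (carrier A)" and g: "lin R B C g" "g ` carrier B = carrier C"
    and ex: "{y \<in> carrier B. g y = \<zero>\<^bsub>C\<^esub>} = f ` carrier A" and B: "fin_gen R B"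
  shows "pro_exact R (pq A) (\<lambda>n k. pt A n) (pq B) (\<lambda>n k. pt B n) (pq C) (\<lambda>n k. pt C n)
    (\<lambda>n. pf B n f) (\<lambda>n. pf C n g)"
proof -
  note MA = lin_module1[OF f(1)] and MB = lin_module2[OF f(1)] and MC = lin_module2[OF g(1)]
  interpret B: module R B by (rule MB)
  interpret C: module R C by (rule MC)
  note sA = submodule_pw[OF R I MA] and sB = submodule_pw[OF R I MB] and sC = submodule_pw[OF R I MC]
  have zA: "\<zero>\<^bsub>pq A n\<^esub> = pw R I A n" and zB: "\<zero>\<^bsub>pq B n\<^esub> = pw R I B n" and zC: "\<zero>\<^bsub>pq C n\<^esub> = pw R I C n" for n
    by (simp_all add: quot_module_simps(2))
  show ?thesis
  proof (intro pro_exact.intro pro_exact_axioms.intro module_system_pq MA MB MC lin_pf f(1) g(1))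
    fix n k x assume nk: "n \<le> k" and "x \<in> carrier (pq A k)"
    then obtain a where "a \<in> carrier A" "x = pw R I A k +>\<^bsub>A\<^esub> a" by (elim pq_cases)
    then show "pf B n f (pt A n x) = pt B n (pf B k f x)"
      using nk lin_closed[OF f(1)] by (simp add: pt_eq[OF MA] pt_eq[OF MB] pf_eq[OF f(1)])
  next
    fix n k x assume nk: "n \<le> k" and "x \<in> carrier (pq B k)"
    then obtain a where "a \<in> carrier B" "x = pw R I B k +>\<^bsub>B\<^esub> a" by (elim pq_cases)
    then show "pf C n g (pt B n x) = pt C n (pf C k g x)"
      using nk lin_closed[OF g(1)] by (simp add: pt_eq[OF MB] pt_eq[OF MC] pf_eq[OF g(1)])
  next
    fix n x assume "x \<in> carrier (pq A n)"
    then obtain a where a: "a \<in> carrier A" "x = pw R I A n +>\<^bsub>A\<^esub> a" by (elim pq_cases)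
    then have "g (f a) = \<zero>\<^bsub>C\<^esub>" using ex by blast
    then show "pf C n g (pf B n f x) = \<zero>\<^bsub>pq C n\<^esub>"
      using a lin_closed[OF f(1) a(1)] rcoset_eq_iff_zero[OF MC sC, of "\<zero>\<^bsub>C\<^esub>" n] submoduleD(2)[OF MC sC, of n]
      by (simp add: pf_eq[OF f(1)] pf_eq[OF g(1)] zC)
  next
    fix n y assume "y \<in> carrier (pq B n)" and y0: "pf C n g y = \<zero>\<^bsub>pq C n\<^esub>"
    then obtain b where b: "b \<in> carrier B" "y = pw R I B n +>\<^bsub>B\<^esub> b" by (elim pq_cases)
    have "g b \<in> pw R I C n"
      using y0 b rcoset_eq_iff_zero[OF MC sC lin_closed[OF g(1) b(1)], of n] by (simp add: pf_eq[OF g(1)] zC)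
    then obtain b' where b': "b' \<in> pw R I B n" "g b = g b'" using pw_surj[OF R I g] by blast
    have b'B: "b' \<in> carrier B" using b' submoduleD(1)[OF MB sB[of n]] by auto
    have "g (b \<ominus>\<^bsub>B\<^esub> b') = \<zero>\<^bsub>C\<^esub>"
      using b b'B b' C.diff_zero_iff[OF lin_closed[OF g(1) b(1)] lin_closed[OF g(1) b'B]] by (simp add: lin_diff[OF g(1)])
    then have "b \<ominus>\<^bsub>B\<^esub> b' \<in> f ` carrier A" using ex b b'B by blast
    then obtain a where a: "a \<in> carrier A" "b \<ominus>\<^bsub>B\<^esub> b' = f a" by blast
    have "b \<ominus>\<^bsub>B\<^esub> f a = b'"
    proof -
      have "b \<ominus>\<^bsub>B\<^esub> (b \<ominus>\<^bsub>B\<^esub> b') = (b \<ominus>\<^bsub>B\<^esub> b) \<oplus>\<^bsub>B\<^esub> b'"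
        using b b'B by (simp add: B.minus_eq B.minus_add B.a_assoc)
      then show ?thesis using b b'B a by (simp add: B.minus_eq B.r_neg)
    qed
    then have "y = pw R I B n +>\<^bsub>B\<^esub> f a"
      using b b'(1) rcoset_eq_iff[OF MB sB[of n] b(1) lin_closed[OF f(1) a(1)]] by simp
    then have "y = pf B n f (pw R I A n +>\<^bsub>A\<^esub> a)" using a by (simp add: pf_eq[OF f(1)])
    then show "y \<in> pf B n f ` carrier (pq A n)" using lin_closed[OF lin_pq[OF MA] a(1)] by blast
  next
    fix n
    show "pf C n g ` carrier (pq B n) = carrier (pq C n)"
    proof
      show "pf C n g ` carrier (pq B n) \<subseteq> carrier (pq C n)" using lin_closed[OF lin_pf[OF g(1)]] by blast
      show "carrier (pq C n) \<subseteq> pf C n g ` carrier (pq B n)"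
      proof
        fix x assume "x \<in> carrier (pq C n)"
        then obtain c where c: "c \<in> carrier C" "x = pw R I C n +>\<^bsub>C\<^esub> c" by (elim pq_cases)
        then obtain b where b: "b \<in> carrier B" "c = g b" using g(2) by blast
        have "x = pf C n g (pw R I B n +>\<^bsub>B\<^esub> b)" using b c by (simp add: pf_eq[OF g(1)])
        then show "x \<in> pf C n g ` carrier (pq B n)" using lin_closed[OF lin_pq[OF MB] b(1)] by blast
      qed
    qed
  next
    fix n
    have fA: "submodule (f ` carrier A) R B" by (rule submodule_range[OF f(1)])
    have L: "submodule (f ` pw R I A n) R B" by (rule submodule_image[OF f(1) sA])
    have LK: "f ` pw R I A n \<subseteq> f ` carrier A" using submoduleD(1)[OF MA sA[of n]] by blast
    have kill: "r \<odot>\<^bsub>B\<^esub> x \<in> f ` pw R I A n" if r: "r \<in> ideal_power R I n" and x: "x \<in> f ` carrier A" for r x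
    proof -
      obtain a where a: "a \<in> carrier A" "x = f a" using x by blast
      have "r \<in> carrier R" using r ideal_power_subset[OF R I] by blast
      then have "r \<odot>\<^bsub>B\<^esub> x = f (r \<odot>\<^bsub>A\<^esub> a)" using a by (simp add: lin_smult[OF f(1)])
      then show ?thesis using pw_gen[OF R I r a(1)] by blast
    qed
    \<comment> \<open>Artin-Rees with \<open>f(A)\<close> as the submodule and
      \<open>f(I^n A)\<close> inside it; multiplication by \<open>I^n\<close> takes the former into
      the latter.\<close>
    have "\<exists>m. pw R I B m \<inter> f ` carrier A \<subseteq> f ` pw R I A n"
      by (rule artin_rees[OF R I N MB B fA L LK kill])
    then obtain m0 where m0: "pw R I B m0 \<inter> f ` carrier A \<subseteq> f ` pw R I A n" by blast
    define m where "m = max n m0"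
    have m: "pw R I B m \<inter> f ` carrier A \<subseteq> f ` pw R I A n"
      using m0 pw_antimono[OF R I, of m0 m B] by (auto simp: m_def)
    have "pt A n x = \<zero>\<^bsub>pq A n\<^esub>" if x: "x \<in> carrier (pq A m)" "pf B m f x = \<zero>\<^bsub>pq B m\<^esub>" for x
    proof -
      obtain a where a: "a \<in> carrier A" "x = pw R I A m +>\<^bsub>A\<^esub> a" using x(1) by (elim pq_cases)
      have "f a \<in> pw R I B m"
        using x(2) a rcoset_eq_iff_zero[OF MB sB lin_closed[OF f(1) a(1)], of m] by (simp add: pf_eq[OF f(1)] zB)
      then have "f a \<in> f ` pw R I A n" using m a(1) by blast
      then obtain a' where a': "a' \<in> pw R I A n" "f a = f a'" by blast
      have "a' \<in> carrier A" using a'(1) submoduleD(1)[OF MA sA[of n]] by blast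
      then have "a = a'" using inj_onD[OF f(2) a'(2) a(1)] by simp
      then have "pw R I A n +>\<^bsub>A\<^esub> a = pw R I A n" using rcoset_eq_iff_zero[OF MA sA a(1), of n] a'(1) by simp
      then show ?thesis using pt_eq[OF MA _ a(1), of n m] a(2) by (simp add: zA m_def)
    qed
    then show "\<exists>m\<ge>n. \<forall>x\<in>carrier (pq A m). pf B m f x = \<zero>\<^bsub>pq B m\<^esub> \<longrightarrow> pt A n x = \<zero>\<^bsub>pq A n\<^esub>"
      by (intro exI[of _ m]) (auto simp: m_def)
  qed
qed

section \<open>Long exact sequences of generalized local cohomology\<close>

context
  fixes K :: "('a, 'k) module"
  assumes K: "module R K"
begin

text \<open>The cone of the pro-exact system carries the long exact sequence, and
  \<open>\<iota>\<close> exchanges its cohomology for that of \<open>C\<close>. As \<open>T\<close>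
  is contravariant in the module, \<open>C\<close> comes first in each degree.\<close>

lemma T_les:
  fixes A :: "('a, 'x) module" and B :: "('a, 'y) module" and C :: "('a, 'z) module"
  assumes f: "lin R A B f" "inj_on f (carrier A)" and g: "lin R B C g" "g ` carrier B = carrier C"
    and ex: "{y \<in> carrier B. g y = \<zero>\<^bsub>C\<^esub>} = f ` carrier A" and B: "fin_gen R B"
  shows T_cofinite_C: "cofinite_module R I (T B K i) \<Longrightarrow> semi (T A K i) \<Longrightarrow>
      (\<And>j. i = Suc j \<Longrightarrow> cofinite_module R I (T A K j) \<and> cofinite_module R I (T B K j)) \<Longrightarrow>
      cofinite_module R I (T C K i)"
    and T_semi_C: "cofinite_module R I (T B K i) \<Longrightarrow>
      (\<And>j. i = Suc j \<Longrightarrow> cofinite_module R I (T A K j) \<and> cofinite_module R I (T B K j)) \<Longrightarrow> semi (T C K i)"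
    and T_cofinite_B: "cofinite_module R I (T C K i) \<Longrightarrow> cofinite_module R I (T C K (Suc i)) \<Longrightarrow>
      cofinite_module R I (T A K i) \<Longrightarrow>
      (\<And>j. i = Suc j \<Longrightarrow> cofinite_module R I (T A K j)) \<Longrightarrow> cofinite_module R I (T B K i)"
proof -
  interpret E: pro_exact R "pq A" "\<lambda>n k. pt A n" "pq B" "\<lambda>n k. pt B n" "pq C" "\<lambda>n k. pt C n"
    "\<lambda>n. pf B n f" "\<lambda>n. pf C n g"
    by (rule pro_exact_pq[OF f g ex B])
  obtain \<iota> where \<iota>: "\<And>i. lin R (T C K i) (E.TU K i) (\<iota> i)" "\<And>i. inj_on (\<iota> i) (carrier (T C K i))"
    "\<And>i. \<iota> i ` carrier (T C K i) = carrier (E.TU K i)"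
    unfolding T_eq
  proof (rule E.cone_iso[OF K], goal_cases)
    case (1 \<iota>)
    show ?case by (rule 1(1)[of \<iota>]) (rule 1(2) 1(3) 1(4))+
  qed
  have CU: "cofinite_module R I (E.TU K i)" if "cofinite_module R I (T C K i)" for i
    by (rule cofinite_iso[OF R N I \<iota> that])
  have UC: "cofinite_module R I (T C K i)" if u: "cofinite_module R I (E.TU K i)" for i
  proof (rule lin_inverse[OF \<iota>])
    fix h assume h: "lin R (E.TU K i) (T C K i) h" "inj_on h (carrier (E.TU K i))"
      "h ` carrier (E.TU K i) = carrier (T C K i)"
    show ?thesis by (rule cofinite_iso[OF R N I h u])
  qed
  have sUC: "semi (T C K i)" if "semi (E.TU K i)" for i
    by (rule semi_iso[OF \<iota> that])
  obtain \<alpha> \<beta> \<gamma> where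
    1: "\<And>i. exact_seq R (E.TU K i) (\<gamma> i) (T B K i) (\<alpha> i) (T A K i)" and
    2: "\<And>i. exact_seq R (T B K i) (\<alpha> i) (T A K i) (\<beta> i) (E.TU K (Suc i))" and
    3: "\<And>i. exact_seq R (T A K i) (\<beta> i) (E.TU K (Suc i)) (\<gamma> (Suc i)) (T B K (Suc i))" and
    4: "\<And>x. x \<in> carrier (E.TU K 0) \<Longrightarrow> \<gamma> 0 x = \<zero>\<^bsub>T B K 0\<^esub> \<Longrightarrow> x = \<zero>\<^bsub>E.TU K 0\<^esub>"
    unfolding T_eq
  proof (rule E.U.cone_long_exact[OF K], goal_cases)
    case (1 \<alpha> \<beta> \<gamma>)
    show ?case
    proof (rule 1(1))
      show "exact_seq R (E.TU K i) (\<gamma> i) (E.TB K i) (\<alpha> i) (E.TA K i)" for i by (rule 1(2))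
      show "exact_seq R (E.TB K i) (\<alpha> i) (E.TA K i) (\<beta> i) (E.TU K (Suc i))" for i by (rule 1(3))
      show "exact_seq R (E.TA K i) (\<beta> i) (E.TU K (Suc i)) (\<gamma> (Suc i)) (E.TB K (Suc i))" for i by (rule 1(4))
      show "x = \<zero>\<^bsub>E.TU K 0\<^esub>" if "x \<in> carrier (E.TU K 0)" "\<gamma> 0 x = \<zero>\<^bsub>E.TB K 0\<^esub>" for x
        by (rule 1(5)[OF that])
    qed
  qed
  show "cofinite_module R I (T C K i)" if "cofinite_module R I (T B K i)" "semi (T A K i)"
    "\<And>j. i = Suc j \<Longrightarrow> cofinite_module R I (T A K j) \<and> cofinite_module R I (T B K j)"
    by (rule UC, rule les_cofinite_C[where A = "T A K" and B = "T B K" and C = "E.TU K", OF 1 2 3 4 that])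
  show "semi (T C K i)" if "cofinite_module R I (T B K i)"
    "\<And>j. i = Suc j \<Longrightarrow> cofinite_module R I (T A K j) \<and> cofinite_module R I (T B K j)"
    by (rule sUC, rule les_semi_C[where A = "T A K" and B = "T B K" and C = "E.TU K", OF 1 2 3 4 that])
  show "cofinite_module R I (T B K i)" if "cofinite_module R I (T C K i)" "cofinite_module R I (T C K (Suc i))"
    "cofinite_module R I (T A K i)" "\<And>j. i = Suc j \<Longrightarrow> cofinite_module R I (T A K j)"
    by (rule les_cofinite_B[where A = "T A K" and B = "T B K" and C = "E.TU K",
          OF 1 2 3 4 CU[OF that(1)] CU[OF that(2)] that(3,4)])
qed


section \<open>Finitely generated free modules\<close>

text \<open>The type of \<open>R^k\<close> does not mention the module that it covers, so first
  syzygies of modules of any type lie in \<open>nat \<Rightarrow> 'a\<close>, where the induction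
  takes place.\<close>

abbreviation "fr k \<equiv> free_module R {..<k::nat}"

lemma unit_generates:
  assumes u: "u \<in> carrier (fr k)"
  shows "u \<in> module_span R (fr k) (unit_vec R ` {..<k})"
proof -
  note M = module_free[OF R, of "{..<k}"]
  have sub: "unit_vec R ` {..<k} \<subseteq> carrier (fr k)" by (rule image_subsetI) (rule unit_vec_closed[OF R])
  note D = submoduleD[OF M span_submodule[OF M sub]]
  have inc: "unit_vec R b \<in> module_span R (fr k) (unit_vec R ` {..<k})" if "b \<in> {..<k}" for b
    using subsetD[OF span_incl imageI[OF that]] .
  show ?thesis
    using u
  proof (induction rule: free_induct[OF R, consumes 1, case_names zero add])
    case zero
    then show ?case using D(2) by simp
  next
    case (add v b r)
    then show ?case by (intro D(3) D(4) inc)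
  qed
qed

lemma fin_gen_free: "fin_gen R (fr k)"
proof -
  have sub: "unit_vec R ` {..<k} \<subseteq> carrier (fr k)" by (rule image_subsetI) (rule unit_vec_closed[OF R])
  have "module_span R (fr k) (unit_vec R ` {..<k}) = carrier (fr k)"
    using unit_generates span_subset_carrier[OF module_free[OF R] sub] by blast
  then show ?thesis using sub unfolding fin_gen_def by (intro exI[of _ "unit_vec R ` {..<k}"]) auto
qed

lemma fin_gen_presentation:
  fixes M :: "('a, 'm) module"
  assumes M: "module R M" "fin_gen R M"
  obtains k g where "lin R (fr k) M g" "g ` carrier (fr k) = carrier M"
proof -
  obtain A where A: "finite A" "A \<subseteq> carrier M" "module_span R M A = carrier M"
    using M(2) by (auto simp: fin_gen_def)
  obtain \<beta> where \<beta>: "A = \<beta> ` {..<card A}"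
    using ex_bij_betw_nat_finite[OF A(1)] by (auto simp: bij_betw_def atLeast0LessThan)
  let ?g = "linext R M \<beta>"
  have \<beta>M: "\<beta> b \<in> carrier M" if "b \<in> {..<card A}" for b using that \<beta> A(2) by blast
  have l: "lin R (fr (card A)) M ?g" by (rule lin_linext[OF R M(1) \<beta>M])
  have "A \<subseteq> ?g ` carrier (fr (card A))"
  proof
    fix a assume "a \<in> A"
    then obtain b where b: "b \<in> {..<card A}" "a = \<beta> b" using \<beta> by blast
    then have "a = ?g (unit_vec R b)" using linext_unit[OF R M(1), of \<beta> b] \<beta>M[OF b(1)] by simp
    then show "a \<in> ?g ` carrier (fr (card A))" using unit_vec_closed[OF R b(1)] by blast
  qed
  then have "carrier M \<subseteq> ?g ` carrier (fr (card A))"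
    using span_least[OF submodule_range[OF l]] A(3) by blast
  then have "?g ` carrier (fr (card A)) = carrier M" using lin_closed[OF l] by blast
  with l show thesis by (rule that)
qed

section \<open>Induction on the rank and on the degree\<close>

context
  assumes TR: "\<And>i. cofinite_module R I (T (regular_module R) K i)"
begin

text \<open>Induction on the rank with \<open>0 \<rightarrow> R \<rightarrow> R^(k+1) \<rightarrow>
  R^k \<rightarrow> 0\<close>, where \<open>R\<close> is the last coordinate; the exact sequence
  spares a proof that the functor is additive.\<close>

lemma T_free: "cofinite_module R I (T (fr k) K i)"
proof (induction k arbitrary: i)
  case 0
  note G = module_regular[OF R] and F = module_free[OF R, of "{..<0::nat}"]
  have c: "carrier (fr 0) = {\<zero>\<^bsub>fr 0\<^esub>}"
    using cring.cring_simprules(2)[OF R] by (auto simp: carrier_free fun_eq_iff)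
  \<comment> \<open>The zero module is treated as the cokernel of the identity of
    \<open>R\<close>.\<close>
  show ?case
    by (rule T_cofinite_C[OF lin_ident[OF G] _ lin_const_zero[OF G F] _ _ fin_gen_regular[OF R] TR cofinite_semi[OF TR]])
       (use c TR module_zero_closed[OF G] in auto)
next
  case (Suc k)
  interpret R: cring R by (rule R)
  note G = module_regular[OF R] and F = module_free[OF R, of "{..<Suc k}"]
  let ?f = "\<lambda>r. r \<odot>\<^bsub>fr (Suc k)\<^esub> unit_vec R k"
  let ?g = "\<lambda>u::nat \<Rightarrow> 'a. u(k := \<zero>\<^bsub>R\<^esub>)"
  have f: "lin R (regular_module R) (fr (Suc k)) ?f"
    by (rule lin_multiples[OF F unit_vec_closed[OF R]]) simp
  have inj: "inj_on ?f (carrier (regular_module R))"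
  proof (rule inj_onI)
    fix r s assume rs: "r \<in> carrier (regular_module R)" "s \<in> carrier (regular_module R)" "?f r = ?f s"
    then have "?f r k = ?f s k" by simp
    then show "r = s" using rs(1,2) by (simp add: unit_vec_def)
  qed
  have gc: "?g u \<in> carrier (fr k)" if "u \<in> carrier (fr (Suc k))" for u
  proof -
    have "{b. ?g u b \<noteq> \<zero>\<^bsub>R\<^esub>} \<subseteq> {b. u b \<noteq> \<zero>\<^bsub>R\<^esub>}" by auto
    then show ?thesis
      using that finite_subset[of "{b. ?g u b \<noteq> \<zero>\<^bsub>R\<^esub>}" "{b. u b \<noteq> \<zero>\<^bsub>R\<^esub>}"]
      by (auto simp: carrier_free less_Suc_eq)
  qed
  have g: "lin R (fr (Suc k)) (fr k) ?g"
    by (rule linI[OF F module_free[OF R] gc]) (auto simp: fun_eq_iff)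
  have "carrier (fr k) \<subseteq> ?g ` carrier (fr (Suc k))"
  proof
    fix u assume u: "u \<in> carrier (fr k)"
    then have "u k = \<zero>\<^bsub>R\<^esub>" by (auto simp: carrier_free)
    then have "u = ?g u" by (simp add: fun_upd_idem)
    moreover have "u \<in> carrier (fr (Suc k))" using u by (auto simp: carrier_free)
    ultimately show "u \<in> ?g ` carrier (fr (Suc k))" by (rule image_eqI)
  qed
  then have surj: "?g ` carrier (fr (Suc k)) = carrier (fr k)" using gc by blast
  have "u = ?f (u k)" if "u \<in> carrier (fr (Suc k))" "?g u = \<zero>\<^bsub>fr k\<^esub>" for u
  proof
    fix b
    have "u k \<in> carrier R" using that(1) by (auto simp: carrier_free)
    then show "u b = ?f (u k) b" using fun_cong[OF that(2), of b] by (auto simp: unit_vec_def split: if_splits)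
  qed
  moreover have "?g (?f r) = \<zero>\<^bsub>fr k\<^esub>" if "r \<in> carrier R" for r
    using that by (auto simp: fun_eq_iff unit_vec_def)
  ultimately have ex: "{u \<in> carrier (fr (Suc k)). ?g u = \<zero>\<^bsub>fr k\<^esub>} = ?f ` carrier (regular_module R)"
    using lin_closed[OF f]
    by (intro subset_antisym subsetI) (auto simp: carrier_free simp del: free_module_simps intro!: image_eqI)
  show ?case
    by (rule T_cofinite_B[OF f inj g surj ex fin_gen_free Suc Suc TR TR])
qed

text \<open>Two successive syzygies are used: \<open>Q'\<close> makes \<open>T Q K i\<close> at
  least \<open>semi\<close>, and this suffices to make \<open>T M K i\<close> cofinite. Both
  syzygies live in the fixed type of \<open>prev\<close>, while \<open>M\<close> may have any
  type.\<close>

lemma T_step: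
  fixes M :: "('a, 'm) module"
  assumes prev: "\<And>j (X :: ('a, nat \<Rightarrow> 'a) module). i = Suc j \<Longrightarrow> module R X \<Longrightarrow> fin_gen R X \<Longrightarrow>
      cofinite_module R I (T X K j)"
    and M: "module R M" "fin_gen R M"
  shows "cofinite_module R I (T M K i)"
proof -
  \<comment> \<open>Stated for a fresh type, since it is applied to \<open>M\<close> and again to
    the syzygy of \<open>M\<close>.\<close>
  have pres: "\<exists>k (Q :: ('a, nat \<Rightarrow> 'a) module) g. module R Q \<and> fin_gen R Q \<and> lin R Q (fr k) (\<lambda>x. x) \<and>
      inj_on (\<lambda>x. x) (carrier Q) \<and> lin R (fr k) X g \<and> g ` carrier (fr k) = carrier X \<and>
      {y \<in> carrier (fr k). g y = \<zero>\<^bsub>X\<^esub>} = (\<lambda>x. x) ` carrier Q"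
    if X: "module R X" "fin_gen R X" for X :: "('a, 'w) module"
  proof -
    obtain k g where g: "lin R (fr k) X g" "g ` carrier (fr k) = carrier X"
      by (rule fin_gen_presentation[OF X])
    note F = module_free[OF R, of "{..<k}"]
    note ks = submodule_kernel[OF g(1)]
    show ?thesis
      using submodule_module[OF F ks] fin_gen_submodule[OF R N F fin_gen_free ks]
        lin_submodule[OF lin_ident[OF F] ks] g
      by (intro exI[of _ k] exI[of _ "(fr k)\<lparr>carrier := {x \<in> carrier (fr k). g x = \<zero>\<^bsub>X\<^esub>}\<rparr>"] exI[of _ g]) auto
  qed
  obtain k Q g where Q: "module R Q" "fin_gen R Q"
    and s: "lin R Q (fr k) (\<lambda>x. x)" "inj_on (\<lambda>x. x) (carrier Q)" "lin R (fr k) M g" "g ` carrier (fr k) = carrier M"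
      "{y \<in> carrier (fr k). g y = \<zero>\<^bsub>M\<^esub>} = (\<lambda>x. x) ` carrier Q"
    using pres[OF M] by blast
  obtain k' Q' g' where Q': "module R Q'" "fin_gen R Q'"
    and s': "lin R Q' (fr k') (\<lambda>x. x)" "inj_on (\<lambda>x. x) (carrier Q')" "lin R (fr k') Q g'" "g' ` carrier (fr k') = carrier Q"
      "{y \<in> carrier (fr k'). g' y = \<zero>\<^bsub>Q\<^esub>} = (\<lambda>x. x) ` carrier Q'"
    using pres[OF Q] by blast
  have "semi (T Q K i)"
    by (rule T_semi_C[OF s' fin_gen_free T_free]) (use prev Q' T_free in blast)
  then show ?thesis
    by (rule T_cofinite_C[OF s fin_gen_free T_free]) (use prev Q T_free in blast)
qed

lemma T_cofinite:
  fixes M :: "('a, 'm) module"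
  assumes M: "module R M" "fin_gen R M"
  shows "cofinite_module R I (T M K i)"
proof -
  \<comment> \<open>The induction on the degree has to stay in one type; the final
    \<open>T_step\<close> leaves it for the type of \<open>M\<close>.\<close>
  have *: "cofinite_module R I (T X K j)" if "module R X" "fin_gen R X" for X :: "('a, nat \<Rightarrow> 'a) module" and j
    using that
  proof (induction j arbitrary: X)
    case 0
    show ?case by (rule T_step[OF _ 0]) simp
  next
    case (Suc j)
    show ?case by (rule T_step[OF _ Suc.prems]) (use Suc.IH in simp)
  qed
  show ?thesis by (rule T_step[OF * M])
qed

end

end

end

theorem theorem3p7:
  fixes R :: "('a, 'r) ring_scheme"
    and I :: "'a set"
    and M :: "('a, 'm) module"
    and N :: "('a, 'n) module"
    and t :: nat
  assumes "cring R" and "noetherian_ring R"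
    and "ideal I R"
    and "module R M" and "fin_gen R M"
    and "module R N" and "fin_gen R N"
    and "proj_dim R M = enat t"
    and "\<And>i. cofinite_module R I (local_cohomology R I i N)"
    and "cofinite_category_abelian R I"
  shows "\<forall>i. cofinite_module R I (gen_local_cohomology R I i M N)"
proof
  fix i
  \<comment> \<open>For \<open>R\<close> as a module over itself the submodules \<open>I^n R\<close>
    are the ideals \<open>I^n\<close>, so the hypothesis on the local cohomology of \<open>N\<close>
    starts the induction on the rank.\<close>
  have "gen_local_cohomology R I j (regular_module R) N = local_cohomology R I j N" for j
    by (simp add: gen_local_cohomology_def local_cohomology_def pw_regular[OF assms(1,3)])
  then show "cofinite_module R I (gen_local_cohomology R I i M N)"
    using T_cofinite[OF assms(1-3,10,6) _ assms(4,5)] assms(9) by simp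
qed

end
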